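(* Let $d\ge 1$, $\ell>0$, and let $(K_\epsilon)_{\epsilon>0}$ be a family of kernels with $K_\epsilon\nearrow K_0$ as $\epsilon\searrow 0$, where $K_0$ satisfies $$\int_0^1 K_0(r)\,r^{d-1}\,dr=\infty,\qquad \int_\delta^\infty K_0(r)\min\{r^{d-2},r^{d-1}\}\,dr<\infty\quad\text{for all }\delta>0 .$$ Let $\mathcal E_\epsilon$ ($\epsilon>0$) be the energies defined in the context. Then: (i) (Compactness) For any family $u_\epsilon\in BV(\mathbb T_\ell;\{0,1\})$ with $\sup_\epsilon \mathcal E_\epsilon(u_\epsilon)<\infty$ there exist $u\in BV(\mathbb T_\ell;\{0,1\})$ and a subsequence (not relabelled) such that $$u_\epsilon\to u\ \text{ in }L^1(\mathbb T_\ell)\qquad\text{and}\qquad \int_{\mathbb T_\ell}|\nabla u_\epsilon|\to\int_{\mathbb T_\ell}|\nabla u|\qquad\text{as }\epsilon\to0 .$$ (ii) ($\Gamma$-convergence) $\mathcal E_\epsilon$ $\Gamma$-converges to $\mathcal E_0$ as $\epsilon\to 0$ in the $L^1(\mathbb T_\ell)$-topology, where $$\mathcal E_0(u)=\frac12\int_{\mathbb R^d}\frac{1}{|\mathbb T_\ell|}\int_{\mathbb T_\ell}K_0(|z|)\Big(\Big|\frac{z}{|z|}\cdot\nabla u(x)\Big|\,\chi_{B_1}(z)-\frac{|u(x+z)-u(x)|}{|z|}\Big)\,dx\,dz$$ for $u\in BV(\mathbb T_\ell;\{0,1\})$ and $\mathcal E_0(u)=+\infty$ otherwise.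
   Context: $\mathbb T_\ell=\mathbb R^d/(\ell\mathbb Z)^d$ is the flat torus with side length $\ell$, $|\mathbb T_\ell|=\ell^d$; functions on $\mathbb T_\ell$ are identified with $(\ell\mathbb Z)^d$-periodic functions on $\mathbb R^d$. $B_1$ is the unit ball of $\mathbb R^d$ centred at $0$. $\omega_d$ is the volume of the unit ball in $\mathbb R^d$ ($\omega_0=1$). Kernels: $K_\epsilon:\mathbb R^d\to[0,\infty)$ is measurable and radial, $K_\epsilon(z)=K_\epsilon(|z|)$, with $K_\epsilon\in L^1(B_1)$ for $\epsilon>0$. $K_\epsilon\nearrow K_0$ as $\epsilon\searrow0$ means that $K_\epsilon$ increases pointwise to the radial function $K_0$ as $\epsilon$ decreases to $0$. $M_\epsilon:=\omega_{d-1}\int_0^1K_\epsilon(t)t^{d-1}\,dt$, and for $\epsilon>0$ and $u\in BV(\mathbb T_\ell;\{0,1\})$ $$\mathcal E_\epsilon(u):=\frac{M_\epsilon}{|\mathbb T_\ell|}\int_{\mathbb T_\ell}|\nabla u|-\int_{\mathbb R^d}K_\epsilon(z)\,\frac1{|\mathbb T_\ell|}\int_{\mathbb T_\ell}\frac{|u(x+z)-u(x)|}{2|z|}\,dx\,dz ,$$ with $\mathcal E_\epsilon(u)=+\infty$ for $u\notin BV(\mathbb T_\ell;\{0,1\})$. $\int_{\mathbb T_\ell}|\nabla u|$ is the total variation. Writing $\nabla u=\sigma|\nabla u|$ with $\sigma:\mathbb T_\ell\to\mathbb S^{d-1}$ (structure theorem for BV), $\int_{\mathbb T_\ell}|\omega\cdot\nabla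 u(x)|\,dx$ denotes $\int_{\mathbb T_\ell}|\omega\cdot\sigma|\,d|\nabla u|$. In the definition of $\mathcal E_0$ the $x$-integral is performed first, then the $z$-integral, with values in $(-\infty,+\infty]$. *)

theory Defs
  imports "HOL-Analysis.Analysis"
begin

(* Functions on the flat torus R^d / (l Z)^d are l-periodic functions on real^'n with
   d = CARD('n); integrals over the torus are Lebesgue integrals over a half-open cell. *)

definition torus_periodic :: "real \<Rightarrow> (real^'n \<Rightarrow> 'b) \<Rightarrow> bool" where
  "torus_periodic l f \<longleftrightarrow> (\<forall>x i. f (x + l *\<^sub>R axis i 1) = f x)"

definition torus_cell :: "real \<Rightarrow> (real^'n) set" where
  "torus_cell l = {x. \<forall>i. 0 \<le> x $ i \<and> x $ i < l}"

definition torus_integral :: "real \<Rightarrow> (real^'n \<Rightarrow> real) \<Rightarrow> real" where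
  "torus_integral l f = set_lebesgue_integral lebesgue (torus_cell l) f"

definition torus_L1 :: "real \<Rightarrow> (real^'n \<Rightarrow> real) set" where
  "torus_L1 l = {u. torus_periodic l u \<and> u \<in> borel_measurable lebesgue
                    \<and> set_integrable lebesgue (torus_cell l) u}"

definition L1_dist :: "real \<Rightarrow> (real^'n \<Rightarrow> real) \<Rightarrow> (real^'n \<Rightarrow> real) \<Rightarrow> real" where
  "L1_dist l u v = torus_integral l (\<lambda>x. \<bar>u x - v x\<bar>)"

definition torus_C1_fields :: "real \<Rightarrow> (real^'n \<Rightarrow> real^'n) set" where
  "torus_C1_fields l = {\<phi>. torus_periodic l \<phi> \<and> (\<forall>x. \<phi> differentiable (at x))
      \<and> (\<forall>h. continuous_on UNIV (\<lambda>x. frechet_derivative \<phi> (at x) h))}"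

definition divergence :: "(real^'n \<Rightarrow> real^'n) \<Rightarrow> real^'n \<Rightarrow> real" where
  "divergence \<phi> x = (\<Sum>i\<in>UNIV. frechet_derivative \<phi> (at x) (axis i 1) $ i)"

definition total_variation :: "real \<Rightarrow> (real^'n \<Rightarrow> real) \<Rightarrow> ereal" where
  "total_variation l u =
     (SUP \<phi>\<in>{\<phi> \<in> torus_C1_fields l. \<forall>x. norm (\<phi> x) \<le> 1}.
        ereal (torus_integral l (\<lambda>x. u x * divergence \<phi> x)))"

definition BV01 :: "real \<Rightarrow> (real^'n \<Rightarrow> real) set" where
  "BV01 l = {u \<in> torus_L1 l. (AE x in lebesgue. u x \<in> {0, 1}) \<and> total_variation l u < \<infinity>}"

(* The polar decomposition of the distributional gradient of u: the measure \<mu> plays the role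
   of |grad u|.  The cell is Borel isomorphic to the torus, so a Borel measure on the torus is
   the same thing as a Borel measure on R^d that is carried by the cell. *)

definition is_polar_gradient ::
  "real \<Rightarrow> (real^'n \<Rightarrow> real) \<Rightarrow> (real^'n) measure \<Rightarrow> (real^'n \<Rightarrow> real^'n) \<Rightarrow> bool" where
  "is_polar_gradient l u \<mu> \<sigma> \<longleftrightarrow>
     sets \<mu> = sets borel \<and> finite_measure \<mu> \<and> emeasure \<mu> (- torus_cell l) = 0
     \<and> \<sigma> \<in> borel_measurable borel \<and> (\<forall>x. norm (\<sigma> x) = 1)
     \<and> (\<forall>\<phi>\<in>torus_C1_fields l.
          torus_integral l (\<lambda>x. u x * divergence \<phi> x) = - (\<integral>x. \<phi> x \<bullet> \<sigma> x \<partial>\<mu>))"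

(* The integral of |w . grad u| over the torus.  For u in BV, the measure is unique and the
   field is unique almost everywhere, so the value does not depend on the choice. *)

definition directional_variation :: "real \<Rightarrow> (real^'n \<Rightarrow> real) \<Rightarrow> real^'n \<Rightarrow> real" where
  "directional_variation l u w =
     (case (SOME (\<mu>, \<sigma>). is_polar_gradient l u \<mu> \<sigma>) of (\<mu>, \<sigma>) \<Rightarrow> (\<integral>x. \<bar>w \<bullet> \<sigma> x\<bar> \<partial>\<mu>))"

definition shift_difference :: "real \<Rightarrow> (real^'n \<Rightarrow> real) \<Rightarrow> real^'n \<Rightarrow> real" where
  "shift_difference l u z = torus_integral l (\<lambda>x. \<bar>u (x + z) - u x\<bar>)"

(* Radial kernels are given by their profile k, i.e. the kernel is z |-> k (norm z). *)

definition kernel_mass :: "nat \<Rightarrow> (real \<Rightarrow> real) \<Rightarrow> real" where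
  "kernel_mass d k =
     unit_ball_vol (real (d - 1)) * set_lebesgue_integral lebesgue {0..1} (\<lambda>t. k t * t ^ (d - 1))"

definition energy :: "real \<Rightarrow> (real \<Rightarrow> real) \<Rightarrow> (real^'n \<Rightarrow> real) \<Rightarrow> ereal" where
  "energy l k u =
     (if u \<in> BV01 l
      then ereal (kernel_mass CARD('n) k / l ^ CARD('n)) * total_variation l u
           - enn2ereal (\<integral>\<^sup>+z. ennreal (k (norm z) *
               (1 / l ^ CARD('n) * (shift_difference l u z / (2 * norm z)))) \<partial>lebesgue)
      else \<infinity>)"

(* Integral with values in the extended reals; meaningful when the positive or the negative
   part has finite integral. *)

definition extended_integral :: "'a measure \<Rightarrow> ('a \<Rightarrow> ereal) \<Rightarrow> ereal" where
  "extended_integral M f =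
     enn2ereal (\<integral>\<^sup>+x. e2ennreal (f x) \<partial>M) - enn2ereal (\<integral>\<^sup>+x. e2ennreal (- f x) \<partial>M)"

(* The x-integral is carried out first: it turns |(z/|z|) . grad u(x)| into the directional
   variation and |u(x+z) - u(x)| into the shift difference, and K0(|z|) is constant in x. *)

definition limit_energy :: "real \<Rightarrow> (real \<Rightarrow> ennreal) \<Rightarrow> (real^'n \<Rightarrow> real) \<Rightarrow> ereal" where
  "limit_energy l k0 u =
     (if u \<in> BV01 l
      then ereal (1 / 2) * extended_integral lebesgue (\<lambda>z.
             enn2ereal (k0 (norm z)) * ereal (1 / l ^ CARD('n) *
               (directional_variation l u ((1 / norm z) *\<^sub>R z) * indicator (ball 0 1) z
                - shift_difference l u z / norm z)))
      else \<infinity>)"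

definition gamma_converges ::
  "'x set \<Rightarrow> ('x \<Rightarrow> 'x \<Rightarrow> real) \<Rightarrow> 'p filter \<Rightarrow> ('p \<Rightarrow> 'x \<Rightarrow> ereal) \<Rightarrow> ('x \<Rightarrow> ereal) \<Rightarrow> bool" where
  "gamma_converges X dst F En E \<longleftrightarrow> (\<forall>x\<in>X.
     (\<forall>y. (\<forall>p. y p \<in> X) \<and> ((\<lambda>p. dst (y p) x) \<longlongrightarrow> 0) F \<longrightarrow> E x \<le> Liminf F (\<lambda>p. En p (y p)))
     \<and> (\<exists>y. (\<forall>p. y p \<in> X) \<and> ((\<lambda>p. dst (y p) x) \<longlongrightarrow> 0) F \<and> Limsup F (\<lambda>p. En p (y p)) \<le> E x))"

end

theory Submission
  imports Defs "HOL-Probability.Probability" "HOL-Complex_Analysis.Great_Picard"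
begin

text \<open>
  For \<open>u \<in> BV(\<bbbT>\<^sub>l; {0,1})\<close> put \<open>V(w) = \<integral>|w \<bullet> \<nabla>u|\<close> and \<open>D(z) = \<integral>|u(x + z) - u(x)| dx\<close>. Then
  \<open>D(z) \<le> |z| V(z/|z|)\<close>, and \<open>|w \<bullet> \<sigma>|\<close> integrates over the unit sphere to \<open>2 \<omega>\<^sub>d\<^sub>-\<^sub>1\<close>. Hence, up to the
  factor \<open>1/(2 l\<^sup>d)\<close>, the part of the energy in the unit ball is
  \<open>\<integral> K(|z|) (V(z/|z|) - D(z)/|z|) dz\<close> with a nonnegative integrand, so it increases as \<open>\<epsilon>\<close> decreases,
  while the part outside the ball converges by the tail condition; constant sequences are therefore
  recovery sequences. After cutting the kernels off near the origin, the loss \<open>\<integral> K(|z|) D(z)/|z| dz\<close> is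
  continuous in \<open>L\<^sup>1\<close> and bounded for \<open>u \<in> {0,1}\<close>; so an energy bound controls the total variation, whose
  lower semicontinuity gives the liminf inequality. Along \<open>L\<^sup>1\<close>-convergent sequences with bounded energy the
  excess of total variation is at most a constant over the mass of the cut-off kernel, hence vanishes
  because these masses diverge.
  The polar decomposition \<open>\<nabla>u = \<sigma>|\<nabla>u|\<close> is obtained by Radon-Nikodym from a weak limit of difference quotients.\<close>

section \<open>Periodic functions and translation invariance\<close>

text \<open>Both terms of \<open>energy\<close> may diverge as \<epsilon> tends to 0; only their
  difference has a limit. The constant in the kernel mass is the one that makes them cancel: the
  unit sphere covers its equatorial disc twice, which is the origin of twice the volume of the unit
  ball in dimension d - 1. The cancellation is stated as a sum of nonnegative integrals, so it keeps
  its meaning for infinite masses, and differences are formed only where finiteness is known.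
  Kernels are measurable as functions on R^d, so the measurability of the radial profile has to be
  derived before polar coordinates apply. Weak limits of measures on the torus are produced on the
  real line: a Borel code for the points of the cell, with a continuous decoder, carries densities
  to probability laws on [0,1], where tightness is automatic. The values 0 and 1 enter through the
  bound 1 for the difference of two values, which limits the shift term by the volume whatever the
  variation is. That is what lets an energy bound control the variation.\<close>

lemma torus_periodic_axis_int:
  assumes "torus_periodic l f"
  shows "f (x + (l * of_int m) *\<^sub>R axis i 1) = f x"
proof -
  have nat: "f (y + (l * of_nat n) *\<^sub>R axis i 1) = f y" for n :: nat and y
  proof (induction n)
    case (Suc n)
    have "f (y + (l * of_nat (Suc n)) *\<^sub>R axis i 1) = f ((y + (l * of_nat n) *\<^sub>R axis i 1) + l *\<^sub>R axis i 1)"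
      by (simp add: algebra_simps)
    also have "\<dots> = f y" using assms Suc by (simp add: torus_periodic_def)
    finally show ?case .
  qed simp
  show ?thesis
  proof (cases "m \<ge> 0")
    case True
    then show ?thesis using nat[of x "nat m"] by simp
  next
    case False
    then show ?thesis using nat[of "x + (l * of_int m) *\<^sub>R axis i 1" "nat (-m)"] by simp
  qed
qed

definition lattice_vec :: "real \<Rightarrow> int^'n \<Rightarrow> real^'n" where
  "lattice_vec l k = (\<chi> i. l * of_int (k $ i))"

lemma torus_periodic_lattice:
  assumes "torus_periodic l f"
  shows "f (x + lattice_vec l k) = f x"
proof -
  have *: "finite S \<Longrightarrow> f (x + (\<Sum>i\<in>S. (l * of_int (k $ i)) *\<^sub>R axis i 1)) = f x" for S
  proof (induction S rule: finite_induct)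
    case (insert i S)
    then show ?case
      using torus_periodic_axis_int[OF assms, of "x + (\<Sum>i\<in>S. (l * of_int (k $ i)) *\<^sub>R axis i 1)" "k $ i" i]
      by (simp add: algebra_simps)
  qed simp
  have "lattice_vec l k = (\<Sum>i\<in>UNIV. (l * of_int (k $ i)) *\<^sub>R axis i 1)"
    by (simp add: vec_eq_iff lattice_vec_def axis_def if_distrib cong: if_cong)
  with *[of UNIV] show ?thesis by simp
qed

definition torus_wrap :: "real \<Rightarrow> real^'n \<Rightarrow> real^'n" where
  "torus_wrap l x = (\<chi> i. x $ i - l * of_int \<lfloor>x $ i / l\<rfloor>)"

text \<open>Every orbit of the lattice meets the half-open cell exactly once, and floors name the
  translation. The unfolding arguments below rest on this tiling.\<close>

lemma lattice_vec_cell_iff: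
  assumes "l > 0"
  shows "x + lattice_vec l k \<in> torus_cell l \<longleftrightarrow> k = (\<chi> i. - \<lfloor>x $ i / l\<rfloor>)"
proof -
  have "0 \<le> x $ i + l * of_int m \<and> x $ i + l * of_int m < l \<longleftrightarrow> m = - \<lfloor>x $ i / l\<rfloor>" for i m
  proof -
    have "0 \<le> x $ i + l * of_int m \<and> x $ i + l * of_int m < l \<longleftrightarrow> of_int (-m) \<le> x $ i / l \<and> x $ i / l < of_int (-m) + 1"
      using assms by (auto simp: field_simps)
    also have "\<dots> \<longleftrightarrow> \<lfloor>x $ i / l\<rfloor> = - m" by (simp add: floor_eq_iff)
    finally show ?thesis by auto
  qed
  then show ?thesis by (auto simp: torus_cell_def lattice_vec_def vec_eq_iff)
qed

lemma torus_wrap_lattice: "torus_wrap l x = x + lattice_vec l (\<chi> i. - \<lfloor>x $ i / l\<rfloor>)"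
  by (simp add: torus_wrap_def lattice_vec_def vec_eq_iff)

lemma torus_wrap_in_cell: "l > 0 \<Longrightarrow> torus_wrap l x \<in> torus_cell l"
  unfolding torus_wrap_lattice by (subst lattice_vec_cell_iff) auto

lemma torus_periodic_wrap: "torus_periodic l f \<Longrightarrow> f (torus_wrap l x) = f x"
  unfolding torus_wrap_lattice by (rule torus_periodic_lattice)

lemma measurable_torus_wrap [measurable]: "(torus_wrap l :: real^'n \<Rightarrow> real^'n) \<in> borel_measurable borel"
proof -
  have nth: "(\<lambda>x::real^'n. x $ i) \<in> borel_measurable borel" for i
    by (intro borel_measurable_continuous_onI continuous_intros)
  have *: "(\<lambda>x::real^'n. x $ i - l * of_int \<lfloor>x $ i / l\<rfloor>) \<in> borel_measurable borel" for i
    using nth[of i] by measurable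
  show ?thesis
  proof (rule borel_measurable_euclidean_space[THEN iffD2], rule ballI)
    fix b :: "real^'n" assume "b \<in> Basis"
    then obtain i where b: "b = axis i 1" by (auto simp: Basis_vec_def)
    show "(\<lambda>x. torus_wrap l x \<bullet> b) \<in> borel_measurable borel"
      unfolding b inner_axis using * by (simp only: torus_wrap_def vec_lambda_beta inner_real_def mult_1_right)
  qed
qed

lemma torus_cell_sets [measurable]: "torus_cell l \<in> sets borel"
proof -
  have "torus_cell l = {x \<in> space borel. \<forall>i. 0 \<le> x $ i \<and> x $ i < l}" by (simp add: torus_cell_def)
  also have "\<dots> \<in> sets borel" by measurable
  finally show ?thesis .
qed

lemma torus_cell_lebesgue [measurable, simp]: "torus_cell l \<in> sets lebesgue"
  using torus_cell_sets sets_completionI_sets by (metis sets_lborel)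

lemma torus_cell_subset_cbox: "torus_cell l \<subseteq> cbox 0 (\<chi> i. l)"
  by (auto simp: torus_cell_def mem_box_cart less_imp_le)

text \<open>The half-open cell lies between an open and a closed box of equal volume.\<close>

lemma emeasure_torus_cell:
  assumes "l > 0"
  shows "emeasure lebesgue (torus_cell l :: (real^'n) set) = ennreal (l ^ CARD('n))"
proof -
  have 1: "box 0 (\<chi> i. l) \<subseteq> (torus_cell l :: (real^'n) set)"
    by (auto simp: torus_cell_def mem_box_cart less_imp_le)
  have c: "measure lborel (cbox 0 (\<chi> i. l) :: (real^'n) set) = l ^ CARD('n)"
    using assms by (subst content_cbox_cart) (auto simp: interval_ne_empty_cart)
  have e1: "emeasure lebesgue (cbox 0 (\<chi> i. l) :: (real^'n) set) = ennreal (l ^ CARD('n))"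
    unfolding c[symmetric] using emeasure_lborel_cbox_finite
    by (subst emeasure_eq_ennreal_measure[symmetric]) (auto simp: less_top[symmetric])
  have e2: "emeasure lebesgue (box 0 (\<chi> i. l) :: (real^'n) set) = emeasure lebesgue (cbox 0 (\<chi> i. l) :: (real^'n) set)"
    by (simp add: emeasure_lborel_box_eq emeasure_lborel_cbox_eq)
  have 3: "emeasure lebesgue (torus_cell l :: (real^'n) set) \<le> emeasure lebesgue (cbox 0 (\<chi> i. l) :: (real^'n) set)"
    by (rule emeasure_mono[OF torus_cell_subset_cbox]) simp
  show ?thesis
    using emeasure_mono[OF 1, of lebesgue] 3 e1 e2
    by (intro antisym) simp_all
qed

lemma measure_torus_cell:
  "l > 0 \<Longrightarrow> measure lebesgue (torus_cell l :: (real^'n) set) = l ^ CARD('n)"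
  using emeasure_torus_cell[of l, where 'n='n] by (simp add: measure_def)

lemma measurable_lebesgue_shift [measurable]: "(\<lambda>x::'a::euclidean_space. x + z) \<in> lebesgue \<rightarrow>\<^sub>M lebesgue"
  using lebesgue_affine_measurable[of "\<lambda>_. 1" z] by (simp add: euclidean_representation add.commute)

lemma distr_lebesgue_shift: "distr lebesgue lebesgue (\<lambda>x::'a::euclidean_space. x + z) = lebesgue"
  using lebesgue_affine_euclidean[of "\<lambda>_. 1" z]
  by (simp add: euclidean_representation add.commute density_1)

lemma nn_integral_lebesgue_shift:
  fixes f :: "'a::euclidean_space \<Rightarrow> ennreal"
  assumes [measurable]: "f \<in> borel_measurable lebesgue"
  shows "(\<integral>\<^sup>+x. f (x + z) \<partial>lebesgue) = (\<integral>\<^sup>+x. f x \<partial>lebesgue)"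
  by (subst distr_lebesgue_shift[of z, symmetric]) (subst nn_integral_distr; simp)

lemma borel_measurable_lebesgue_shift:
  "f \<in> measurable lebesgue N \<Longrightarrow> (\<lambda>x::'a::euclidean_space. f (x + z)) \<in> measurable lebesgue N"
  by (rule measurable_compose[OF measurable_lebesgue_shift])

lemma AE_lebesgue_shift:
  assumes "AE x in lebesgue. P x"
  shows "AE x::'a::euclidean_space in lebesgue. P (x + z)"
proof -
  obtain N where N: "{x \<in> space lebesgue. \<not> P x} \<subseteq> N" "emeasure lebesgue N = 0" "N \<in> sets lebesgue"
    using assms by (rule AE_E)
  have [measurable]: "N \<in> sets lebesgue" using N by auto
  have "emeasure lebesgue ((\<lambda>x. x + z) -` N \<inter> space lebesgue) = emeasure (distr lebesgue lebesgue (\<lambda>x. x + z)) N"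
    by (subst emeasure_distr) auto
  also have "\<dots> = 0" using N by (simp only: distr_lebesgue_shift)
  finally have "(\<lambda>x. x + z) -` N \<inter> space lebesgue \<in> null_sets lebesgue"
    by (intro null_setsI measurable_sets[OF measurable_lebesgue_shift]) (use N in auto)
  then show ?thesis by (rule AE_I') (use N in auto)
qed

text \<open>Unfolding: an integral over R^d is a sum over the lattice of integrals over the cell.
  Applied to \<open>f\<close> times the indicator of the shifted cell and folded back, it replaces
  that cell by the standard one, because both contain one point of each orbit and \<open>f\<close>
  is constant on orbits.\<close>

lemma nn_integral_torus_shift:
  fixes f :: "real^'n \<Rightarrow> ennreal"
  assumes l: "l > 0" and per: "torus_periodic l f" and [measurable]: "f \<in> borel_measurable lebesgue"
  shows "(\<integral>\<^sup>+x\<in>torus_cell l. f (x + z) \<partial>lebesgue) = (\<integral>\<^sup>+x\<in>torus_cell l. f x \<partial>lebesgue)"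
proof -
  let ?C = "indicator (torus_cell l) :: real^'n \<Rightarrow> ennreal"
  have one: "(\<integral>\<^sup>+k. ?C (x + lattice_vec l k) \<partial>count_space UNIV) = 1" for x
  proof -
    have "(\<integral>\<^sup>+k. ?C (x + lattice_vec l k) \<partial>count_space UNIV)
        = (\<integral>\<^sup>+k. indicator {\<chi> i. - \<lfloor>x $ i / l\<rfloor>} k \<partial>count_space UNIV)"
      using lattice_vec_cell_iff[OF l, of x] by (intro nn_integral_cong) (auto split: split_indicator)
    then show ?thesis by simp
  qed
  have [measurable]: "(\<lambda>x. ?C (x + y)) \<in> borel_measurable lebesgue" for y :: "real^'n"
    by (rule borel_measurable_lebesgue_shift) measurable
  have [measurable]: "(\<lambda>x. f (x + y)) \<in> borel_measurable lebesgue" for y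
    by (rule borel_measurable_lebesgue_shift) measurable
  \<comment> \<open>Each point has exactly one translate in the cell, so inserting the sum of the
    indicators changes nothing; a shift and the reflection of the lattice then bring every summand
    to the cell.\<close>
  have swap: "(\<integral>\<^sup>+x. g x \<partial>lebesgue) = (\<integral>\<^sup>+k. \<integral>\<^sup>+x. g (x + lattice_vec l k) * ?C x \<partial>lebesgue \<partial>count_space UNIV)"
    if [measurable]: "g \<in> borel_measurable lebesgue" for g :: "real^'n \<Rightarrow> ennreal"
  proof -
    have "(\<integral>\<^sup>+x. g x \<partial>lebesgue) = (\<integral>\<^sup>+x. \<integral>\<^sup>+k. g x * ?C (x + lattice_vec l k) \<partial>count_space UNIV \<partial>lebesgue)"
      by (subst nn_integral_cmult) (auto simp: one)
    also have "\<dots> = (\<integral>\<^sup>+k. \<integral>\<^sup>+x. g x * ?C (x + lattice_vec l k) \<partial>lebesgue \<partial>count_space UNIV)"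
      by (rule nn_integral_count_space_nn_integral) auto
    also have "\<dots> = (\<integral>\<^sup>+k. \<integral>\<^sup>+x. g (x + lattice_vec l (-k)) * ?C (x + lattice_vec l (-k) + lattice_vec l k) \<partial>lebesgue \<partial>count_space UNIV)"
      by (intro nn_integral_cong nn_integral_lebesgue_shift[symmetric]) measurable
    also have "\<dots> = (\<integral>\<^sup>+k. \<integral>\<^sup>+x. g (x + lattice_vec l (-k)) * ?C x \<partial>lebesgue \<partial>count_space UNIV)"
    proof -
      have "lattice_vec l (-k) + lattice_vec l k = 0" for k :: "int^'n" by (simp add: lattice_vec_def vec_eq_iff)
      then show ?thesis by (simp add: add.assoc)
    qed
    also have "\<dots> = (\<integral>\<^sup>+k. \<integral>\<^sup>+x. g (x + lattice_vec l k) * ?C x \<partial>lebesgue \<partial>count_space UNIV)"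
      by (rule nn_integral_bij_count_space[of uminus UNIV UNIV]) (auto simp: bij_def inj_on_def surj_def intro: exI[of _ "- _"])
    finally show ?thesis .
  qed
  have "(\<integral>\<^sup>+x\<in>torus_cell l. f (x + z) \<partial>lebesgue) = (\<integral>\<^sup>+x. f (x + z) * ?C ((x + z) + (-z)) \<partial>lebesgue)"
    by simp
  also have "\<dots> = (\<integral>\<^sup>+x. f x * ?C (x + (-z)) \<partial>lebesgue)"
    by (rule nn_integral_lebesgue_shift) measurable
  also have "\<dots> = (\<integral>\<^sup>+k. \<integral>\<^sup>+x. f (x + lattice_vec l k) * ?C (x + lattice_vec l k + (-z)) * ?C x \<partial>lebesgue \<partial>count_space UNIV)"
    by (rule swap) measurable
  also have "\<dots> = (\<integral>\<^sup>+k. \<integral>\<^sup>+x. f x * ?C x * ?C (x + (-z) + lattice_vec l k) \<partial>lebesgue \<partial>count_space UNIV)"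
    by (simp add: torus_periodic_lattice[OF per] algebra_simps)
  also have "\<dots> = (\<integral>\<^sup>+x. \<integral>\<^sup>+k. f x * ?C x * ?C (x + (-z) + lattice_vec l k) \<partial>count_space UNIV \<partial>lebesgue)"
    by (intro nn_integral_count_space_nn_integral[symmetric] countableI_type) (simp only: add.assoc, measurable)
  also have "\<dots> = (\<integral>\<^sup>+x\<in>torus_cell l. f x \<partial>lebesgue)"
    by (subst nn_integral_cmult) (simp_all add: one[of "_ - z", simplified])
  finally show ?thesis .
qed

lemma torus_periodic_comp: "torus_periodic l f \<Longrightarrow> torus_periodic l (\<lambda>x. g (f x))"
  by (simp add: torus_periodic_def)

lemma torus_periodic_comp2: "torus_periodic l f \<Longrightarrow> torus_periodic l h \<Longrightarrow> torus_periodic l (\<lambda>x. g (f x) (h x))"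
  by (simp add: torus_periodic_def)

lemma torus_periodic_shift: "torus_periodic l f \<Longrightarrow> torus_periodic l (\<lambda>x. f (x + z))"
  by (simp add: torus_periodic_def) (metis add.assoc add.commute)

lemma set_integrable_torus_shift:
  fixes f :: "real^'n \<Rightarrow> real"
  assumes l: "l > 0" and per: "torus_periodic l f" and [measurable]: "f \<in> borel_measurable lebesgue"
    and int: "set_integrable lebesgue (torus_cell l) f"
  shows "set_integrable lebesgue (torus_cell l) (\<lambda>x. f (x + z))"
proof -
  have [measurable]: "(\<lambda>x. f (x + z)) \<in> borel_measurable lebesgue"
    by (rule borel_measurable_lebesgue_shift) measurable
  have "(\<integral>\<^sup>+x\<in>torus_cell l. ennreal (norm (f (x + z))) \<partial>lebesgue) = (\<integral>\<^sup>+x\<in>torus_cell l. ennreal (norm (f x)) \<partial>lebesgue)"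
    by (rule nn_integral_torus_shift[OF l torus_periodic_comp[OF per]]) measurable
  also have "\<dots> < \<infinity>"
    using int by (simp add: set_integrable_def integrable_iff_bounded nn_integral_set_ennreal indicator_mult_ennreal abs_mult mult.commute)
  finally show ?thesis
    by (simp add: set_integrable_def integrable_iff_bounded nn_integral_set_ennreal indicator_mult_ennreal abs_mult mult.commute)
qed

lemma torus_integral_shift:
  fixes f :: "real^'n \<Rightarrow> real"
  assumes l: "l > 0" and per: "torus_periodic l f" and [measurable]: "f \<in> borel_measurable lebesgue"
    and int: "set_integrable lebesgue (torus_cell l) f"
  shows "torus_integral l (\<lambda>x. f (x + z)) = torus_integral l f"
proof -
  have *: "torus_integral l g = enn2real (\<integral>\<^sup>+x\<in>torus_cell l. ennreal (g x) \<partial>lebesgue) - enn2real (\<integral>\<^sup>+x\<in>torus_cell l. ennreal (- g x) \<partial>lebesgue)"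
    if "set_integrable lebesgue (torus_cell l) g" for g :: "real^'n \<Rightarrow> real"
  proof -
    have "(\<integral>\<^sup>+x. ennreal (indicator (torus_cell l) x *\<^sub>R h x) \<partial>lebesgue) = (\<integral>\<^sup>+x\<in>torus_cell l. ennreal (h x) \<partial>lebesgue)" for h :: "real^'n \<Rightarrow> real"
      by (intro nn_integral_cong) (auto split: split_indicator)
    from this[of g] this[of "\<lambda>x. - g x"] show ?thesis
      using that unfolding torus_integral_def set_lebesgue_integral_def set_integrable_def
      by (subst real_lebesgue_integral_def) simp_all
  qed
  show ?thesis
    unfolding *[OF int] *[OF set_integrable_torus_shift[OF assms]]
    using nn_integral_torus_shift[OF l torus_periodic_comp[OF per], of ennreal z]
      nn_integral_torus_shift[OF l torus_periodic_comp[OF per], of "\<lambda>y. ennreal (- y)" z] by simp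
qed

section \<open>Density of periodic fields\<close>

text \<open>Regularity squeezes \<open>A\<close> between a compact \<open>k\<close> and an open
  \<open>U\<close> of nearly the same measure; a Urysohn function for the pair differs from the
  indicator only on \<open>U - k\<close>.\<close>

lemma continuous_approx_indicator:
  fixes m :: "'a::euclidean_space measure"
  assumes fin: "finite_measure m" and sets: "sets m = sets borel" and A: "A \<in> sets borel" and e: "e > 0"
  obtains f where "continuous_on UNIV f" "\<And>x. f x \<in> {0..1::real}" "(\<integral>x. \<bar>f x - indicator A x\<bar> \<partial>m) < e"
proof -
  interpret finite_measure m by fact
  have ne: "emeasure m (space m) \<noteq> \<infinity>" by simp
  have m: "emeasure m B = ennreal (measure m B)" for B by (rule emeasure_eq_measure)
  have [measurable]: "A \<in> sets m" using A sets by simp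
  have "\<exists>k. k \<subseteq> A \<and> compact k \<and> measure m k > measure m A - e/2"
  proof (rule ccontr)
    assume H: "\<not> (\<exists>k. k \<subseteq> A \<and> compact k \<and> measure m k > measure m A - e/2)"
    then have "emeasure m k \<le> ennreal (measure m A - e/2)" if "k \<subseteq> A" "compact k" for k
      using that by (force simp: m intro: ennreal_leI)
    then have le: "emeasure m A \<le> ennreal (measure m A - e/2)"
      unfolding inner_regular[OF sets ne A] by (intro SUP_least) auto
    \<comment> \<open>The empty set is compact too, so the negated claim bounds the right-hand side
      below by 0; this rules out truncation by \<open>ennreal\<close>.\<close>
    have pos: "measure m A - e/2 \<ge> 0"
      using spec[OF H[unfolded not_ex], of "{}"] by simp
    from le have "measure m A \<le> measure m A - e/2"
      unfolding m using pos by (simp add: ennreal_le_iff)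
    with e show False by simp
  qed
  then obtain k where k: "k \<subseteq> A" "compact k" "measure m k > measure m A - e/2" by blast
  have "\<exists>U. A \<subseteq> U \<and> open U \<and> measure m U < measure m A + e/2"
  proof (rule ccontr)
    assume "\<not> (\<exists>U. A \<subseteq> U \<and> open U \<and> measure m U < measure m A + e/2)"
    then have "emeasure m U \<ge> ennreal (measure m A + e/2)" if "A \<subseteq> U" "open U" for U
      using that by (force simp: m intro: ennreal_leI)
    then have le: "emeasure m A \<ge> ennreal (measure m A + e/2)"
      unfolding outer_regular[OF sets ne A] by (intro INF_greatest) auto
    then have "measure m A + e/2 \<le> measure m A"
      unfolding m using e by (simp add: ennreal_le_iff)
    with e show False by simp
  qed
  then obtain U where U: "A \<subseteq> U" "open U" "measure m U < measure m A + e/2" by blast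
  obtain f where f: "continuous_on UNIV f" "\<And>x. f x \<in> closed_segment 1 (0::real)"
     "\<And>x. x \<in> k \<Longrightarrow> f x = 1" "\<And>x. x \<in> -U \<Longrightarrow> f x = 0"
  proof (rule Urysohn[of k "-U" 1 "0::real"])
    show "closed k" "closed (- U)" "k \<inter> - U = {}" using k U by (auto intro: compact_imp_closed)
  qed blast
  have f01: "f x \<in> {0..1}" for x using f(2)[of x] by (simp add: closed_segment_eq_real_ivl)
  have [measurable]: "U \<in> sets m" "k \<in> sets m" using U k sets by (auto simp: compact_imp_closed)
  have fm[measurable]: "f \<in> borel_measurable m"
    using borel_measurable_continuous_onI[OF f(1)] measurable_cong_sets[OF sets refl] by blast
  have pt: "\<bar>f x - indicator A x\<bar> \<le> indicator (U - k) x" for x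
    using f01[of x] f(3)[of x] f(4)[of x] k(1) U(1) by (auto split: split_indicator)
  have "(\<integral>x. \<bar>f x - indicator A x\<bar> \<partial>m) \<le> (\<integral>x. indicator (U - k) x \<partial>m)"
  proof (rule integral_mono)
    have "\<bar>f x - indicator A x\<bar> \<le> 1" for x using f01[of x] by (auto split: split_indicator)
    then show "integrable m (\<lambda>x. \<bar>f x - indicator A x\<bar>)"
      by (intro integrable_const_bound[where B=1]) auto
    show "integrable m (indicator (U - k) :: _ \<Rightarrow> real)"
      by (intro integrable_const_bound[where B=1]) (auto split: split_indicator)
  qed (rule pt)
  also have "\<dots> = measure m U - measure m k"
    using k U by (subst finite_measure_Diff[symmetric]) auto
  also have "\<dots> < e" using k U by linarith
  finally show thesis using f(1) f01 that by blast
qed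

text \<open>Induction over integrable functions. Boundedness is carried along because on a finite
  measure it makes the continuous approximants integrable, which the sum and limit cases
  use.\<close>

lemma continuous_dense_L1:
  fixes m :: "'a::euclidean_space measure" and \<psi> :: "'a \<Rightarrow> 'b::euclidean_space"
  assumes fin: "finite_measure m" and sets: "sets m = sets borel" and "integrable m \<psi>" and "e > 0"
  shows "\<exists>f. continuous_on UNIV f \<and> bounded (range f) \<and> (\<integral>x. norm (f x - \<psi> x) \<partial>m) < e"
  using assms(3,4)
proof (induction \<psi> arbitrary: e rule: integrable_induct)
  case (base A c)
  interpret finite_measure m by fact
  have A: "A \<in> sets borel" using base sets by simp
  \<comment> \<open>Adding 1 to the norm keeps the tolerance meaningful for
    \<open>c = 0\<close>.\<close>
  have "e / (norm c + 1) > 0" using base by (simp add: add_nonneg_pos)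
  from continuous_approx_indicator[OF fin sets A this]
  obtain f where f: "continuous_on UNIV f" "\<And>x. f x \<in> {0..1::real}" "(\<integral>x. \<bar>f x - indicator A x\<bar> \<partial>m) < e / (norm c + 1)" by blast
  show ?case
  proof (intro exI[of _ "\<lambda>x. f x *\<^sub>R c"] conjI)
    show "continuous_on UNIV (\<lambda>x. f x *\<^sub>R c)" using f(1) by (intro continuous_intros)
    show "bounded (range (\<lambda>x. f x *\<^sub>R c))"
      using f(2) by (auto intro!: boundedI[of _ "norm c"] mult_left_le_one_le)
    have "(\<integral>x. norm (f x *\<^sub>R c - indicator A x *\<^sub>R c) \<partial>m) = (\<integral>x. \<bar>f x - indicator A x\<bar> \<partial>m) * norm c"
      by (simp flip: scaleR_left_diff_distrib)
    also have "\<dots> \<le> (\<integral>x. \<bar>f x - indicator A x\<bar> \<partial>m) * (norm c + 1)"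
      by (intro mult_left_mono) auto
    also have "\<dots> < e" using f(3) by (simp add: pos_less_divide_eq add_nonneg_pos)
    finally show "(\<integral>x. norm (f x *\<^sub>R c - indicator A x *\<^sub>R c) \<partial>m) < e" .
  qed
next
  case (add f g)
  interpret finite_measure m by fact
  have e2: "e/2 > 0" using add by simp
  obtain f' g' where fg: "continuous_on UNIV f'" "bounded (range f')" "(\<integral>x. norm (f' x - f x) \<partial>m) < e/2"
    "continuous_on UNIV g'" "bounded (range g')" "(\<integral>x. norm (g' x - g x) \<partial>m) < e/2"
    using add.IH(1)[OF e2] add.IH(2)[OF e2] by blast
  have int: "integrable m h" if "continuous_on UNIV h" "bounded (range h)" for h :: "'a \<Rightarrow> 'b"
  proof -
    have "h \<in> borel_measurable m"
      using borel_measurable_continuous_onI[OF that(1)] measurable_cong_sets[OF sets refl] by blast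
    with that(2) show ?thesis unfolding bounded_iff by (auto intro: integrable_const_bound)
  qed
  note int' = int[OF fg(1,2)] int[OF fg(4,5)]
  show ?case
  proof (intro exI[of _ "\<lambda>x. f' x + g' x"] conjI)
    show "continuous_on UNIV (\<lambda>x. f' x + g' x)" using fg by (intro continuous_intros)
    show "bounded (range (\<lambda>x. f' x + g' x))" using fg(2,5) by (rule bounded_plus_comp)
    have "(\<integral>x. norm (f' x + g' x - (f x + g x)) \<partial>m) \<le> (\<integral>x. norm (f' x - f x) + norm (g' x - g x) \<partial>m)"
      using add.hyps int' by (intro integral_mono) (auto simp: add_diff_add norm_triangle_ineq)
    also have "\<dots> = (\<integral>x. norm (f' x - f x) \<partial>m) + (\<integral>x. norm (g' x - g x) \<partial>m)"
      using add.hyps int' by (intro Bochner_Integration.integral_add) auto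
    finally show "(\<integral>x. norm (f' x + g' x - (f x + g x)) \<partial>m) < e" using fg by simp
  qed
next
  case (lim f s)
  interpret finite_measure m by fact
  have "(\<lambda>i. (\<integral>x. norm (s i x - f x) \<partial>m)) \<longlonglongrightarrow> (\<integral>x. norm (f x - f x) \<partial>m)"
  proof (rule integral_dominated_convergence[where w="\<lambda>x. 3 * norm (f x)"])
    show "AE x in m. norm (norm (s i x - f x)) \<le> 3 * norm (f x)" for i
    proof (rule AE_I2)
      fix x assume "x \<in> space m"
      then have "norm (s i x) \<le> 2 * norm (f x)" by (rule lim.hyps)
      then show "norm (norm (s i x - f x)) \<le> 3 * norm (f x)"
        using norm_triangle_ineq4[of "s i x" "f x"] by simp
    qed
    show "AE x in m. (\<lambda>i. norm (s i x - f x)) \<longlonglongrightarrow> norm (f x - f x)"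
      using lim.hyps(2) by (intro AE_I2 tendsto_intros) auto
  qed (use lim in \<open>auto simp: borel_measurable_integrable\<close>)
  then have "(\<lambda>i. (\<integral>x. norm (s i x - f x) \<partial>m)) \<longlonglongrightarrow> 0" by simp
  from order_tendstoD(2)[OF this, of "e/2"] lim.prems obtain i where i: "(\<integral>x. norm (s i x - f x) \<partial>m) < e/2"
    by (auto simp: eventually_sequentially)
  obtain g where g: "continuous_on UNIV g" "bounded (range g)" "(\<integral>x. norm (g x - s i x) \<partial>m) < e/2"
    using lim.IH[of "e/2" i] lim.prems by auto
  have "g \<in> borel_measurable m"
    using borel_measurable_continuous_onI[OF g(1)] measurable_cong_sets[OF sets refl] by blast
  with g(2) have int: "integrable m g" unfolding bounded_iff by (auto intro: integrable_const_bound)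
  have "(\<integral>x. norm (g x - f x) \<partial>m) \<le> (\<integral>x. norm (g x - s i x) + norm (s i x - f x) \<partial>m)"
  proof (rule integral_mono)
    show "norm (g x - f x) \<le> norm (g x - s i x) + norm (s i x - f x)" for x
      using norm_triangle_ineq[of "g x - s i x" "s i x - f x"] by simp
  qed (use lim int in auto)
  also have "\<dots> = (\<integral>x. norm (g x - s i x) \<partial>m) + (\<integral>x. norm (s i x - f x) \<partial>m)"
    using lim int by (intro Bochner_Integration.integral_add) auto
  finally show ?case using g i by (intro exI[of _ g]) auto
qed

text \<open>Projection onto the closed unit ball is 1-Lipschitz and fixes the values of
  \<open>\<psi>\<close>, so composing an approximant with it enforces the constraint without
  increasing the error.\<close>

lemma continuous_dense_unit_ball:
  fixes m :: "'a::euclidean_space measure" and \<psi> :: "'a \<Rightarrow> 'b::euclidean_space"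
  assumes fin: "finite_measure m" and sets: "sets m = sets borel" and [measurable]: "\<psi> \<in> borel_measurable borel"
    and le1: "\<And>x. norm (\<psi> x) \<le> 1" and "e > 0"
  shows "\<exists>f. continuous_on UNIV f \<and> (\<forall>x. norm (f x) \<le> 1) \<and> (\<integral>x. norm (f x - \<psi> x) \<partial>m) < e"
proof -
  interpret finite_measure m by fact
  have [measurable]: "\<psi> \<in> borel_measurable m" using measurable_cong_sets[OF sets refl] assms(3) by blast
  have int: "integrable m \<psi>" by (rule integrable_const_bound[where B=1]) (use le1 in auto)
  then obtain f where f: "continuous_on UNIV f" "bounded (range f)" "(\<integral>x. norm (f x - \<psi> x) \<partial>m) < e"
    using continuous_dense_L1[OF fin sets] \<open>e > 0\<close> by blast
  define P :: "'b \<Rightarrow> 'b" where "P = closest_point (cball 0 1)"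
  have ne: "convex (cball 0 1 :: 'b set)" "closed (cball 0 1 :: 'b set)" "cball 0 1 \<noteq> ({} :: 'b set)" by auto
  have Pc: "continuous_on UNIV P" unfolding P_def by (rule continuous_on_closest_point[OF ne])
  have P1: "norm (P y) \<le> 1" for y using closest_point_in_set[OF ne(2,3), of y] by (simp add: P_def)
  have PL: "norm (P y - \<psi> x) \<le> norm (y - \<psi> x)" for y x
    using closest_point_lipschitz[OF ne, of y "\<psi> x"] closest_point_self[of "\<psi> x" "cball 0 1"] le1[of x]
    by (simp add: P_def dist_norm)
  have Pf: "continuous_on UNIV (\<lambda>x. P (f x))"
    by (rule continuous_on_compose2[OF Pc f(1)]) auto
  have im: "integrable m h" if "continuous_on UNIV h" "bounded (range h)" for h :: "'a \<Rightarrow> 'b"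
  proof -
    have "h \<in> borel_measurable m"
      using borel_measurable_continuous_onI[OF that(1)] measurable_cong_sets[OF sets refl] by blast
    with that(2) show ?thesis unfolding bounded_iff by (auto intro: integrable_const_bound)
  qed
  have "integrable m (\<lambda>x. P (f x))" by (rule im[OF Pf]) (auto intro: boundedI P1)
  then have "(\<integral>x. norm (P (f x) - \<psi> x) \<partial>m) \<le> (\<integral>x. norm (f x - \<psi> x) \<partial>m)"
    using im[OF f(1,2)] int by (intro integral_mono PL) auto
  then show ?thesis using f(3) Pf P1 by (intro exI[of _ "\<lambda>x. P (f x)"]) auto
qed

text \<open>Stone-Weierstrass gives a polynomial within \<open>d\<close> of a continuous approximant
  on \<open>S\<close>, hence of norm at most \<open>1 + d\<close> there; dividing by
  \<open>1 + d\<close> restores the constraint and costs another \<open>d\<close>.\<close>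

lemma polynomial_dense_unit_ball:
  fixes m :: "'a::euclidean_space measure" and \<psi> :: "'a \<Rightarrow> 'b::euclidean_space"
  assumes fin: "finite_measure m" and sets: "sets m = sets borel" and \<psi>: "\<psi> \<in> borel_measurable borel"
    and le1: "\<And>x. norm (\<psi> x) \<le> 1" and "e > 0" and S: "compact S" and supp: "AE x in m. x \<in> S"
  shows "\<exists>g. polynomial_function g \<and> (\<forall>x\<in>S. norm (g x) \<le> 1) \<and> (\<integral>x. norm (g x - \<psi> x) \<partial>m) < e"
proof -
  interpret finite_measure m by fact
  have [measurable]: "\<psi> \<in> borel_measurable m" using measurable_cong_sets[OF sets refl] \<psi> by blast
  obtain f where f: "continuous_on UNIV f" "\<And>x. norm (f x) \<le> 1" "(\<integral>x. norm (f x - \<psi> x) \<partial>m) < e/2"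
    using continuous_dense_unit_ball[OF fin sets \<psi> le1, of "e/2"] \<open>e > 0\<close> by auto
  define M where "M = measure m (space m)"
  have M: "M \<ge> 0" by (simp add: M_def)
  \<comment> \<open>Half of \<open>e\<close> is reserved for the continuous approximant; the uniform
    error \<open>2 * d\<close> integrates to at most the other half. The summand 1 covers
    \<open>M = 0\<close>.\<close>
  define d where "d = e / (4 * (M + 1))"
  have d: "d > 0" using \<open>e > 0\<close> M by (simp add: d_def)
  obtain g where g: "polynomial_function g" "\<And>x. x \<in> S \<Longrightarrow> norm (f x - g x) < d"
    using Stone_Weierstrass_polynomial_function[OF S, of f d] f(1) d continuous_on_subset by (metis subset_UNIV)
  define h where "h x = (1 / (1 + d)) *\<^sub>R g x" for x
  have h: "polynomial_function h" unfolding h_def using g(1) by (rule polynomial_function_cmul)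
  have h1: "norm (h x) \<le> 1" and hf: "norm (h x - f x) \<le> 2 * d" if "x \<in> S" for x
  proof -
    have gx: "norm (g x) \<le> 1 + d" using g(2)[OF that] f(2)[of x] norm_triangle_ineq2[of "g x" "f x"] by (simp add: norm_minus_commute)
    then show "norm (h x) \<le> 1" using d by (simp add: h_def divide_le_eq)
    have "norm (h x - g x) = norm ((- d / (1 + d)) *\<^sub>R g x)"
    proof -
      have "h x - g x = (1 / (1 + d) - 1) *\<^sub>R g x" by (simp add: h_def scaleR_left_diff_distrib)
      also have "1 / (1 + d) - 1 = - d / (1 + d)" using d by (simp add: field_simps)
      finally show ?thesis by simp
    qed
    also have "\<dots> = d / (1 + d) * norm (g x)" using d by simp
    also have "\<dots> \<le> d / (1 + d) * (1 + d)" using gx d by (intro mult_left_mono) auto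
    also have "\<dots> = d" using d by simp
    finally have "norm (h x - g x) \<le> d" .
    then show "norm (h x - f x) \<le> 2 * d"
      using g(2)[OF that] norm_triangle_ineq[of "h x - g x" "g x - f x"] by (simp add: norm_minus_commute)
  qed
  have hm[measurable]: "h \<in> borel_measurable m"
    using borel_measurable_continuous_onI[OF continuous_on_polymonial_function[OF h]] measurable_cong_sets[OF sets refl] by blast
  have fm[measurable]: "f \<in> borel_measurable m"
    using borel_measurable_continuous_onI[OF f(1)] measurable_cong_sets[OF sets refl] by blast
  have ih: "integrable m h" by (rule integrable_const_bound[where B=1]) (use supp h1 in auto)
  have if': "integrable m f" by (rule integrable_const_bound[where B=1]) (use f in auto)
  have ip: "integrable m \<psi>" by (rule integrable_const_bound[where B=1]) (use le1 in auto)
  have "(\<integral>x. norm (h x - \<psi> x) \<partial>m) \<le> (\<integral>x. 2 * d + norm (f x - \<psi> x) \<partial>m)"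
  proof (rule integral_mono_AE)
    show "AE x in m. norm (h x - \<psi> x) \<le> 2 * d + norm (f x - \<psi> x)"
      using supp
    proof eventually_elim
      case (elim x)
      then show ?case using hf[of x] norm_triangle_ineq[of "h x - f x" "f x - \<psi> x"] by simp
    qed
  qed (use ih if' ip in auto)
  also have "\<dots> = 2 * d * M + (\<integral>x. norm (f x - \<psi> x) \<partial>m)"
    using if' ip by (subst Bochner_Integration.integral_add) (auto simp: M_def)
  also have "\<dots> < e"
  proof -
    have "2 * d * M \<le> e / 2" using M \<open>e > 0\<close> by (simp add: d_def field_simps)
    then show ?thesis using f(3) by simp
  qed
  finally show ?thesis using h h1 by blast
qed

section \<open>Periodic functions of class C1\<close>

definition C1_periodic :: "real \<Rightarrow> (real^'n \<Rightarrow> 'b::real_normed_vector) \<Rightarrow> bool" where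
  "C1_periodic l \<phi> \<longleftrightarrow> torus_periodic l \<phi> \<and>
     (\<exists>D. (\<forall>x. (\<phi> has_derivative D x) (at x)) \<and> (\<forall>h. continuous_on UNIV (\<lambda>x. D x h)))"

text \<open>In \<open>C1_periodic\<close> the derivative is supplied as a witness and the codomain
  is arbitrary, so scalar test functions and the torus embedding obey the same closure rules. On
  vector fields uniqueness of the derivative identifies the two notions.\<close>

lemma torus_C1_fields_iff: "\<phi> \<in> torus_C1_fields l \<longleftrightarrow> C1_periodic l \<phi>"
proof
  assume "\<phi> \<in> torus_C1_fields l"
  then show "C1_periodic l \<phi>"
    unfolding torus_C1_fields_def C1_periodic_def frechet_derivative_works
    by (intro conjI exI[of _ "\<lambda>x. frechet_derivative \<phi> (at x)"]) auto
next
  assume "C1_periodic l \<phi>"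
  then obtain D where D: "torus_periodic l \<phi>" "\<And>x. (\<phi> has_derivative D x) (at x)" "\<And>h. continuous_on UNIV (\<lambda>x. D x h)"
    unfolding C1_periodic_def by blast
  have "D x = frechet_derivative \<phi> (at x)" for x using D(2) by (rule frechet_derivative_at)
  with D show "\<phi> \<in> torus_C1_fields l" by (auto simp: torus_C1_fields_def differentiable_def)
qed

lemma C1_periodic_const: "C1_periodic l (\<lambda>x. c)"
  unfolding C1_periodic_def torus_periodic_def by (auto intro!: exI[of _ "\<lambda>x h. 0"])

lemma C1_periodic_add:
  assumes "C1_periodic l f" "C1_periodic l g"
  shows "C1_periodic l (\<lambda>x. f x + g x)"
proof -
  from assms obtain D E where D: "\<And>x. (f has_derivative D x) (at x)" "\<And>h. continuous_on UNIV (\<lambda>x. D x h)"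
    and E: "\<And>x. (g has_derivative E x) (at x)" "\<And>h. continuous_on UNIV (\<lambda>x. E x h)"
    unfolding C1_periodic_def by blast
  show ?thesis unfolding C1_periodic_def
    using assms by (intro conjI exI[of _ "\<lambda>x h. D x h + E x h"] allI)
      (auto intro!: D E derivative_intros continuous_intros simp: C1_periodic_def torus_periodic_def)
qed

lemma C1_periodic_scaleR:
  assumes "C1_periodic l f" "C1_periodic l g"
  shows "C1_periodic l (\<lambda>x. f x *\<^sub>R g x)"
proof -
  from assms obtain D E where D: "\<And>x. (f has_derivative D x) (at x)" "\<And>h. continuous_on UNIV (\<lambda>x. D x h)"
    and E: "\<And>x. (g has_derivative E x) (at x)" "\<And>h. continuous_on UNIV (\<lambda>x. E x h)"
    unfolding C1_periodic_def by blast
  have "continuous_on UNIV f" "continuous_on UNIV g"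
    using D(1) E(1) by (auto intro!: has_derivative_continuous_on)
  then show ?thesis unfolding C1_periodic_def
    using assms by (intro conjI exI[of _ "\<lambda>x h. f x *\<^sub>R E x h + D x h *\<^sub>R g x"] allI)
      (auto intro!: D E has_derivative_scaleR continuous_intros simp: C1_periodic_def torus_periodic_def)
qed

lemma C1_periodic_sum:
  "finite I \<Longrightarrow> (\<And>i. i \<in> I \<Longrightarrow> C1_periodic l (f i)) \<Longrightarrow> C1_periodic l (\<lambda>x. \<Sum>i\<in>I. f i x)"
  by (induction I rule: finite_induct) (auto intro: C1_periodic_const C1_periodic_add)

lemma C1_periodic_shift:
  assumes "C1_periodic l f"
  shows "C1_periodic l (\<lambda>x. f (x + z))"
proof -
  from assms obtain D where D: "\<And>x. (f has_derivative D x) (at x)" "\<And>h. continuous_on UNIV (\<lambda>x. D x h)"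
    unfolding C1_periodic_def by blast
  show ?thesis unfolding C1_periodic_def
  proof (intro conjI exI[of _ "\<lambda>x h. D (x + z) h"] allI)
    show "torus_periodic l (\<lambda>x. f (x + z))" using assms torus_periodic_shift by (auto simp: C1_periodic_def)
    show "((\<lambda>x. f (x + z)) has_derivative (\<lambda>h. D (x + z) h)) (at x)" for x
      by (rule has_derivative_compose[of "\<lambda>x. x + z" "\<lambda>h. h", OF _ D(1)]) (auto intro!: derivative_eq_intros)
    show "continuous_on UNIV (\<lambda>x. D (x + z) h)" for h
      by (rule continuous_on_compose2[OF D(2)]) (auto intro!: continuous_intros)
  qed
qed

definition torus_embed :: "real \<Rightarrow> real^'n \<Rightarrow> (real^'n) \<times> (real^'n)" where
  "torus_embed l x = (\<chi> i. cos (2 * pi * x $ i / l), \<chi> i. sin (2 * pi * x $ i / l))"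

lemma C1_periodic_vec:
  fixes f :: "real^'n \<Rightarrow> real^'m"
  assumes "\<And>i. C1_periodic l (\<lambda>x. f x $ i)"
  shows "C1_periodic l f"
proof -
  have "C1_periodic l (\<lambda>x. \<Sum>i\<in>UNIV. f x $ i *\<^sub>R axis i (1::real))"
    by (intro C1_periodic_sum C1_periodic_scaleR assms C1_periodic_const) simp
  also have "(\<lambda>x. \<Sum>i\<in>UNIV. f x $ i *\<^sub>R axis i (1::real)) = f"
    using basis_expansion[of "f _"] by (simp add: scalar_mult_eq_scaleR)
  finally show ?thesis .
qed

lemma C1_periodic_Pair:
  assumes "C1_periodic l f" "C1_periodic l g"
  shows "C1_periodic l (\<lambda>x. (f x, g x))"
proof -
  from assms obtain D E where D: "\<And>x. (f has_derivative D x) (at x)" "\<And>h. continuous_on UNIV (\<lambda>x. D x h)"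
    and E: "\<And>x. (g has_derivative E x) (at x)" "\<And>h. continuous_on UNIV (\<lambda>x. E x h)"
    unfolding C1_periodic_def by blast
  show ?thesis unfolding C1_periodic_def
    using assms by (intro conjI exI[of _ "\<lambda>x h. (D x h, E x h)"] allI)
      (auto intro!: D E has_derivative_Pair continuous_on_Pair simp: C1_periodic_def torus_periodic_def)
qed

lemma C1_periodic_torus_embed:
  assumes "l > 0"
  shows "C1_periodic l (torus_embed l :: real^'n \<Rightarrow> _)"
  unfolding torus_embed_def
proof (intro C1_periodic_Pair C1_periodic_vec)
  fix i :: 'n
  have nth: "((\<lambda>x::real^'n. x $ i) has_derivative (\<lambda>h. h $ i)) (at x)" for x
    by (rule bounded_linear_imp_has_derivative[OF bounded_linear_vec_nth])
  have cnth: "continuous_on UNIV (\<lambda>x::real^'n. x $ i)" by (intro continuous_intros)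
  have l0: "l \<noteq> 0" using assms by simp
  show "C1_periodic l (\<lambda>x::real^'n. (\<chi> i. cos (2 * pi * x $ i / l)) $ i)"
    unfolding C1_periodic_def vec_lambda_beta
    apply (intro conjI exI[of _ "\<lambda>x h. - (sin (2 * pi * x $ i / l) * (2 * pi * h $ i / l))"] allI)
    subgoal unfolding torus_periodic_def by (auto simp: axis_def add_divide_distrib distrib_left l0)
    subgoal by (rule derivative_eq_intros nth refl | simp add: l0)+ (simp add: fun_eq_iff algebra_simps)
    subgoal using cnth by (intro continuous_intros) (auto simp: l0)
    done
  show "C1_periodic l (\<lambda>x::real^'n. (\<chi> i. sin (2 * pi * x $ i / l)) $ i)"
    unfolding C1_periodic_def vec_lambda_beta
    apply (intro conjI exI[of _ "\<lambda>x h. (cos (2 * pi * x $ i / l) * (2 * pi * h $ i / l))"] allI)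
    subgoal unfolding torus_periodic_def by (auto simp: axis_def add_divide_distrib distrib_left l0)
    subgoal by (rule derivative_eq_intros nth refl | simp add: l0)+ (simp add: fun_eq_iff algebra_simps)
    subgoal using cnth by (intro continuous_intros) (auto simp: l0)
    done
qed

lemma C1_periodic_bounded_linear:
  assumes "C1_periodic l f" "bounded_linear b"
  shows "C1_periodic l (\<lambda>x. b (f x))"
proof -
  from assms obtain D where D: "\<And>x. (f has_derivative D x) (at x)" "\<And>h. continuous_on UNIV (\<lambda>x. D x h)"
    unfolding C1_periodic_def by blast
  show ?thesis unfolding C1_periodic_def
    using assms(1) by (intro conjI exI[of _ "\<lambda>x h. b (D x h)"] allI)
      (auto intro!: bounded_linear.has_derivative[OF assms(2)] bounded_linear.continuous_on[OF assms(2)] D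
        simp: C1_periodic_def torus_periodic_def)
qed

text \<open>Coordinates of a polynomial function are built from linear forms and constants by sums
  and products, all of which preserve the class.\<close>

lemma C1_periodic_polynomial_comp:
  fixes p :: "'a::euclidean_space \<Rightarrow> 'b::euclidean_space"
  assumes f: "C1_periodic l f" and p: "polynomial_function p"
  shows "C1_periodic l (\<lambda>x. p (f x))"
proof -
  have real: "C1_periodic l (\<lambda>x. q (f x))" if "real_polynomial_function q" for q :: "'a \<Rightarrow> real"
    using that
  proof induction
    case (mult g h)
    then show ?case using C1_periodic_scaleR[of l "\<lambda>x. g (f x)" "\<lambda>x. h (f x)"] by simp
  qed (auto intro: C1_periodic_bounded_linear f C1_periodic_const C1_periodic_add)
  have "C1_periodic l (\<lambda>x. \<Sum>b\<in>Basis. (p (f x) \<bullet> b) *\<^sub>R b)"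
  proof (intro C1_periodic_sum C1_periodic_scaleR C1_periodic_const finite_Basis)
    fix b :: 'b
    have "real_polynomial_function (\<lambda>y. p y \<bullet> b)"
      using p bounded_linear_inner_left unfolding polynomial_function_def o_def by blast
    from real[OF this] show "C1_periodic l (\<lambda>x. p (f x) \<bullet> b)" .
  qed
  then show ?thesis by (simp add: euclidean_representation)
qed

text \<open>Arccosine recovers the angle on the upper half circle, and the sign of the sine selects
  \<open>2 * pi - A c\<close> on the lower half. The argument is clamped to [-1,1] so that
  \<open>A\<close> is continuous, hence Borel, everywhere. The inverse transports Borel functions
  from the cell to the ambient space of the embedding.\<close>

lemma torus_embed_inverse:
  assumes l: "l > 0"
  obtains R :: "(real^'n) \<times> (real^'n) \<Rightarrow> real^'n"
  where "R \<in> borel_measurable borel" "\<And>x. x \<in> torus_cell l \<Longrightarrow> R (torus_embed l x) = x"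
proof -
  define A where "A t = arccos (max (-1) (min 1 t))" for t :: real
  have Ac: "continuous_on UNIV A" unfolding A_def
    by (intro continuous_on_arccos continuous_intros) (auto simp: min_def max_def)
  have Am[measurable]: "A \<in> borel_measurable borel" by (rule borel_measurable_continuous_onI[OF Ac])
  define r where "r c s = (if s \<ge> 0 then A c else 2 * pi - A c) * l / (2 * pi)" for c s :: real
  define R :: "(real^'n) \<times> (real^'n) \<Rightarrow> real^'n" where "R p = (\<chi> i. r (fst p $ i) (snd p $ i))" for p
  have c1[measurable]: "(\<lambda>p::(real^'n) \<times> (real^'n). fst p $ i) \<in> borel_measurable borel" for i
    by (intro borel_measurable_continuous_onI continuous_intros)
  have c2[measurable]: "(\<lambda>p::(real^'n) \<times> (real^'n). snd p $ i) \<in> borel_measurable borel" for i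
    by (intro borel_measurable_continuous_onI continuous_intros)
  show thesis
  proof
    show "R \<in> borel_measurable borel"
    proof (rule borel_measurable_euclidean_space[THEN iffD2], rule ballI)
      fix b :: "real^'n" assume "b \<in> Basis"
      then obtain i where b: "b = axis i 1" by (auto simp: Basis_vec_def)
      have "(\<lambda>p::(real^'n) \<times> (real^'n). r (fst p $ i) (snd p $ i)) \<in> borel_measurable borel"
        unfolding r_def by measurable
      then show "(\<lambda>p. R p \<bullet> b) \<in> borel_measurable borel"
        unfolding b inner_axis by (simp only: R_def vec_lambda_beta inner_real_def mult_1_right)
    qed
    fix x :: "real^'n" assume x: "x \<in> torus_cell l"
    have "r (cos (2 * pi * x $ i / l)) (sin (2 * pi * x $ i / l)) = x $ i" for i
    proof -
      define t where "t = 2 * pi * x $ i / l"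
      have xi: "0 \<le> x $ i" "x $ i < l" using x by (auto simp: torus_cell_def)
      have t: "0 \<le> t" "t < 2 * pi" using xi l by (auto simp: t_def divide_less_eq)
      have "max (-1) (min 1 (cos t)) = cos t" by (simp add: min_def max_def) (metis antisym cos_ge_minus_one cos_le_one linear)
      then have A: "A (cos t) = arccos (cos t)" by (simp add: A_def)
      have "r (cos t) (sin t) = t * l / (2 * pi)"
      proof (cases "t \<le> pi")
        case True
        then show ?thesis using t sin_ge_zero[of t] arccos_cos[of t] by (simp add: r_def A)
      next
        case False
        have "sin t < 0" using sin_lt_zero[of t] False t by simp
        moreover have "arccos (cos t) = 2 * pi - t"
          using arccos_cos[of "2 * pi - t"] False t by (simp add: cos_diff)
        ultimately show ?thesis by (simp add: r_def A)
      qed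
      then show ?thesis using l by (simp add: t_def)
    qed
    then show "R (torus_embed l x) = x" by (simp add: R_def torus_embed_def vec_eq_iff)
  qed
qed

lemma C1_periodic_imp_periodic: "C1_periodic l f \<Longrightarrow> torus_periodic l f"
  by (simp add: C1_periodic_def)

lemma C1_periodic_continuous: "C1_periodic l f \<Longrightarrow> continuous_on UNIV f"
  by (auto simp: C1_periodic_def intro: has_derivative_continuous_on)

text \<open>Composing polynomials on \<open>\<real>\<^sup>2\<^sup>n\<close> with the embedding of the torus as a product of circles produces
  periodic smooth functions, so periodicity never has to be enforced by hand.\<close>

lemma C1_periodic_dense_unit_ball:
  fixes m :: "(real^'n) measure" and \<psi> :: "real^'n \<Rightarrow> 'b::euclidean_space"
  assumes l: "l > 0" and fin: "finite_measure m" and sets: "sets m = sets borel" and supp: "emeasure m (- torus_cell l) = 0"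
    and \<psi>[measurable]: "\<psi> \<in> borel_measurable borel" and le1: "\<And>x. norm (\<psi> x) \<le> 1" and e: "e > 0"
  shows "\<exists>\<phi>. C1_periodic l \<phi> \<and> (\<forall>x. norm (\<phi> x) \<le> 1) \<and> (\<integral>x. norm (\<phi> x - \<psi> x) \<partial>m) < e"
proof -
  interpret finite_measure m by fact
  let ?E = "torus_embed l :: real^'n \<Rightarrow> _"
  note C1E = C1_periodic_torus_embed[OF l, where 'n='n]
  have Ec: "continuous_on UNIV ?E" by (rule C1_periodic_continuous[OF C1E])
  have Em: "?E \<in> m \<rightarrow>\<^sub>M borel"
    using borel_measurable_continuous_onI[OF Ec] measurable_cong_sets[OF sets refl] by blast
  obtain R :: "(real^'n) \<times> (real^'n) \<Rightarrow> real^'n"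
    where R[measurable]: "R \<in> borel_measurable borel" and RE: "\<And>x. x \<in> torus_cell l \<Longrightarrow> R (?E x) = x"
    using torus_embed_inverse[OF l] by blast
  \<comment> \<open>The closed box makes the image compact, as Stone-Weierstrass requires; by
    periodicity it is the image of the whole space.\<close>
  define S where "S = ?E ` cbox 0 (\<chi> i. l)"
  have S: "compact S" unfolding S_def by (intro compact_continuous_image continuous_on_subset[OF Ec]) auto
  define m' where "m' = distr m borel ?E"
  have cellAE: "AE x in m. x \<in> torus_cell l"
    by (rule AE_I[of _ _ "- torus_cell l"]) (use supp sets in auto)
  have ES: "?E x \<in> S" for x
  proof -
    have "?E x = ?E (torus_wrap l x)" using torus_periodic_wrap[OF C1_periodic_imp_periodic[OF C1E], of x] by simp
    moreover have "torus_wrap l x \<in> cbox 0 (\<chi> i. l)" using torus_wrap_in_cell[OF l] torus_cell_subset_cbox by blast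
    ultimately show ?thesis by (auto simp: S_def)
  qed
  have fin': "finite_measure m'" unfolding m'_def by (rule finite_measure_distr[OF Em])
  have suppS: "AE y in m'. y \<in> S" unfolding m'_def
    by (subst AE_distr_iff[OF Em]) (use compact_imp_closed[OF S] ES in auto)
  have comp[measurable]: "(\<lambda>y. \<psi> (R y)) \<in> borel_measurable borel" by measurable
  obtain g where g: "polynomial_function g" "\<And>y. y \<in> S \<Longrightarrow> norm (g y) \<le> 1" "(\<integral>y. norm (g y - \<psi> (R y)) \<partial>m') < e"
    using polynomial_dense_unit_ball[OF fin' _ comp le1 e S suppS] by (auto simp: m'_def)
  have gm[measurable]: "g \<in> borel_measurable borel"
    by (intro borel_measurable_continuous_onI continuous_on_polymonial_function g)
  have "(\<integral>y. norm (g y - \<psi> (R y)) \<partial>m') = (\<integral>x. norm (g (?E x) - \<psi> (R (?E x))) \<partial>m)"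
    unfolding m'_def by (rule integral_distr[OF Em]) measurable
  \<comment> \<open>\<open>R\<close> inverts the embedding on the cell, and the cell carries all of
    \<open>m\<close>.\<close>
  also have "\<dots> = (\<integral>x. norm (g (?E x) - \<psi> x) \<partial>m)"
    by (rule integral_cong_AE) (use cellAE Em sets in \<open>auto simp: RE measurable_cong_sets[OF sets refl] intro!: borel_measurable_norm borel_measurable_diff measurable_compose[OF Em]\<close>)
  finally have "(\<integral>x. norm (g (?E x) - \<psi> x) \<partial>m) < e" using g by simp
  then show ?thesis
    using C1_periodic_polynomial_comp[OF C1E g(1)] g(2) ES by blast
qed

section \<open>Shift differences and total variation\<close>

lemma continuous_periodic_bounded:
  fixes f :: "real^'n \<Rightarrow> 'b::real_normed_vector"
  assumes l: "l > 0" and "continuous_on UNIV f" "torus_periodic l f"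
  obtains B where "B \<ge> 0" "\<And>x. norm (f x) \<le> B"
proof -
  have "compact (f ` cbox 0 (\<chi> i. l))"
    by (intro compact_continuous_image continuous_on_subset[OF assms(2)]) auto
  then obtain B where B: "\<And>y. y \<in> cbox 0 (\<chi> i. l) \<Longrightarrow> norm (f y) \<le> B"
    using compact_imp_bounded[of "f ` cbox 0 (\<chi> i. l)"] unfolding bounded_iff by (metis imageI)
  have "norm (f x) \<le> B" for x
    using B[of "torus_wrap l x"] torus_wrap_in_cell[OF l, of x] torus_cell_subset_cbox[of l]
      torus_periodic_wrap[OF assms(3), of x] by auto
  then show thesis using that[of "max B 0"] by (meson max.cobounded2 max.coboundedI1)
qed

lemma continuous_imp_lebesgue_measurable:
  "continuous_on UNIV f \<Longrightarrow> f \<in> borel_measurable (lebesgue :: 'a::euclidean_space measure)"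
  by (intro measurable_completion) (simp add: borel_measurable_continuous_onI)

lemma torus_L1_D:
  assumes "u \<in> torus_L1 l"
  shows "torus_periodic l u" "u \<in> borel_measurable lebesgue" "set_integrable lebesgue (torus_cell l) u"
  using assms by (auto simp: torus_L1_def)

lemma set_integrable_torus_bounded:
  fixes g :: "real^'n \<Rightarrow> real"
  assumes l: "l > 0" and [measurable]: "g \<in> borel_measurable lebesgue" and "AE x in lebesgue. \<bar>g x\<bar> \<le> B"
  shows "set_integrable lebesgue (torus_cell l) g"
  unfolding set_integrable_def
proof (rule Bochner_Integration.integrable_bound)
  show "integrable lebesgue (\<lambda>x::real^'n. indicator (torus_cell l) x *\<^sub>R B)"
    using emeasure_torus_cell[OF l, where 'n='n] by (intro integrable_scaleR_left integrable_real_indicator) (simp_all add: less_top)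
  show "AE x in lebesgue. norm (indicator (torus_cell l) x *\<^sub>R g x) \<le> norm (indicator (torus_cell l) x *\<^sub>R B)"
    using assms(3) by eventually_elim (auto split: split_indicator)
qed measurable

lemma set_integrable_torus_mult_bounded:
  fixes u g :: "real^'n \<Rightarrow> real"
  assumes u: "set_integrable lebesgue (torus_cell l) u" and [measurable]: "u \<in> borel_measurable lebesgue" "g \<in> borel_measurable lebesgue"
    and "\<And>x. \<bar>g x\<bar> \<le> B"
  shows "set_integrable lebesgue (torus_cell l) (\<lambda>x. u x * g x)"
  unfolding set_integrable_def
proof (rule Bochner_Integration.integrable_bound)
  show "integrable lebesgue (\<lambda>x. B * (indicator (torus_cell l) x *\<^sub>R u x))"
    using u by (intro integrable_mult_right) (simp add: set_integrable_def)
  show "AE x in lebesgue. norm (indicator (torus_cell l) x *\<^sub>R (u x * g x)) \<le> norm (B * (indicator (torus_cell l) x *\<^sub>R u x))"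
  proof (rule AE_I2)
    fix x
    have "\<bar>u x\<bar> * \<bar>g x\<bar> \<le> \<bar>u x\<bar> * \<bar>B\<bar>"
      using assms(4)[of x] by (intro mult_left_mono) auto
    then show "norm (indicator (torus_cell l) x *\<^sub>R (u x * g x)) \<le> norm (B * (indicator (torus_cell l) x *\<^sub>R u x))"
      by (auto split: split_indicator simp: abs_mult mult.commute)
  qed
qed measurable

lemma torus_integral_add:
  "set_integrable lebesgue (torus_cell l) f \<Longrightarrow> set_integrable lebesgue (torus_cell l) g \<Longrightarrow>
    torus_integral l (\<lambda>x. f x + g x) = torus_integral l f + torus_integral l g"
  by (simp add: torus_integral_def set_integral_add)

lemma torus_integral_diff:
  "set_integrable lebesgue (torus_cell l) f \<Longrightarrow> set_integrable lebesgue (torus_cell l) g \<Longrightarrow>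
    torus_integral l (\<lambda>x. f x - g x) = torus_integral l f - torus_integral l g"
  by (simp add: torus_integral_def set_integral_diff)

lemma torus_integral_cmult: "torus_integral l (\<lambda>x. c * f x) = c * torus_integral l f"
  by (simp add: torus_integral_def)

lemma torus_integral_mono_AE:
  assumes "set_integrable lebesgue (torus_cell l) f" "set_integrable lebesgue (torus_cell l) g"
    and "AE x in lebesgue. f x \<le> g x"
  shows "torus_integral l f \<le> torus_integral l g"
  unfolding torus_integral_def using assms by (intro set_integral_mono_AE) auto

lemma torus_integral_nonneg: "(\<And>x. 0 \<le> f x) \<Longrightarrow> 0 \<le> torus_integral l f"
  unfolding torus_integral_def set_lebesgue_integral_def by (intro integral_nonneg_AE AE_I2) auto

lemma torus_integral_abs_le:
  assumes "set_integrable lebesgue (torus_cell l) f"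
  shows "\<bar>torus_integral l f\<bar> \<le> torus_integral l (\<lambda>x. \<bar>f x\<bar>)"
  unfolding torus_integral_def
  using set_integral_norm_bound[OF assms] by simp

lemma torus_integral_dominated:
  fixes f :: "nat \<Rightarrow> real^'n \<Rightarrow> real"
  assumes "\<And>n. f n \<in> borel_measurable lebesgue" "g \<in> borel_measurable lebesgue"
    and "set_integrable lebesgue (torus_cell l) w"
    and "AE x in lebesgue. (\<lambda>n. f n x) \<longlonglongrightarrow> g x" "\<And>n. AE x in lebesgue. \<bar>f n x\<bar> \<le> w x"
  shows "(\<lambda>n. torus_integral l (f n)) \<longlonglongrightarrow> torus_integral l g"
  unfolding torus_integral_def set_lebesgue_integral_def
proof (rule integral_dominated_convergence[where w="\<lambda>x. indicator (torus_cell l) x *\<^sub>R w x"])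
  show "integrable lebesgue (\<lambda>x. indicator (torus_cell l) x *\<^sub>R w x)" using assms(3) by (simp add: set_integrable_def)
  show "AE x in lebesgue. (\<lambda>n. indicator (torus_cell l) x *\<^sub>R f n x) \<longlonglongrightarrow> indicator (torus_cell l) x *\<^sub>R g x"
    using assms(4) by eventually_elim (intro tendsto_intros)
  show "AE x in lebesgue. norm (indicator (torus_cell l) x *\<^sub>R f n x) \<le> indicator (torus_cell l) x *\<^sub>R w x" for n
    using assms(5)[of n] by eventually_elim (auto split: split_indicator)
qed (use assms in measurable)

section \<open>Directional derivatives and duality for shift differences\<close>

text \<open>For a constant direction \<open>z\<close> only the scalar factor is differentiated, and
  linearity collects the partial derivatives into the derivative along \<open>z\<close>. Fields of
  this form test one direction of the gradient at a time.\<close>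

lemma divergence_scalar:
  assumes "(\<phi> has_derivative D) (at x)"
  shows "divergence (\<lambda>y. \<phi> y *\<^sub>R z) x = D z"
proof -
  have lin: "linear D" using assms has_derivative_linear by blast
  have "((\<lambda>y. \<phi> y *\<^sub>R z) has_derivative (\<lambda>h. D h *\<^sub>R z)) (at x)"
    using assms by (auto intro!: derivative_eq_intros)
  then have "frechet_derivative (\<lambda>y. \<phi> y *\<^sub>R z) (at x) = (\<lambda>h. D h *\<^sub>R z)" by (rule frechet_derivative_at[symmetric])
  then have "divergence (\<lambda>y. \<phi> y *\<^sub>R z) x = (\<Sum>i\<in>UNIV. z $ i *\<^sub>R D (axis i 1))"
    by (simp add: divergence_def mult.commute)
  also have "\<dots> = D (\<Sum>i\<in>UNIV. z $ i *\<^sub>R axis i 1)"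
    by (simp add: linear_sum[OF lin] linear_scale[OF lin])
  also have "(\<Sum>i\<in>UNIV. z $ i *\<^sub>R axis i (1::real)) = z"
    using basis_expansion[of z] by (simp add: scalar_mult_eq_scaleR)
  finally show ?thesis .
qed

text \<open>Uniqueness of derivatives passes the period of \<open>\<phi>\<close> on to
  \<open>D\<close>; with continuity this is what later bounds the directional derivatives.\<close>

lemma C1_periodic_derivative:
  assumes "C1_periodic l \<phi>"
  obtains D where "\<And>x. (\<phi> has_derivative D x) (at x)" "\<And>h. continuous_on UNIV (\<lambda>x. D x h)"
    "\<And>h. torus_periodic l (\<lambda>x. D x h)"
proof -
  from assms obtain D where D: "\<And>x. (\<phi> has_derivative D x) (at x)" "\<And>h. continuous_on UNIV (\<lambda>x. D x h)"
    unfolding C1_periodic_def by blast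
  have "D (x + l *\<^sub>R axis i 1) = D x" for x i
  proof -
    have "((\<lambda>y. \<phi> (y + l *\<^sub>R axis i 1)) has_derivative D (x + l *\<^sub>R axis i 1)) (at x)"
      by (rule has_derivative_compose[of "\<lambda>x. x + l *\<^sub>R axis i 1" "\<lambda>h. h", OF _ D(1)]) (auto intro!: derivative_eq_intros)
    moreover have "(\<lambda>y. \<phi> (y + l *\<^sub>R axis i 1)) = \<phi>"
      using assms by (simp add: C1_periodic_def torus_periodic_def)
    ultimately show ?thesis using has_derivative_unique[OF _ D(1)[of x]] by auto
  qed
  then have "torus_periodic l (\<lambda>x. D x h)" for h by (simp add: torus_periodic_def)
  with D that show thesis by blast
qed

lemma divergence_bounded_continuous:
  fixes \<phi> :: "real^'n \<Rightarrow> real^'n"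
  assumes l: "l > 0" and "\<phi> \<in> torus_C1_fields l"
  obtains B where "B \<ge> 0" "continuous_on UNIV (divergence \<phi>)" "\<And>x. \<bar>divergence \<phi> x\<bar> \<le> B"
proof -
  have c1: "C1_periodic l \<phi>" using assms torus_C1_fields_iff by blast
  obtain D where D: "\<And>x. (\<phi> has_derivative D x) (at x)" "\<And>h. continuous_on UNIV (\<lambda>x. D x h)"
    "\<And>h. torus_periodic l (\<lambda>x. D x h)" using C1_periodic_derivative[OF c1] by blast
  have fd: "frechet_derivative \<phi> (at x) = D x" for x using frechet_derivative_at[OF D(1)] by simp
  have div: "divergence \<phi> = (\<lambda>x. \<Sum>i\<in>UNIV. D x (axis i 1) $ i)"
    by (simp add: divergence_def fd fun_eq_iff)
  have c: "continuous_on UNIV (divergence \<phi>)" unfolding div by (intro continuous_intros D)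
  have p: "torus_periodic l (divergence \<phi>)" using D(3) unfolding div torus_periodic_def by simp
  show thesis using continuous_periodic_bounded[OF l c p] that c by (metis real_norm_def)
qed

text \<open>Differentiation under the integral: the mean value inequality bounds the difference
  quotients of \<open>\<phi>\<close> by \<open>B\<close>, so \<open>B * \<bar>u x\<bar>\<close>
  dominates.\<close>

lemma torus_integral_shift_derivative:
  fixes u :: "real^'n \<Rightarrow> real" and \<phi> :: "real^'n \<Rightarrow> real"
  assumes l: "l > 0" and u: "u \<in> torus_L1 l" and \<phi>: "C1_periodic l \<phi>"
  shows "((\<lambda>t. torus_integral l (\<lambda>x. u x * \<phi> (x + t *\<^sub>R z))) has_field_derivative
    torus_integral l (\<lambda>x. u x * divergence (\<lambda>y. \<phi> (y + t *\<^sub>R z) *\<^sub>R z) x)) (at t)"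
proof -
  note [measurable] = torus_L1_D(2)[OF u]
  note ui = torus_L1_D(3)[OF u]
  obtain D where D: "\<And>x. (\<phi> has_derivative D x) (at x)" "\<And>h. continuous_on UNIV (\<lambda>x. D x h)"
    "\<And>h. torus_periodic l (\<lambda>x. D x h)" using C1_periodic_derivative[OF \<phi>] by blast
  obtain B where B: "B \<ge> 0" "\<And>x. norm (D x z) \<le> B" using continuous_periodic_bounded[OF l D(2,3)] by blast
  have \<phi>c: "continuous_on UNIV \<phi>" by (rule C1_periodic_continuous[OF \<phi>])
  obtain B' where B': "B' \<ge> 0" "\<And>x. norm (\<phi> x) \<le> B'"
    using continuous_periodic_bounded[OF l \<phi>c C1_periodic_imp_periodic[OF \<phi>]] by blast
  have \<phi>m[measurable]: "(\<lambda>x. \<phi> (x + y)) \<in> borel_measurable lebesgue" for y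
    by (rule borel_measurable_lebesgue_shift[OF continuous_imp_lebesgue_measurable[OF \<phi>c]])
  have Dm[measurable]: "(\<lambda>x. D (x + y) z) \<in> borel_measurable lebesgue" for y
    by (rule borel_measurable_lebesgue_shift[OF continuous_imp_lebesgue_measurable[OF D(2)]])
  have der: "((\<lambda>s. \<phi> (x + s *\<^sub>R z)) has_field_derivative D (x + s *\<^sub>R z) z) (at s)" for x s
  proof -
    have lin: "linear (D (x + s *\<^sub>R z))" using D(1) has_derivative_linear by blast
    have "((\<lambda>s. \<phi> (x + s *\<^sub>R z)) has_derivative (\<lambda>h. D (x + s *\<^sub>R z) (h *\<^sub>R z))) (at s)"
      by (rule has_derivative_compose[of "\<lambda>s. x + s *\<^sub>R z" "\<lambda>h. h *\<^sub>R z", OF _ D(1)]) (auto intro!: derivative_eq_intros)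
    then show ?thesis by (simp add: has_field_derivative_def linear_scale[OF lin] mult.commute[of _ "D _ z"] mult_commute_abs)
  qed
  have dq: "\<bar>\<phi> (x + (t + h) *\<^sub>R z) - \<phi> (x + t *\<^sub>R z)\<bar> \<le> B * \<bar>h\<bar>" for x h
    using field_differentiable_bound[of UNIV "\<lambda>s. \<phi> (x + s *\<^sub>R z)" "\<lambda>s. D (x + s *\<^sub>R z) z" B t "t + h"] der B
    by (simp add: norm_minus_commute)
  have div: "divergence (\<lambda>y. \<phi> (y + t *\<^sub>R z) *\<^sub>R z) x = D (x + t *\<^sub>R z) z" for x
    by (rule divergence_scalar, rule has_derivative_compose[of "\<lambda>x. x + t *\<^sub>R z" "\<lambda>h. h", OF _ D(1)]) (auto intro!: derivative_eq_intros)
  have int: "set_integrable lebesgue (torus_cell l) (\<lambda>x. u x * \<phi> (x + y))" for y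
    by (rule set_integrable_torus_mult_bounded[OF ui, of _ B']) (use B' in auto)
  show ?thesis
    unfolding DERIV_def div tendsto_at_iff_sequentially comp_def
  proof (intro allI impI)
    fix h :: "nat \<Rightarrow> real" assume h: "\<forall>i. h i \<in> UNIV - {0}" "h \<longlonglongrightarrow> 0"
    have eq: "(torus_integral l (\<lambda>x. u x * \<phi> (x + (t + h i) *\<^sub>R z)) - torus_integral l (\<lambda>x. u x * \<phi> (x + t *\<^sub>R z))) / h i
        = torus_integral l (\<lambda>x. u x * ((\<phi> (x + (t + h i) *\<^sub>R z) - \<phi> (x + t *\<^sub>R z)) / h i))" for i
    proof -
      have "torus_integral l (\<lambda>x. u x * ((\<phi> (x + (t + h i) *\<^sub>R z) - \<phi> (x + t *\<^sub>R z)) / h i))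
         = torus_integral l (\<lambda>x. (1 / h i) * (u x * \<phi> (x + (t + h i) *\<^sub>R z) - u x * \<phi> (x + t *\<^sub>R z)))"
        by (simp add: algebra_simps diff_divide_distrib)
      then show ?thesis
        by (simp only: torus_integral_cmult torus_integral_diff[OF int int]) simp
    qed
    show "(\<lambda>i. (torus_integral l (\<lambda>x. u x * \<phi> (x + (t + h i) *\<^sub>R z)) - torus_integral l (\<lambda>x. u x * \<phi> (x + t *\<^sub>R z))) / h i)
       \<longlonglongrightarrow> torus_integral l (\<lambda>x. u x * D (x + t *\<^sub>R z) z)"
      unfolding eq
    proof (rule torus_integral_dominated[where w="\<lambda>x. B * \<bar>u x\<bar>"])
      show "set_integrable lebesgue (torus_cell l) (\<lambda>x. B * \<bar>u x\<bar>)"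
        using set_integrable_abs[OF ui] by simp
      show "AE x in lebesgue. (\<lambda>n. u x * ((\<phi> (x + (t + h n) *\<^sub>R z) - \<phi> (x + t *\<^sub>R z)) / h n)) \<longlonglongrightarrow> u x * D (x + t *\<^sub>R z) z"
      proof (intro AE_I2 tendsto_intros)
        fix x
        show "(\<lambda>n. (\<phi> (x + (t + h n) *\<^sub>R z) - \<phi> (x + t *\<^sub>R z)) / h n) \<longlonglongrightarrow> D (x + t *\<^sub>R z) z"
          using der[of x t] h unfolding DERIV_def tendsto_at_iff_sequentially comp_def by blast
      qed
      show "AE x in lebesgue. \<bar>u x * ((\<phi> (x + (t + h n) *\<^sub>R z) - \<phi> (x + t *\<^sub>R z)) / h n)\<bar> \<le> B * \<bar>u x\<bar>" for n
      proof (intro AE_I2)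
        fix x
        have "\<bar>(\<phi> (x + (t + h n) *\<^sub>R z) - \<phi> (x + t *\<^sub>R z)) / h n\<bar> \<le> B"
          using dq[of x "h n"] h(1) by (simp add: abs_divide divide_le_eq)
        then have "\<bar>u x\<bar> * \<bar>(\<phi> (x + (t + h n) *\<^sub>R z) - \<phi> (x + t *\<^sub>R z)) / h n\<bar> \<le> \<bar>u x\<bar> * B"
          by (intro mult_left_mono) auto
        then show "\<bar>u x * ((\<phi> (x + (t + h n) *\<^sub>R z) - \<phi> (x + t *\<^sub>R z)) / h n)\<bar> \<le> B * \<bar>u x\<bar>"
          by (simp only: abs_mult mult.commute)
      qed
    qed measurable
  qed
qed

lemma set_integrable_shift_mult:
  fixes u \<phi> :: "real^'n \<Rightarrow> real"
  assumes l: "l > 0" and u: "u \<in> torus_L1 l" and \<phi>: "continuous_on UNIV \<phi>" "torus_periodic l \<phi>"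
  shows "set_integrable lebesgue (torus_cell l) (\<lambda>x. u (x + y) * \<phi> (x + z))"
proof -
  note [measurable] = torus_L1_D(2)[OF u]
  obtain B' where B': "B' \<ge> 0" "\<And>x. norm (\<phi> x) \<le> B'"
    using continuous_periodic_bounded[OF l \<phi>] by blast
  have [measurable]: "(\<lambda>x. \<phi> (x + z)) \<in> borel_measurable lebesgue"
    by (rule borel_measurable_lebesgue_shift[OF continuous_imp_lebesgue_measurable[OF \<phi>(1)]])
  have [measurable]: "(\<lambda>x. u (x + y)) \<in> borel_measurable lebesgue"
    by (rule borel_measurable_lebesgue_shift) measurable
  show ?thesis
    by (rule set_integrable_torus_mult_bounded[OF set_integrable_torus_shift[OF l torus_L1_D[OF u]], where B=B'])
      (use B' in auto)
qed

text \<open>Discrete integration by parts: translation invariance moves the shift from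
  \<open>u\<close> to the test function, with the opposite sign.\<close>

lemma torus_integral_difference_by_parts:
  fixes u \<phi> :: "real^'n \<Rightarrow> real"
  assumes l: "l > 0" and u: "u \<in> torus_L1 l" and \<phi>: "continuous_on UNIV \<phi>" "torus_periodic l \<phi>"
  shows "torus_integral l (\<lambda>x. (u (x + z) - u x) * \<phi> x) = torus_integral l (\<lambda>x. u x * \<phi> (x - z)) - torus_integral l (\<lambda>x. u x * \<phi> x)"
proof -
  note [measurable] = torus_L1_D(2)[OF u]
  note i = set_integrable_shift_mult[OF l u \<phi>]
  have [measurable]: "\<phi> \<in> borel_measurable lebesgue" by (intro continuous_imp_lebesgue_measurable \<phi>)
  have m: "(\<lambda>x. u (x + z) * \<phi> x) \<in> borel_measurable lebesgue"
    by (intro borel_measurable_times borel_measurable_lebesgue_shift) measurable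
  have "torus_integral l (\<lambda>x. (u (x + z) - u x) * \<phi> x) = torus_integral l (\<lambda>x. u (x + z) * \<phi> x - u x * \<phi> x)"
    by (simp add: left_diff_distrib)
  also have "\<dots> = torus_integral l (\<lambda>x. u (x + z) * \<phi> x) - torus_integral l (\<lambda>x. u x * \<phi> x)"
    using i[of z 0] i[of 0 0] by (intro torus_integral_diff) simp_all
  also have "torus_integral l (\<lambda>x. u (x + z) * \<phi> x) = torus_integral l (\<lambda>x. u ((x + -z) + z) * \<phi> (x + -z))"
    using i[of z 0] m torus_periodic_comp2[OF torus_periodic_shift[OF torus_L1_D(1)[OF u]] \<phi>(2), of "(*)" z]
    by (intro torus_integral_shift[OF l, symmetric]) simp_all
  finally show ?thesis by simp
qed

text \<open>Along the segment of shifts from \<open>- z\<close> to 0 the tested integral changes at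
  a rate that is again \<open>u\<close> tested with a divergence, which \<open>B\<close> controls;
  the mean value inequality on the unit interval gives the bound.\<close>

lemma torus_difference_test_le:
  fixes u \<phi> :: "real^'n \<Rightarrow> real"
  assumes l: "l > 0" and u: "u \<in> torus_L1 l" and \<phi>: "C1_periodic l \<phi>" "\<And>x. \<bar>\<phi> x\<bar> \<le> 1"
    and B: "\<And>\<phi>. C1_periodic l \<phi> \<Longrightarrow> (\<And>x. \<bar>\<phi> x\<bar> \<le> 1) \<Longrightarrow> \<bar>torus_integral l (\<lambda>x. u x * divergence (\<lambda>y. \<phi> y *\<^sub>R z) x)\<bar> \<le> B"
  shows "\<bar>torus_integral l (\<lambda>x. (u (x + z) - u x) * \<phi> x)\<bar> \<le> B"
proof -
  define G where "G t = torus_integral l (\<lambda>x. u x * \<phi> (x - z + t *\<^sub>R z))" for t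
  have \<phi>s: "C1_periodic l (\<lambda>x. \<phi> (x - z))" using C1_periodic_shift[OF \<phi>(1), of "- z"] by simp
  have "(G has_field_derivative torus_integral l (\<lambda>x. u x * divergence (\<lambda>y. \<phi> (y - z + t *\<^sub>R z) *\<^sub>R z) x)) (at t)" for t
    using torus_integral_shift_derivative[OF l u \<phi>s, of z t] unfolding G_def by (simp add: algebra_simps)
  moreover have "\<bar>torus_integral l (\<lambda>x. u x * divergence (\<lambda>y. \<phi> (y - z + t *\<^sub>R z) *\<^sub>R z) x)\<bar> \<le> B" for t
    using C1_periodic_shift[OF \<phi>s, of "t *\<^sub>R z"] \<phi>(2) by (intro B) (simp_all add: algebra_simps)
  ultimately have "norm (G 0 - G 1) \<le> B * norm (0 - 1 :: real)"
    by (intro field_differentiable_bound[of UNIV G]) auto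
  then show ?thesis
    using torus_integral_difference_by_parts[OF l u C1_periodic_continuous[OF \<phi>(1)] C1_periodic_imp_periodic[OF \<phi>(1)], of z]
    by (simp add: G_def)
qed

lemma AE_abs_shift_le_1:
  assumes "AE x in lebesgue. u x \<in> {0, 1::real}"
  shows "AE x::'a::euclidean_space in lebesgue. \<bar>u (x + z) - u x\<bar> \<le> 1"
  using assms AE_lebesgue_shift[OF assms, of z] by eventually_elim auto

text \<open>The L1 norm of the difference arises by testing with its sign. The sign is replaced by a
  C1 function at L1 distance less than \<open>e\<close>, and since the difference is bounded by 1
  for values in {0,1}, the replacement costs at most \<open>e\<close>.\<close>

lemma shift_difference_le_dual:
  fixes u :: "real^'n \<Rightarrow> real"
  assumes l: "l > 0" and u: "u \<in> torus_L1 l" and u01: "AE x in lebesgue. u x \<in> {0, 1}"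
    and B: "\<And>\<phi>. C1_periodic l \<phi> \<Longrightarrow> (\<And>x. \<bar>\<phi> x\<bar> \<le> 1) \<Longrightarrow> \<bar>torus_integral l (\<lambda>x. u x * divergence (\<lambda>y. \<phi> y *\<^sub>R z) x)\<bar> \<le> B"
  shows "shift_difference l u z \<le> B"
proof (rule field_le_epsilon)
  fix e :: real assume e: "e > 0"
  define w where "w x = u (x + z) - u x" for x
  have [measurable]: "u \<in> borel_measurable lebesgue" by (rule torus_L1_D(2)[OF u])
  have [measurable]: "(\<lambda>x. u (x + z)) \<in> borel_measurable lebesgue" by (rule borel_measurable_lebesgue_shift) measurable
  have wm[measurable]: "w \<in> borel_measurable lebesgue" unfolding w_def by measurable
  have w1: "AE x in lebesgue. \<bar>w x\<bar> \<le> 1" unfolding w_def by (rule AE_abs_shift_le_1[OF u01])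
  \<comment> \<open>The density result takes Borel functions, so the sign is taken of a Borel
    representative of \<open>w\<close>.\<close>
  obtain g where g[measurable]: "g \<in> borel_measurable lborel" and wg: "AE x in lborel. w x = g x"
    using completion_ex_borel_measurable_real[OF wm] by blast
  define \<psi> where "\<psi> x = sgn (g x)" for x
  have \<psi>m: "\<psi> \<in> borel_measurable lborel" unfolding \<psi>_def by measurable
  have \<psi>b[measurable]: "\<psi> \<in> borel_measurable borel" using \<psi>m by simp
  have \<psi>l[measurable]: "\<psi> \<in> borel_measurable lebesgue" by (rule measurable_completion[OF \<psi>m])
  have wpsi: "AE x in lebesgue. \<bar>w x\<bar> = w x * \<psi> x"
    using AE_completion[OF wg] by eventually_elim (simp add: \<psi>_def abs_sgn)
  define m where "m = density lborel (\<lambda>x::real^'n. ennreal (indicator (torus_cell l) x))"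
  have cellb: "torus_cell l \<in> sets (lborel :: (real^'n) measure)" using torus_cell_sets by simp
  have fin: "finite_measure m"
    using emeasure_torus_cell[OF l, where 'n='n] cellb
    by (intro finite_measureI) (simp add: m_def emeasure_density ennreal_indicator)
  have sm: "sets m = sets borel" by (simp add: m_def)
  have supp: "emeasure m (- torus_cell l) = 0"
    using cellb by (auto simp: m_def emeasure_density nn_integral_0_iff_AE split: split_indicator intro!: AE_I2)
  obtain \<phi> where \<phi>: "C1_periodic l \<phi>" "\<And>x. norm (\<phi> x) \<le> 1" "(\<integral>x. norm (\<phi> x - \<psi> x) \<partial>m) < e"
    using C1_periodic_dense_unit_ball[OF l fin sm supp \<psi>b _ e] by (force simp: \<psi>_def abs_sgn_eq)
  have \<phi>b: "\<phi> \<in> borel_measurable borel" by (intro borel_measurable_continuous_onI C1_periodic_continuous[OF \<phi>(1)])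
  have \<phi>l[measurable]: "\<phi> \<in> borel_measurable lebesgue" by (intro continuous_imp_lebesgue_measurable C1_periodic_continuous[OF \<phi>(1)])
  have "(\<integral>x. norm (\<phi> x - \<psi> x) \<partial>m) = (\<integral>x. indicator (torus_cell l) x *\<^sub>R norm (\<phi> x - \<psi> x) \<partial>lborel)"
    unfolding m_def using cellb \<phi>b
    by (intro integral_density) auto
  also have "\<dots> = torus_integral l (\<lambda>x. \<bar>\<phi> x - \<psi> x\<bar>)"
    unfolding torus_integral_def set_lebesgue_integral_def using cellb \<phi>b
    by (subst integral_completion) auto
  finally have close: "torus_integral l (\<lambda>x. \<bar>\<phi> x - \<psi> x\<bar>) < e" using \<phi> by simp
  have \<psi>1: "\<bar>\<psi> x\<bar> \<le> 1" for x by (simp add: \<psi>_def abs_sgn_eq)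
  have i1: "set_integrable lebesgue (torus_cell l) (\<lambda>x. w x * \<phi> x)"
    by (rule set_integrable_torus_bounded[OF l, of _ 1], measurable)
       (use w1 in eventually_elim, use \<phi>(2) in \<open>auto simp: abs_mult intro: mult_le_one\<close>)
  have i2: "set_integrable lebesgue (torus_cell l) (\<lambda>x. \<bar>\<phi> x - \<psi> x\<bar>)"
  proof (rule set_integrable_torus_bounded[OF l, of _ 2])
    show "AE x in lebesgue. \<bar>\<bar>\<phi> x - \<psi> x\<bar>\<bar> \<le> 2"
    proof (rule AE_I2)
      fix x show "\<bar>\<bar>\<phi> x - \<psi> x\<bar>\<bar> \<le> 2" using \<phi>(2)[of x] \<psi>1[of x] by simp
    qed
  qed measurable
  have i3: "set_integrable lebesgue (torus_cell l) (\<lambda>x. \<bar>w x\<bar>)"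
    by (rule set_integrable_torus_bounded[OF l, of _ 1]) (use w1 in auto)
  have "shift_difference l u z = torus_integral l (\<lambda>x. \<bar>w x\<bar>)" by (simp add: shift_difference_def w_def)
  also have "\<dots> \<le> torus_integral l (\<lambda>x. w x * \<phi> x + \<bar>\<phi> x - \<psi> x\<bar>)"
  proof (rule torus_integral_mono_AE[OF i3 set_integral_add(1)[OF i1 i2]])
    show "AE x in lebesgue. \<bar>w x\<bar> \<le> w x * \<phi> x + \<bar>\<phi> x - \<psi> x\<bar>"
      using wpsi w1
    proof eventually_elim
      case (elim x)
      have "w x * \<psi> x = w x * \<phi> x - w x * (\<phi> x - \<psi> x)" by (simp add: algebra_simps)
      moreover have "\<bar>w x * (\<phi> x - \<psi> x)\<bar> \<le> 1 * \<bar>\<phi> x - \<psi> x\<bar>"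
        unfolding abs_mult using elim by (intro mult_right_mono) auto
      then have "- (w x * (\<phi> x - \<psi> x)) \<le> \<bar>\<phi> x - \<psi> x\<bar>" using abs_ge_minus_self order_trans by fastforce
      ultimately show ?case using elim(1) by linarith
    qed
  qed
  also have "\<dots> = torus_integral l (\<lambda>x. w x * \<phi> x) + torus_integral l (\<lambda>x. \<bar>\<phi> x - \<psi> x\<bar>)"
    by (rule torus_integral_add[OF i1 i2])
  also have "torus_integral l (\<lambda>x. w x * \<phi> x) \<le> B"
    using torus_difference_test_le[OF l u \<phi>(1) _ B] \<phi>(2) unfolding w_def by (simp add: abs_le_iff)
  finally show "shift_difference l u z \<le> B + e" using close by simp
qed

lemma torus_scalar_field:
  "C1_periodic l \<phi> \<Longrightarrow> (\<lambda>y. \<phi> y *\<^sub>R z) \<in> torus_C1_fields l"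
  unfolding torus_C1_fields_iff by (intro C1_periodic_scaleR C1_periodic_const)

lemma torus_integral_zero [simp]: "torus_integral l (\<lambda>x. 0) = 0"
  by (simp add: torus_integral_def set_lebesgue_integral_def)

lemma divergence_zero [simp]: "divergence (\<lambda>_. 0) x = 0"
  using divergence_scalar[of "\<lambda>_. 0" "\<lambda>_. 0" x 0] by simp

lemma total_variation_nonneg: "0 \<le> total_variation l u"
proof -
  have "(\<lambda>_. 0) \<in> {\<phi> \<in> torus_C1_fields l. \<forall>x. norm (\<phi> x) \<le> 1}"
    using C1_periodic_const[of l 0] by (simp add: torus_C1_fields_iff)
  from SUP_upper[OF this, of "\<lambda>\<phi>. ereal (torus_integral l (\<lambda>x. u x * divergence \<phi> x))"]
  show ?thesis by (simp add: total_variation_def zero_ereal_def)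
qed

definition tv :: "real \<Rightarrow> (real^'n \<Rightarrow> real) \<Rightarrow> real" where
  "tv l u = real_of_ereal (total_variation l u)"

lemma BV01_tv: "u \<in> BV01 l \<Longrightarrow> total_variation l u = ereal (tv l u)"
  using total_variation_nonneg[of l u] by (auto simp: BV01_def tv_def ereal_real')

lemma tv_nonneg: "0 \<le> tv l u"
  using total_variation_nonneg[of l u] by (simp add: tv_def real_of_ereal_pos)

lemma BV01_D:
  assumes "u \<in> BV01 l"
  shows "u \<in> torus_L1 l" "AE x in lebesgue. u x \<in> {0, 1}"
  using assms by (auto simp: BV01_def)

lemma total_variation_upper:
  assumes "\<phi> \<in> torus_C1_fields l" "\<And>x. norm (\<phi> x) \<le> 1"
  shows "ereal (torus_integral l (\<lambda>x. u x * divergence \<phi> x)) \<le> total_variation l u"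
  unfolding total_variation_def using assms by (intro SUP_upper) auto

text \<open>Multiplied by \<open>z\<close> over its norm, with either sign \<open>s\<close>, the
  scalar test function becomes an admissible field for the total variation.\<close>

lemma shift_difference_le_tv:
  fixes u :: "real^'n \<Rightarrow> real"
  assumes l: "l > 0" and u: "u \<in> BV01 l"
  shows "shift_difference l u z \<le> norm z * tv l u"
proof (rule shift_difference_le_dual[OF l BV01_D[OF u]])
  fix \<phi> :: "real^'n \<Rightarrow> real" assume \<phi>: "C1_periodic l \<phi>" "\<And>x. \<bar>\<phi> x\<bar> \<le> 1"
  obtain D where D: "\<And>x. (\<phi> has_derivative D x) (at x)" using \<phi>(1) unfolding C1_periodic_def by blast
  have lin: "linear (D x)" for x using D has_derivative_linear by blast
  show "\<bar>torus_integral l (\<lambda>x. u x * divergence (\<lambda>y. \<phi> y *\<^sub>R z) x)\<bar> \<le> norm z * tv l u"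
  proof (cases "z = 0")
    case True
    then show ?thesis
      by simp
  next
    case False
    have *: "s * torus_integral l (\<lambda>x. u x * divergence (\<lambda>y. \<phi> y *\<^sub>R z) x) \<le> norm z * tv l u" if s: "\<bar>s\<bar> = 1" for s
    proof -
      let ?w = "(s / norm z) *\<^sub>R z"
      have w: "norm ?w = 1" using False s by simp
      have "ereal (torus_integral l (\<lambda>x. u x * divergence (\<lambda>y. \<phi> y *\<^sub>R ?w) x)) \<le> total_variation l u"
        using \<phi>(2) w by (intro total_variation_upper torus_scalar_field[OF \<phi>(1)]) (simp add: divide_simps abs_mult s)
      moreover have "(\<lambda>x. u x * divergence (\<lambda>y. \<phi> y *\<^sub>R ?w) x) = (\<lambda>x. (s / norm z) * (u x * divergence (\<lambda>y. \<phi> y *\<^sub>R z) x))"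
        by (simp only: divergence_scalar[OF D] linear_scale[OF lin]) (simp add: algebra_simps)
      ultimately have "(s / norm z) * torus_integral l (\<lambda>x. u x * divergence (\<lambda>y. \<phi> y *\<^sub>R z) x) \<le> tv l u"
        by (simp only: torus_integral_cmult BV01_tv[OF u] ereal_less_eq)
      then show ?thesis using False by (simp add: field_simps)
    qed
    from *[of 1] *[of "-1"] show ?thesis by (simp add: abs_le_iff)
  qed
qed

text \<open>Here the bound keeps the direction: the test function is integrated against the
  component of \<open>\<sigma>\<close> along \<open>z\<close>. This directional form, rather than
  the bound by the total variation, makes \<open>gap\<close> nonnegative.\<close>

lemma shift_difference_le_polar:
  fixes u :: "real^'n \<Rightarrow> real"
  assumes l: "l > 0" and u: "u \<in> torus_L1 l" "AE x in lebesgue. u x \<in> {0, 1}" and p: "is_polar_gradient l u \<mu> \<sigma>"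
  shows "shift_difference l u z \<le> (\<integral>x. \<bar>z \<bullet> \<sigma> x\<bar> \<partial>\<mu>)"
proof (rule shift_difference_le_dual[OF l u])
  fix \<phi> :: "real^'n \<Rightarrow> real" assume \<phi>: "C1_periodic l \<phi>" "\<And>x. \<bar>\<phi> x\<bar> \<le> 1"
  have sm: "sets \<mu> = sets borel" and fin: "finite_measure \<mu>" and sb: "\<sigma> \<in> borel_measurable borel" and s1: "\<And>x. norm (\<sigma> x) = 1"
    using p by (auto simp: is_polar_gradient_def)
  interpret finite_measure \<mu> by fact
  have [measurable]: "\<sigma> \<in> borel_measurable \<mu>" using sb measurable_cong_sets[OF sm refl] by blast
  have pb: "\<phi> \<in> borel_measurable borel" by (intro borel_measurable_continuous_onI C1_periodic_continuous[OF \<phi>(1)])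
  have [measurable]: "\<phi> \<in> borel_measurable \<mu>" using pb measurable_cong_sets[OF sm refl] by blast
  have zs: "\<bar>z \<bullet> \<sigma> x\<bar> \<le> norm z" for x using Cauchy_Schwarz_ineq2[of z "\<sigma> x"] s1 by simp
  have b: "\<bar>\<phi> x * (z \<bullet> \<sigma> x)\<bar> \<le> \<bar>z \<bullet> \<sigma> x\<bar>" for x
    unfolding abs_mult using \<phi>(2) by (intro mult_left_le_one_le) auto
  have i: "integrable \<mu> (\<lambda>x. \<bar>z \<bullet> \<sigma> x\<bar>)" by (rule integrable_const_bound[where B="norm z"]) (use zs in auto)
  have "torus_integral l (\<lambda>x. u x * divergence (\<lambda>y. \<phi> y *\<^sub>R z) x) = - (\<integral>x. (\<phi> x *\<^sub>R z) \<bullet> \<sigma> x \<partial>\<mu>)"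
    using p torus_scalar_field[OF \<phi>(1)] by (auto simp: is_polar_gradient_def)
  also have "\<bar>\<dots>\<bar> \<le> (\<integral>x. norm ((\<phi> x *\<^sub>R z) \<bullet> \<sigma> x) \<partial>\<mu>)"
    using integral_norm_bound[of \<mu> "\<lambda>x. (\<phi> x *\<^sub>R z) \<bullet> \<sigma> x"] by simp
  also have "\<dots> \<le> (\<integral>x. \<bar>z \<bullet> \<sigma> x\<bar> \<partial>\<mu>)"
  proof (rule integral_mono[OF _ i])
    show "integrable \<mu> (\<lambda>x. norm ((\<phi> x *\<^sub>R z) \<bullet> \<sigma> x))"
      by (rule Bochner_Integration.integrable_bound[OF i]) (use b in auto)
  qed (use b in auto)
  finally show "\<bar>torus_integral l (\<lambda>x. u x * divergence (\<lambda>y. \<phi> y *\<^sub>R z) x)\<bar> \<le> (\<integral>x. \<bar>z \<bullet> \<sigma> x\<bar> \<partial>\<mu>)" .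
qed

text \<open>Cauchy-Schwarz gives one inequality. For the other, admissible fields close to
  \<open>- \<sigma>\<close> in L1 of the measure nearly attain its mass; the minus sign is that of
  the integration by parts formula.\<close>

lemma total_variation_polar:
  fixes u :: "real^'n \<Rightarrow> real"
  assumes l: "l > 0" and p: "is_polar_gradient l u \<mu> \<sigma>"
  shows "total_variation l u = ereal (measure \<mu> UNIV)"
proof -
  have sm: "sets \<mu> = sets borel" and fin: "finite_measure \<mu>" and sb: "\<sigma> \<in> borel_measurable borel" and s1: "\<And>x. norm (\<sigma> x) = 1"
    and supp: "emeasure \<mu> (- torus_cell l) = 0"
    using p by (auto simp: is_polar_gradient_def)
  have sp: "space \<mu> = UNIV" using sets_eq_imp_space_eq[OF sm] by simp
  interpret finite_measure \<mu> by fact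
  have [measurable]: "\<sigma> \<in> borel_measurable \<mu>" using sb measurable_cong_sets[OF sm refl] by blast
  have par: "torus_integral l (\<lambda>x. u x * divergence \<phi> x) = - (\<integral>x. \<phi> x \<bullet> \<sigma> x \<partial>\<mu>)" if "\<phi> \<in> torus_C1_fields l" for \<phi>
    using p that by (auto simp: is_polar_gradient_def)
  have i1: "integrable \<mu> \<sigma>" by (rule integrable_const_bound[where B=1]) (use s1 in auto)
  have fm: "\<phi> \<in> borel_measurable \<mu>" if "\<phi> \<in> torus_C1_fields l" for \<phi>
  proof -
    have "\<phi> \<in> borel_measurable borel" using that
      by (intro borel_measurable_continuous_onI C1_periodic_continuous) (simp add: torus_C1_fields_iff)
    then show ?thesis using measurable_cong_sets[OF sm refl] by blast
  qed
  show ?thesis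
  proof (rule antisym)
    show "total_variation l u \<le> ereal (measure \<mu> UNIV)"
      unfolding total_variation_def
    proof (rule SUP_least)
      fix \<phi> :: "real^'n \<Rightarrow> real^'n" assume "\<phi> \<in> {\<phi> \<in> torus_C1_fields l. \<forall>x. norm (\<phi> x) \<le> 1}"
      then have \<phi>: "\<phi> \<in> torus_C1_fields l" "\<And>x. norm (\<phi> x) \<le> 1" by auto
      note [measurable] = fm[OF \<phi>(1)]
      have b: "\<bar>\<phi> x \<bullet> \<sigma> x\<bar> \<le> 1" for x using Cauchy_Schwarz_ineq2[of "\<phi> x" "\<sigma> x"] \<phi>(2)[of x] s1[of x] by simp
      have "- (\<integral>x. \<phi> x \<bullet> \<sigma> x \<partial>\<mu>) \<le> \<bar>\<integral>x. \<phi> x \<bullet> \<sigma> x \<partial>\<mu>\<bar>" by simp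
      also have "\<dots> \<le> (\<integral>x. norm (\<phi> x \<bullet> \<sigma> x) \<partial>\<mu>)" using integral_norm_bound[of \<mu> "\<lambda>x. \<phi> x \<bullet> \<sigma> x"] by simp
      also have "\<dots> \<le> (\<integral>x. 1 \<partial>\<mu>)"
      proof (rule integral_mono)
        show "integrable \<mu> (\<lambda>x. norm (\<phi> x \<bullet> \<sigma> x))" by (rule integrable_const_bound[where B=1]) (use b in auto)
      qed (use b in auto)
      finally show "ereal (torus_integral l (\<lambda>x. u x * divergence \<phi> x)) \<le> ereal (measure \<mu> UNIV)"
        using par[OF \<phi>(1)] by (simp add: sp)
    qed
    show "ereal (measure \<mu> UNIV) \<le> total_variation l u"
    proof (rule ereal_le_epsilon2)
      fix e :: real assume e: "e > 0"
      have "(\<lambda>x. - \<sigma> x) \<in> borel_measurable borel" using sb by simp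
      from C1_periodic_dense_unit_ball[OF l fin sm supp this _ e] s1
      obtain \<phi> where \<phi>: "C1_periodic l \<phi>" "\<And>x. norm (\<phi> x) \<le> 1" "(\<integral>x. norm (\<phi> x - (- \<sigma> x)) \<partial>\<mu>) < e" by auto
      have \<phi>C: "\<phi> \<in> torus_C1_fields l" using \<phi>(1) by (simp add: torus_C1_fields_iff)
      note [measurable] = fm[OF \<phi>C]
      have i2: "integrable \<mu> \<phi>" by (rule integrable_const_bound[where B=1]) (use \<phi> in auto)
      have i3: "integrable \<mu> (\<lambda>x. \<phi> x \<bullet> \<sigma> x)"
      proof (rule integrable_const_bound[where B=1])
        show "AE x in \<mu>. norm (\<phi> x \<bullet> \<sigma> x) \<le> 1"
        proof (rule AE_I2)
          fix x show "norm (\<phi> x \<bullet> \<sigma> x) \<le> 1" using Cauchy_Schwarz_ineq2[of "\<phi> x" "\<sigma> x"] \<phi>(2)[of x] s1[of x] by simp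
        qed
      qed measurable
      have "measure \<mu> UNIV = (\<integral>x. 1 \<partial>\<mu>)" by (simp add: sp)
      also have "\<dots> \<le> (\<integral>x. - (\<phi> x \<bullet> \<sigma> x) + norm (\<phi> x - (- \<sigma> x)) \<partial>\<mu>)"
      proof (rule integral_mono)
        fix x
        have "\<sigma> x \<bullet> \<sigma> x = 1" using s1[of x] by (simp add: dot_square_norm)
        moreover have "(\<phi> x + \<sigma> x) \<bullet> \<sigma> x \<le> norm (\<phi> x + \<sigma> x)"
          using norm_cauchy_schwarz[of "\<phi> x + \<sigma> x" "\<sigma> x"] s1[of x] by simp
        ultimately show "1 \<le> - (\<phi> x \<bullet> \<sigma> x) + norm (\<phi> x - (- \<sigma> x))" by (simp add: inner_add_left)
      qed (use i1 i2 i3 in auto)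
      also have "\<dots> = - (\<integral>x. \<phi> x \<bullet> \<sigma> x \<partial>\<mu>) + (\<integral>x. norm (\<phi> x - (- \<sigma> x)) \<partial>\<mu>)"
        using i1 i2 i3 by (subst Bochner_Integration.integral_add) auto
      finally have "measure \<mu> UNIV \<le> torus_integral l (\<lambda>x. u x * divergence \<phi> x) + e"
        using par[OF \<phi>C] \<phi>(3) by simp
      then have "ereal (measure \<mu> UNIV) \<le> ereal (torus_integral l (\<lambda>x. u x * divergence \<phi> x)) + ereal e" by simp
      also have "\<dots> \<le> total_variation l u + ereal e"
        by (intro add_right_mono total_variation_upper \<phi>C \<phi>)
      finally show "ereal (measure \<mu> UNIV) \<le> total_variation l u + ereal e" .
    qed
  qed
qed

section \<open>The L1 distance and stability of shift differences\<close>

lemma L1_dist_nonneg: "0 \<le> L1_dist l u v"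
  unfolding L1_dist_def by (intro torus_integral_nonneg) auto

lemma L1_dist_commute: "L1_dist l u v = L1_dist l v u"
  by (simp add: L1_dist_def abs_minus_commute)

lemma set_integrable_abs_diff:
  assumes "u \<in> torus_L1 l" "v \<in> torus_L1 l"
  shows "set_integrable lebesgue (torus_cell l) (\<lambda>x. \<bar>u x - v x\<bar>)"
  using assms by (intro set_integrable_abs set_integral_diff torus_L1_D)

lemma torus_L1_shift:
  assumes "l > 0" "u \<in> torus_L1 l"
  shows "(\<lambda>x. u (x + z)) \<in> torus_L1 l"
  using assms by (auto simp: torus_L1_def intro: torus_periodic_shift borel_measurable_lebesgue_shift set_integrable_torus_shift)

lemma shift_difference_eq: "shift_difference l u z = L1_dist l (\<lambda>x. u (x + z)) u"
  by (simp add: shift_difference_def L1_dist_def)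

lemma L1_dist_triangle:
  assumes "u \<in> torus_L1 l" "v \<in> torus_L1 l" "w \<in> torus_L1 l"
  shows "L1_dist l u w \<le> L1_dist l u v + L1_dist l v w"
proof -
  note i = set_integrable_abs_diff[OF assms(1,2)] set_integrable_abs_diff[OF assms(2,3)] set_integrable_abs_diff[OF assms(1,3)]
  have "L1_dist l u w \<le> torus_integral l (\<lambda>x. \<bar>u x - v x\<bar> + \<bar>v x - w x\<bar>)"
    unfolding L1_dist_def by (intro torus_integral_mono_AE i set_integral_add AE_I2) auto
  also have "\<dots> = L1_dist l u v + L1_dist l v w"
    unfolding L1_dist_def by (intro torus_integral_add i)
  finally show ?thesis .
qed

lemma L1_dist_shift:
  assumes l: "l > 0" and u: "u \<in> torus_L1 l" and v: "v \<in> torus_L1 l"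
  shows "L1_dist l (\<lambda>x. u (x + z)) (\<lambda>x. v (x + z)) = L1_dist l u v"
  unfolding L1_dist_def
  by (rule torus_integral_shift[OF l])
    (use torus_L1_D[OF u] torus_L1_D[OF v] set_integrable_abs_diff[OF u v] in \<open>auto simp: torus_periodic_def\<close>)

text \<open>Replacing \<open>u\<close> by \<open>v\<close> costs their distance once at
  \<open>x + z\<close>, by translation invariance, and once at \<open>x\<close>; hence the factor
  2.\<close>

lemma shift_difference_L1_lipschitz:
  assumes l: "l > 0" and u: "u \<in> torus_L1 l" and v: "v \<in> torus_L1 l"
  shows "\<bar>shift_difference l u z - shift_difference l v z\<bar> \<le> 2 * L1_dist l u v"
proof -
  have *: "shift_difference l u z \<le> shift_difference l v z + 2 * L1_dist l u v"
    if u: "u \<in> torus_L1 l" and v: "v \<in> torus_L1 l" for u v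
  proof -
    let ?u = "\<lambda>x. u (x + z)" and ?v = "\<lambda>x. v (x + z)"
    note s = torus_L1_shift[OF l u, of z] torus_L1_shift[OF l v, of z]
    have "L1_dist l ?u u \<le> L1_dist l ?u ?v + (L1_dist l ?v v + L1_dist l v u)"
      using L1_dist_triangle[OF s(1) s(2) u] L1_dist_triangle[OF s(2) v u] by simp
    then show ?thesis using L1_dist_shift[OF l u v, of z] L1_dist_commute[of l u v] by (simp add: shift_difference_eq)
  qed
  from *[OF u v] *[OF v u] show ?thesis using L1_dist_commute[of l u v] by (simp add: abs_le_iff)
qed

text \<open>Translation invariance turns the distance between two shifts into the shift difference
  for \<open>z - y\<close>; the triangle inequality does the rest.\<close>

lemma shift_difference_diff:
  assumes l: "l > 0" and u: "u \<in> torus_L1 l"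
  shows "\<bar>shift_difference l u z - shift_difference l u y\<bar> \<le> shift_difference l u (z - y)"
proof -
  note s = torus_L1_shift[OF l u]
  have a: "L1_dist l (\<lambda>x. u (x + z)) (\<lambda>x. u (x + y)) = shift_difference l u (z - y)"
    using L1_dist_shift[OF l s[of "z - y"] u, of y] by (simp add: shift_difference_eq algebra_simps)
  have b: "L1_dist l (\<lambda>x. u (x + y)) (\<lambda>x. u (x + z)) = shift_difference l u (z - y)"
    using a L1_dist_commute by metis
  show ?thesis
    using L1_dist_triangle[OF s[of z] s[of y] u] L1_dist_triangle[OF s[of y] s[of z] u] a b
    by (simp add: shift_difference_eq abs_le_iff)
qed

lemma shift_difference_nonneg: "0 \<le> shift_difference l u z"
  by (simp add: shift_difference_eq L1_dist_nonneg)

text \<open>The total variation is a Lipschitz constant. Continuity supplies the measurability in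
  \<open>z\<close> of the shift integrands.\<close>

lemma shift_difference_continuous:
  fixes u :: "real^'n \<Rightarrow> real"
  assumes l: "l > 0" and u: "u \<in> BV01 l"
  shows "continuous_on UNIV (shift_difference l u)"
proof (rule lipschitz_on_continuous_on)
  show "(tv l u)-lipschitz_on UNIV (shift_difference l u)"
  proof (rule lipschitz_onI)
    fix x y :: "real^'n"
    show "dist (shift_difference l u x) (shift_difference l u y) \<le> tv l u * dist x y"
      using shift_difference_diff[OF l BV01_D(1)[OF u], of x y] shift_difference_le_tv[OF l u, of "x - y"]
      by (simp add: dist_norm mult.commute)
  qed (rule tv_nonneg)
qed

text \<open>Values in {0,1} differ by at most 1. The bound does not involve the total variation, so
  loss terms can be absorbed when the variation is estimated.\<close>

lemma shift_difference_le_volume: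
  fixes u :: "real^'n \<Rightarrow> real"
  assumes l: "l > 0" and u: "u \<in> BV01 l"
  shows "shift_difference l u z \<le> l ^ CARD('n)"
proof -
  note L1 = BV01_D(1)[OF u]
  have "shift_difference l u z \<le> torus_integral l (\<lambda>x::real^'n. 1)"
    unfolding shift_difference_def
  proof (rule torus_integral_mono_AE)
    show "set_integrable lebesgue (torus_cell l) (\<lambda>x. \<bar>u (x + z) - u x\<bar>)"
      using set_integrable_abs_diff[OF torus_L1_shift[OF l L1] L1] .
    show "set_integrable lebesgue (torus_cell l) (\<lambda>x::real^'n. 1::real)"
      by (rule set_integrable_torus_bounded[OF l, of _ 1]) auto
  qed (rule AE_abs_shift_le_1[OF BV01_D(2)[OF u]])
  also have "\<dots> = l ^ CARD('n)"
    using measure_torus_cell[OF l, where 'n='n] by (simp add: torus_integral_def set_lebesgue_integral_def)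
  finally show ?thesis .
qed

text \<open>Each admissible field defines an L1-continuous functional, its divergence being bounded,
  and a supremum of such functionals is lower semicontinuous.\<close>

lemma total_variation_lsc:
  fixes u :: "nat \<Rightarrow> real^'n \<Rightarrow> real"
  assumes l: "l > 0" and u: "\<And>n. u n \<in> torus_L1 l" and v: "v \<in> torus_L1 l" and lim: "(\<lambda>n. L1_dist l (u n) v) \<longlonglongrightarrow> 0"
  shows "total_variation l v \<le> liminf (\<lambda>n. total_variation l (u n))"
  unfolding total_variation_def[of l v]
proof (rule SUP_least)
  fix \<phi> :: "real^'n \<Rightarrow> real^'n" assume "\<phi> \<in> {\<phi> \<in> torus_C1_fields l. \<forall>x. norm (\<phi> x) \<le> 1}"
  then have \<phi>: "\<phi> \<in> torus_C1_fields l" "\<And>x. norm (\<phi> x) \<le> 1" by auto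
  obtain B where B: "B \<ge> 0" "continuous_on UNIV (divergence \<phi>)" "\<And>x. \<bar>divergence \<phi> x\<bar> \<le> B"
    using divergence_bounded_continuous[OF l \<phi>(1)] by blast
  have [measurable]: "divergence \<phi> \<in> borel_measurable lebesgue" by (rule continuous_imp_lebesgue_measurable[OF B(2)])
  have i: "set_integrable lebesgue (torus_cell l) (\<lambda>x. w x * divergence \<phi> x)" if "w \<in> torus_L1 l" for w
    using torus_L1_D[OF that] B(3) by (intro set_integrable_torus_mult_bounded) auto
  have "(\<lambda>n. torus_integral l (\<lambda>x. u n x * divergence \<phi> x)) \<longlonglongrightarrow> torus_integral l (\<lambda>x. v x * divergence \<phi> x)"
  proof (rule Lim_null[THEN iffD2], rule Lim_null_comparison)
    show "\<forall>\<^sub>F n in sequentially. norm (torus_integral l (\<lambda>x. u n x * divergence \<phi> x) - torus_integral l (\<lambda>x. v x * divergence \<phi> x)) \<le> B * L1_dist l (u n) v"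
    proof (intro always_eventually allI)
      fix n
      have "torus_integral l (\<lambda>x. u n x * divergence \<phi> x) - torus_integral l (\<lambda>x. v x * divergence \<phi> x)
        = torus_integral l (\<lambda>x. u n x * divergence \<phi> x - v x * divergence \<phi> x)"
        by (intro torus_integral_diff[symmetric] i u v)
      also have "\<bar>\<dots>\<bar> \<le> torus_integral l (\<lambda>x. \<bar>u n x * divergence \<phi> x - v x * divergence \<phi> x\<bar>)"
        by (intro torus_integral_abs_le set_integral_diff i u v)
      also have "\<dots> \<le> torus_integral l (\<lambda>x. B * \<bar>u n x - v x\<bar>)"
      proof (rule torus_integral_mono_AE)
        show "AE x in lebesgue. \<bar>u n x * divergence \<phi> x - v x * divergence \<phi> x\<bar> \<le> B * \<bar>u n x - v x\<bar>"
        proof (rule AE_I2)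
          fix x
          have "\<bar>(u n x - v x) * divergence \<phi> x\<bar> \<le> \<bar>u n x - v x\<bar> * B"
            unfolding abs_mult by (intro mult_left_mono B) auto
          then show "\<bar>u n x * divergence \<phi> x - v x * divergence \<phi> x\<bar> \<le> B * \<bar>u n x - v x\<bar>"
            by (simp add: algebra_simps)
        qed
        show "set_integrable lebesgue (torus_cell l) (\<lambda>x. B * \<bar>u n x - v x\<bar>)"
          using set_integrable_abs_diff[OF u v] by simp
      qed (intro set_integrable_abs set_integral_diff i u v)
      also have "\<dots> = B * L1_dist l (u n) v" by (simp add: torus_integral_cmult L1_dist_def)
      finally show "norm (torus_integral l (\<lambda>x. u n x * divergence \<phi> x) - torus_integral l (\<lambda>x. v x * divergence \<phi> x)) \<le> B * L1_dist l (u n) v" by simp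
    qed
    show "(\<lambda>n. B * L1_dist l (u n) v) \<longlonglongrightarrow> 0" using tendsto_mult_left[OF lim, of B] by simp
  qed
  then have "(\<lambda>n. ereal (torus_integral l (\<lambda>x. u n x * divergence \<phi> x))) \<longlonglongrightarrow> ereal (torus_integral l (\<lambda>x. v x * divergence \<phi> x))"
    by simp
  then have "ereal (torus_integral l (\<lambda>x. v x * divergence \<phi> x)) = liminf (\<lambda>n. ereal (torus_integral l (\<lambda>x. u n x * divergence \<phi> x)))"
    by (rule lim_imp_Liminf[OF sequentially_bot, symmetric])
  also have "\<dots> \<le> liminf (\<lambda>n. total_variation l (u n))"
    by (intro Liminf_mono always_eventually allI total_variation_upper \<phi>)
  finally show "ereal (torus_integral l (\<lambda>x. v x * divergence \<phi> x)) \<le> liminf (\<lambda>n. total_variation l (u n))" .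
qed

section \<open>Weak compactness of densities\<close>

text \<open>Indices start at 0: digit \<open>k\<close> has weight
  \<open>1 / 2 ^ Suc k\<close>.\<close>

definition binary_digit :: "nat \<Rightarrow> real \<Rightarrow> real" where
  "binary_digit k y = of_int (\<lfloor>2 ^ Suc k * y\<rfloor> mod 2)"

lemma binary_digit_cases: "binary_digit k y = 0 \<or> binary_digit k y = 1"
  unfolding binary_digit_def by (auto simp: mod_2_eq_odd)

text \<open>The first \<open>n\<close> digits add up to
  \<open>\<lfloor>2 ^ n * y\<rfloor> / 2 ^ n\<close>, which is within \<open>(1/2) ^ n\<close> of
  \<open>y\<close>.\<close>

lemma binary_digit_sums:
  assumes "0 \<le> y" "y < 1"
  shows "(\<lambda>k. binary_digit k y / 2 ^ Suc k) sums y"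
proof -
  have part: "(\<Sum>k<n. binary_digit k y / 2 ^ Suc k) = of_int \<lfloor>2 ^ n * y\<rfloor> / 2 ^ n" for n
  proof (induction n)
    case 0
    have "\<lfloor>y\<rfloor> = 0" using assms by (simp add: floor_eq_iff)
    then show ?case by simp
  next
    case (Suc n)
    let ?f = "\<lfloor>2 ^ n * y\<rfloor>" and ?g = "\<lfloor>2 ^ Suc n * y\<rfloor>"
    have "?g div 2 = ?f"
    proof -
      have "real_of_int ?f \<le> 2 ^ n * y" "2 ^ n * y < real_of_int ?f + 1" by linarith+
      then have "2 * ?f \<le> ?g" "?g < 2 * ?f + 2"
        by (simp_all add: le_floor_iff floor_less_iff mult.assoc) linarith
      then show ?thesis by linarith
    qed
    then have "?g = 2 * ?f + ?g mod 2" by presburger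
    then have "real_of_int ?g = 2 * real_of_int ?f + binary_digit n y"
      unfolding binary_digit_def by (metis of_int_add of_int_mult of_int_numeral)
    then show ?case using Suc by (simp add: field_simps)
  qed
  have "(\<lambda>n. of_int \<lfloor>2 ^ n * y\<rfloor> / 2 ^ n) \<longlonglongrightarrow> y"
  proof (rule Lim_null[THEN iffD2], rule Lim_null_comparison)
    show "\<forall>\<^sub>F n in sequentially. norm (of_int \<lfloor>2 ^ n * y\<rfloor> / 2 ^ n - y) \<le> (1/2) ^ n"
    proof (intro always_eventually allI)
      fix n
      have "\<bar>of_int \<lfloor>2 ^ n * y\<rfloor> - 2 ^ n * y\<bar> \<le> 1" by linarith
      moreover have "of_int \<lfloor>2 ^ n * y\<rfloor> / 2 ^ n - y = (of_int \<lfloor>2 ^ n * y\<rfloor> - 2 ^ n * y) / 2 ^ n" by (simp add: field_simps)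
      ultimately show "norm (of_int \<lfloor>2 ^ n * y\<rfloor> / 2 ^ n - y) \<le> (1/2) ^ n"
        by (simp add: abs_divide power_divide divide_right_mono)
    qed
    show "(\<lambda>n. (1/2) ^ n :: real) \<longlonglongrightarrow> 0" by (rule LIMSEQ_power_zero) simp
  qed
  then show ?thesis unfolding sums_def part .
qed

text \<open>A continuous, even, 2-periodic function that is 0 on [0,1/3] and 1 on [2/3,1]; clipping
  a cosine provides all of this at once.\<close>

definition schoenberg_step :: "real \<Rightarrow> real" where
  "schoenberg_step t = max 0 (min 1 (1/2 - cos (pi * t)))"

lemma cos_pi_bounds:
  "0 \<le> s \<Longrightarrow> s \<le> 1/3 \<Longrightarrow> cos (pi * s) \<ge> 1/2"
  "2/3 \<le> s \<Longrightarrow> s \<le> 1 \<Longrightarrow> cos (pi * s) \<le> -1/2"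
proof -
  assume s: "0 \<le> s" "s \<le> 1/3"
  have "cos (pi * (1/3)) \<le> cos (pi * s)"
    using s by (intro cos_monotone_0_pi_le mult_left_mono) auto
  then show "cos (pi * s) \<ge> 1/2" using cos_60 by simp
next
  assume s: "2/3 \<le> s" "s \<le> 1"
  have "cos (pi * s) \<le> cos (pi * (2/3))"
    using s by (intro cos_monotone_0_pi_le mult_left_mono) auto
  also have "cos (pi * (2/3)) = cos (pi - pi/3)" by (simp add: field_simps)
  also have "\<dots> = - cos (pi/3)" by (simp only: cos_pi_minus)
  finally show "cos (pi * s) \<le> -1/2" using cos_60 by simp
qed

lemma cos_add_even_pi: "cos (pi * (2 * of_int k + s)) = cos (pi * s)"
proof -
  have "cos (pi * (2 * of_int k + s)) = cos (of_int k * (2 * pi) + pi * s)" by (simp add: algebra_simps)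
  also have "\<dots> = cos (pi * s)"
    using cos_int_2pin[of k] sin_int_2pin[of k] by (simp add: cos_add mult.commute)
  finally show ?thesis .
qed

text \<open>Comparison with the series of all digits 1, whose sum is 1. The bounds serve for shifted
  digit sequences as well.\<close>

lemma ternary_series_bounds:
  fixes c :: "nat \<Rightarrow> real"
  assumes c: "\<And>k. c k = 0 \<or> c k = 1"
  shows "summable (\<lambda>k. 2 * c k / 3 ^ Suc k)" "0 \<le> (\<Sum>k. 2 * c k / 3 ^ Suc k)" "(\<Sum>k. 2 * c k / 3 ^ Suc k) \<le> 1"
proof -
  have "(\<lambda>k. (2/3) * (1/3) ^ k :: real) sums ((2/3) * (1 / (1 - 1/3)))"
    by (intro sums_mult geometric_sums) simp
  then have geo: "(\<lambda>k. 2 / 3 ^ Suc k :: real) sums 1" by (simp add: power_divide field_simps)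
  have a: "0 \<le> 2 * c k / 3 ^ Suc k" "2 * c k / 3 ^ Suc k \<le> 2 / 3 ^ Suc k" for k
    using c[of k] by auto
  show sm: "summable (\<lambda>k. 2 * c k / 3 ^ Suc k)"
    by (rule summable_comparison_test'[OF sums_summable[OF geo], of 0]) (use a in \<open>simp only: real_norm_def abs_of_nonneg\<close>)
  show "0 \<le> (\<Sum>k. 2 * c k / 3 ^ Suc k)" by (intro suminf_nonneg sm a)
  have "(\<Sum>k. 2 * c k / 3 ^ Suc k) \<le> (\<Sum>k. 2 / 3 ^ Suc k)"
    by (intro suminf_le sm a sums_summable[OF geo])
  also have "\<dots> = 1" using geo by (simp only: sums_iff)
  finally show "(\<Sum>k. 2 * c k / 3 ^ Suc k) \<le> 1" .
qed

text \<open>Schoenberg's trick: the ternary expansion with digits \<open>2 c\<^sub>k\<close> is read off by a continuous function,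
  because multiplying by \<open>3\<^sup>m\<close> shifts the digit \<open>c\<^sub>m\<close> to the front up to an even integer.\<close>

lemma schoenberg_step_ternary:
  fixes c :: "nat \<Rightarrow> real"
  assumes c: "\<And>k. c k = 0 \<or> c k = 1"
  shows "schoenberg_step (3 ^ m * (\<Sum>k. 2 * c k / 3 ^ Suc k)) = c m"
proof -
  let ?a = "\<lambda>k. 2 * c k / 3 ^ Suc k"
  note sm = ternary_series_bounds(1)
  define R where "R = (\<Sum>k. ?a (k + Suc m)) * 3 ^ m"
  have "(\<Sum>k. ?a k) = (\<Sum>k. ?a (k + Suc m)) + (\<Sum>k<Suc m. ?a k)"
    by (rule suminf_split_initial_segment[OF sm[OF c]])
  then have "3 ^ m * (\<Sum>k. ?a k) = R + (\<Sum>k<m. 3 ^ m * ?a k) + 3 ^ m * ?a m"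
    by (simp add: R_def algebra_simps sum_distrib_left)
  also have "3 ^ m * ?a m = 2 * c m / 3" by simp
  also have "\<exists>j::int. (\<Sum>k<m. 3 ^ m * ?a k) = 2 * of_int j"
  proof (intro exI)
    have "3 ^ m * ?a k = 2 * of_int (\<lfloor>c k\<rfloor> * 3 ^ (m - Suc k))" if "k < m" for k
    proof -
      have "(3::real) ^ m = 3 ^ (m - Suc k) * 3 ^ Suc k" using that by (subst power_add[symmetric]) simp
      then show ?thesis using c[of k] by auto
    qed
    then show "(\<Sum>k<m. 3 ^ m * ?a k) = 2 * of_int (\<Sum>k<m. \<lfloor>c k\<rfloor> * 3 ^ (m - Suc k))"
      by (simp add: sum_distrib_left)
  qed
  then obtain j :: int where j: "(\<Sum>k<m. 3 ^ m * ?a k) = 2 * of_int j" by blast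
  finally have eq: "3 ^ m * (\<Sum>k. ?a k) = 2 * of_int j + (2 * c m / 3 + R)" using j by simp
  have "R = (\<Sum>k. 2 * c (k + Suc m) / 3 ^ Suc k) / 3"
  proof -
    have "R = (\<Sum>k. 3 ^ m * ?a (k + Suc m))"
      unfolding R_def using summable_ignore_initial_segment[OF sm[of c, OF c], where k="Suc m"]
      by (subst suminf_mult) (simp_all only: mult.commute)
    also have "(\<lambda>k. 3 ^ m * ?a (k + Suc m)) = (\<lambda>k. (2 * c (k + Suc m) / 3 ^ Suc k) / 3)"
      by (simp add: power_add fun_eq_iff)
    also have "(\<Sum>k. (2 * c (k + Suc m) / 3 ^ Suc k) / 3) = (\<Sum>k. 2 * c (k + Suc m) / 3 ^ Suc k) / 3"
      using sm[of "\<lambda>k. c (k + Suc m)"] c by (intro suminf_divide) auto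
    finally show ?thesis .
  qed
  \<comment> \<open>Hence \<open>2 * c m / 3 + R\<close> lies in [0,1/3] for digit 0 and in [2/3,1]
    for digit 1, where \<open>schoenberg_step\<close> is constant.\<close>
  then have R: "0 \<le> R" "R \<le> 1/3"
    using ternary_series_bounds[of "\<lambda>k. c (k + Suc m)"] c by auto
  show ?thesis
    unfolding eq schoenberg_step_def cos_add_even_pi
    using c[of m] cos_pi_bounds[of R] cos_pi_bounds[of "2/3 + R"] R by auto
qed

text \<open>The binary digits of all coordinates are interleaved into one ternary number
  \<open>s x\<close>, and \<open>P\<close> decodes it. Since \<open>P\<close> is continuous,
  continuous functions on the torus pull back to continuous functions on the line; the code
  \<open>s\<close> is merely Borel, which is enough to push measures forward.\<close>

lemma space_filling_curve:
  assumes l: "l > 0"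
  obtains P :: "real \<Rightarrow> real^'n" and s :: "real^'n \<Rightarrow> real"
  where "continuous_on UNIV P" "s \<in> borel_measurable borel" "\<And>x. x \<in> torus_cell l \<Longrightarrow> P (s x) = x"
    "\<And>x. 0 \<le> s x \<and> s x \<le> 1"
proof -
  define d where "d = CARD('n)"
  have d: "d > 0" by (simp add: d_def)
  obtain idx :: "'n \<Rightarrow> nat" where idx: "bij_betw idx UNIV {..<d}"
    using ex_bij_betw_finite_nat[of "UNIV :: 'n set"] by (auto simp: d_def atLeast0LessThan)
  define enum where "enum = inv_into UNIV idx"
  have enum: "enum (idx i) = i" and idx_less: "idx i < d" for i
    using idx by (auto simp: enum_def bij_betw_def)
  \<comment> \<open>Position \<open>d * k + idx i\<close> holds digit \<open>k\<close> of coordinate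
    \<open>i\<close>.\<close>
  define c where "c x m = binary_digit (m div d) (x $ enum (m mod d) / l)" for x :: "real^'n" and m
  have c01: "c x m = 0 \<or> c x m = 1" for x m unfolding c_def by (rule binary_digit_cases)
  define s where "s x = (\<Sum>k. 2 * c x k / 3 ^ Suc k)" for x :: "real^'n"
  define P :: "real \<Rightarrow> real^'n" where "P t = (\<chi> i. l * (\<Sum>k. schoenberg_step (3 ^ (d * k + idx i) * t) / 2 ^ Suc k))" for t
  have geo: "summable (\<lambda>k. 1 / 2 ^ Suc k :: real)"
    using summable_mult[OF summable_geometric[of "1/2::real"], of "1/2"] by (simp add: power_divide)
  have ss: "0 \<le> schoenberg_step t" "schoenberg_step t \<le> 1" for t by (auto simp: schoenberg_step_def)
  have ssc: "continuous_on A (\<lambda>t. schoenberg_step (f t))" if "continuous_on A f" for A and f :: "real \<Rightarrow> real"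
    unfolding schoenberg_step_def using that by (intro continuous_intros)
  show thesis
  proof
    show "continuous_on UNIV P"
    proof -
      have *: "continuous_on UNIV (\<lambda>t. \<Sum>k. schoenberg_step (3 ^ (d * k + idx i) * t) / 2 ^ Suc k)" for i
      proof (rule uniform_limit_theorem[OF _ Weierstrass_m_test[OF _ geo]])
        show "\<forall>\<^sub>F n in sequentially. continuous_on UNIV (\<lambda>t. \<Sum>k<n. schoenberg_step (3 ^ (d * k + idx i) * t) / 2 ^ Suc k)"
          by (intro always_eventually allI continuous_intros ssc) auto
        show "norm (schoenberg_step (3 ^ (d * k + idx i) * t) / 2 ^ Suc k) \<le> 1 / 2 ^ Suc k" for k t
          using ss by (simp add: divide_right_mono)
      qed auto
      show ?thesis unfolding P_def
        by (intro continuous_on_vec_lambda continuous_on_mult_left *)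
    qed
    have nth: "(\<lambda>x::real^'n. x $ i) \<in> borel_measurable borel" for i
      by (intro borel_measurable_continuous_onI continuous_intros)
    have [measurable]: "(\<lambda>x. c x m) \<in> borel_measurable borel" for m
      unfolding c_def binary_digit_def using nth[of "enum (m mod d)"] by measurable
    show "s \<in> borel_measurable borel" unfolding s_def by measurable
    show "P (s x) = x" if x: "x \<in> torus_cell l" for x
    proof -
      have "l * (\<Sum>k. schoenberg_step (3 ^ (d * k + idx i) * s x) / 2 ^ Suc k) = x $ i" for i
      proof -
        have "schoenberg_step (3 ^ (d * k + idx i) * s x) = binary_digit k (x $ i / l)" for k
          unfolding s_def schoenberg_step_ternary[OF c01] using idx_less[of i] d by (simp add: c_def enum)
        moreover have "(\<lambda>k. binary_digit k (x $ i / l) / 2 ^ Suc k) sums (x $ i / l)"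
          using x l by (intro binary_digit_sums) (auto simp: torus_cell_def)
        ultimately show ?thesis using l by (simp add: sums_iff)
      qed
      then show ?thesis by (simp add: P_def vec_eq_iff)
    qed
    show "0 \<le> s x \<and> s x \<le> 1" for x
    proof -
      show ?thesis unfolding s_def using ternary_series_bounds[of "c x"] c01 by blast
    qed
  qed
qed

section \<open>Weak limits of nonnegative densities\<close>

lemma torus_integral_tendsto_zero:
  fixes f :: "nat \<Rightarrow> real^'n \<Rightarrow> real"
  assumes fm: "\<And>n. f n \<in> borel_measurable lebesgue" and f0: "\<And>n x. 0 \<le> f n x"
    and fi: "\<And>n. set_integrable lebesgue (torus_cell l) (f n)"
    and lim: "(\<lambda>n. torus_integral l (f n)) \<longlonglongrightarrow> 0"
    and \<phi>: "\<phi> \<in> borel_measurable lebesgue" "\<And>x. \<bar>\<phi> x\<bar> \<le> B"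
  shows "(\<lambda>n. torus_integral l (\<lambda>x. \<phi> x * f n x)) \<longlonglongrightarrow> 0"
proof (rule Lim_null_comparison)
  have B: "B \<ge> 0" using \<phi>(2)[of 0] by simp
  show "\<forall>\<^sub>F n in sequentially. norm (torus_integral l (\<lambda>x. \<phi> x * f n x)) \<le> B * torus_integral l (f n)"
  proof (intro always_eventually allI)
    fix n
    have i: "set_integrable lebesgue (torus_cell l) (\<lambda>x. f n x * \<phi> x)"
      by (rule set_integrable_torus_mult_bounded[OF fi fm \<phi>])
    have "norm (torus_integral l (\<lambda>x. f n x * \<phi> x)) \<le> torus_integral l (\<lambda>x. \<bar>f n x * \<phi> x\<bar>)"
      using torus_integral_abs_le[OF i] by simp
    also have "\<dots> \<le> torus_integral l (\<lambda>x. B * f n x)"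
    proof (rule torus_integral_mono_AE[OF set_integrable_abs[OF i]])
      show "set_integrable lebesgue (torus_cell l) (\<lambda>x. B * f n x)" using fi by simp
      show "AE x in lebesgue. \<bar>f n x * \<phi> x\<bar> \<le> B * f n x"
      proof (rule AE_I2)
        fix x show "\<bar>f n x * \<phi> x\<bar> \<le> B * f n x"
          using mult_left_mono[OF \<phi>(2)[of x] f0[of n x]] f0[of n x] by (simp add: abs_mult mult.commute)
      qed
    qed
    finally show "norm (torus_integral l (\<lambda>x. \<phi> x * f n x)) \<le> B * torus_integral l (f n)"
      by (simp add: torus_integral_cmult mult.commute[of "\<phi> _"])
  qed
  show "(\<lambda>n. B * torus_integral l (f n)) \<longlonglongrightarrow> 0" using tendsto_mult_left[OF lim, of B] by simp
qed

text \<open>The densities become laws of \<open>s\<close> on [0,1], a tight family on the line, so a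
  subsequence converges weakly. The limit is brought back by \<open>P\<close>: test functions
  composed with \<open>P\<close> are continuous and bounded, and on the cell \<open>P\<close> undoes
  \<open>s\<close>.\<close>

lemma weak_compactness_normalised:
  fixes f :: "nat \<Rightarrow> real^'n \<Rightarrow> real"
  assumes l: "l > 0" and fm: "\<And>n. f n \<in> borel_measurable lebesgue" and f0: "\<And>n x. 0 \<le> f n x"
    and fi: "\<And>n. set_integrable lebesgue (torus_cell l) (f n)" and one: "\<And>n. torus_integral l (f n) = 1"
  shows "\<exists>\<mu> r. strict_mono (r :: nat \<Rightarrow> nat) \<and> finite_measure \<mu> \<and> sets \<mu> = sets borel \<and> emeasure \<mu> (- torus_cell l) = 0 \<and>
    (\<forall>\<phi> :: real^'n \<Rightarrow> real. continuous_on UNIV \<phi> \<longrightarrow> torus_periodic l \<phi> \<longrightarrow>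
      (\<lambda>n. torus_integral l (\<lambda>x. \<phi> x * f (r n) x)) \<longlonglongrightarrow> (\<integral>x. \<phi> x \<partial>\<mu>))"
proof -
  note [measurable] = fm
  obtain P :: "real \<Rightarrow> real^'n" and s :: "real^'n \<Rightarrow> real"
    where P: "continuous_on UNIV P" and s[measurable]: "s \<in> borel_measurable borel"
      and Ps: "\<And>x. x \<in> torus_cell l \<Longrightarrow> P (s x) = x" and s01: "\<And>x. 0 \<le> s x \<and> s x \<le> 1"
    using space_filling_curve[OF l] by metis
  define F where "F n x = indicator (torus_cell l) x * f n x" for n x
  have Fm[measurable]: "F n \<in> borel_measurable lebesgue" for n unfolding F_def by measurable
  have F0: "0 \<le> F n x" for n x by (simp add: F_def f0)
  define D where "D n = density lebesgue (\<lambda>x. ennreal (F n x))" for n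
  have intF: "integrable lebesgue (F n)" "(\<integral>x. F n x \<partial>lebesgue) = 1" for n
    using fi[of n] one[of n] by (auto simp: set_integrable_def torus_integral_def set_lebesgue_integral_def F_def[abs_def])
  have "emeasure (D n) (space (D n)) = 1" for n
  proof -
    have "emeasure (D n) (space (D n)) = (\<integral>\<^sup>+x. ennreal (F n x) \<partial>lebesgue)"
      unfolding D_def by (subst emeasure_density) (auto simp del: nn_integral_completion)
    also have "\<dots> = ennreal (\<integral>x. F n x \<partial>lebesgue)" using intF(1)[of n] F0 by (intro nn_integral_eq_integral) auto
    finally show ?thesis using intF(2)[of n] by simp
  qed
  then have prD: "prob_space (D n)" for n by (rule prob_spaceI)
  have sD: "s \<in> D n \<rightarrow>\<^sub>M borel" for n
    unfolding D_def using measurable_completion[of s lborel borel] s by simp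
  define p where "p n = distr (D n) borel s" for n
  have rd: "real_distribution (p n)" for n
    unfolding p_def using prob_space.prob_space_distr[OF prD sD]
    by (intro real_distribution.intro) (auto simp: real_distribution_axioms_def)
  have tight: "tight p"
    unfolding tight_def
  proof (intro conjI allI impI rd)
    fix e :: real assume e: "e > 0"
    have "measure (p n) {-1<..2} = 1" for n
    proof -
      have "s -` {-1<..2} \<inter> space (D n) = space (D n)"
      proof (intro equalityI subsetI IntI vimageI2)
        fix x show "s x \<in> {-1<..2}" using s01[of x] by auto
      qed auto
      then show ?thesis unfolding p_def using sD prob_space.prob_space[OF prD]
        by (subst measure_distr) auto
    qed
    then show "\<exists>a b. a < b \<and> (\<forall>n. measure (p n) {a<..b} > 1 - e)"
      using e by (intro exI[of _ "-1"] exI[of _ 2]) auto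
  qed
  obtain r M where r: "strict_mono (r :: nat \<Rightarrow> nat)" and M: "real_distribution M" and conv: "weak_conv_m (p \<circ> id \<circ> r) M"
    using tight_imp_convergent_subsubsequence[OF tight strict_mono_id] by blast
  interpret M: real_distribution M by fact
  have Pm[measurable]: "P \<in> borel_measurable borel" by (rule borel_measurable_continuous_onI[OF P])
  have Wm: "(\<lambda>t. torus_wrap l (P t)) \<in> M \<rightarrow>\<^sub>M borel" by measurable
  \<comment> \<open>\<open>P\<close> takes values in the closed cube, so the limit can charge its
    outer faces. Wrapping returns them to the half-open cell, and periodic test functions do not see
    the difference.\<close>
  define \<mu> where "\<mu> = distr M borel (\<lambda>t. torus_wrap l (P t))"
  show ?thesis
  proof (intro exI[of _ \<mu>] exI[of _ r] conjI allI impI)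
    show "finite_measure \<mu>" unfolding \<mu>_def by (rule M.finite_measure_distr[OF Wm])
    show "emeasure \<mu> (- torus_cell l) = 0"
    proof -
      have "(\<lambda>t. torus_wrap l (P t)) -` (- torus_cell l) \<inter> space M = {}"
        using torus_wrap_in_cell[OF l] by auto
      then show ?thesis unfolding \<mu>_def by (subst emeasure_distr[OF Wm]) auto
    qed
    fix \<phi> :: "real^'n \<Rightarrow> real" assume \<phi>: "continuous_on UNIV \<phi>" "torus_periodic l \<phi>"
    obtain B where B: "B \<ge> 0" "\<And>x. norm (\<phi> x) \<le> B" using continuous_periodic_bounded[OF l \<phi>] by blast
    have \<phi>b[measurable]: "\<phi> \<in> borel_measurable borel" by (rule borel_measurable_continuous_onI[OF \<phi>(1)])
    have \<phi>l[measurable]: "\<phi> \<in> borel_measurable lebesgue" by (rule continuous_imp_lebesgue_measurable[OF \<phi>(1)])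
    have "continuous_on UNIV (\<lambda>t. \<phi> (P t))" by (rule continuous_on_compose2[OF \<phi>(1) P]) auto
    then have cont: "isCont (\<lambda>t. \<phi> (P t)) t" for t by (simp add: continuous_on_eq_continuous_at)
    have "(\<lambda>n. integral\<^sup>L ((p \<circ> id \<circ> r) n) (\<lambda>t. \<phi> (P t))) \<longlonglongrightarrow> integral\<^sup>L M (\<lambda>t. \<phi> (P t))"
      by (rule weak_conv_imp_integral_bdd_continuous_conv[OF _ M conv cont]) (use rd B in auto)
    moreover have "integral\<^sup>L M (\<lambda>t. \<phi> (P t)) = (\<integral>x. \<phi> x \<partial>\<mu>)"
      unfolding \<mu>_def by (subst integral_distr[OF Wm \<phi>b]) (simp add: torus_periodic_wrap[OF \<phi>(2)])
    moreover have "integral\<^sup>L ((p \<circ> id \<circ> r) n) (\<lambda>t. \<phi> (P t)) = torus_integral l (\<lambda>x. \<phi> x * f (r n) x)" for n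
    proof -
      have m1: "(\<lambda>x. \<phi> (P (s x))) \<in> borel_measurable lebesgue" 
        using measurable_completion[of "\<lambda>x. \<phi> (P (s x))" lborel borel] by simp
      have "integral\<^sup>L ((p \<circ> id \<circ> r) n) (\<lambda>t. \<phi> (P t)) = (\<integral>x. \<phi> (P (s x)) \<partial>D (r n))"
        unfolding comp_def id_def p_def by (rule integral_distr[OF sD]) measurable
      also have "\<dots> = (\<integral>x. F (r n) x *\<^sub>R \<phi> (P (s x)) \<partial>lebesgue)"
        unfolding D_def using F0 m1 by (intro integral_density) auto
      also have "\<dots> = (\<integral>x. indicator (torus_cell l) x *\<^sub>R (\<phi> x * f (r n) x) \<partial>lebesgue)"
      proof (rule Bochner_Integration.integral_cong[OF refl])
        fix x show "F (r n) x *\<^sub>R \<phi> (P (s x)) = indicator (torus_cell l) x *\<^sub>R (\<phi> x * f (r n) x)"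
          using Ps[of x] by (cases "x \<in> torus_cell l") (auto simp: F_def)
      qed
      finally show ?thesis by (simp add: torus_integral_def set_lebesgue_integral_def)
    qed
    ultimately show "(\<lambda>n. torus_integral l (\<lambda>x. \<phi> x * f (r n) x)) \<longlonglongrightarrow> (\<integral>x. \<phi> x \<partial>\<mu>)" by simp
  qed (use r in \<open>auto simp: \<mu>_def\<close>)
qed

text \<open>The total masses are bounded and converge along a subsequence to some \<open>A\<close>.
  For \<open>A = 0\<close> the limit is the zero measure; otherwise the masses are eventually
  positive, the normalised densities have a weak limit, and this limit is rescaled by
  \<open>A\<close>.\<close>

lemma weak_compactness_densities:
  fixes f :: "nat \<Rightarrow> real^'n \<Rightarrow> real"
  assumes l: "l > 0" and fm: "\<And>n. f n \<in> borel_measurable lebesgue" and f0: "\<And>n x. 0 \<le> f n x"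
    and fi: "\<And>n. set_integrable lebesgue (torus_cell l) (f n)" and C: "\<And>n. torus_integral l (f n) \<le> C"
  shows "\<exists>\<mu> r. strict_mono (r :: nat \<Rightarrow> nat) \<and> finite_measure \<mu> \<and> sets \<mu> = sets borel \<and> emeasure \<mu> (- torus_cell l) = 0 \<and>
    (\<forall>\<phi> :: real^'n \<Rightarrow> real. continuous_on UNIV \<phi> \<longrightarrow> torus_periodic l \<phi> \<longrightarrow>
      (\<lambda>n. torus_integral l (\<lambda>x. \<phi> x * f (r n) x)) \<longlonglongrightarrow> (\<integral>x. \<phi> x \<partial>\<mu>))"
proof -
  define a where "a n = torus_integral l (f n)" for n
  have a0: "a n \<ge> 0" for n unfolding a_def by (rule torus_integral_nonneg) (rule f0)
  have "\<forall>n. a n \<in> {0..C}" using a0 C by (auto simp: a_def)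
  then obtain A r where A: "A \<in> {0..C}" and r: "strict_mono r" and lim: "(a \<circ> r) \<longlonglongrightarrow> A"
    using compact_Icc[of 0 C] unfolding compact_eq_seq_compact_metric seq_compact_def by metis
  show ?thesis
  proof (cases "A = 0")
    case True
    have "(\<lambda>n. torus_integral l (\<lambda>x. \<phi> x * f (r n) x)) \<longlonglongrightarrow> (\<integral>x. \<phi> x \<partial>null_measure borel)"
      if \<phi>: "continuous_on UNIV \<phi>" "torus_periodic l \<phi>" for \<phi> :: "real^'n \<Rightarrow> real"
    proof -
      obtain B where B: "B \<ge> 0" "\<And>x. norm (\<phi> x) \<le> B" using continuous_periodic_bounded[OF l \<phi>] by blast
      have "(\<lambda>n. torus_integral l (\<lambda>x. \<phi> x * f (r n) x)) \<longlonglongrightarrow> 0"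
        by (rule torus_integral_tendsto_zero[where B=B])
          (use fm f0 fi lim B continuous_imp_lebesgue_measurable[OF \<phi>(1)] in \<open>auto simp: a_def comp_def True\<close>)
      then show ?thesis by simp
    qed
    then show ?thesis using r by (intro exI[of _ "null_measure borel"] exI[of _ r]) (auto intro!: finite_measureI)
  next
    case False
    with A have Apos: "A > 0" by simp
    then have "\<forall>\<^sub>F n in sequentially. (a \<circ> r) n > 0" by (intro order_tendstoD(1)[OF lim])
    then obtain N where N: "\<And>n. n \<ge> N \<Longrightarrow> a (r n) > 0" by (auto simp: eventually_sequentially)
    define q where "q n = r (n + N)" for n
    have q: "strict_mono q" using r by (auto simp: q_def strict_mono_def)
    have aq: "a (q n) > 0" for n using N[of "n + N"] by (simp add: q_def)
    have limq: "(\<lambda>n. a (q n)) \<longlonglongrightarrow> A" using LIMSEQ_ignore_initial_segment[OF lim, of N] by (simp add: q_def comp_def)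
    define g where "g n x = (1 / a (q n)) * f (q n) x" for n x
    obtain \<mu> t where t: "strict_mono (t :: nat \<Rightarrow> nat)" and \<mu>: "finite_measure \<mu>" "sets \<mu> = sets borel" "emeasure \<mu> (- torus_cell l) = 0"
      and conv: "\<And>\<phi> :: real^'n \<Rightarrow> real. continuous_on UNIV \<phi> \<Longrightarrow> torus_periodic l \<phi> \<Longrightarrow>
        (\<lambda>n. torus_integral l (\<lambda>x. \<phi> x * g (t n) x)) \<longlonglongrightarrow> (\<integral>x. \<phi> x \<partial>\<mu>)"
    proof -
      have "g n \<in> borel_measurable lebesgue" for n unfolding g_def using fm by measurable
      moreover have "0 \<le> g n x" for n x using f0 aq[of n] by (simp add: g_def)
      moreover have "set_integrable lebesgue (torus_cell l) (g n)" for n unfolding g_def using fi by simp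
      moreover have "torus_integral l (g n) = 1" for n
        unfolding g_def torus_integral_cmult using aq[of n] by (simp add: a_def)
      ultimately show thesis using weak_compactness_normalised[OF l, of g] that by blast
    qed
    define \<nu> where "\<nu> = density \<mu> (\<lambda>_. ennreal A)"
    interpret \<mu>: finite_measure \<mu> by fact
    have "finite_measure \<nu>" unfolding \<nu>_def
      by (intro finite_measureI) (simp add: emeasure_density nn_integral_cmult ennreal_mult_eq_top_iff)
    moreover have "sets \<nu> = sets borel" by (simp add: \<nu>_def \<mu>)
    moreover have "emeasure \<nu> (- torus_cell l) = 0"
      unfolding \<nu>_def using \<mu> by (subst emeasure_density) (auto simp: nn_integral_cmult)
    moreover have "strict_mono (q \<circ> t)" using q t by (rule strict_mono_o)
    moreover have "(\<lambda>n. torus_integral l (\<lambda>x. \<phi> x * f ((q \<circ> t) n) x)) \<longlonglongrightarrow> (\<integral>x. \<phi> x \<partial>\<nu>)"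
      if \<phi>: "continuous_on UNIV \<phi>" "torus_periodic l \<phi>" for \<phi> :: "real^'n \<Rightarrow> real"
    proof -
      have \<phi>b: "\<phi> \<in> borel_measurable \<mu>" using borel_measurable_continuous_onI[OF \<phi>(1)] measurable_cong_sets[OF \<mu>(2) refl] by blast
      have e1: "torus_integral l (\<lambda>x. \<phi> x * f ((q \<circ> t) n) x) = a (q (t n)) * torus_integral l (\<lambda>x. \<phi> x * g (t n) x)" for n
        unfolding torus_integral_cmult[symmetric] using aq[of "t n"] by (simp add: g_def)
      have e2: "(\<integral>x. \<phi> x \<partial>\<nu>) = A * (\<integral>x. \<phi> x \<partial>\<mu>)"
        unfolding \<nu>_def using Apos \<phi>b by (subst integral_density) auto
      show ?thesis unfolding e1 e2
        by (intro tendsto_mult conv[OF \<phi>] LIMSEQ_subseq_LIMSEQ[OF limq t, unfolded comp_def])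
    qed
    ultimately show ?thesis by blast
  qed
qed

text \<open>Extraction one index at a time: later subsequences keep the limits already
  obtained.\<close>

lemma weak_compactness_densities_finite:
  fixes f :: "'i \<Rightarrow> nat \<Rightarrow> real^'n \<Rightarrow> real"
  assumes l: "l > 0" and fm: "\<And>i n. f i n \<in> borel_measurable lebesgue" and f0: "\<And>i n x. 0 \<le> f i n x"
    and fi: "\<And>i n. set_integrable lebesgue (torus_cell l) (f i n)" and C: "\<And>i n. torus_integral l (f i n) \<le> C"
    and I: "finite I"
  shows "\<exists>\<mu> r. strict_mono (r :: nat \<Rightarrow> nat) \<and> (\<forall>i\<in>I. finite_measure (\<mu> i) \<and> sets (\<mu> i) = sets borel \<and> emeasure (\<mu> i) (- torus_cell l) = 0 \<and>
    (\<forall>\<phi> :: real^'n \<Rightarrow> real. continuous_on UNIV \<phi> \<longrightarrow> torus_periodic l \<phi> \<longrightarrow>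
      (\<lambda>n. torus_integral l (\<lambda>x. \<phi> x * f i (r n) x)) \<longlonglongrightarrow> (\<integral>x. \<phi> x \<partial>(\<mu> i))))"
  using I
proof (induction I rule: finite_induct)
  case empty
  show ?case by (intro exI[of _ "\<lambda>_. undefined"] exI[of _ id]) (simp add: strict_mono_id)
next
  case (insert j I)
  then obtain \<mu> r where r: "strict_mono (r :: nat \<Rightarrow> nat)" and \<mu>: "\<And>i. i \<in> I \<Longrightarrow> finite_measure (\<mu> i) \<and> sets (\<mu> i) = sets borel \<and> emeasure (\<mu> i) (- torus_cell l) = 0 \<and>
    (\<forall>\<phi> :: real^'n \<Rightarrow> real. continuous_on UNIV \<phi> \<longrightarrow> torus_periodic l \<phi> \<longrightarrow>
      (\<lambda>n. torus_integral l (\<lambda>x. \<phi> x * f i (r n) x)) \<longlonglongrightarrow> (\<integral>x. \<phi> x \<partial>(\<mu> i)))" by blast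
  obtain \<nu> t where t: "strict_mono (t :: nat \<Rightarrow> nat)" and \<nu>: "finite_measure \<nu> \<and> sets \<nu> = sets borel \<and> emeasure \<nu> (- torus_cell l) = 0 \<and>
    (\<forall>\<phi> :: real^'n \<Rightarrow> real. continuous_on UNIV \<phi> \<longrightarrow> torus_periodic l \<phi> \<longrightarrow>
      (\<lambda>n. torus_integral l (\<lambda>x. \<phi> x * f j (r (t n)) x)) \<longlonglongrightarrow> (\<integral>x. \<phi> x \<partial>\<nu>))"
    using weak_compactness_densities[OF l, of "\<lambda>n. f j (r n)" C] fm f0 fi C by auto
  have "finite_measure ((\<mu>(j := \<nu>)) i) \<and> sets ((\<mu>(j := \<nu>)) i) = sets borel \<and> emeasure ((\<mu>(j := \<nu>)) i) (- torus_cell l) = 0 \<and>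
    (\<forall>\<phi> :: real^'n \<Rightarrow> real. continuous_on UNIV \<phi> \<longrightarrow> torus_periodic l \<phi> \<longrightarrow>
      (\<lambda>n. torus_integral l (\<lambda>x. \<phi> x * f i ((r \<circ> t) n) x)) \<longlonglongrightarrow> (\<integral>x. \<phi> x \<partial>((\<mu>(j := \<nu>)) i)))" if "i \<in> insert j I" for i
  proof (cases "i = j")
    case True
    then show ?thesis using \<nu> by simp
  next
    case False
    with that have i: "i \<in> I" by simp
    from False \<mu>[OF i] show ?thesis
      using LIMSEQ_subseq_LIMSEQ[OF _ t] by (auto simp: comp_def)
  qed
  then show ?case using strict_mono_o[OF r t] by blast
qed

section \<open>Existence of the polar decomposition\<close>

text \<open>Supplies one measure dominating a finite family, so that the Radon-Nikodym densities of
  all members live over the same base.\<close>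

lemma sum_of_measures:
  fixes \<mu> :: "'i \<Rightarrow> 'a::topological_space measure"
  assumes I: "finite I" and sets: "\<And>i. i \<in> I \<Longrightarrow> sets (\<mu> i) = sets borel" and fin: "\<And>i. i \<in> I \<Longrightarrow> finite_measure (\<mu> i)"
  obtains M where "finite_measure M" "sets M = sets borel" "\<And>A. A \<in> sets borel \<Longrightarrow> emeasure M A = (\<Sum>i\<in>I. emeasure (\<mu> i) A)"
proof -
  define M where "M = measure_of UNIV (sets borel) (\<lambda>A. \<Sum>i\<in>I. emeasure (\<mu> i) A)"
  have sM: "sets M = sets (borel :: 'a measure)"
    unfolding M_def using sets.sigma_sets_eq[of "borel :: 'a measure"] by (subst sets_measure_of) (auto simp: space_borel)
  have em: "emeasure M A = (\<Sum>i\<in>I. emeasure (\<mu> i) A)" if A: "A \<in> sets borel" for A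
    unfolding M_def
  proof (rule emeasure_measure_of[OF refl])
    show "A \<in> sets (measure_of UNIV (sets borel) (\<lambda>A. \<Sum>i\<in>I. emeasure (\<mu> i) A))" using A sM by (simp add: M_def)
    show "positive (sets (measure_of UNIV (sets borel) (\<lambda>A. \<Sum>i\<in>I. emeasure (\<mu> i) A))) (\<lambda>A. \<Sum>i\<in>I. emeasure (\<mu> i) A)"
      by (simp add: positive_def)
    show "countably_additive (sets (measure_of UNIV (sets borel) (\<lambda>A. \<Sum>i\<in>I. emeasure (\<mu> i) A))) (\<lambda>A. \<Sum>i\<in>I. emeasure (\<mu> i) A)"
      unfolding countably_additive_def
    proof (intro allI impI)
      fix A :: "nat \<Rightarrow> 'a set"
      assume A: "range A \<subseteq> sets (measure_of UNIV (sets borel) (\<lambda>A. \<Sum>i\<in>I. emeasure (\<mu> i) A))" "disjoint_family A"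
      then have "range A \<subseteq> sets borel" using sM by (simp add: M_def)
      then have "(\<Sum>n. emeasure (\<mu> i) (A n)) = emeasure (\<mu> i) (\<Union>n. A n)" if "i \<in> I" for i
        using that A sets by (intro suminf_emeasure) auto
      then show "(\<Sum>n. \<Sum>i\<in>I. emeasure (\<mu> i) (A n)) = (\<Sum>i\<in>I. emeasure (\<mu> i) (\<Union>n. A n))"
        by (subst suminf_sum) auto
    qed
  qed auto
  have "finite_measure M"
  proof (rule finite_measureI)
    have "space M = UNIV" using sets_eq_imp_space_eq[OF sM] by simp
    then show "emeasure M (space M) \<noteq> \<infinity>"
      using finite_measure.emeasure_finite[OF fin] I by (simp add: em infinity_ennreal_def)
  qed
  then show thesis using sM em that by blast
qed

lemma torus_integral_sum:
  assumes "finite I" "\<And>i. set_integrable lebesgue (torus_cell l) (f i)"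
  shows "torus_integral l (\<lambda>x. \<Sum>i\<in>I. f i x) = (\<Sum>i\<in>I. torus_integral l (f i))"
  unfolding torus_integral_def set_lebesgue_integral_def scaleR_sum_right
  by (rule Bochner_Integration.integral_sum) (use assms in \<open>simp add: set_integrable_def\<close>)

text \<open>Difference quotients along the axes have L1 norm at most the total variation. Their
  positive and negative parts are nonnegative densities with weak limits, whose differences are the
  distributional partial derivatives. Densities over the sum of all limits assemble into one vector
  function \<open>g\<close>: its norm is the density of the variation measure, its direction the
  normal field.\<close>

lemma polar_gradient_exists:
  fixes u :: "real^'n \<Rightarrow> real"
  assumes l: "l > 0" and u: "u \<in> BV01 l"
  shows "\<exists>\<mu> \<sigma>. is_polar_gradient l u \<mu> \<sigma>"
proof -
  note L1 = BV01_D(1)[OF u]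
  note [measurable] = torus_L1_D(2)[OF L1]
  define h where "h n = inverse (real (Suc n))" for n
  have h: "h n > 0" for n by (simp add: h_def)
  have h0: "h \<longlonglongrightarrow> 0" unfolding h_def by (rule LIMSEQ_inverse_real_of_nat)
  define e where "e i = (axis i 1 :: real^'n)" for i
  define q where "q i n x = (u (x + h n *\<^sub>R e i) - u x) / h n" for i n x
  \<comment> \<open>The Boolean selects the positive part for \<open>True\<close> and the negative
    part for \<open>False\<close>.\<close>
  define f where "f p n x = max 0 ((if snd p then 1 else -1) * q (fst p) n x)" for p :: "'n \<times> bool" and n x
  have [measurable]: "(\<lambda>x. u (x + y)) \<in> borel_measurable lebesgue" for y
    by (rule borel_measurable_lebesgue_shift) measurable
  have qm[measurable]: "q i n \<in> borel_measurable lebesgue" for i n unfolding q_def by measurable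
  have fm: "f p n \<in> borel_measurable lebesgue" for p n unfolding f_def by measurable
  have f0: "0 \<le> f p n x" for p n x by (simp add: f_def)
  have qi: "set_integrable lebesgue (torus_cell l) (q i n)" for i n
    unfolding q_def divide_inverse
    by (intro set_integrable_mult_left set_integral_diff set_integrable_torus_shift[OF l] torus_L1_D[OF L1])
  have fq: "f p n x \<le> \<bar>q (fst p) n x\<bar>" for p n x using abs_ge_self[of "q (fst p) n x"] abs_ge_minus_self[of "q (fst p) n x"] by (auto simp: f_def)
  have fi: "set_integrable lebesgue (torus_cell l) (f p n)" for p n
  proof (rule set_integrable_bound[OF set_integrable_abs[OF qi[of "fst p" n]]])
    show "set_borel_measurable lebesgue (torus_cell l) (f p n)"
      unfolding set_borel_measurable_def using fm by measurable
    show "AE x in lebesgue. x \<in> torus_cell l \<longrightarrow> norm (f p n x) \<le> norm \<bar>q (fst p) n x\<bar>"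
      using fq f0 by (intro AE_I2) (simp add: abs_of_nonneg)
  qed
  have fC: "torus_integral l (f p n) \<le> tv l u" for p n
  proof -
    have "torus_integral l (f p n) \<le> torus_integral l (\<lambda>x. \<bar>q (fst p) n x\<bar>)"
      by (intro torus_integral_mono_AE fi set_integrable_abs qi AE_I2 fq)
    also have "\<dots> = torus_integral l (\<lambda>x. (1 / h n) * \<bar>u (x + h n *\<^sub>R e (fst p)) - u x\<bar>)"
      using h[of n] by (simp add: q_def abs_divide)
    also have "\<dots> = shift_difference l u (h n *\<^sub>R e (fst p)) / h n"
      by (simp only: torus_integral_cmult shift_difference_def) simp
    also have "\<dots> \<le> tv l u"
      using shift_difference_le_tv[OF l u, of "h n *\<^sub>R e (fst p)"] h[of n] by (simp add: e_def divide_le_eq norm_axis_1 mult.commute)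
    finally show ?thesis .
  qed
  obtain \<mu> r where r: "strict_mono (r :: nat \<Rightarrow> nat)" and fin: "\<And>p. finite_measure (\<mu> p)" and sets: "\<And>p. sets (\<mu> p) = sets borel"
    and supp: "\<And>p. emeasure (\<mu> p) (- torus_cell l) = 0"
    and conv: "\<And>p \<phi>. continuous_on UNIV \<phi> \<Longrightarrow> torus_periodic l \<phi> \<Longrightarrow>
      (\<lambda>n. torus_integral l (\<lambda>x. \<phi> x * f p (r n) x)) \<longlonglongrightarrow> (\<integral>x. \<phi> x \<partial>(\<mu> p))"
  proof -
    from weak_compactness_densities_finite[where f=f and C="tv l u" and I=UNIV, OF l fm f0 fi fC finite_class.finite_UNIV]
    show thesis using that by (elim exE conjE) (simp only: ball_UNIV, meson)
  qed
  obtain M where M: "finite_measure M" "sets M = sets borel" "\<And>A. A \<in> sets borel \<Longrightarrow> emeasure M A = (\<Sum>p\<in>UNIV. emeasure (\<mu> p) A)"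
    using sum_of_measures[of "UNIV :: ('n \<times> bool) set" \<mu>] sets fin by auto
  interpret M: finite_measure M by fact
  have spM: "space M = UNIV" using sets_eq_imp_space_eq[OF M(2)] by simp
  define dens where "dens p d \<longleftrightarrow> d \<in> borel_measurable borel \<and> (\<forall>x. 0 \<le> d x) \<and> integrable M d \<and>
    (\<forall>\<phi>\<in>borel_measurable borel. (\<integral>x. \<phi> x \<partial>(\<mu> p)) = (\<integral>x. d x * \<phi> x \<partial>M))" for p and d :: "real^'n \<Rightarrow> real"
  have "\<forall>p. \<exists>d. dens p d"
  proof
    fix p
    interpret N: finite_measure "\<mu> p" by (rule fin)
    have ac: "absolutely_continuous M (\<mu> p)"
      unfolding absolutely_continuous_def
    proof
      fix A assume "A \<in> null_sets M"
      then have A: "A \<in> sets borel" "(\<Sum>p\<in>UNIV. emeasure (\<mu> p) A) = 0" using M by (auto simp: null_sets_def)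
      then have "\<forall>p\<in>UNIV. emeasure (\<mu> p) A = 0" by (subst (asm) sum_nonneg_eq_0_iff) auto
      then have "emeasure (\<mu> p) A = 0" by blast
      then show "A \<in> null_sets (\<mu> p)" by (rule null_setsI) (simp only: sets A)
    qed
    obtain d where d: "d \<in> borel_measurable M" "AE x in M. RN_deriv M (\<mu> p) x = ennreal (d x)" "\<And>x. 0 \<le> d x"
      using M.real_RN_deriv[OF fin ac] sets M(2) by metis
    have eq: "density M (\<lambda>x. ennreal (d x)) = \<mu> p"
      using M.density_RN_deriv[OF ac] sets M(2) d by (subst density_cong[of _ M "RN_deriv M (\<mu> p)"]) auto
    have db[measurable]: "d \<in> borel_measurable borel" using d(1) measurable_cong_sets[OF M(2) refl] by blast
    have "(\<integral>\<^sup>+x. ennreal (d x) \<partial>M) = emeasure (\<mu> p) UNIV"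
      unfolding eq[symmetric] using d(1) spM M(2) by (subst emeasure_density) auto
    also have "\<dots> < \<infinity>" using N.emeasure_finite[of UNIV] by (simp only: less_top infinity_ennreal_def)
    finally have int: "integrable M d"
      using d by (intro integrableI_nonneg) auto
    have "(\<integral>x. \<phi> x \<partial>(\<mu> p)) = (\<integral>x. d x * \<phi> x \<partial>M)" if "\<phi> \<in> borel_measurable borel" for \<phi> :: "real^'n \<Rightarrow> real"
    proof -
      have "\<phi> \<in> borel_measurable M" using that measurable_cong_sets[OF M(2) refl] by blast
      then show ?thesis unfolding eq[symmetric] using d by (subst integral_density) auto
    qed
    with db d(3) int have "dens p d" unfolding dens_def by simp
    then show "\<exists>d. dens p d" by (rule exI[of _ d])
  qed
  then obtain d where dd: "\<And>p. dens p (d p)" using choice[of dens] by blast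
  have d[measurable]: "\<And>p. d p \<in> borel_measurable borel" and d0: "\<And>p x. 0 \<le> d p x"
    and di: "\<And>p. integrable M (d p)" and dint: "\<And>p \<phi>. \<phi> \<in> borel_measurable borel \<Longrightarrow> (\<integral>x. \<phi> x \<partial>(\<mu> p)) = (\<integral>x. d p x * \<phi> x \<partial>M)"
    using dd unfolding dens_def by simp_all
  define g where "g x = (\<Sum>i\<in>UNIV. (d (i, True) x - d (i, False) x) *\<^sub>R e i)" for x
  have gb[measurable]: "g \<in> borel_measurable borel" unfolding g_def by measurable
  have gM[measurable]: "g \<in> borel_measurable M" using gb measurable_cong_sets[OF M(2) refl] by blast
  have gi: "integrable M g" unfolding g_def by (intro Bochner_Integration.integrable_sum integrable_scaleR_left Bochner_Integration.integrable_diff di)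
  \<comment> \<open>Where \<open>g\<close> vanishes the direction is an arbitrary unit vector;
    \<open>\<nu>\<close> has no mass there.\<close>
  define \<sigma> where "\<sigma> x = (if g x = 0 then e undefined else (1 / norm (g x)) *\<^sub>R g x)" for x
  define \<nu> where "\<nu> = density M (\<lambda>x. ennreal (norm (g x)))"
  have \<sigma>b: "\<sigma> \<in> borel_measurable borel" unfolding \<sigma>_def by measurable
  have main: "torus_integral l (\<lambda>x. u x * divergence \<phi> x) = - (\<integral>x. \<phi> x \<bullet> \<sigma> x \<partial>\<nu>)" if \<phi>: "\<phi> \<in> torus_C1_fields l" for \<phi>
  proof -
    have c1: "C1_periodic l \<phi>" using \<phi> torus_C1_fields_iff by blast
    have comp: "C1_periodic l (\<lambda>x. \<phi> x $ i)" for i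
      by (rule C1_periodic_bounded_linear[OF c1 bounded_linear_vec_nth])
    note cc = C1_periodic_continuous[OF comp] and cp = C1_periodic_imp_periodic[OF comp]
    have cb[measurable]: "(\<lambda>x. \<phi> x $ i) \<in> borel_measurable borel" for i by (rule borel_measurable_continuous_onI[OF cc])
    have \<phi>b[measurable]: "\<phi> \<in> borel_measurable borel" by (rule borel_measurable_continuous_onI[OF C1_periodic_continuous[OF c1]])
    obtain B where B: "B \<ge> 0" "\<And>x. norm (\<phi> x) \<le> B"
      using continuous_periodic_bounded[OF l C1_periodic_continuous[OF c1] C1_periodic_imp_periodic[OF c1]] by blast
    obtain D where D: "\<And>x. (\<phi> has_derivative D x) (at x)" using c1 unfolding C1_periodic_def by blast
    have dc: "divergence (\<lambda>y. \<phi> y $ i *\<^sub>R e i) x = D x (e i) $ i" for i x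
      by (rule divergence_scalar) (rule bounded_linear.has_derivative[OF bounded_linear_vec_nth D])
    have div: "divergence \<phi> x = (\<Sum>i\<in>UNIV. divergence (\<lambda>y. \<phi> y $ i *\<^sub>R e i) x)" for x
      by (simp only: dc) (simp add: divergence_def e_def frechet_derivative_at[OF D, symmetric])
    have divc: "(\<lambda>y. \<phi> y $ i *\<^sub>R e i) \<in> torus_C1_fields l" for i by (rule torus_scalar_field[OF comp])
    have lim1: "(\<lambda>n. torus_integral l (\<lambda>x. \<phi> x $ i * q i (r n) x)) \<longlonglongrightarrow> - torus_integral l (\<lambda>x. u x * divergence (\<lambda>y. \<phi> y $ i *\<^sub>R e i) x)" for i
    proof -
      define G where "G t = torus_integral l (\<lambda>x. u x * (\<phi> (x + t *\<^sub>R e i) $ i))" for t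
      have "(G has_field_derivative torus_integral l (\<lambda>x. u x * divergence (\<lambda>y. \<phi> y $ i *\<^sub>R e i) x)) (at 0)"
        using torus_integral_shift_derivative[OF l L1 comp[of i], of "e i" 0] unfolding G_def by simp
      then have "((\<lambda>t. (G (0 + t) - G 0) / t) \<longlongrightarrow> torus_integral l (\<lambda>x. u x * divergence (\<lambda>y. \<phi> y $ i *\<^sub>R e i) x)) (at 0)"
        by (simp add: DERIV_def)
      \<comment> \<open>Discrete integration by parts moves the shift to the test function with a
        minus sign, so the derivative at 0 is approached along negative increments.\<close>
      moreover have "filterlim (\<lambda>n. - h (r n)) (at 0) sequentially"
        unfolding filterlim_at
      proof
        have "(\<lambda>n. h (r n)) \<longlonglongrightarrow> 0" using LIMSEQ_subseq_LIMSEQ[OF h0 r] by (simp add: comp_def)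
        from tendsto_minus[OF this] show "(\<lambda>n. - h (r n)) \<longlonglongrightarrow> 0" by simp
        show "\<forall>\<^sub>F n in sequentially. - h (r n) \<in> UNIV \<and> - h (r n) \<noteq> 0"
          using h by (intro always_eventually allI) (metis UNIV_I less_irrefl neg_equal_0_iff_equal)
      qed
      ultimately have "(\<lambda>n. (G (0 + - h (r n)) - G 0) / - h (r n)) \<longlonglongrightarrow> torus_integral l (\<lambda>x. u x * divergence (\<lambda>y. \<phi> y $ i *\<^sub>R e i) x)"
        by (rule filterlim_compose)
      moreover have "(G (0 + - h k) - G 0) / - h k = - torus_integral l (\<lambda>x. \<phi> x $ i * q i k x)" for k
      proof -
        have "torus_integral l (\<lambda>x. \<phi> x $ i * q i k x) = torus_integral l (\<lambda>x. (1 / h k) * ((u (x + h k *\<^sub>R e i) - u x) * \<phi> x $ i))"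
          by (simp add: q_def mult.commute)
        also have "\<dots> = (1 / h k) * (torus_integral l (\<lambda>x. u x * \<phi> (x - h k *\<^sub>R e i) $ i) - torus_integral l (\<lambda>x. u x * \<phi> x $ i))"
          by (simp only: torus_integral_cmult torus_integral_difference_by_parts[OF l L1 cc cp])
        finally show ?thesis by (simp add: G_def)
      qed
      ultimately have "(\<lambda>n. - torus_integral l (\<lambda>x. \<phi> x $ i * q i (r n) x)) \<longlonglongrightarrow> torus_integral l (\<lambda>x. u x * divergence (\<lambda>y. \<phi> y $ i *\<^sub>R e i) x)"
        by simp
      from tendsto_minus[OF this] show ?thesis by simp
    qed
    have lim2: "(\<lambda>n. torus_integral l (\<lambda>x. \<phi> x $ i * q i (r n) x)) \<longlonglongrightarrow> (\<integral>x. \<phi> x $ i \<partial>(\<mu> (i, True))) - (\<integral>x. \<phi> x $ i \<partial>(\<mu> (i, False)))" for i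
    proof -
      have fpi: "set_integrable lebesgue (torus_cell l) (\<lambda>x. \<phi> x $ i * f p n x)" for p n
      proof -
        have "\<bar>\<phi> x $ i\<bar> \<le> B" for x using component_le_norm_cart[of "\<phi> x" i] B(2)[of x] by linarith
        from set_integrable_torus_mult_bounded[OF fi fm continuous_imp_lebesgue_measurable[OF cc] this]
        show ?thesis by (simp add: mult.commute)
      qed
      have "torus_integral l (\<lambda>x. \<phi> x $ i * q i n x) = torus_integral l (\<lambda>x. \<phi> x $ i * f (i, True) n x) - torus_integral l (\<lambda>x. \<phi> x $ i * f (i, False) n x)" for n
      proof -
        have "q i n x = f (i, True) n x - f (i, False) n x" for x by (simp add: f_def)
        then have "torus_integral l (\<lambda>x. \<phi> x $ i * q i n x) = torus_integral l (\<lambda>x. \<phi> x $ i * f (i, True) n x - \<phi> x $ i * f (i, False) n x)"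
          by (simp only: right_diff_distrib)
        then show ?thesis by (simp only: torus_integral_diff[OF fpi fpi])
      qed
      then show ?thesis using tendsto_diff[OF conv[OF cc cp, of i "(i, True)"] conv[OF cc cp, of i "(i, False)"]] by simp
    qed
    have pw: "- torus_integral l (\<lambda>x. u x * divergence (\<lambda>y. \<phi> y $ i *\<^sub>R e i) x) = (\<integral>x. (d (i, True) x - d (i, False) x) * \<phi> x $ i \<partial>M)" for i
    proof -
      have i: "integrable M (\<lambda>x. d p x * \<phi> x $ i)" for p
      proof (rule Bochner_Integration.integrable_bound[OF integrable_mult_right[OF di[of p], of B]])
        show "(\<lambda>x. d p x * \<phi> x $ i) \<in> borel_measurable M"
          using borel_measurable_times[OF d[of p] cb[of i]] measurable_cong_sets[OF M(2) refl] by blast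
        show "AE x in M. norm (d p x * \<phi> x $ i) \<le> norm (B * d p x)"
        proof (rule AE_I2)
          fix x
          have "\<bar>\<phi> x $ i\<bar> \<le> B" using component_le_norm_cart[of "\<phi> x" i] B(2)[of x] by linarith
          from mult_left_mono[OF this d0[of p x]] show "norm (d p x * \<phi> x $ i) \<le> norm (B * d p x)"
            using B(1) d0[of p x] by (simp add: abs_mult mult.commute)
        qed
      qed
      have "- torus_integral l (\<lambda>x. u x * divergence (\<lambda>y. \<phi> y $ i *\<^sub>R e i) x) = (\<integral>x. \<phi> x $ i \<partial>(\<mu> (i, True))) - (\<integral>x. \<phi> x $ i \<partial>(\<mu> (i, False)))"
        by (rule LIMSEQ_unique[OF lim1 lim2])
      then show ?thesis using i by (simp add: dint[OF cb] left_diff_distrib)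
    qed
    have int3: "integrable M (\<lambda>x. (d (i, True) x - d (i, False) x) * \<phi> x $ i)" for i
    proof (rule Bochner_Integration.integrable_bound[OF integrable_mult_right[OF Bochner_Integration.integrable_diff[OF di[of "(i,True)"] di[of "(i,False)"]], of B]])
      show "(\<lambda>x. (d (i, True) x - d (i, False) x) * \<phi> x $ i) \<in> borel_measurable M"
        using borel_measurable_times[OF borel_measurable_diff[OF d[of "(i, True)"] d[of "(i, False)"]] cb[of i]] measurable_cong_sets[OF M(2) refl] by blast
      show "AE x in M. norm ((d (i, True) x - d (i, False) x) * \<phi> x $ i) \<le> norm (B * (d (i, True) x - d (i, False) x))"
      proof (rule AE_I2)
        fix x
        have "\<bar>\<phi> x $ i\<bar> \<le> \<bar>B\<bar>" using component_le_norm_cart[of "\<phi> x" i] B(2)[of x] by linarith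
        from mult_left_mono[OF this abs_ge_zero[of "d (i, True) x - d (i, False) x"]]
        show "norm ((d (i, True) x - d (i, False) x) * \<phi> x $ i) \<le> norm (B * (d (i, True) x - d (i, False) x))"
          by (simp add: abs_mult mult.commute)
      qed
    qed
    have ti: "set_integrable lebesgue (torus_cell l) (\<lambda>x. u x * divergence (\<lambda>y. \<phi> y $ i *\<^sub>R e i) x)" for i
    proof -
      obtain B' where "B' \<ge> 0" "continuous_on UNIV (divergence (\<lambda>y. \<phi> y $ i *\<^sub>R e i))" "\<And>x. \<bar>divergence (\<lambda>y. \<phi> y $ i *\<^sub>R e i) x\<bar> \<le> B'"
        using divergence_bounded_continuous[OF l divc] by blast
      then show ?thesis
        by (intro set_integrable_torus_mult_bounded[where B=B'] torus_L1_D[OF L1]) (auto intro: continuous_imp_lebesgue_measurable)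
    qed
    have "torus_integral l (\<lambda>x. u x * divergence \<phi> x) = torus_integral l (\<lambda>x. \<Sum>i\<in>UNIV. u x * divergence (\<lambda>y. \<phi> y $ i *\<^sub>R e i) x)"
      by (simp only: div sum_distrib_left)
    also have "\<dots> = (\<Sum>i\<in>UNIV. torus_integral l (\<lambda>x. u x * divergence (\<lambda>y. \<phi> y $ i *\<^sub>R e i) x))"
      by (rule torus_integral_sum[OF finite_class.finite_UNIV ti])
    also have "\<dots> = - (\<Sum>i\<in>UNIV. (\<integral>x. (d (i, True) x - d (i, False) x) * \<phi> x $ i \<partial>M))"
      unfolding pw[symmetric] by (simp add: sum_negf)
    also have "(\<Sum>i\<in>UNIV. (\<integral>x. (d (i, True) x - d (i, False) x) * \<phi> x $ i \<partial>M)) = (\<integral>x. (\<Sum>i\<in>UNIV. (d (i, True) x - d (i, False) x) * \<phi> x $ i) \<partial>M)"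
      by (rule Bochner_Integration.integral_sum[symmetric]) (rule int3)
    also have "\<dots> = (\<integral>x. \<phi> x \<bullet> g x \<partial>M)"
    proof -
      have "\<phi> x \<bullet> e i = \<phi> x $ i" for x i unfolding e_def by (simp add: inner_axis)
      then show ?thesis by (simp add: g_def inner_sum_right)
    qed
    also have "\<dots> = (\<integral>x. norm (g x) *\<^sub>R (\<phi> x \<bullet> \<sigma> x) \<partial>M)"
    proof (rule Bochner_Integration.integral_cong[OF refl])
      fix x show "\<phi> x \<bullet> g x = norm (g x) *\<^sub>R (\<phi> x \<bullet> \<sigma> x)" by (simp add: \<sigma>_def)
    qed
    also have "\<dots> = (\<integral>x. \<phi> x \<bullet> \<sigma> x \<partial>\<nu>)"
    proof -
      have "(\<lambda>x. \<phi> x \<bullet> \<sigma> x) \<in> borel_measurable M"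
        using measurable_cong_sets[OF M(2) refl] borel_measurable_inner[OF \<phi>b \<sigma>b] by blast
      then show ?thesis unfolding \<nu>_def by (subst integral_density) auto
    qed
    finally show ?thesis .
  qed
  have "is_polar_gradient l u \<nu> \<sigma>"
    unfolding is_polar_gradient_def
  proof (intro conjI allI ballI main)
    show "sets \<nu> = sets borel" by (simp add: \<nu>_def M)
    show "finite_measure \<nu>"
    proof (rule finite_measureI)
      have "emeasure \<nu> (space \<nu>) = (\<integral>\<^sup>+x. ennreal (norm (g x)) \<partial>M)"
        unfolding \<nu>_def by (subst emeasure_density) auto
      also have "\<dots> < \<infinity>" using gi by (simp add: integrable_iff_bounded)
      finally show "emeasure \<nu> (space \<nu>) \<noteq> \<infinity>" by simp
    qed
    have "emeasure M (- torus_cell l) = 0" using M(3)[of "- torus_cell l"] supp by simp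
    then have "- torus_cell l \<in> null_sets M" by (rule null_setsI) (simp add: M(2))
    then show "emeasure \<nu> (- torus_cell l) = 0"
      unfolding \<nu>_def using M(2) by (subst emeasure_density) (auto simp: nn_integral_null_set intro!: nn_integral_0_iff_AE[THEN iffD2] dest: AE_not_in split: split_indicator elim: eventually_mono)
    show "\<sigma> \<in> borel_measurable borel" by (rule \<sigma>b)
    show "norm (\<sigma> x) = 1" for x by (simp add: \<sigma>_def e_def norm_axis_1)
  qed
  then show ?thesis by blast
qed

text \<open>Existence of a decomposition makes the choice in \<open>directional_variation\<close> a
  genuine one, and the same pair serves all directions \<open>w\<close>.\<close>

lemma directional_variation_polar:
  fixes u :: "real^'n \<Rightarrow> real"
  assumes l: "l > 0" and u: "u \<in> BV01 l"
  obtains \<mu> \<sigma> where "is_polar_gradient l u \<mu> \<sigma>" "\<And>w. directional_variation l u w = (\<integral>x. \<bar>w \<bullet> \<sigma> x\<bar> \<partial>\<mu>)"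
proof -
  define p where "p = (SOME (\<mu>, \<sigma>). is_polar_gradient l u \<mu> \<sigma>)"
  obtain \<mu>' \<sigma>' where "is_polar_gradient l u \<mu>' \<sigma>'" using polar_gradient_exists[OF l u] by blast
  then have "case (\<mu>', \<sigma>') of (\<mu>, \<sigma>) \<Rightarrow> is_polar_gradient l u \<mu> \<sigma>" by simp
  then have "case p of (\<mu>, \<sigma>) \<Rightarrow> is_polar_gradient l u \<mu> \<sigma>" unfolding p_def by (rule someI)
  then show thesis
    using that[of "fst p" "snd p"] by (auto simp: directional_variation_def p_def[symmetric] split: prod.splits)
qed

section \<open>Polar coordinates and the spherical mean\<close>

lemma nn_integral_lborel_scale:
  fixes f :: "'a::euclidean_space \<Rightarrow> ennreal"
  assumes [measurable]: "f \<in> borel_measurable borel" and c: "c > 0"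
  shows "(\<integral>\<^sup>+x. f x \<partial>lborel) = ennreal (c ^ DIM('a)) * (\<integral>\<^sup>+x. f (c *\<^sub>R x) \<partial>lborel)"
proof -
  have "(\<integral>\<^sup>+x. f x \<partial>lborel) = (\<integral>\<^sup>+x. f x \<partial>density (distr lborel borel (\<lambda>x::'a. 0 + c *\<^sub>R x)) (\<lambda>_. \<bar>c\<bar>^DIM('a)))"
    using c by (subst lborel_affine[of c "0::'a"]) auto
  also have "\<dots> = ennreal (c ^ DIM('a)) * (\<integral>\<^sup>+x. f (c *\<^sub>R x) \<partial>lborel)"
    using c by (simp add: nn_integral_density nn_integral_distr nn_integral_cmult)
  finally show ?thesis .
qed

text \<open>Both sides of the polar formula define measures in \<open>k\<close>; by homogeneity they agree on the
  intervals \<open>{..r}\<close>.\<close>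

lemma nn_integral_radial_homogeneous:
  fixes h :: "'a::euclidean_space \<Rightarrow> ennreal" and k :: "real \<Rightarrow> ennreal"
  assumes h[measurable]: "h \<in> borel_measurable borel" and hom: "\<And>c x. c > 0 \<Longrightarrow> h (c *\<^sub>R x) = h x"
    and fin: "(\<integral>\<^sup>+x\<in>cball 0 1. h x \<partial>lborel) < \<infinity>" and k[measurable]: "k \<in> borel_measurable borel"
  shows "(\<integral>\<^sup>+x. k (norm x) * h x \<partial>lborel) =
    of_nat DIM('a) * (\<integral>\<^sup>+x\<in>cball 0 1. h x \<partial>lborel) * (\<integral>\<^sup>+t\<in>{0<..}. k t * ennreal (t ^ (DIM('a) - 1)) \<partial>lborel)"
proof -
  let ?d = "DIM('a)" and ?C = "\<integral>\<^sup>+x\<in>cball 0 1. h x \<partial>lborel"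
  have d: "?d > 0" by simp
  obtain C where C: "?C = ennreal C" "C \<ge> 0" using fin by (cases ?C) auto
  \<comment> \<open>\<open>m1\<close> is the law of the norm under the measure with density
    \<open>h\<close>, which gives the ball of radius r the mass \<open>C * r ^ ?d\<close>; the
    density of \<open>m2\<close> is the derivative of this function.\<close>
  define m1 where "m1 = distr (density lborel h) borel norm"
  define m2 where "m2 = density lborel (\<lambda>t. ennreal (C * ?d * t ^ (?d - 1)) * indicator {0<..} t)"
  have m1r: "emeasure m1 {..r} = ennreal (C * max 0 r ^ ?d)" for r
  proof -
    have "emeasure m1 {..r} = (\<integral>\<^sup>+x. h x * indicator {x. norm x \<le> r} x \<partial>lborel)"
      unfolding m1_def by (subst emeasure_distr) (auto simp: emeasure_density vimage_def intro!: nn_integral_cong split: split_indicator)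
    also have "\<dots> = ennreal (C * max 0 r ^ ?d)"
    proof (cases "r > 0")
      case True
      have m: "(\<lambda>x. h x * indicator {x. norm x \<le> r} x) \<in> borel_measurable borel" by measurable
      have "(\<integral>\<^sup>+x. h x * indicator {x. norm x \<le> r} x \<partial>lborel)
         = ennreal (r ^ ?d) * (\<integral>\<^sup>+x. h (r *\<^sub>R x) * indicator {x. norm x \<le> r} (r *\<^sub>R x) \<partial>lborel)"
        by (rule nn_integral_lborel_scale[OF m True])
      also have "(\<integral>\<^sup>+x. h (r *\<^sub>R x) * indicator {x. norm x \<le> r} (r *\<^sub>R x) \<partial>lborel) = ?C"
        using True by (intro nn_integral_cong) (auto simp: hom split: split_indicator)
      finally show ?thesis using True C by (simp add: ennreal_mult'[symmetric] mult.commute)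
    next
      case False
      have "(\<integral>\<^sup>+x. h x * indicator {x. norm x \<le> r} x \<partial>lborel) = (\<integral>\<^sup>+x. 0 \<partial>(lborel :: 'a measure))"
      proof (rule nn_integral_cong_AE)
        have "AE x in lborel. x \<noteq> (0::'a)" by (rule AE_lborel_singleton)
        then show "AE x in lborel. h x * indicator {x. norm x \<le> r} x = 0"
        proof eventually_elim
          case (elim x)
          then have "0 < norm x" by simp
          then have "\<not> norm x \<le> r" using False by linarith
          then show ?case by simp
        qed
      qed
      then show ?thesis using False d by (simp add: max_def zero_power)
    qed
    finally show ?thesis .
  qed
  have m2r: "emeasure m2 {..r} = ennreal (C * max 0 r ^ ?d)" for r
  proof -
    have "emeasure m2 {..r} = (\<integral>\<^sup>+t. ennreal (C * ?d * t ^ (?d - 1)) * indicator {0..max 0 r} t \<partial>lborel)"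
      unfolding m2_def
    proof (subst emeasure_density)
      show "(\<integral>\<^sup>+t. ennreal (C * ?d * t ^ (?d - 1)) * indicator {0<..} t * indicator {..r} t \<partial>lborel)
         = (\<integral>\<^sup>+t. ennreal (C * ?d * t ^ (?d - 1)) * indicator {0..max 0 r} t \<partial>lborel)"
      proof (rule nn_integral_cong_AE)
        have "AE t in lborel. t \<noteq> (0::real)" by (rule AE_lborel_singleton)
        then show "AE t in lborel. ennreal (C * ?d * t ^ (?d - 1)) * indicator {0<..} t * indicator {..r} t = ennreal (C * ?d * t ^ (?d - 1)) * indicator {0..max 0 r} t"
          by eventually_elim (auto split: split_indicator)
      qed
    qed auto
    also have "\<dots> = ennreal (C * max 0 r ^ ?d - C * 0 ^ ?d)"
    proof (rule nn_integral_FTC_Icc)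
      show "DERIV (\<lambda>t. C * t ^ ?d) t :> C * ?d * t ^ (?d - 1)" for t
        by (rule derivative_eq_intros refl)+ simp
    qed (use C in auto)
    finally show ?thesis using d by (simp add: zero_power)
  qed
  have "m1 = m2"
  proof (rule measure_eqI_generator_eq[where E="range (\<lambda>r. {..r::real})" and \<Omega>=UNIV and A="\<lambda>n. {..real n}"])
    show "Int_stable (range (\<lambda>r. {..r::real}))"
      by (auto simp: Int_stable_def intro!: image_eqI[where x="min _ _"])
    show "sets m1 = sigma_sets UNIV (range (\<lambda>r. {..r::real}))" unfolding m1_def by (subst sets_distr) (subst borel_eq_atMost, simp)
    show "sets m2 = sigma_sets UNIV (range (\<lambda>r. {..r::real}))" unfolding m2_def by (simp, subst borel_eq_atMost, simp)
    show "(\<Union>n. {..real n}) = UNIV" using real_arch_simple by auto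
  qed (auto simp: m1r m2r)
  have "(\<integral>\<^sup>+x. k (norm x) * h x \<partial>lborel) = (\<integral>\<^sup>+t. k t \<partial>m1)"
    unfolding m1_def by (subst nn_integral_distr) (auto simp: nn_integral_density mult.commute)
  also have "\<dots> = (\<integral>\<^sup>+t. k t \<partial>m2)" by (simp add: \<open>m1 = m2\<close>)
  also have "\<dots> = (\<integral>\<^sup>+t. ennreal (C * ?d) * (k t * ennreal (t ^ (?d - 1)) * indicator {0<..} t) \<partial>lborel)"
    unfolding m2_def using C
    by (subst nn_integral_density) (auto intro!: nn_integral_cong split: split_indicator simp: ennreal_mult' mult.assoc mult.left_commute mult.commute)
  also have "\<dots> = ennreal (C * ?d) * (\<integral>\<^sup>+t\<in>{0<..}. k t * ennreal (t ^ (?d - 1)) \<partial>lborel)"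
    by (rule nn_integral_cmult) measurable
  also have "ennreal (C * ?d) = of_nat ?d * ?C" using C by (simp add: ennreal_mult'' ennreal_of_nat_eq_real_of_nat mult.commute)
  finally show ?thesis .
qed

section \<open>The sphere constant by Gaussian integration\<close>

text \<open>On rectangles the integral of the product density factorises, and values on rectangles
  determine the product measure.\<close>

lemma PiM_density_lborel:
  fixes f :: "real \<Rightarrow> real"
  assumes I: "finite I" and f[measurable]: "f \<in> borel_measurable borel" "\<And>x. 0 \<le> f x" and pr: "prob_space (density lborel f)"
  shows "PiM I (\<lambda>_. density lborel f) = density (PiM I (\<lambda>_. lborel)) (\<lambda>w. \<Prod>i\<in>I. ennreal (f (w i)))"
proof -
  interpret P: product_sigma_finite "\<lambda>_::'a. density lborel f"
    using pr by (intro product_sigma_finite.intro prob_space_imp_sigma_finite)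
  interpret L: product_sigma_finite "\<lambda>_::'a. lborel :: real measure"
    by (intro product_sigma_finite.intro lborel.sigma_finite_measure_axioms)
  show ?thesis
  proof (rule P.PiM_eqI[OF I, symmetric])
    show "sets (density (PiM I (\<lambda>_. lborel)) (\<lambda>w. \<Prod>i\<in>I. ennreal (f (w i)))) = sets (PiM I (\<lambda>_. density lborel f))"
      by (simp cong: sets_PiM_cong)
    fix A :: "'a \<Rightarrow> real set" assume A: "\<And>i. i \<in> I \<Longrightarrow> A i \<in> sets (density lborel f)"
    then have A'[measurable]: "\<And>i. i \<in> I \<Longrightarrow> A i \<in> sets borel" by simp
    have PA: "Pi\<^sub>E I A \<in> sets (PiM I (\<lambda>_. lborel))" using A' I by (intro sets_PiM_I_finite) auto
    have m: "(\<lambda>w. \<Prod>i\<in>I. ennreal (f (w i))) \<in> borel_measurable (PiM I (\<lambda>_. lborel))" by measurable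
    have "emeasure (density (PiM I (\<lambda>_. lborel)) (\<lambda>w. \<Prod>i\<in>I. ennreal (f (w i)))) (Pi\<^sub>E I A)
       = (\<integral>\<^sup>+w. (\<Prod>i\<in>I. ennreal (f (w i))) * indicator (Pi\<^sub>E I A) w \<partial>PiM I (\<lambda>_. lborel))"
      by (rule emeasure_density[OF m PA])
    also have "\<dots> = (\<integral>\<^sup>+w. (\<Prod>i\<in>I. ennreal (f (w i)) * indicator (A i) (w i)) \<partial>PiM I (\<lambda>_. lborel))"
    proof (rule nn_integral_cong)
      fix w :: "'a \<Rightarrow> real" assume "w \<in> space (PiM I (\<lambda>_. lborel :: real measure))"
      then have w: "w \<in> extensional I" by (auto simp: space_PiM PiE_def)
      have "indicator (Pi\<^sub>E I A) w = (\<Prod>i\<in>I. indicator (A i) (w i) :: ennreal)"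
      proof (cases "\<forall>i\<in>I. w i \<in> A i")
        case True
        then show ?thesis using w by (simp add: PiE_def Pi_def)
      next
        case False
        then obtain i where i: "i \<in> I" "w i \<notin> A i" by auto
        then have "(\<Prod>i\<in>I. indicator (A i) (w i) :: ennreal) = 0" by (intro prod_zero[OF I] bexI[of _ i]) auto
        moreover have "w \<notin> Pi\<^sub>E I A" using i by (auto simp: PiE_def Pi_def)
        ultimately show ?thesis by simp
      qed
      then show "(\<Prod>i\<in>I. ennreal (f (w i))) * indicator (Pi\<^sub>E I A) w = (\<Prod>i\<in>I. ennreal (f (w i)) * indicator (A i) (w i))"
        by (simp add: prod.distrib)
    qed
    also have "\<dots> = (\<Prod>i\<in>I. (\<integral>\<^sup>+t. ennreal (f t) * indicator (A i) t \<partial>lborel))"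
      using A' by (intro L.product_nn_integral_prod[OF I]) measurable
    also have "\<dots> = (\<Prod>i\<in>I. emeasure (density lborel f) (A i))"
      using A' by (intro prod.cong refl emeasure_density[symmetric]) auto
    finally show "emeasure (density (PiM I (\<lambda>_. lborel)) (\<lambda>w. \<Prod>i\<in>I. ennreal (f (w i)))) (Pi\<^sub>E I A) = (\<Prod>i\<in>I. emeasure (density lborel f) (A i))" .
  qed
qed

text \<open>Under the Gaussian measure the coordinates are independent normal variables, so \<open>z \<bullet> \<sigma>\<close> is normal
  with the same variance for every unit vector \<open>\<sigma>\<close>; no rotation invariance of Lebesgue measure is needed.\<close>

lemma gaussian_abs_inner:
  fixes \<sigma> :: "'a::euclidean_space"
  assumes \<sigma>: "norm \<sigma> = 1"
  shows "(\<integral>\<^sup>+z. ennreal (\<bar>z \<bullet> \<sigma>\<bar> * exp (- (norm z)\<^sup>2)) \<partial>lborel) = ennreal (pi powr (real (DIM('a) - 1) / 2))"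
proof -
  \<comment> \<open>Variance 1/2 turns the normal density into
    \<open>exp (- x\<^sup>2) / sqrt pi\<close>.\<close>
  define s :: real where "s = 1 / sqrt 2"
  have s: "s > 0" "2 * s\<^sup>2 = 1" by (auto simp: s_def power_divide)
  define f where "f = normal_density 0 s"
  have f: "f x = exp (- x\<^sup>2) / sqrt pi" for x
  proof -
    have "2 * pi * s\<^sup>2 = pi" using s(2) by (simp add: algebra_simps)
    then show ?thesis by (simp add: f_def normal_density_def s(2))
  qed
  have f0: "0 \<le> f x" for x by (simp add: f)
  have fm[measurable]: "f \<in> borel_measurable borel" by (simp add: f_def)
  have pr: "prob_space (density lborel f)" unfolding f_def by (rule prob_space_normal_density[OF s(1)])
  define P where "P = PiM (Basis :: 'a set) (\<lambda>_. density lborel f)"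
  interpret PP: product_prob_space "\<lambda>_::'a. density lborel f" Basis
    using pr by (simp add: product_prob_space_def product_prob_space_axioms_def product_sigma_finite_def prob_space_imp_sigma_finite)
  have prP: "prob_space P" unfolding P_def by (rule PP.prob_space_axioms)
  interpret P: prob_space P by (rule prP)
  have comp: "distr P borel (\<lambda>w. w b) = density lborel f" if "b \<in> Basis" for b
  proof -
    have "distr P (density lborel f) (\<lambda>w. w b) = density lborel f" unfolding P_def by (rule PP.PiM_component[OF that])
    moreover have "distr P (density lborel f) (\<lambda>w. w b) = distr P borel (\<lambda>w. w b)" by (rule distr_cong) auto
    ultimately show ?thesis by simp
  qed
  have meas: "(\<lambda>w. w b) \<in> P \<rightarrow>\<^sub>M borel" if "b \<in> Basis" for b
    using measurable_component_singleton[OF that, of "\<lambda>_. density lborel f"] unfolding P_def by simp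
  \<comment> \<open>Independence of the coordinates: their joint law is \<open>P\<close> itself,
    which is the product of the marginals.\<close>
  have indep: "P.indep_vars (\<lambda>_. borel) (\<lambda>b w. w b) (Basis :: 'a set)"
  proof (subst P.indep_vars_iff_distr_eq_PiM')
    show "distr P (PiM Basis (\<lambda>_. borel)) (\<lambda>x. \<lambda>b\<in>Basis. x b) = PiM Basis (\<lambda>b. distr P borel (\<lambda>w. w b))"
    proof -
      have "PiM Basis (\<lambda>b. distr P borel (\<lambda>w. w b)) = P" unfolding P_def[symmetric]
        using comp by (auto simp: P_def intro!: PiM_cong)
      moreover have "distr P (PiM Basis (\<lambda>_. borel)) (\<lambda>x. \<lambda>b\<in>Basis. x b) = distr P P (\<lambda>x. x)"
      proof (rule distr_cong)
        show "sets (PiM (Basis :: 'a set) (\<lambda>_. borel)) = sets P" unfolding P_def by (intro sets_PiM_cong) auto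
        show "(\<lambda>b\<in>Basis. x b) = x" if "x \<in> space P" for x
          using that by (auto simp: P_def space_PiM PiE_def extensional_restrict)
      qed simp
      ultimately show ?thesis by (simp add: distr_id)
    qed
  qed (use meas in auto)
  \<comment> \<open>The normal laws that are added must have positive standard deviation, so
    coordinates with coefficient 0 are left out of the sum.\<close>
  define I where "I = {b \<in> Basis. b \<bullet> \<sigma> \<noteq> 0}"
  have I: "finite I" "I \<subseteq> Basis" by (auto simp: I_def)
  have sumI: "(\<Sum>b\<in>I. (b \<bullet> \<sigma>)\<^sup>2) = 1"
  proof -
    have "(\<Sum>b\<in>I. (b \<bullet> \<sigma>)\<^sup>2) = (\<Sum>b\<in>Basis. (b \<bullet> \<sigma>)\<^sup>2)"
      by (rule sum.mono_neutral_left) (auto simp: I_def)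
    also have "\<dots> = \<sigma> \<bullet> \<sigma>"
      unfolding euclidean_inner[of \<sigma> \<sigma>] by (simp add: power2_eq_square inner_commute)
    finally show ?thesis using \<sigma> by (simp add: dot_square_norm)
  qed
  then have Ine: "I \<noteq> {}" by auto
  define X where "X w = (\<Sum>b\<in>I. 0 + (b \<bullet> \<sigma>) * w b)" for w :: "'a \<Rightarrow> real"
  have "distributed P lborel X (normal_density (\<Sum>b\<in>I. 0 + (b \<bullet> \<sigma>) * 0) (sqrt (\<Sum>b\<in>I. (\<bar>b \<bullet> \<sigma>\<bar> * s)\<^sup>2)))"
    unfolding X_def
  proof (rule P.sum_indep_normal[OF I(1) Ine])
    show "P.indep_vars (\<lambda>_. borel) (\<lambda>b w. 0 + (b \<bullet> \<sigma>) * w b) I"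
      by (rule P.indep_vars_compose2[OF P.indep_vars_subset[OF indep I(2)]]) measurable
    fix b assume b: "b \<in> I"
    then show "0 < \<bar>b \<bullet> \<sigma>\<bar> * s" using s by (simp add: I_def)
    have "distributed P lborel (\<lambda>w. w b) (normal_density 0 s)"
      unfolding distributed_def using comp[of b] meas[of b] b I(2)
      by (auto simp: f_def cong: distr_cong)
    from P.normal_density_affine[OF this s(1), of "b \<bullet> \<sigma>" 0] b
    show "distributed P lborel (\<lambda>w. 0 + (b \<bullet> \<sigma>) * w b) (normal_density (0 + (b \<bullet> \<sigma>) * 0) (\<bar>b \<bullet> \<sigma>\<bar> * s))"
      by (simp add: I_def)
  qed
  moreover have "sqrt (\<Sum>b\<in>I. (\<bar>b \<bullet> \<sigma>\<bar> * s)\<^sup>2) = s"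
    using sumI s by (simp add: power_mult_distrib sum_distrib_right[symmetric])
  ultimately have dX: "distributed P lborel X f" by (simp add: f_def)
  have Xsum: "X w = (\<Sum>b\<in>Basis. w b * (b \<bullet> \<sigma>))" for w
    unfolding X_def by (simp add: mult.commute) (rule sum.mono_neutral_left, auto simp: I_def)
  have Xm[measurable]: "X \<in> borel_measurable (PiM (Basis :: 'a set) (\<lambda>_. lborel :: real measure))"
  proof -
    have "(\<lambda>w. w b) \<in> borel_measurable (PiM (Basis :: 'a set) (\<lambda>_. lborel :: real measure))" if "b \<in> Basis" for b
      using measurable_component_singleton[OF that, of "\<lambda>_. lborel :: real measure"] by simp
    then have "(\<lambda>w. \<Sum>b\<in>Basis. w b * (b \<bullet> \<sigma>)) \<in> borel_measurable (PiM (Basis :: 'a set) (\<lambda>_. lborel :: real measure))"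
      by (intro borel_measurable_sum borel_measurable_times borel_measurable_const)
    then show ?thesis by (simp add: Xsum[abs_def])
  qed
  \<comment> \<open>The first absolute moment: the half-line moment is 1/2, even reflection doubles
    it, and the normalisation divides by the square root of pi.\<close>
  have one: "(\<integral>\<^sup>+t. ennreal (f t) * ennreal \<bar>t\<bar> \<partial>lborel) = ennreal (1 / sqrt pi)"
  proof -
    have "has_bochner_integral lborel (\<lambda>x::real. indicator {0..} x *\<^sub>R (exp (- x\<^sup>2) * \<bar>x\<bar>)) (1 / 2)"
      by (rule has_bochner_integral_cong[THEN iffD1, OF refl _ refl gaussian_moment_1]) (auto split: split_indicator)
    from has_bochner_integral_even_function[OF this]
    have "has_bochner_integral lborel (\<lambda>x::real. exp (- x\<^sup>2) * \<bar>x\<bar>) 1" by simp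
    from has_bochner_integral_divide_zero[OF this, of "sqrt pi"]
    have *: "has_bochner_integral lborel (\<lambda>x. f x * \<bar>x\<bar>) (1 / sqrt pi)" by (simp add: f)
    have "(\<integral>\<^sup>+t. ennreal (f t) * ennreal \<bar>t\<bar> \<partial>lborel) = (\<integral>\<^sup>+t. ennreal (f t * \<bar>t\<bar>) \<partial>lborel)"
      using f0 by (simp add: ennreal_mult')
    also have "\<dots> = ennreal (1 / sqrt pi)"
      using * f0 by (subst nn_integral_eq_integral) (auto simp: has_bochner_integral_iff)
    finally show ?thesis .
  qed
  let ?PL = "PiM (Basis :: 'a set) (\<lambda>_. lborel :: real measure)"
  have "(\<integral>\<^sup>+z. ennreal (\<bar>z \<bullet> \<sigma>\<bar> * exp (- (norm z)\<^sup>2)) \<partial>lborel)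
      = (\<integral>\<^sup>+w. ennreal (\<bar>(\<Sum>b\<in>Basis. w b *\<^sub>R b) \<bullet> \<sigma>\<bar> * exp (- (norm (\<Sum>b\<in>Basis. w b *\<^sub>R b))\<^sup>2)) \<partial>?PL)"
    by (subst lborel_eq, subst nn_integral_distr) measurable
  also have "\<dots> = (\<integral>\<^sup>+w. ennreal (sqrt pi ^ DIM('a)) * ((\<Prod>b\<in>Basis. ennreal (f (w b))) * ennreal \<bar>X w\<bar>) \<partial>?PL)"
  proof (rule nn_integral_cong)
    fix w :: "'a \<Rightarrow> real"
    let ?z = "\<Sum>b\<in>Basis. w b *\<^sub>R b"
    have "(norm ?z)\<^sup>2 = (\<Sum>b\<in>Basis. (w b)\<^sup>2)"
      unfolding power2_norm_eq_inner by (subst euclidean_inner) (simp add: power2_eq_square)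
    then have "exp (- (norm ?z)\<^sup>2) = (\<Prod>b\<in>(Basis::'a set). exp (- (w b)\<^sup>2))"
      by (simp add: sum_negf[symmetric] exp_sum)
    also have "\<dots> = sqrt pi ^ DIM('a) * (\<Prod>b\<in>(Basis::'a set). f (w b))"
      by (simp add: f prod_dividef)
    finally have e: "exp (- (norm ?z)\<^sup>2) = sqrt pi ^ DIM('a) * (\<Prod>b\<in>(Basis::'a set). f (w b))" .
    have "?z \<bullet> \<sigma> = X w" by (simp add: Xsum inner_sum_left)
    then have "\<bar>?z \<bullet> \<sigma>\<bar> * exp (- (norm ?z)\<^sup>2) = sqrt pi ^ DIM('a) * ((\<Prod>b\<in>(Basis::'a set). f (w b)) * \<bar>X w\<bar>)" by (simp add: e)
    then show "ennreal (\<bar>?z \<bullet> \<sigma>\<bar> * exp (- (norm ?z)\<^sup>2)) = ennreal (sqrt pi ^ DIM('a)) * ((\<Prod>b\<in>Basis. ennreal (f (w b))) * ennreal \<bar>X w\<bar>)"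
      using f0 by (simp only:) (simp add: ennreal_mult' prod_ennreal prod_nonneg)
  qed
  also have "\<dots> = ennreal (sqrt pi ^ DIM('a)) * (\<integral>\<^sup>+w. (\<Prod>b\<in>Basis. ennreal (f (w b))) * ennreal \<bar>X w\<bar> \<partial>?PL)"
    by (intro nn_integral_cmult) measurable
  also have "(\<integral>\<^sup>+w. (\<Prod>b\<in>Basis. ennreal (f (w b))) * ennreal \<bar>X w\<bar> \<partial>?PL) = (\<integral>\<^sup>+w. ennreal \<bar>X w\<bar> \<partial>P)"
    unfolding P_def PiM_density_lborel[OF finite_Basis fm f0 pr]
    by (intro nn_integral_density[symmetric]) measurable
  also have "\<dots> = (\<integral>\<^sup>+t. ennreal (f t) * ennreal \<bar>t\<bar> \<partial>lborel)"
    by (rule distributed_nn_integral[OF dX, symmetric]) measurable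
  also note one
  also have "ennreal (sqrt pi ^ DIM('a)) * ennreal (1 / sqrt pi) = ennreal (sqrt pi ^ (DIM('a) - 1))"
  proof -
    have "sqrt pi ^ DIM('a) = sqrt pi ^ (DIM('a) - 1) * sqrt pi"
      by (metis DIM_positive Suc_diff_1 power_Suc2)
    then show ?thesis by (simp add: ennreal_mult'[symmetric])
  qed
  also have "sqrt pi ^ (DIM('a) - 1) = pi powr (real (DIM('a) - 1) / 2)"
    by (simp add: powr_half_sqrt[symmetric] powr_realpow[symmetric] powr_powr)
  finally show ?thesis .
qed

text \<open>Half-line Gaussian moments have separate closed forms for even and odd powers. Gamma at
  half-integers and at integers merges them into one formula, valid in every dimension.\<close>

lemma gaussian_moment_Gamma:
  "(\<integral>\<^sup>+t\<in>{0<..}. ennreal (exp (- t\<^sup>2) * t ^ m) \<partial>lborel) = ennreal (Gamma ((real m + 1) / 2) / 2)"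
proof -
  have *: "has_bochner_integral lborel (\<lambda>x::real. indicator {0..} x *\<^sub>R (exp (-x\<^sup>2) * x ^ m)) (Gamma ((real m + 1) / 2) / 2)"
  proof (cases "even m")
    case True
    then obtain k where k: "m = 2 * k" by (elim evenE)
    \<comment> \<open>The values at half-integers follow from \<open>Gamma (1/2)\<close> and the
      recursion \<open>Gamma (x + 1) = x * Gamma x\<close>.\<close>
    have G: "Gamma (real k + 1/2) = sqrt pi * (fact (2 * k) / (2 ^ (2 * k) * fact k))"
    proof (induction k)
      case 0
      then show ?case using Gamma_one_half_real by simp
    next
      case (Suc k)
      have nz: "real k + 1/2 \<notin> \<int>\<^sub>\<le>\<^sub>0"
        using nonpos_Ints_nonpos[of "real k + 1/2"] by auto
      have aux: "(x + 1/2) * (r * (F / (P * G))) = r * ((2 * x + 2) * (2 * x + 1) * F / (4 * P * ((x + 1) * G)))"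
        if "P \<noteq> 0" "G \<noteq> 0" "x \<ge> 0" for x r F P G :: real
      proof -
        have "(2 * x + 2) * (2 * x + 1) * F / (4 * P * ((x + 1) * G)) = (x + 1) * ((4 * (x + 1/2)) * F) / ((x + 1) * (4 * (P * G)))"
          by (rule arg_cong2[where f="(/)"]) (simp_all add: algebra_simps)
        also have "\<dots> = (4 * (x + 1/2)) * F / (4 * (P * G))"
          using that(3) by (intro nonzero_mult_divide_mult_cancel_left) simp
        also have "\<dots> = (x + 1/2) * (F / (P * G))" using that by (simp add: field_simps)
        finally show ?thesis by simp
      qed
      have "real (Suc k) + 1/2 = real k + 1/2 + 1" by simp
      then have "Gamma (real (Suc k) + 1/2) = (real k + 1/2) * Gamma (real k + 1/2)"
        by (simp only: Gamma_plus1[OF nz])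
      also have "\<dots> = sqrt pi * ((2 * real k + 2) * (2 * real k + 1) * fact (2 * k) / (4 * 2 ^ (2 * k) * ((real k + 1) * fact k)))"
        unfolding Suc by (rule aux) auto
      also have "(2 * real k + 2) * (2 * real k + 1) * fact (2 * k) = fact (2 * Suc k)" by (simp add: algebra_simps)
      also have "4 * 2 ^ (2 * k) * ((real k + 1) * fact k) = 2 ^ (2 * Suc k) * fact (Suc k)" by (simp add: algebra_simps)
      finally show ?case .
    qed
    have "(real m + 1) / 2 = real k + 1/2" by (simp add: k)
    then have val: "Gamma ((real m + 1) / 2) / 2 = (sqrt pi / 2) * (fact (2 * k) / (2 ^ (2 * k) * fact k))"
      by (simp only: G) simp
    show ?thesis unfolding val using gaussian_moment_even_pos[of k] by (simp only: k)
  next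
    case False
    then obtain k where k: "m = 2 * k + 1" by (elim oddE)
    have "(real m + 1) / 2 = 1 + real k" by (simp add: k field_simps)
    then have "Gamma ((real m + 1) / 2) = fact k" by (simp only: Gamma_fact)
    then show ?thesis using gaussian_moment_odd_pos[of k] by (simp only: k)
  qed
  have "(\<integral>\<^sup>+t\<in>{0<..}. ennreal (exp (- t\<^sup>2) * t ^ m) \<partial>lborel) = (\<integral>\<^sup>+t. ennreal (indicator {0..} t *\<^sub>R (exp (-t\<^sup>2) * t ^ m)) \<partial>lborel)"
  proof (rule nn_integral_cong_AE)
    have "AE t in lborel. t \<noteq> (0::real)" by (rule AE_lborel_singleton)
    then show "AE t in lborel. ennreal (exp (- t\<^sup>2) * t ^ m) * indicator {0<..} t = ennreal (indicator {0..} t *\<^sub>R (exp (-t\<^sup>2) * t ^ m))"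
      by eventually_elim (auto split: split_indicator)
  qed
  also have "\<dots> = ennreal (Gamma ((real m + 1) / 2) / 2)"
    using * by (subst nn_integral_eq_integral) (auto simp: has_bochner_integral_iff split: split_indicator)
  finally show ?thesis .
qed

text \<open>Polar coordinates write the Gaussian integral of
  \<open>\<bar>z \<bullet> \<sigma>\<bar>\<close> as the sphere integral, here d times a ball
  integral of a function homogeneous of degree 0, times a Gamma moment. Division leaves
  \<open>2 * pi powr ((d - 1) / 2) / Gamma ((d + 1) / 2)\<close>, which is twice the volume of the
  unit ball in dimension d - 1.\<close>

lemma sphere_abs_inner_constant:
  fixes \<sigma> :: "'a::euclidean_space"
  assumes \<sigma>: "norm \<sigma> = 1"
  shows "of_nat DIM('a) * (\<integral>\<^sup>+x\<in>cball 0 1. ennreal (\<bar>x \<bullet> \<sigma>\<bar> / norm x) \<partial>lborel) = ennreal (2 * unit_ball_vol (real (DIM('a) - 1)))"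
    and "(\<integral>\<^sup>+x\<in>cball 0 1. ennreal (\<bar>x \<bullet> \<sigma>\<bar> / norm x) \<partial>lborel) < \<infinity>"
proof -
  let ?d = "DIM('a)" and ?C = "\<integral>\<^sup>+x\<in>cball 0 1. ennreal (\<bar>x \<bullet> \<sigma>\<bar> / norm x) \<partial>lborel"
  have h1: "\<bar>x \<bullet> \<sigma>\<bar> / norm x \<le> 1" for x
    using Cauchy_Schwarz_ineq2[of x \<sigma>] \<sigma> by (cases "x = 0") (auto simp: divide_le_eq)
  have "?C \<le> (\<integral>\<^sup>+x. indicator (cball 0 1) x \<partial>(lborel :: 'a measure))"
    using h1 by (intro nn_integral_mono) (auto split: split_indicator intro: ennreal_leI[of _ 1, simplified])
  also have "\<dots> < \<infinity>" using emeasure_lborel_cball_finite[of "0::'a" 1] by simp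
  finally show fin: "?C < \<infinity>" .
  have "ennreal (pi powr (real (?d - 1) / 2)) = (\<integral>\<^sup>+z. ennreal (\<bar>z \<bullet> \<sigma>\<bar> * exp (- (norm z)\<^sup>2)) \<partial>lborel)"
    by (rule gaussian_abs_inner[OF \<sigma>, symmetric])
  also have "\<dots> = (\<integral>\<^sup>+z. ennreal (norm z * exp (- (norm z)\<^sup>2)) * ennreal (\<bar>z \<bullet> \<sigma>\<bar> / norm z) \<partial>lborel)"
    by (intro nn_integral_cong) (auto simp: ennreal_mult'[symmetric])
  also have "\<dots> = of_nat ?d * ?C * (\<integral>\<^sup>+t\<in>{0<..}. ennreal (t * exp (- t\<^sup>2)) * ennreal (t ^ (?d - 1)) \<partial>lborel)"
    by (rule nn_integral_radial_homogeneous[OF _ _ fin]) (auto simp: abs_mult)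
  also have "(\<integral>\<^sup>+t\<in>{0<..}. ennreal (t * exp (- t\<^sup>2)) * ennreal (t ^ (?d - 1)) \<partial>lborel) = (\<integral>\<^sup>+t\<in>{0<..}. ennreal (exp (- t\<^sup>2) * t ^ ?d) \<partial>lborel)"
  proof (rule nn_integral_cong)
    fix t :: real
    have "t ^ ?d = t * t ^ (?d - 1)" by (metis DIM_positive Suc_diff_1 power_Suc)
    then show "ennreal (t * exp (- t\<^sup>2)) * ennreal (t ^ (?d - 1)) * indicator {0<..} t = ennreal (exp (- t\<^sup>2) * t ^ ?d) * indicator {0<..} t"
      by (auto split: split_indicator simp: ennreal_mult'[symmetric] mult_ac)
  qed
  also have "\<dots> = ennreal (Gamma ((real ?d + 1) / 2) / 2)" by (rule gaussian_moment_Gamma)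
  finally have eq: "of_nat ?d * ?C * ennreal (Gamma ((real ?d + 1) / 2) / 2) = ennreal (pi powr (real (?d - 1) / 2))" by simp
  obtain C where C: "of_nat ?d * ?C = ennreal C" "C \<ge> 0" using fin
    by (cases "of_nat ?d * ?C") (auto simp: ennreal_mult_eq_top_iff of_nat_eq_enat)
  have G: "Gamma ((real ?d + 1) / 2) > 0" by (rule Gamma_real_pos) simp
  have "C * (Gamma ((real ?d + 1) / 2) / 2) = pi powr (real (?d - 1) / 2)"
    using eq G C by (simp add: ennreal_mult'[symmetric])
  moreover have "c = 2 * (p / g)" if "c * (g / 2) = p" "g > 0" for c g p :: real using that by (simp add: field_simps)
  ultimately have "C = 2 * (pi powr (real (?d - 1) / 2) / Gamma ((real ?d + 1) / 2))" using G by blast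
  also have "(real ?d + 1) / 2 = real (?d - 1) / 2 + 1" by (simp add: of_nat_diff Suc_leI field_simps)
  finally show "of_nat ?d * ?C = ennreal (2 * unit_ball_vol (real (?d - 1)))"
    by (simp add: C unit_ball_vol_def)
qed

section \<open>Measurability of radial profiles\<close>

text \<open>The radial set and its complement are exhausted up to null sets by countable unions of
  compact sets, and the norm maps compact sets to compact sets. The radii reached from neither side
  form a Borel set with null preimage, hence a null set by polar coordinates.\<close>

lemma lebesgue_set_of_radial:
  fixes A :: "real set"
  assumes A: "A \<subseteq> {0<..}" and A': "{z::'a::euclidean_space. norm z \<in> A} \<in> sets lebesgue"
  shows "A \<in> sets lebesgue"
proof -
  have inner: "\<exists>B. B \<in> sets borel \<and> B \<subseteq> X \<and> {z::'a. norm z \<in> X - B} \<in> null_sets lebesgue"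
    if X: "{z::'a. norm z \<in> X} \<in> sets lebesgue" for X :: "real set"
  proof -
    obtain C T where CT: "fsigma C" "T \<in> null_sets lebesgue" "C \<union> T = {z::'a. norm z \<in> X}" "disjnt C T"
      using lebesgue_set_almost_fsigma[OF X] by blast
    obtain F :: "nat \<Rightarrow> 'a set" where F: "\<And>n. compact (F n)" "C = (\<Union>n. F n)"
      using CT(1)[unfolded fsigma_Union_compact] by (metis mem_Collect_eq range_subsetD)
    have "norm ` C = (\<Union>n. norm ` F n)" using F by auto
    moreover have "norm ` F n \<in> sets borel" for n
      by (intro borel_compact compact_continuous_image F continuous_intros)
    ultimately have B: "norm ` C \<in> sets borel" by auto
    have "{z::'a. norm z \<in> X - norm ` C} \<subseteq> T" using CT(3) by auto
    then have "{z::'a. norm z \<in> X - norm ` C} \<in> null_sets lebesgue"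
      using CT(2) null_sets_completion_subset by blast
    then show ?thesis using B CT(3) by (intro exI[of _ "norm ` C"]) auto
  qed
  obtain B1 where B1: "B1 \<in> sets borel" "B1 \<subseteq> A" "{z::'a. norm z \<in> A - B1} \<in> null_sets lebesgue"
    using inner[OF A'] by blast
  have "{z::'a. norm z \<in> {0<..} - A} = UNIV - {z. norm z \<in> A} - {0}" using A by auto
  also have "\<dots> = space lebesgue - {z. norm z \<in> A} - {0}" by simp
  also have "\<dots> \<in> sets lebesgue" by (intro sets.Diff sets.top A') simp
  finally obtain B2 where B2: "B2 \<in> sets borel" "B2 \<subseteq> {0<..} - A" "{z::'a. norm z \<in> {0<..} - A - B2} \<in> null_sets lebesgue"
    using inner[of "{0<..} - A"] by blast
  \<comment> \<open>\<open>W\<close> collects the undecided radii; it contains \<open>A - B1\<close>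
    because \<open>B2\<close> avoids \<open>A\<close>.\<close>
  define W where "W = {0<..} - B1 - B2"
  have W[measurable]: "W \<in> sets borel" using B1 B2 by (simp add: W_def)
  have Wb: "{z::'a. norm z \<in> W} \<in> sets borel"
  proof -
    have "norm -` W \<inter> space (borel :: 'a measure) \<in> sets borel" by (rule measurable_sets[OF _ W]) simp
    then show ?thesis by (simp add: vimage_def)
  qed
  have "{z::'a. norm z \<in> W} = {z. norm z \<in> A - B1} \<union> {z. norm z \<in> {0<..} - A - B2}"
    using A B1 B2 by (auto simp: W_def)
  then have "{z::'a. norm z \<in> W} \<in> null_sets lebesgue" using B1 B2 by auto
  then have W0: "emeasure lborel {z::'a. norm z \<in> W} = 0" using Wb by (auto simp: null_sets_def)
  have "(\<integral>\<^sup>+x. indicator W (norm x) * (1::ennreal) \<partial>(lborel :: 'a measure)) =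
    of_nat DIM('a) * (\<integral>\<^sup>+x\<in>cball 0 1. 1 \<partial>(lborel :: 'a measure)) * (\<integral>\<^sup>+t\<in>{0<..}. indicator W t * ennreal (t ^ (DIM('a) - 1)) \<partial>lborel)"
    using emeasure_lborel_cball_finite[of "0::'a" 1] by (intro nn_integral_radial_homogeneous) auto
  moreover have "(\<integral>\<^sup>+x. indicator W (norm x) * (1::ennreal) \<partial>(lborel :: 'a measure)) = 0"
  proof -
    have "(\<integral>\<^sup>+x. indicator W (norm x) * (1::ennreal) \<partial>(lborel :: 'a measure)) = (\<integral>\<^sup>+x. indicator {z. norm z \<in> W} x \<partial>(lborel :: 'a measure))"
      by (intro nn_integral_cong) (auto split: split_indicator)
    then show ?thesis using W0 Wb by simp
  qed
  moreover have "(\<integral>\<^sup>+x\<in>cball 0 1. 1 \<partial>(lborel :: 'a measure)) > 0"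
  proof -
    have "(\<integral>\<^sup>+x\<in>cball 0 1. 1 \<partial>(lborel :: 'a measure)) = ennreal (unit_ball_vol (real DIM('a)))"
      using emeasure_cball[of 1 "0::'a"] by simp
    then show ?thesis by simp
  qed
  ultimately have "(\<integral>\<^sup>+t\<in>{0<..}. indicator W t * ennreal (t ^ (DIM('a) - 1)) \<partial>lborel) = 0" by auto
  then have "AE t in lborel. indicator W t * ennreal (t ^ (DIM('a) - 1)) * indicator {0<..} t = 0"
    by (subst (asm) nn_integral_0_iff_AE) auto
  then have "AE t in lborel. t \<notin> W"
    by eventually_elim (auto simp: W_def split: split_indicator_asm)
  then have "W \<in> null_sets lborel" using W by (auto simp: AE_iff_null_sets)
  then have Wn: "W \<in> null_sets lebesgue" using null_sets_completionI by blast
  have "A - B1 \<subseteq> W" using A B2 by (auto simp: W_def)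
  then have "A - B1 \<in> null_sets lebesgue" using Wn null_sets_completion_subset by blast
  then have "B1 \<union> (A - B1) \<in> sets lebesgue" using B1 by (intro sets.Un) (auto intro: sets_completionI_sets)
  moreover have "B1 \<union> (A - B1) = A" using B1 by auto
  ultimately show ?thesis by simp
qed

text \<open>A function of the norm says nothing about negative radii, and radius 0 is a single
  point; hence the restriction to positive ones. Superlevel sets of the kernel are radial up to the
  origin.\<close>

lemma radial_profile_measurable:
  fixes K :: "real \<Rightarrow> ennreal"
  assumes "(\<lambda>z::'a::euclidean_space. K (norm z)) \<in> borel_measurable lebesgue"
  shows "(\<lambda>t. K t * indicator {0<..} t) \<in> borel_measurable lebesgue"
proof (rule borel_measurableI_greater)
  fix y :: ennreal
  have "{t \<in> space lebesgue. y < K t * indicator {0<..} t} = {t. 0 < t \<and> y < K t}"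
    by (auto split: split_indicator_asm)
  moreover have "{t. 0 < t \<and> y < K t} \<in> sets lebesgue"
  proof (rule lebesgue_set_of_radial[where 'a='a])
    have "{z::'a. norm z \<in> {t. 0 < t \<and> y < K t}} = {z \<in> space lebesgue. y < K (norm z)} - {0}" by auto
    also have "\<dots> \<in> sets lebesgue" by (intro sets.Diff borel_measurable_less borel_measurable_const assms) simp
    finally show "{z::'a. norm z \<in> {t. 0 < t \<and> y < K t}} \<in> sets lebesgue" .
  qed auto
  ultimately show "{t \<in> space lebesgue. y < K t * indicator {0<..} t} \<in> sets lebesgue" by simp
qed

text \<open>The radii where a Borel representative differs form a null set, and polar coordinates
  lift it to a null set of the space. One \<open>k\<close> therefore serves both in the radial
  variable and in space.\<close>

lemma radial_profile_borel:
  fixes K :: "real \<Rightarrow> ennreal"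
  assumes K: "(\<lambda>z::'a::euclidean_space. K (norm z)) \<in> borel_measurable lebesgue"
  obtains k where "k \<in> borel_measurable borel" "AE t in lborel. t > 0 \<longrightarrow> K t = k t" "AE z in (lborel :: 'a measure). K (norm z) = k (norm z)"
proof -
  obtain k where k[measurable]: "k \<in> borel_measurable lborel" and ae: "AE t in lborel. K t * indicator {0<..} t = k t"
    using completion_ex_borel_measurable[OF radial_profile_measurable[OF K]] by blast
  obtain N where N: "{t \<in> space lborel. \<not> (K t * indicator {0<..} t = k t)} \<subseteq> N" "emeasure lborel N = 0" "N \<in> sets lborel"
    using ae by (rule AE_E)
  have [measurable]: "N \<in> sets borel" using N by simp
  have NN: "K t * indicator {0<..} t = k t" if "t \<notin> N" for t
  proof (rule ccontr)
    assume "\<not> ?thesis"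
    then have "t \<in> {t \<in> space lborel. \<not> (K t * indicator {0<..} t = k t)}" by simp
    then have "t \<in> N" by (rule subsetD[OF N(1)])
    with that show False by simp
  qed
  have N0: "AE t in lborel. t \<notin> N" using N by (intro AE_not_in) (auto simp: null_sets_def)
  have "(\<integral>\<^sup>+x. indicator N (norm x) * (1::ennreal) \<partial>(lborel :: 'a measure)) =
    of_nat DIM('a) * (\<integral>\<^sup>+x\<in>cball 0 1. 1 \<partial>(lborel :: 'a measure)) * (\<integral>\<^sup>+t\<in>{0<..}. indicator N t * ennreal (t ^ (DIM('a) - 1)) \<partial>lborel)"
    using emeasure_lborel_cball_finite[of "0::'a" 1] by (intro nn_integral_radial_homogeneous) auto
  also have "(\<integral>\<^sup>+t\<in>{0<..}. indicator N t * ennreal (t ^ (DIM('a) - 1)) \<partial>lborel) = (\<integral>\<^sup>+t. 0 \<partial>(lborel :: real measure))"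
    by (rule nn_integral_cong_AE) (use N0 in eventually_elim, simp)
  finally have "(\<integral>\<^sup>+x. indicator N (norm x) * (1::ennreal) \<partial>(lborel :: 'a measure)) = 0" by simp
  then have "AE x in (lborel :: 'a measure). indicator N (norm x) * (1::ennreal) = 0"
    by (subst (asm) nn_integral_0_iff_AE) auto
  moreover have "AE x in lborel. x \<noteq> (0::'a)" by (rule AE_lborel_singleton)
  ultimately have "AE z in (lborel :: 'a measure). K (norm z) = k (norm z)"
  proof eventually_elim
    case (elim x)
    then have "norm x \<notin> N" "norm x > 0" by (auto split: split_indicator_asm)
    then have "K (norm x) * indicator {0<..} (norm x) = k (norm x)" by (intro NN)
    then show ?case using \<open>norm x > 0\<close> by simp
  qed
  moreover have "AE t in lborel. t > 0 \<longrightarrow> K t = k t" using ae by eventually_elim (auto split: split_indicator_asm)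
  ultimately show thesis by (intro that[of k]) simp_all
qed

lemma nn_integral_radial_lebesgue:
  fixes h :: "'a::euclidean_space \<Rightarrow> ennreal" and K :: "real \<Rightarrow> ennreal"
  assumes h[measurable]: "h \<in> borel_measurable borel" and hom: "\<And>c x. c > 0 \<Longrightarrow> h (c *\<^sub>R x) = h x"
    and fin: "(\<integral>\<^sup>+x\<in>cball 0 1. h x \<partial>lborel) < \<infinity>"
    and K: "(\<lambda>z::'a. K (norm z)) \<in> borel_measurable lebesgue" and S[measurable]: "S \<in> sets borel"
  shows "(\<integral>\<^sup>+x. K (norm x) * indicator S (norm x) * h x \<partial>lebesgue) =
    of_nat DIM('a) * (\<integral>\<^sup>+x\<in>cball 0 1. h x \<partial>lborel) * (\<integral>\<^sup>+t\<in>{0<..} \<inter> S. K t * ennreal (t ^ (DIM('a) - 1)) \<partial>lebesgue)"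
proof -
  obtain k where k[measurable]: "k \<in> borel_measurable borel" and k1: "AE t in lborel. t > 0 \<longrightarrow> K t = k t"
    and k2: "AE z in (lborel :: 'a measure). K (norm z) = k (norm z)" using radial_profile_borel[OF K] by blast
  have "(\<integral>\<^sup>+x. K (norm x) * indicator S (norm x) * h x \<partial>lebesgue) = (\<integral>\<^sup>+x. (k (norm x) * indicator S (norm x)) * h x \<partial>lborel)"
    unfolding nn_integral_completion by (rule nn_integral_cong_AE) (use k2 in eventually_elim, simp)
  also have "\<dots> = of_nat DIM('a) * (\<integral>\<^sup>+x\<in>cball 0 1. h x \<partial>lborel) * (\<integral>\<^sup>+t\<in>{0<..}. (k t * indicator S t) * ennreal (t ^ (DIM('a) - 1)) \<partial>lborel)"
    by (rule nn_integral_radial_homogeneous[OF h hom fin]) measurable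
  also have "(\<integral>\<^sup>+t\<in>{0<..}. (k t * indicator S t) * ennreal (t ^ (DIM('a) - 1)) \<partial>lborel) = (\<integral>\<^sup>+t\<in>{0<..} \<inter> S. K t * ennreal (t ^ (DIM('a) - 1)) \<partial>lebesgue)"
    unfolding nn_integral_completion by (rule nn_integral_cong_AE) (use k1 in eventually_elim, auto split: split_indicator)
  finally show ?thesis .
qed

section \<open>Compactness in \<open>L\<^sup>1\<close>\<close>

text \<open>The lattice is countable, so almost every point has all its translates outside the
  exceptional part of the cell.\<close>

lemma AE_periodic_from_cell:
  fixes P :: "real^'n \<Rightarrow> bool"
  assumes l: "l > 0" and per: "torus_periodic l P" and ae: "AE x in lebesgue. x \<in> torus_cell l \<longrightarrow> P x"
  shows "AE x in lebesgue. P x"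
proof -
  have "AE x in lebesgue. x + lattice_vec l k \<in> torus_cell l \<longrightarrow> P (x + lattice_vec l k)" for k :: "int^'n"
    by (rule AE_lebesgue_shift[OF ae])
  then have "AE x in lebesgue. \<forall>k :: int^'n. x + lattice_vec l k \<in> torus_cell l \<longrightarrow> P (x + lattice_vec l k)"
    by (subst AE_all_countable) simp
  then show ?thesis
  proof eventually_elim
    case (elim x)
    have "torus_wrap l x \<in> torus_cell l" by (rule torus_wrap_in_cell[OF l])
    then have "P (torus_wrap l x)" using elim unfolding torus_wrap_lattice by blast
    then show ?case using torus_periodic_wrap[OF per, of x] by simp
  qed
qed

lemma torus_integral_nonneg_eq_0:
  fixes f :: "real^'n \<Rightarrow> real"
  assumes l: "l > 0" and f: "f \<in> torus_L1 l" "\<And>x. 0 \<le> f x" and zero: "torus_integral l f = 0"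
  shows "AE x in lebesgue. f x = 0"
proof (rule AE_periodic_from_cell[OF l torus_periodic_comp[OF torus_L1_D(1)[OF f(1)], of "\<lambda>y. y = 0"]])
  have "AE x in lebesgue. indicator (torus_cell l) x *\<^sub>R f x = 0"
    using zero torus_L1_D(3)[OF f(1)] f(2)
    unfolding torus_integral_def set_lebesgue_integral_def set_integrable_def
    by (subst (asm) integral_nonneg_eq_0_iff_AE) auto
  then show "AE x in lebesgue. x \<in> torus_cell l \<longrightarrow> f x = 0" by eventually_elim auto
qed

text \<open>The distance of \<open>v x\<close> from {0,1} is at most its distance from any value 0
  or 1, so its integral is below every \<open>L1_dist l (u n) v\<close>.\<close>

lemma L1_limit_01:
  fixes u :: "nat \<Rightarrow> real^'n \<Rightarrow> real"
  assumes l: "l > 0" and u: "\<And>n. u n \<in> torus_L1 l" "\<And>n. AE x in lebesgue. u n x \<in> {0, 1}"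
    and v: "v \<in> torus_L1 l" and lim: "(\<lambda>n. L1_dist l (u n) v) \<longlonglongrightarrow> 0"
  shows "AE x in lebesgue. v x \<in> {0, 1}"
proof -
  define m where "m y = min \<bar>y\<bar> \<bar>y - 1\<bar>" for y :: real
  have m0: "0 \<le> m y" for y by (simp add: m_def)
  have [measurable]: "v \<in> borel_measurable lebesgue" by (rule torus_L1_D[OF v])
  have mv: "(\<lambda>x. m (v x)) \<in> torus_L1 l"
    unfolding torus_L1_def mem_Collect_eq
  proof (intro conjI)
    show "torus_periodic l (\<lambda>x. m (v x))" by (rule torus_periodic_comp[OF torus_L1_D(1)[OF v]])
    show "(\<lambda>x. m (v x)) \<in> borel_measurable lebesgue" unfolding m_def by measurable
    then show "set_integrable lebesgue (torus_cell l) (\<lambda>x. m (v x))"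
      by (intro set_integrable_bound[OF torus_L1_D(3)[OF v]]) (auto simp: m_def set_borel_measurable_def)
  qed
  have "torus_integral l (\<lambda>x. m (v x)) \<le> L1_dist l (u n) v" for n
    unfolding L1_dist_def
  proof (rule torus_integral_mono_AE[OF torus_L1_D(3)[OF mv] set_integrable_abs_diff[OF u(1) v]])
    show "AE x in lebesgue. m (v x) \<le> \<bar>u n x - v x\<bar>"
      using u(2)[of n] by eventually_elim (auto simp: m_def min_def)
  qed
  then have "torus_integral l (\<lambda>x. m (v x)) \<le> 0"
    using LIMSEQ_le_const[OF lim] by blast
  then have "torus_integral l (\<lambda>x. m (v x)) = 0"
    using torus_integral_nonneg[of "\<lambda>x. m (v x)" l] m0 by force
  from torus_integral_nonneg_eq_0[OF l mv m0 this] show ?thesis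
    by eventually_elim (auto simp: m_def min_def split: if_splits)
qed

lemma BV01_closed:
  fixes u :: "nat \<Rightarrow> real^'n \<Rightarrow> real"
  assumes l: "l > 0" and u: "\<And>n. u n \<in> BV01 l" "\<And>n. tv l (u n) \<le> C"
    and v: "v \<in> torus_L1 l" and lim: "(\<lambda>n. L1_dist l (u n) v) \<longlonglongrightarrow> 0"
  shows "v \<in> BV01 l"
proof -
  have "total_variation l v \<le> liminf (\<lambda>n. total_variation l (u n))"
    by (rule total_variation_lsc[OF l BV01_D(1)[OF u(1)] v lim])
  also have "\<dots> \<le> liminf (\<lambda>n. ereal C)"
    using u by (intro Liminf_mono always_eventually allI) (simp add: BV01_tv)
  also have "\<dots> = ereal C" by (simp add: Liminf_const)
  finally have "total_variation l v < \<infinity>" by auto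
  then show ?thesis
    using L1_limit_01[OF l BV01_D[OF u(1)] v lim] v by (simp add: BV01_def)
qed

lemma tv_lsc:
  fixes u :: "nat \<Rightarrow> real^'n \<Rightarrow> real"
  assumes l: "l > 0" and u: "\<And>n. u n \<in> BV01 l" and v: "v \<in> BV01 l"
    and lim: "(\<lambda>n. L1_dist l (u n) v) \<longlonglongrightarrow> 0" and e: "e > 0"
  shows "\<forall>\<^sub>F n in sequentially. tv l v - e < tv l (u n)"
proof -
  have "ereal (tv l v - e) < ereal (tv l v)" using e by simp
  also have "\<dots> \<le> liminf (\<lambda>n. ereal (tv l (u n)))"
    using total_variation_lsc[OF l BV01_D(1)[OF u] BV01_D(1)[OF v] lim] BV01_tv[OF u] BV01_tv[OF v] by simp
  finally have "\<forall>\<^sub>F n in sequentially. ereal (tv l v - e) < ereal (tv l (u n))"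
    by (rule less_LiminfD)
  then show ?thesis by simp
qed

section \<open>Averages over grid cubes\<close>

definition grid_index :: "real \<Rightarrow> real^'n \<Rightarrow> int^'n" where
  "grid_index h x = (\<chi> i. \<lfloor>x $ i / h\<rfloor>)"

text \<open>The cubes tile the whole space with mesh \<open>h\<close> and need not match the period,
  so means are indexed by all integer vectors; this index set is still countable.\<close>

definition grid_mean :: "real \<Rightarrow> (real^'n \<Rightarrow> real) \<Rightarrow> int^'n \<Rightarrow> real" where
  "grid_mean h u k = (1 / h ^ CARD('n)) * (\<integral>y. indicator {y. grid_index h y = k} y * u y \<partial>lebesgue)"

lemma grid_index_eq_iff:
  assumes "h > 0"
  shows "grid_index h y = k \<longleftrightarrow> y + (- lattice_vec h k) \<in> torus_cell h"
proof -
  have "\<lfloor>t / h\<rfloor> = j \<longleftrightarrow> 0 \<le> t - h * of_int j \<and> t - h * of_int j < h" for t j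
  proof -
    have "\<lfloor>t / h\<rfloor> = j \<longleftrightarrow> of_int j \<le> t / h \<and> t / h < of_int j + 1" by (simp add: floor_eq_iff)
    also have "\<dots> \<longleftrightarrow> 0 \<le> t - h * of_int j \<and> t - h * of_int j < h" using assms by (auto simp: field_simps)
    finally show ?thesis .
  qed
  then show ?thesis
    by (simp add: grid_index_def torus_cell_def lattice_vec_def vec_eq_iff)
qed

lemma grid_cube_measure:
  assumes h: "h > 0"
  shows "{y :: real^'n. grid_index h y = k} \<in> sets borel"
    and "emeasure lebesgue {y :: real^'n. grid_index h y = k} = ennreal (h ^ CARD('n))"
proof -
  have eq: "{y :: real^'n. grid_index h y = k} = {y. y + (- lattice_vec h k) \<in> torus_cell h}"
    by (simp only: grid_index_eq_iff[OF h])
  have "(\<lambda>y::real^'n. y + (- lattice_vec h k)) -` torus_cell h \<inter> space borel \<in> sets borel"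
    by (rule measurable_sets[OF _ torus_cell_sets]) measurable
  then show b: "{y :: real^'n. grid_index h y = k} \<in> sets borel" unfolding eq by (simp add: vimage_def)
  have bl: "{y :: real^'n. grid_index h y = k} \<in> sets lebesgue" using b by (simp add: sets_completionI_sets)
  have "emeasure lebesgue {y :: real^'n. grid_index h y = k} = (\<integral>\<^sup>+y. indicator (torus_cell h) (y + (- lattice_vec h k)) \<partial>lebesgue)"
    unfolding nn_integral_indicator[OF bl, symmetric] by (intro nn_integral_cong) (auto simp: eq split: split_indicator)
  also have "\<dots> = (\<integral>\<^sup>+y. indicator (torus_cell h) y \<partial>(lebesgue :: (real^'n) measure))"
    by (rule nn_integral_lebesgue_shift) measurable
  also have "\<dots> = ennreal (h ^ CARD('n))" using emeasure_torus_cell[OF h, where 'n='n] by (simp del: nn_integral_completion)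
  finally show "emeasure lebesgue {y :: real^'n. grid_index h y = k} = ennreal (h ^ CARD('n))" .
qed

lemma grid_index_eq_measurable [measurable]:
  "Measurable.pred (borel \<Otimes>\<^sub>M borel) (\<lambda>(x::real^'n, y). grid_index h y = grid_index h x)"
proof -
  have nth: "(\<lambda>x::real^'n. x $ i) \<in> borel_measurable borel" for i
    by (intro borel_measurable_continuous_onI continuous_intros)
  have fl: "(\<lambda>x::real^'n. real_of_int \<lfloor>x $ i / h\<rfloor>) \<in> borel_measurable borel" for i
    using nth[of i] by measurable
  have [measurable]: "Measurable.pred (borel \<Otimes>\<^sub>M borel) (\<lambda>p::(real^'n) \<times> (real^'n). real_of_int \<lfloor>snd p $ i / h\<rfloor> = real_of_int \<lfloor>fst p $ i / h\<rfloor>)" for i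
  proof -
    have [measurable]: "(\<lambda>p::(real^'n) \<times> (real^'n). real_of_int \<lfloor>snd p $ i / h\<rfloor>) \<in> borel_measurable (borel \<Otimes>\<^sub>M borel)"
      by (rule measurable_compose[OF measurable_snd fl])
    have [measurable]: "(\<lambda>p::(real^'n) \<times> (real^'n). real_of_int \<lfloor>fst p $ i / h\<rfloor>) \<in> borel_measurable (borel \<Otimes>\<^sub>M borel)"
      by (rule measurable_compose[OF measurable_fst fl])
    show ?thesis by measurable
  qed
  have "Measurable.pred (borel \<Otimes>\<^sub>M borel) (\<lambda>p::(real^'n) \<times> (real^'n). \<forall>i. real_of_int \<lfloor>snd p $ i / h\<rfloor> = real_of_int \<lfloor>fst p $ i / h\<rfloor>)"
    by measurable
  then show ?thesis by (simp add: grid_index_def vec_eq_iff case_prod_unfold)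
qed

text \<open>Averaging \<open>|u(x) - u(y)|\<close> over \<open>y\<close> in the cube of \<open>x\<close> and substituting \<open>y = x + z\<close> bounds the
  error by shift differences with \<open>z\<close> in a cube of twice the mesh size.\<close>

lemma grid_mean_approx:
  fixes u :: "real^'n \<Rightarrow> real" and h :: real
  assumes l: "l > 0" and h: "h > 0" and u: "u \<in> BV01 l"
  shows "(\<lambda>x. grid_mean h u (grid_index h x)) \<in> borel_measurable lebesgue" (is ?m)
    and "\<bar>grid_mean h u k\<bar> \<le> 1" (is ?b)
    and "torus_integral l (\<lambda>x. \<bar>u x - grid_mean h u (grid_index h x)\<bar>) \<le> 2 ^ CARD('n) * (real CARD('n) * h * tv l u)" (is ?a)
proof -
  let ?d = "CARD('n)"
  note L1 = BV01_D(1)[OF u]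
  have um: "u \<in> borel_measurable lebesgue" by (rule torus_L1_D[OF L1])
  \<comment> \<open>Tonelli's theorem is applied to a Borel representative, clipped to [0,1] so that
    its bounds hold everywhere.\<close>
  obtain w0 where w0[measurable]: "w0 \<in> borel_measurable lborel" and uw0: "AE x in lborel. u x = w0 x"
    using completion_ex_borel_measurable_real[OF um] by blast
  define w where "w x = max 0 (min 1 (w0 x))" for x
  have [measurable]: "w \<in> borel_measurable borel" unfolding w_def using w0 by simp
  have wl: "w \<in> borel_measurable lebesgue" by (intro measurable_completion) simp
  have w01: "0 \<le> w x" "w x \<le> 1" for x by (auto simp: w_def)
  have uw: "AE x in lebesgue. u x = w x"
    using AE_completion[OF uw0] BV01_D(2)[OF u] by eventually_elim (auto simp: w_def)
  let ?Q = "\<lambda>k. {y :: real^'n. grid_index h y = k}"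
  have Qb[measurable]: "?Q k \<in> sets borel" for k by (rule grid_cube_measure[OF h])
  have Ql[measurable]: "?Q k \<in> sets lebesgue" for k using Qb[of k] by (simp add: sets_completionI_sets)
  have Qe: "emeasure lborel (?Q k) = ennreal (h ^ ?d)" for k using grid_cube_measure(2)[OF h, of k] Qb by simp
  have Qi: "integrable lborel (indicator (?Q k) :: real^'n \<Rightarrow> real)" for k
    using Qb Qe by (intro integrable_real_indicator) (auto simp: less_top)
  have Qm: "measure lborel (?Q k) = h ^ ?d" for k using Qe h by (simp add: measure_def)
  have mean: "grid_mean h u k = (1 / h ^ ?d) * (\<integral>y. indicator (?Q k) y * w y \<partial>lborel)" for k
  proof -
    have "(\<integral>y. indicator (?Q k) y * u y \<partial>lebesgue) = (\<integral>y. indicator (?Q k) y * w y \<partial>lebesgue)"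
    proof (rule integral_cong_AE)
      show "AE y in lebesgue. indicator (?Q k) y * u y = indicator (?Q k) y * w y"
        using uw by eventually_elim simp
    qed (use um wl in measurable)
    also have "\<dots> = (\<integral>y. indicator (?Q k) y * w y \<partial>lborel)"
      by (rule integral_completion) measurable
    finally show ?thesis by (simp add: grid_mean_def)
  qed
  have Qwi: "integrable lborel (\<lambda>y. indicator (?Q k) y * w y)" for k
    by (rule Bochner_Integration.integrable_bound[OF Qi[of k]]) (use w01 in \<open>auto split: split_indicator\<close>)
  show ?b
  proof -
    have "(\<integral>y. indicator (?Q k) y * w y \<partial>lborel) \<le> (\<integral>y. indicator (?Q k) y \<partial>lborel)"
      by (rule integral_mono[OF Qwi Qi]) (use w01 in \<open>auto split: split_indicator\<close>)
    moreover have "0 \<le> (\<integral>y. indicator (?Q k) y * w y \<partial>lborel)"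
      by (rule integral_nonneg_AE) (use w01 in auto)
    ultimately show ?thesis using h by (simp add: mean Qm abs_mult divide_le_eq)
  qed
  have Mb: "(\<lambda>x. grid_mean h u (grid_index h x)) \<in> borel_measurable borel"
  proof -
    have "(\<lambda>x. \<integral>y. (if grid_index h y = grid_index h x then 1 else 0) * w y \<partial>lborel) \<in> borel_measurable borel"
      by (intro lborel.borel_measurable_lebesgue_integral) measurable
    then show ?thesis unfolding mean by (simp add: indicator_def)
  qed
  then show m: ?m by (intro measurable_completion) simp
  \<comment> \<open>Differences of points in one cube lie in \<open>B\<close>. Its volume is
    \<open>2 ^ ?d\<close> times that of a cube, which is the factor in the estimate, and its vectors
    have norm at most \<open>?d * h\<close>.\<close>
  define B where "B = {z :: real^'n. \<forall>i. \<bar>z $ i\<bar> < h}"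
  have Bbox: "B = box (\<chi> i. -h) (\<chi> i. h)" by (auto simp: B_def mem_box_cart abs_less_iff minus_less_iff)
  have Bb[measurable]: "B \<in> sets borel" by (simp add: Bbox)
  have Bm: "emeasure lborel B = ennreal ((2 * h) ^ ?d)"
  proof -
    have "measure lborel (cbox (\<chi> i. -h) (\<chi> i. h) :: (real^'n) set) = (2 * h) ^ ?d"
      using h by (subst content_cbox_cart) (auto simp: interval_ne_empty_cart)
    then have "emeasure lborel (cbox (\<chi> i. -h) (\<chi> i. h) :: (real^'n) set) = ennreal ((2 * h) ^ ?d)"
      using emeasure_lborel_cbox_finite[of "\<chi> i. -h" "(\<chi> i. h) :: real^'n"]
      by (subst emeasure_eq_ennreal_measure) (auto simp: less_top)
    then show ?thesis by (simp add: Bbox emeasure_lborel_box_eq emeasure_lborel_cbox_eq)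
  qed
  have Bn: "norm z \<le> ?d * h" if "z \<in> B" for z
  proof -
    have "norm z \<le> (\<Sum>i\<in>UNIV. \<bar>z $ i\<bar>)" by (rule norm_le_l1_cart)
    also have "\<dots> \<le> (\<Sum>i\<in>(UNIV::'n set). h)" using that by (intro sum_mono) (auto simp: B_def less_imp_le)
    finally show ?thesis by simp
  qed
  have near: "x' - x \<in> B" if "grid_index h x' = grid_index h x" for x x' :: "real^'n"
  proof -
    have "\<bar>x' $ i - x $ i\<bar> < h" for i
    proof -
      have "\<lfloor>x' $ i / h\<rfloor> = \<lfloor>x $ i / h\<rfloor>" using that by (simp add: grid_index_def vec_eq_iff)
      then have "\<bar>x' $ i / h - x $ i / h\<bar> < 1" by linarith
      then have "\<bar>(x' $ i - x $ i) / h\<bar> < 1" by (simp add: diff_divide_distrib)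
      then show ?thesis using h by (simp add: abs_divide divide_less_eq)
    qed
    then show ?thesis by (simp add: B_def)
  qed
  let ?C = "torus_cell l :: (real^'n) set"
  have Cb[measurable]: "?C \<in> sets borel" by (rule torus_cell_sets)
  have point: "ennreal \<bar>w x - grid_mean h u (grid_index h x)\<bar> \<le> ennreal (1 / h ^ ?d) * (\<integral>\<^sup>+z. ennreal \<bar>w (x + z) - w x\<bar> * indicator B z \<partial>lborel)" for x
  proof -
    let ?k = "grid_index h x"
    have "w x = (1 / h ^ ?d) * (\<integral>y. indicator (?Q ?k) y * w x \<partial>lborel)" using h Qm[of ?k] by simp
    then have "w x - grid_mean h u ?k = (1 / h ^ ?d) * ((\<integral>y. indicator (?Q ?k) y * w x \<partial>lborel) - (\<integral>y. indicator (?Q ?k) y * w y \<partial>lborel))"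
      by (simp add: mean right_diff_distrib)
    also have "(\<integral>y. indicator (?Q ?k) y * w x \<partial>lborel) - (\<integral>y. indicator (?Q ?k) y * w y \<partial>lborel) = (\<integral>y. indicator (?Q ?k) y * (w x - w y) \<partial>lborel)"
      using Qi[of ?k] Qwi[of ?k] by (subst Bochner_Integration.integral_diff[symmetric]) (auto simp: right_diff_distrib)
    finally have "\<bar>w x - grid_mean h u ?k\<bar> = (1 / h ^ ?d) * \<bar>\<integral>y. indicator (?Q ?k) y * (w x - w y) \<partial>lborel\<bar>"
      using h by (simp add: abs_mult)
    then have "ennreal \<bar>w x - grid_mean h u ?k\<bar> = ennreal (1 / h ^ ?d) * ennreal \<bar>\<integral>y. indicator (?Q ?k) y * (w x - w y) \<partial>lborel\<bar>"
      using h by (simp add: ennreal_mult'[symmetric])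
    also have "ennreal \<bar>\<integral>y. indicator (?Q ?k) y * (w x - w y) \<partial>lborel\<bar> \<le> (\<integral>\<^sup>+y. ennreal (norm (indicator (?Q ?k) y * (w x - w y))) \<partial>lborel)"
    proof -
      have "integrable lborel (\<lambda>y. indicator (?Q ?k) y * (w x - w y))"
        using Qi[of ?k] Qwi[of ?k] by (simp add: right_diff_distrib)
      from integral_norm_bound_ennreal[OF this] show ?thesis by simp
    qed
    also have "\<dots> \<le> (\<integral>\<^sup>+y. ennreal \<bar>w y - w x\<bar> * indicator B (y - x) \<partial>lborel)"
    proof (rule nn_integral_mono)
      fix y show "ennreal (norm (indicator (?Q ?k) y * (w x - w y))) \<le> ennreal \<bar>w y - w x\<bar> * indicator B (y - x)"
        using near[of y x] by (auto split: split_indicator simp: abs_minus_commute)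
    qed
    also have "\<dots> = (\<integral>\<^sup>+z. ennreal \<bar>w (x + z) - w x\<bar> * indicator B z \<partial>lborel)"
    proof -
      have "(\<integral>\<^sup>+y. ennreal \<bar>w y - w x\<bar> * indicator B (y - x) \<partial>lborel) = (\<integral>\<^sup>+y. ennreal \<bar>w y - w x\<bar> * indicator B (y - x) \<partial>distr lborel borel ((+) x))"
        by (simp add: lborel_distr_plus)
      also have "\<dots> = (\<integral>\<^sup>+z. ennreal \<bar>w (x + z) - w x\<bar> * indicator B (x + z - x) \<partial>lborel)"
        by (rule nn_integral_distr) measurable
      finally show ?thesis by simp
    qed
    finally show ?thesis by (simp add: mult_left_mono)
  qed
  have sd: "(\<integral>\<^sup>+x. ennreal \<bar>w (x + z) - w x\<bar> * indicator ?C x \<partial>lborel) = ennreal (shift_difference l u z)" for z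
  proof -
    have ae: "AE x in lebesgue. \<bar>u (x + z) - u x\<bar> = \<bar>w (x + z) - w x\<bar>"
      using uw AE_lebesgue_shift[OF uw, of z] by eventually_elim simp
    have i: "set_integrable lebesgue ?C (\<lambda>x. \<bar>u (x + z) - u x\<bar>)"
      by (rule set_integrable_abs_diff[OF torus_L1_shift[OF l L1] L1])
    have "ennreal (shift_difference l u z) = (\<integral>\<^sup>+x. ennreal (indicator ?C x *\<^sub>R \<bar>u (x + z) - u x\<bar>) \<partial>lebesgue)"
      unfolding shift_difference_def torus_integral_def set_lebesgue_integral_def
      using i by (intro nn_integral_eq_integral[symmetric]) (auto simp: set_integrable_def)
    also have "\<dots> = (\<integral>\<^sup>+x. ennreal \<bar>w (x + z) - w x\<bar> * indicator ?C x \<partial>lebesgue)"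
      by (rule nn_integral_cong_AE) (use ae in eventually_elim, auto split: split_indicator)
    finally show ?thesis by (simp add: nn_integral_completion)
  qed
  have "(\<integral>\<^sup>+x. ennreal \<bar>w x - grid_mean h u (grid_index h x)\<bar> * indicator ?C x \<partial>lborel)
     \<le> (\<integral>\<^sup>+x. ennreal (1 / h ^ ?d) * ((\<integral>\<^sup>+z. ennreal \<bar>w (x + z) - w x\<bar> * indicator B z \<partial>lborel) * indicator ?C x) \<partial>lborel)"
    using point by (intro nn_integral_mono) (auto split: split_indicator)
  also have "\<dots> = ennreal (1 / h ^ ?d) * (\<integral>\<^sup>+x. (\<integral>\<^sup>+z. ennreal \<bar>w (x + z) - w x\<bar> * indicator B z \<partial>lborel) * indicator ?C x \<partial>lborel)"
    by (rule nn_integral_cmult) measurable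
  also have "(\<integral>\<^sup>+x. (\<integral>\<^sup>+z. ennreal \<bar>w (x + z) - w x\<bar> * indicator B z \<partial>lborel) * indicator ?C x \<partial>lborel)
      = (\<integral>\<^sup>+x. (\<integral>\<^sup>+z. ennreal \<bar>w (x + z) - w x\<bar> * indicator B z * indicator ?C x \<partial>lborel) \<partial>lborel)"
    by (intro nn_integral_cong nn_integral_multc[symmetric]) measurable
  also have "\<dots> = (\<integral>\<^sup>+z. (\<integral>\<^sup>+x. ennreal \<bar>w (x + z) - w x\<bar> * indicator B z * indicator ?C x \<partial>lborel) \<partial>lborel)"
    by (rule lborel_pair.Fubini'[symmetric]) measurable
  also have "\<dots> \<le> (\<integral>\<^sup>+z. ennreal (?d * h * tv l u) * indicator B z \<partial>lborel)"
  proof (rule nn_integral_mono)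
    fix z :: "real^'n"
    have "(\<integral>\<^sup>+x. ennreal \<bar>w (x + z) - w x\<bar> * indicator B z * indicator ?C x \<partial>lborel)
        = (\<integral>\<^sup>+x. ennreal \<bar>w (x + z) - w x\<bar> * indicator ?C x \<partial>lborel) * indicator B z"
      by (auto split: split_indicator)
    also have "\<dots> = ennreal (shift_difference l u z) * indicator B z" by (simp only: sd)
    also have "\<dots> \<le> ennreal (?d * h * tv l u) * indicator B z"
    proof -
      have "shift_difference l u z \<le> ?d * h * tv l u" if "z \<in> B"
        using shift_difference_le_tv[OF l u, of z] mult_right_mono[OF Bn[OF that] tv_nonneg[of l u]] by linarith
      then show ?thesis by (auto split: split_indicator intro: ennreal_leI)
    qed
    finally show "(\<integral>\<^sup>+x. ennreal \<bar>w (x + z) - w x\<bar> * indicator B z * indicator ?C x \<partial>lborel) \<le> ennreal (?d * h * tv l u) * indicator B z" .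
  qed
  also have "\<dots> = ennreal (?d * h * tv l u) * ennreal ((2 * h) ^ ?d)"
    by (simp add: nn_integral_cmult Bm)
  finally have "(\<integral>\<^sup>+x. ennreal \<bar>w x - grid_mean h u (grid_index h x)\<bar> * indicator ?C x \<partial>lborel)
      \<le> ennreal (1 / h ^ ?d) * (ennreal (?d * h * tv l u) * ennreal ((2 * h) ^ ?d))"
    by (simp add: mult_left_mono)
  also have "\<dots> = ennreal (2 ^ ?d * (?d * h * tv l u))"
  proof -
    have "(1 / h ^ ?d) * ((?d * h * tv l u) * (2 * h) ^ ?d) = 2 ^ ?d * (?d * h * tv l u)"
      using h by (simp add: power_mult_distrib)
    moreover have "ennreal (1 / h ^ ?d) * (ennreal (?d * h * tv l u) * ennreal ((2 * h) ^ ?d)) = ennreal ((1 / h ^ ?d) * ((?d * h * tv l u) * (2 * h) ^ ?d))"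
      using h tv_nonneg[of l u] by (simp add: ennreal_mult'[symmetric] ennreal_mult''[symmetric] del: times_divide_eq_left)
    ultimately show ?thesis by simp
  qed
  finally have fin: "(\<integral>\<^sup>+x. ennreal \<bar>w x - grid_mean h u (grid_index h x)\<bar> * indicator ?C x \<partial>lborel) \<le> ennreal (2 ^ ?d * (?d * h * tv l u))" .
  have bnd: "AE x in lebesgue. \<bar>\<bar>u x - grid_mean h u (grid_index h x)\<bar>\<bar> \<le> 2"
    using BV01_D(2)[OF u]
  proof eventually_elim
    case (elim x)
    have "\<bar>grid_mean h u (grid_index h x)\<bar> \<le> 1"
    proof -
      have "(\<integral>y. indicator (?Q (grid_index h x)) y * w y \<partial>lborel) \<le> (\<integral>y. indicator (?Q (grid_index h x)) y \<partial>lborel)"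
        by (rule integral_mono[OF Qwi Qi]) (use w01 in \<open>auto split: split_indicator\<close>)
      moreover have "0 \<le> (\<integral>y. indicator (?Q (grid_index h x)) y * w y \<partial>lborel)"
        by (rule integral_nonneg_AE) (use w01 in auto)
      ultimately show ?thesis using h by (simp add: mean Qm abs_mult divide_le_eq)
    qed
    then show ?case using elim by auto
  qed
  have i: "set_integrable lebesgue ?C (\<lambda>x. \<bar>u x - grid_mean h u (grid_index h x)\<bar>)"
    by (rule set_integrable_torus_bounded[OF l _ bnd]) (use um m in measurable)
  have "ennreal (torus_integral l (\<lambda>x. \<bar>u x - grid_mean h u (grid_index h x)\<bar>)) = (\<integral>\<^sup>+x. ennreal (indicator ?C x *\<^sub>R \<bar>u x - grid_mean h u (grid_index h x)\<bar>) \<partial>lebesgue)"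
    unfolding torus_integral_def set_lebesgue_integral_def
    using i by (intro nn_integral_eq_integral[symmetric]) (auto simp: set_integrable_def)
  also have "\<dots> = (\<integral>\<^sup>+x. ennreal \<bar>w x - grid_mean h u (grid_index h x)\<bar> * indicator ?C x \<partial>lebesgue)"
    by (rule nn_integral_cong_AE) (use uw in eventually_elim, auto split: split_indicator)
  also have "\<dots> \<le> ennreal (2 ^ ?d * (?d * h * tv l u))" using fin by (simp add: nn_integral_completion)
  finally show ?a
    using h tv_nonneg[of l u] by (subst (asm) ennreal_le_iff) auto
qed

text \<open>The consecutive distances are summable, so the telescoping series converges absolutely
  almost everywhere on the cell, and by periodicity the sequence converges almost everywhere. Its
  limit again has values in {0,1}, and dominated convergence with bound 1 gives convergence in
  L1.\<close>

lemma BV01_L1_limit_of_cauchy: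
  fixes u :: "nat \<Rightarrow> real^'n \<Rightarrow> real"
  assumes l: "l > 0" and u: "\<And>n. u n \<in> BV01 l" and fast: "\<And>n. L1_dist l (u (Suc n)) (u n) \<le> (1/2) ^ n"
  shows "\<exists>v\<in>torus_L1 l. (\<lambda>n. L1_dist l (u n) v) \<longlonglongrightarrow> 0"
proof -
  let ?C = "torus_cell l :: (real^'n) set"
  note L1 = BV01_D(1)[OF u]
  have um[measurable]: "u n \<in> borel_measurable lebesgue" for n by (rule torus_L1_D[OF L1])
  define v where "v x = lim (\<lambda>n. u n x)" for x
  have vm[measurable]: "v \<in> borel_measurable lebesgue" unfolding v_def by measurable
  have vper: "torus_periodic l v" using torus_L1_D(1)[OF L1] unfolding v_def torus_periodic_def by simp
  have dist: "(\<integral>\<^sup>+x. ennreal \<bar>u (Suc n) x - u n x\<bar> * indicator ?C x \<partial>lebesgue) = ennreal (L1_dist l (u (Suc n)) (u n))" for n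
  proof -
    have i: "set_integrable lebesgue ?C (\<lambda>x. \<bar>u (Suc n) x - u n x\<bar>)" by (rule set_integrable_abs_diff[OF L1 L1])
    have "ennreal (L1_dist l (u (Suc n)) (u n)) = (\<integral>\<^sup>+x. ennreal (indicator ?C x *\<^sub>R \<bar>u (Suc n) x - u n x\<bar>) \<partial>lebesgue)"
      unfolding L1_dist_def torus_integral_def set_lebesgue_integral_def
      using i by (intro nn_integral_eq_integral[symmetric]) (auto simp: set_integrable_def)
    also have "\<dots> = (\<integral>\<^sup>+x. ennreal \<bar>u (Suc n) x - u n x\<bar> * indicator ?C x \<partial>lebesgue)"
      by (intro nn_integral_cong) (auto split: split_indicator)
    finally show ?thesis by simp
  qed
  have "(\<integral>\<^sup>+x. (\<Sum>n. ennreal \<bar>u (Suc n) x - u n x\<bar> * indicator ?C x) \<partial>lebesgue) = (\<Sum>n. ennreal (L1_dist l (u (Suc n)) (u n)))"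
    by (subst nn_integral_suminf) (auto simp: dist simp del: nn_integral_completion)
  also have "\<dots> \<le> (\<Sum>n. ennreal ((1/2) ^ n))" using fast by (intro suminf_le ennreal_leI) auto
  also have "\<dots> = ennreal (\<Sum>n. (1/2) ^ n)" by (intro suminf_ennreal2) (auto intro: summable_geometric)
  finally have "(\<integral>\<^sup>+x. (\<Sum>n. ennreal \<bar>u (Suc n) x - u n x\<bar> * indicator ?C x) \<partial>lebesgue) < \<infinity>"
    by (auto simp: le_less_trans)
  then have "AE x in lebesgue. (\<Sum>n. ennreal \<bar>u (Suc n) x - u n x\<bar> * indicator ?C x) \<noteq> \<infinity>"
    by (intro nn_integral_PInf_AE) auto
  then have "AE x in lebesgue. x \<in> ?C \<longrightarrow> convergent (\<lambda>n. u n x)"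
  proof eventually_elim
    case (elim x)
    show ?case
    proof
      assume "x \<in> ?C"
      then have "(\<Sum>n. ennreal \<bar>u (Suc n) x - u n x\<bar>) \<noteq> top" using elim by simp
      then have "summable (\<lambda>n. \<bar>u (Suc n) x - u n x\<bar>)" by (intro summable_suminf_not_top) auto
      then have "summable (\<lambda>n. u (Suc n) x - u n x)" by (rule summable_rabs_cancel)
      then have "convergent (\<lambda>n. \<Sum>k<n. u (Suc k) x - u k x)" by (simp add: summable_iff_convergent)
      then have "convergent (\<lambda>n. u n x - u 0 x)" by (simp add: sum_lessThan_telescope[of "\<lambda>k. u k x"])
      from convergent_add[OF this convergent_const[of "u 0 x"]] show "convergent (\<lambda>n. u n x)" by simp
    qed
  qed
  then have conv: "AE x in lebesgue. convergent (\<lambda>n. u n x)"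
  proof (rule AE_periodic_from_cell[OF l, rotated])
    show "torus_periodic l (\<lambda>x. convergent (\<lambda>n. u n x))"
      using torus_L1_D(1)[OF L1] unfolding torus_periodic_def by simp
  qed
  have all01: "AE x in lebesgue. \<forall>n. u n x \<in> {0, 1}" using BV01_D(2)[OF u] by (subst AE_all_countable) simp
  have lim: "AE x in lebesgue. (\<lambda>n. u n x) \<longlonglongrightarrow> v x"
    using conv by eventually_elim (simp add: v_def convergent_LIMSEQ_iff)
  have v01: "AE x in lebesgue. v x \<in> {0, 1}"
    using lim all01
  proof eventually_elim
    case (elim x)
    show ?case by (rule closed_sequentially[of "{0,1::real}" "\<lambda>n. u n x"]) (use elim in auto)
  qed
  have vL: "v \<in> torus_L1 l"
    unfolding torus_L1_def mem_Collect_eq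
  proof (intro conjI vper vm set_integrable_torus_bounded[OF l vm])
    show "AE x in lebesgue. \<bar>v x\<bar> \<le> 1" using v01 by eventually_elim auto
  qed
  have "(\<lambda>n. torus_integral l (\<lambda>x. \<bar>u n x - v x\<bar>)) \<longlonglongrightarrow> torus_integral l (\<lambda>x::real^'n. 0)"
  proof (rule torus_integral_dominated[where w="\<lambda>_. 1"])
    show "set_integrable lebesgue ?C (\<lambda>_. 1 :: real)" by (rule set_integrable_torus_bounded[OF l, of _ 1]) auto
    show "AE x in lebesgue. (\<lambda>n. \<bar>u n x - v x\<bar>) \<longlonglongrightarrow> 0"
      using lim by eventually_elim (simp add: LIM_zero tendsto_rabs_zero)
    show "AE x in lebesgue. \<bar>\<bar>u n x - v x\<bar>\<bar> \<le> 1" for n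
      using all01 v01
    proof eventually_elim
      case (elim x)
      then have "u n x \<in> {0, 1}" by blast
      with elim(2) show ?case by auto
    qed
  qed measurable
  then show ?thesis using vL by (intro bexI[of _ v]) (simp_all add: L1_dist_def)
qed

text \<open>There are countably many pairs of mesh and cube, so a diagonal subsequence makes all
  grid means converge. For a fixed mesh the step functions then converge in L1, and by the variation
  bound their distance to the sequence is small with the mesh, uniformly in the index; hence the
  subsequence is Cauchy.\<close>

lemma BV01_compact:
  fixes u :: "nat \<Rightarrow> real^'n \<Rightarrow> real"
  assumes l: "l > 0" and u: "\<And>n. u n \<in> BV01 l" and C: "\<And>n. tv l (u n) \<le> C"
  shows "\<exists>v\<in>BV01 l. \<exists>s :: nat \<Rightarrow> nat. strict_mono s \<and> (\<lambda>n. L1_dist l (u (s n)) v) \<longlonglongrightarrow> 0"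
proof -
  let ?d = "CARD('n)"
  note L1 = BV01_D(1)[OF u]
  have um[measurable]: "u n \<in> borel_measurable lebesgue" for n by (rule torus_L1_D[OF L1])
  define h where "h N = inverse (real (Suc N))" for N
  have h: "h N > 0" for N by (simp add: h_def)
  have h0: "h \<longlonglongrightarrow> 0" unfolding h_def by (rule LIMSEQ_inverse_real_of_nat)
  define a where "a n p = grid_mean (h (fst p)) (u n) (snd p)" for n and p :: "nat \<times> (int^'n)"
  obtain s where s: "strict_mono (s :: nat \<Rightarrow> nat)" and sl: "\<And>p. \<exists>L. (\<lambda>n. a (s n) p) \<longlonglongrightarrow> L"
  proof (rule function_convergent_subsequence[of "UNIV :: (nat \<times> (int^'n)) set" a 1])
    show "norm (a n p) \<le> 1" for n p unfolding a_def using grid_mean_approx(2)[OF l h u] by simp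
  qed (auto intro: countableI_type)
  define m where "m N n x = grid_mean (h N) (u (s n)) (grid_index (h N) x)" for N n x
  have mm[measurable]: "m N n \<in> borel_measurable lebesgue" for N n unfolding m_def by (rule grid_mean_approx(1)[OF l h u])
  have m1: "\<bar>m N n x\<bar> \<le> 1" for N n x unfolding m_def by (rule grid_mean_approx(2)[OF l h u])
  define M where "M N x = lim (\<lambda>n. m N n x)" for N x
  have mlim: "(\<lambda>n. m N n x) \<longlonglongrightarrow> M N x" for N x
  proof -
    obtain L where "(\<lambda>n. a (s n) (N, grid_index (h N) x)) \<longlonglongrightarrow> L" using sl by blast
    then have "(\<lambda>n. m N n x) \<longlonglongrightarrow> L" by (simp add: a_def m_def)
    then show ?thesis unfolding M_def by (simp add: limI)
  qed
  have Mm[measurable]: "M N \<in> borel_measurable lebesgue" for N unfolding M_def by measurable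
  have M1: "\<bar>M N x\<bar> \<le> 1" for N x
  proof -
    have "(\<lambda>n. \<bar>m N n x\<bar>) \<longlonglongrightarrow> \<bar>M N x\<bar>" by (intro tendsto_rabs mlim)
    then show ?thesis by (rule LIMSEQ_le_const2) (use m1 in auto)
  qed
  have mL: "(\<lambda>n. torus_integral l (\<lambda>x. \<bar>m N n x - M N x\<bar>)) \<longlonglongrightarrow> torus_integral l (\<lambda>x::real^'n. 0)" for N
  proof (rule torus_integral_dominated[where w="\<lambda>_. 2"])
    show "set_integrable lebesgue (torus_cell l) (\<lambda>_::real^'n. 2 :: real)" by (rule set_integrable_torus_bounded[OF l, of _ 2]) auto
    show "AE x in lebesgue. (\<lambda>n. \<bar>m N n x - M N x\<bar>) \<longlonglongrightarrow> 0"
      using mlim by (intro AE_I2 tendsto_rabs_zero LIM_zero)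
    show "AE x in lebesgue. \<bar>\<bar>m N n x - M N x\<bar>\<bar> \<le> 2" for n
    proof (rule AE_I2)
      fix x show "\<bar>\<bar>m N n x - M N x\<bar>\<bar> \<le> 2" using m1[of N n x] M1[of N x] by linarith
    qed
  qed measurable
  have iM: "set_integrable lebesgue (torus_cell l) (\<lambda>x. \<bar>m N n x - M N x\<bar>)" for N n
  proof (rule set_integrable_torus_bounded[OF l, of _ 2])
    show "AE x in lebesgue. \<bar>\<bar>m N n x - M N x\<bar>\<bar> \<le> 2"
    proof (rule AE_I2)
      fix x show "\<bar>\<bar>m N n x - M N x\<bar>\<bar> \<le> 2" using m1[of N n x] M1[of N x] by linarith
    qed
  qed measurable
  have iu: "set_integrable lebesgue (torus_cell l) (\<lambda>x. \<bar>u (s n) x - m N n x\<bar>)" for N n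
  proof (rule set_integrable_torus_bounded[OF l, of _ 2])
    show "AE x in lebesgue. \<bar>\<bar>u (s n) x - m N n x\<bar>\<bar> \<le> 2"
      using BV01_D(2)[OF u[of "s n"]]
    proof eventually_elim
      case (elim x) then show ?case using m1[of N n x] by auto
    qed
  qed measurable
  have um_close: "torus_integral l (\<lambda>x. \<bar>u (s n) x - m N n x\<bar>) \<le> 2 ^ ?d * (?d * h N * C)" for n N
  proof -
    have "torus_integral l (\<lambda>x. \<bar>u (s n) x - m N n x\<bar>) \<le> 2 ^ ?d * (?d * h N * tv l (u (s n)))"
      unfolding m_def by (rule grid_mean_approx(3)[OF l h u])
    also have "\<dots> \<le> 2 ^ ?d * (?d * h N * C)" using C h[of N] by (intro mult_left_mono) auto
    finally show ?thesis .
  qed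
  have cauchy: "\<exists>n0. \<forall>i\<ge>n0. \<forall>j\<ge>n0. L1_dist l (u (s i)) (u (s j)) < e" if e: "e > 0" for e
  proof -
    have "(\<lambda>N. 2 ^ ?d * (?d * h N * C)) \<longlonglongrightarrow> 2 ^ ?d * (real ?d * 0 * C)" by (intro tendsto_intros h0)
    from order_tendstoD(2)[OF this, of "e / 4"] e have "\<forall>\<^sub>F N in sequentially. 2 ^ ?d * (?d * h N * C) < e / 4" by simp
    then obtain N where N: "2 ^ ?d * (?d * h N * C) < e / 4" by (auto simp: eventually_sequentially)
    have "\<forall>\<^sub>F n in sequentially. torus_integral l (\<lambda>x. \<bar>m N n x - M N x\<bar>) < e / 4"
      using order_tendstoD(2)[OF mL[of N], of "e / 4"] e by simp
    then obtain n0 where n0: "\<And>n. n \<ge> n0 \<Longrightarrow> torus_integral l (\<lambda>x. \<bar>m N n x - M N x\<bar>) < e / 4" by (auto simp: eventually_sequentially)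
    have "L1_dist l (u (s i)) (u (s j)) < e" if ij: "i \<ge> n0" "j \<ge> n0" for i j
    proof -
      note ints = set_integral_add(1)[OF set_integral_add(1)[OF iu[of i N] iM[of N i]] set_integral_add(1)[OF iM[of N j] iu[of j N]]]
      have "L1_dist l (u (s i)) (u (s j)) \<le> torus_integral l (\<lambda>x. (\<bar>u (s i) x - m N i x\<bar> + \<bar>m N i x - M N x\<bar>) + (\<bar>m N j x - M N x\<bar> + \<bar>u (s j) x - m N j x\<bar>))"
        unfolding L1_dist_def by (rule torus_integral_mono_AE[OF set_integrable_abs_diff[OF L1 L1] ints]) (rule AE_I2, linarith)
      also have "\<dots> = (torus_integral l (\<lambda>x. \<bar>u (s i) x - m N i x\<bar>) + torus_integral l (\<lambda>x. \<bar>m N i x - M N x\<bar>)) + (torus_integral l (\<lambda>x. \<bar>m N j x - M N x\<bar>) + torus_integral l (\<lambda>x. \<bar>u (s j) x - m N j x\<bar>))"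
        by (simp only: torus_integral_add[OF set_integral_add(1)[OF iu iM] set_integral_add(1)[OF iM iu]] torus_integral_add[OF iu iM] torus_integral_add[OF iM iu])
      also have "\<dots> < e" using um_close[of i N] um_close[of j N] n0[OF ij(1)] n0[OF ij(2)] N by linarith
      finally show ?thesis .
    qed
    then show ?thesis by blast
  qed
  obtain n0 where n0: "\<And>k i j. i \<ge> n0 k \<Longrightarrow> j \<ge> n0 k \<Longrightarrow> L1_dist l (u (s i)) (u (s j)) < (1/2) ^ k"
  proof -
    have "\<forall>k. \<exists>n. \<forall>i\<ge>n. \<forall>j\<ge>n. L1_dist l (u (s i)) (u (s j)) < (1/2) ^ k" using cauchy by simp
    from choice[OF this] show thesis using that by blast
  qed
  \<comment> \<open>A strictly increasing choice beyond each \<open>n0 k\<close>; it makes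
    consecutive distances at most \<open>(1/2) ^ k\<close>.\<close>
  define t where "t k = (\<Sum>j\<le>k. n0 j) + k" for k
  have t: "strict_mono t" unfolding strict_mono_Suc_iff t_def by simp
  have tn0: "n0 k \<le> t k" for k unfolding t_def by (simp add: member_le_sum trans_le_add1)
  have "L1_dist l (u (s (t (Suc k)))) (u (s (t k))) \<le> (1/2) ^ k" for k
  proof -
    have "n0 k \<le> t (Suc k)" using tn0[of k] strict_monoD[OF t, of k "Suc k"] by simp
    then show ?thesis using n0[OF _ tn0[of k]] by (simp add: less_imp_le)
  qed
  from BV01_L1_limit_of_cauchy[where u="\<lambda>k. u (s (t k))", OF l u this]
  obtain v where v: "v \<in> torus_L1 l" "(\<lambda>n. L1_dist l (u (s (t n))) v) \<longlonglongrightarrow> 0" by blast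
  have "v \<in> BV01 l" by (rule BV01_closed[OF l u C v])
  moreover have "strict_mono (s \<circ> t)" by (rule strict_mono_o[OF s t])
  ultimately show ?thesis using v(2) by (intro bexI[of _ v] exI[of _ "s \<circ> t"]) (auto simp: comp_def)
qed

section \<open>Splitting of the energy\<close>

definition unit_dir :: "real^'n \<Rightarrow> real^'n" where
  "unit_dir z = (1 / norm z) *\<^sub>R z"

definition gap :: "real \<Rightarrow> (real^'n \<Rightarrow> real) \<Rightarrow> real^'n \<Rightarrow> real" where
  "gap l u z = directional_variation l u (unit_dir z) - shift_difference l u z / norm z"

text \<open>Extended nonnegative values let one definition serve the integrable kernels and
  \<open>K0\<close>.\<close>

definition inner_energy :: "real \<Rightarrow> (real \<Rightarrow> ennreal) \<Rightarrow> (real^'n \<Rightarrow> real) \<Rightarrow> ennreal" where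
  "inner_energy l K u = (\<integral>\<^sup>+z\<in>ball 0 1. K (norm z) * ennreal (gap l u z) \<partial>lebesgue)"

definition inner_loss :: "real \<Rightarrow> (real \<Rightarrow> ennreal) \<Rightarrow> (real^'n \<Rightarrow> real) \<Rightarrow> ennreal" where
  "inner_loss l K u = (\<integral>\<^sup>+z\<in>ball 0 1. K (norm z) * ennreal (shift_difference l u z / norm z) \<partial>lebesgue)"

definition tail_loss :: "real \<Rightarrow> (real \<Rightarrow> ennreal) \<Rightarrow> (real^'n \<Rightarrow> real) \<Rightarrow> ennreal" where
  "tail_loss l K u = (\<integral>\<^sup>+z\<in>- ball 0 1. K (norm z) * ennreal (shift_difference l u z / norm z) \<partial>lebesgue)"

text \<open>The integral in \<open>kernel_mass\<close> without the factor
  \<open>unit_ball_vol\<close>, as an extended number.\<close>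

definition profile_mass :: "nat \<Rightarrow> (real \<Rightarrow> ennreal) \<Rightarrow> ennreal" where
  "profile_mass d K = (\<integral>\<^sup>+t\<in>{0<..<1}. K t * ennreal (t ^ (d - 1)) \<partial>lebesgue)"

lemma borel_imp_lebesgue_measurable: "f \<in> borel_measurable borel \<Longrightarrow> f \<in> borel_measurable (lebesgue :: 'a::euclidean_space measure)"
  by (intro measurable_completion) simp

lemma directional_variation_nonneg:
  assumes "l > 0" "u \<in> BV01 l"
  shows "0 \<le> directional_variation l u w"
proof -
  obtain \<mu> \<sigma> where "is_polar_gradient l u \<mu> \<sigma>" and "\<And>w. directional_variation l u w = (\<integral>x. \<bar>w \<bullet> \<sigma> x\<bar> \<partial>\<mu>)"
    using directional_variation_polar[OF assms] by blast
  then show ?thesis by simp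
qed

lemma directional_variation_measurable:
  fixes u :: "real^'n \<Rightarrow> real"
  assumes l: "l > 0" and u: "u \<in> BV01 l"
  shows "(\<lambda>z. directional_variation l u (unit_dir z)) \<in> borel_measurable borel"
proof -
  obtain \<mu> \<sigma> where p: "is_polar_gradient l u \<mu> \<sigma>" and V: "\<And>w. directional_variation l u w = (\<integral>x. \<bar>w \<bullet> \<sigma> x\<bar> \<partial>\<mu>)"
    using directional_variation_polar[OF l u] by blast
  interpret finite_measure \<mu> using p by (simp add: is_polar_gradient_def)
  have [measurable]: "\<sigma> \<in> borel_measurable \<mu>"
    using p measurable_cong_sets[of \<mu> borel] unfolding is_polar_gradient_def by blast
  show ?thesis unfolding V unit_dir_def
    by (rule borel_measurable_lebesgue_integral) measurable
qed

lemma shift_difference_le_directional: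
  fixes u :: "real^'n \<Rightarrow> real"
  assumes l: "l > 0" and u: "u \<in> BV01 l"
  shows "shift_difference l u z / norm z \<le> directional_variation l u (unit_dir z)"
proof (cases "z = 0")
  case True
  then show ?thesis using directional_variation_nonneg[OF l u] by simp
next
  case False
  obtain \<mu> \<sigma> where p: "is_polar_gradient l u \<mu> \<sigma>" and V: "\<And>w. directional_variation l u w = (\<integral>x. \<bar>w \<bullet> \<sigma> x\<bar> \<partial>\<mu>)"
    using directional_variation_polar[OF l u] by blast
  have "shift_difference l u z / norm z \<le> (\<integral>x. \<bar>z \<bullet> \<sigma> x\<bar> \<partial>\<mu>) / norm z"
    by (intro divide_right_mono shift_difference_le_polar[OF l BV01_D[OF u] p]) simp
  also have "\<dots> = (\<integral>x. \<bar>unit_dir z \<bullet> \<sigma> x\<bar> \<partial>\<mu>)"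
    by (simp add: unit_dir_def abs_mult)
  finally show ?thesis by (simp add: V)
qed

lemma gap_nonneg: "l > 0 \<Longrightarrow> u \<in> BV01 l \<Longrightarrow> 0 \<le> gap l u z"
  using shift_difference_le_directional[of l u z] by (simp add: gap_def)

lemma shift_quotient_measurable:
  fixes u :: "real^'n \<Rightarrow> real"
  assumes l: "l > 0" and u: "u \<in> BV01 l"
  shows "(\<lambda>z. shift_difference l u z / norm z) \<in> borel_measurable borel"
  using borel_measurable_continuous_onI[OF shift_difference_continuous[OF assms]] by measurable

lemma gap_measurable:
  fixes u :: "real^'n \<Rightarrow> real"
  assumes l: "l > 0" and u: "u \<in> BV01 l"
  shows "gap l u \<in> borel_measurable borel"
  unfolding gap_def[abs_def]
  by (intro borel_measurable_diff directional_variation_measurable[OF assms] shift_quotient_measurable[OF assms])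

text \<open>Tonelli: for each point \<open>x\<close> the integral in \<open>z\<close> is a radial
  mass times the sphere constant, the same for every unit vector \<open>\<sigma> x\<close>.
  Integrating over the variation measure then produces the total variation.\<close>

lemma directional_variation_radial_integral:
  fixes u :: "real^'n \<Rightarrow> real"
  assumes l: "l > 0" and u: "u \<in> BV01 l" and K: "(\<lambda>z::real^'n. K (norm z)) \<in> borel_measurable lebesgue"
  shows "(\<integral>\<^sup>+z\<in>ball 0 1. K (norm z) * ennreal (directional_variation l u (unit_dir z)) \<partial>lebesgue)
    = ennreal (2 * unit_ball_vol (real (CARD('n) - 1)) * tv l u) * profile_mass CARD('n) K"
proof -
  obtain \<mu> \<sigma> where p: "is_polar_gradient l u \<mu> \<sigma>" and V: "\<And>w. directional_variation l u w = (\<integral>x. \<bar>w \<bullet> \<sigma> x\<bar> \<partial>\<mu>)"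
    using directional_variation_polar[OF l u] by blast
  have sm: "sets \<mu> = sets borel" and fin: "finite_measure \<mu>" and sb[measurable]: "\<sigma> \<in> borel_measurable borel" and s1: "\<And>x. norm (\<sigma> x) = 1"
    using p by (auto simp: is_polar_gradient_def)
  interpret finite_measure \<mu> by fact
  interpret PS: pair_sigma_finite "lborel :: (real^'n) measure" \<mu>
    by (intro pair_sigma_finite.intro lborel.sigma_finite_measure_axioms sigma_finite_measure_axioms)
  have [measurable]: "\<sigma> \<in> borel_measurable \<mu>" using sb measurable_cong_sets[OF sm refl] by blast
  have sp: "space \<mu> = UNIV" using sets_eq_imp_space_eq[OF sm] by simp
  have tv: "emeasure \<mu> (space \<mu>) = ennreal (tv l u)"
    using total_variation_polar[OF l p] by (simp add: tv_def sp emeasure_eq_measure)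
  obtain k where k[measurable]: "k \<in> borel_measurable borel" and ae: "AE z in (lborel :: (real^'n) measure). K (norm z) = k (norm z)"
    using radial_profile_borel[OF K] by blast
  have hV: "ennreal (directional_variation l u (unit_dir z)) = (\<integral>\<^sup>+x. ennreal (\<bar>z \<bullet> \<sigma> x\<bar> / norm z) \<partial>\<mu>)" for z
  proof -
    have b: "\<bar>unit_dir z \<bullet> \<sigma> x\<bar> \<le> norm (unit_dir z)" for x
      using Cauchy_Schwarz_ineq2[of "unit_dir z" "\<sigma> x"] s1 by simp
    have "(\<integral>\<^sup>+x. ennreal (\<bar>z \<bullet> \<sigma> x\<bar> / norm z) \<partial>\<mu>) = (\<integral>\<^sup>+x. ennreal \<bar>unit_dir z \<bullet> \<sigma> x\<bar> \<partial>\<mu>)"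
      by (simp add: unit_dir_def abs_mult)
    also have "\<dots> = ennreal (\<integral>x. \<bar>unit_dir z \<bullet> \<sigma> x\<bar> \<partial>\<mu>)"
      using b by (intro nn_integral_eq_integral integrable_const_bound[where B="norm (unit_dir z)"]) auto
    finally show ?thesis by (simp add: V)
  qed
  have "(\<integral>\<^sup>+z\<in>ball 0 1. K (norm z) * ennreal (directional_variation l u (unit_dir z)) \<partial>lebesgue)
     = (\<integral>\<^sup>+z. (\<integral>\<^sup>+x. k (norm z) * indicator {..<1} (norm z) * ennreal (\<bar>z \<bullet> \<sigma> x\<bar> / norm z) \<partial>\<mu>) \<partial>lborel)"
    unfolding nn_integral_completion
  proof (rule nn_integral_cong_AE)
    show "AE z in lborel. K (norm z) * ennreal (directional_variation l u (unit_dir z)) * indicator (ball 0 1) z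
      = (\<integral>\<^sup>+x. k (norm z) * indicator {..<1} (norm z) * ennreal (\<bar>z \<bullet> \<sigma> x\<bar> / norm z) \<partial>\<mu>)"
      using ae
    proof eventually_elim
      case (elim z)
      have "(\<integral>\<^sup>+x. k (norm z) * indicator {..<1} (norm z) * ennreal (\<bar>z \<bullet> \<sigma> x\<bar> / norm z) \<partial>\<mu>)
         = k (norm z) * indicator {..<1} (norm z) * ennreal (directional_variation l u (unit_dir z))"
        unfolding hV by (rule nn_integral_cmult) measurable
      then show ?case using elim by (simp add: mult_ac indicator_def)
    qed
  qed
  also have "\<dots> = (\<integral>\<^sup>+x. (\<integral>\<^sup>+z. k (norm z) * indicator {..<1} (norm z) * ennreal (\<bar>z \<bullet> \<sigma> x\<bar> / norm z) \<partial>lborel) \<partial>\<mu>)"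
    by (rule PS.Fubini'[symmetric]) measurable
  also have "\<dots> = (\<integral>\<^sup>+x. ennreal (2 * unit_ball_vol (real (CARD('n) - 1))) * profile_mass CARD('n) K \<partial>\<mu>)"
  proof (rule nn_integral_cong)
    fix x
    have "(\<integral>\<^sup>+z. k (norm z) * indicator {..<1} (norm z) * ennreal (\<bar>z \<bullet> \<sigma> x\<bar> / norm z) \<partial>lborel)
       = (\<integral>\<^sup>+z. K (norm z) * indicator {..<1} (norm z) * ennreal (\<bar>z \<bullet> \<sigma> x\<bar> / norm z) \<partial>lebesgue)"
      unfolding nn_integral_completion by (rule nn_integral_cong_AE) (use ae in eventually_elim, simp)
    also have "\<dots> = of_nat DIM(real^'n) * (\<integral>\<^sup>+z\<in>cball 0 1. ennreal (\<bar>z \<bullet> \<sigma> x\<bar> / norm z) \<partial>lborel) *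
      (\<integral>\<^sup>+t\<in>{0<..} \<inter> {..<1}. K t * ennreal (t ^ (DIM(real^'n) - 1)) \<partial>lebesgue)"
      by (rule nn_integral_radial_lebesgue[OF _ _ sphere_abs_inner_constant(2)[OF s1] K]) (auto simp: abs_mult)
    also have "\<dots> = ennreal (2 * unit_ball_vol (real (CARD('n) - 1))) * profile_mass CARD('n) K"
      using sphere_abs_inner_constant(1)[OF s1[of x]] by (simp add: profile_mass_def greaterThanLessThan_def)
    finally show "(\<integral>\<^sup>+z. k (norm z) * indicator {..<1} (norm z) * ennreal (\<bar>z \<bullet> \<sigma> x\<bar> / norm z) \<partial>lborel)
      = ennreal (2 * unit_ball_vol (real (CARD('n) - 1))) * profile_mass CARD('n) K" .
  qed
  also have "\<dots> = ennreal (2 * unit_ball_vol (real (CARD('n) - 1))) * profile_mass CARD('n) K * ennreal (tv l u)"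
    by (simp add: tv)
  finally show ?thesis by (simp add: ennreal_mult' tv_nonneg mult_ac)
qed

text \<open>Pointwise the gap and the shift quotient add up to the directional variation. Stated as
  a sum, the identity stays meaningful for infinite mass.\<close>

lemma inner_energy_plus_loss:
  fixes u :: "real^'n \<Rightarrow> real"
  assumes l: "l > 0" and u: "u \<in> BV01 l" and K[measurable]: "(\<lambda>z::real^'n. K (norm z)) \<in> borel_measurable lebesgue"
  shows "inner_energy l K u + inner_loss l K u
    = ennreal (2 * unit_ball_vol (real (CARD('n) - 1)) * tv l u) * profile_mass CARD('n) K"
proof -
  have [measurable]: "gap l u \<in> borel_measurable lebesgue" by (rule borel_imp_lebesgue_measurable[OF gap_measurable[OF l u]])
  have [measurable]: "(\<lambda>z. shift_difference l u z / norm z) \<in> borel_measurable lebesgue"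
    by (rule borel_imp_lebesgue_measurable[OF shift_quotient_measurable[OF l u]])
  have [measurable]: "ball (0::real^'n) 1 \<in> sets lebesgue" by simp
  have "inner_energy l K u + inner_loss l K u = (\<integral>\<^sup>+z. K (norm z) * ennreal (gap l u z) * indicator (ball 0 1) z
      + K (norm z) * ennreal (shift_difference l u z / norm z) * indicator (ball 0 1) z \<partial>lebesgue)"
    unfolding inner_energy_def inner_loss_def by (rule nn_integral_add[symmetric]) measurable
  also have "\<dots> = (\<integral>\<^sup>+z\<in>ball 0 1. K (norm z) * ennreal (directional_variation l u (unit_dir z)) \<partial>lebesgue)"
  proof (rule nn_integral_cong)
    fix z
    have "ennreal (directional_variation l u (unit_dir z)) = ennreal (gap l u z) + ennreal (shift_difference l u z / norm z)"
      using gap_nonneg[OF l u, of z] shift_difference_nonneg[of l u z]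
      by (subst ennreal_plus[symmetric]) (auto simp: gap_def)
    then show "K (norm z) * ennreal (gap l u z) * indicator (ball 0 1) z + K (norm z) * ennreal (shift_difference l u z / norm z) * indicator (ball 0 1) z
      = K (norm z) * ennreal (directional_variation l u (unit_dir z)) * indicator (ball 0 1) z"
      by (simp add: distrib_left distrib_right)
  qed
  also have "\<dots> = ennreal (2 * unit_ball_vol (real (CARD('n) - 1)) * tv l u) * profile_mass CARD('n) K"
    by (rule directional_variation_radial_integral[OF l u K])
  finally show ?thesis .
qed

lemma nn_integral_radial_measure:
  fixes K :: "real \<Rightarrow> ennreal"
  assumes K: "(\<lambda>z::'a::euclidean_space. K (norm z)) \<in> borel_measurable lebesgue" and S: "S \<in> sets borel"
  shows "(\<integral>\<^sup>+z. K (norm z) * indicator S (norm z) \<partial>(lebesgue :: 'a measure)) =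
    ennreal (DIM('a) * unit_ball_vol DIM('a)) * (\<integral>\<^sup>+t\<in>{0<..} \<inter> S. K t * ennreal (t ^ (DIM('a) - 1)) \<partial>lebesgue)"
proof -
  have c: "(\<integral>\<^sup>+z\<in>cball 0 1. 1 \<partial>(lborel :: 'a measure)) = ennreal (unit_ball_vol DIM('a))"
    using emeasure_cball[of 1 "0::'a"] by simp
  have "(\<integral>\<^sup>+z. K (norm z) * indicator S (norm z) * 1 \<partial>(lebesgue :: 'a measure)) = of_nat DIM('a) * (\<integral>\<^sup>+z\<in>cball 0 1. 1 \<partial>(lborel :: 'a measure)) *
    (\<integral>\<^sup>+t\<in>{0<..} \<inter> S. K t * ennreal (t ^ (DIM('a) - 1)) \<partial>lebesgue)"
    using c by (intro nn_integral_radial_lebesgue K S) auto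
  then show ?thesis unfolding c by (simp add: ennreal_mult' ennreal_of_nat_eq_real_of_nat)
qed

text \<open>Polar coordinates translate integrability on the unit ball into finiteness of the radial
  mass, after which the Bochner integral in \<open>kernel_mass\<close> agrees with the extended
  one.\<close>

lemma kernel_mass_profile:
  fixes k :: "real \<Rightarrow> real"
  assumes nn: "\<And>r. r \<ge> 0 \<Longrightarrow> 0 \<le> k r" and meas: "(\<lambda>z::real^'n. k (norm z)) \<in> borel_measurable lebesgue"
    and int: "set_integrable lebesgue (ball 0 1) (\<lambda>z::real^'n. k (norm z))"
  shows "profile_mass CARD('n) (\<lambda>r. ennreal (k r)) < \<infinity>"
    and "kernel_mass CARD('n) k = unit_ball_vol (real (CARD('n) - 1)) * enn2real (profile_mass CARD('n) (\<lambda>r. ennreal (k r)))"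
proof -
  have K: "(\<lambda>z::real^'n. ennreal (k (norm z))) \<in> borel_measurable lebesgue" using meas by measurable
  have "(\<integral>\<^sup>+z. ennreal (k (norm z)) * indicator {..<1} (norm z) \<partial>(lebesgue :: (real^'n) measure)) =
    ennreal (DIM(real^'n) * unit_ball_vol DIM(real^'n)) * (\<integral>\<^sup>+t\<in>{0<..} \<inter> {..<1}. ennreal (k t) * ennreal (t ^ (DIM(real^'n) - 1)) \<partial>lebesgue)"
    by (rule nn_integral_radial_measure[OF K]) simp
  moreover have "(\<integral>\<^sup>+z. ennreal (k (norm z)) * indicator {..<1} (norm z) \<partial>(lebesgue :: (real^'n) measure)) < \<infinity>"
  proof -
    have "(\<integral>\<^sup>+z. ennreal (k (norm z)) * indicator {..<1} (norm z) \<partial>(lebesgue :: (real^'n) measure))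
      = (\<integral>\<^sup>+z. ennreal (norm (indicator (ball 0 1) z *\<^sub>R k (norm z))) \<partial>(lebesgue :: (real^'n) measure))"
      using nn by (intro nn_integral_cong) (auto split: split_indicator)
    then show ?thesis using int by (simp only: set_integrable_def integrable_iff_bounded)
  qed
  moreover have "ennreal (DIM(real^'n) * unit_ball_vol DIM(real^'n)) \<noteq> 0"
    by (simp add: ennreal_eq_0_iff not_le)
  ultimately show fin: "profile_mass CARD('n) (\<lambda>r. ennreal (k r)) < \<infinity>"
    unfolding profile_mass_def greaterThanLessThan_def DIM_cart DIM_real mult_1_right
    by (auto simp: ennreal_mult_top less_top[symmetric] simp del: nn_integral_completion)
  let ?f = "\<lambda>t. indicator {0..1} t *\<^sub>R (k t * t ^ (CARD('n) - 1))"
  have fm: "?f \<in> borel_measurable lebesgue"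
  proof -
    have "(\<lambda>t. enn2real (ennreal (k t) * indicator {0<..} t)) \<in> borel_measurable lebesgue"
      using radial_profile_measurable[OF K] by measurable
    moreover have "(\<lambda>t::real. indicator {..1} t * t ^ (CARD('n) - 1)) \<in> borel_measurable lebesgue"
      by (rule borel_imp_lebesgue_measurable) measurable
    \<comment> \<open>The value at radius 0 is put back separately; in dimension 1 the factor
      \<open>0 ^ 0\<close> is 1.\<close>
    moreover have "(\<lambda>t::real. indicator {0} t * (k 0 * 0 ^ (CARD('n) - 1))) \<in> borel_measurable lebesgue"
      by (rule borel_imp_lebesgue_measurable) measurable
    ultimately have "(\<lambda>t. enn2real (ennreal (k t) * indicator {0<..} t) * (indicator {..1} t * t ^ (CARD('n) - 1)) + indicator {0} t * (k 0 * 0 ^ (CARD('n) - 1))) \<in> borel_measurable lebesgue"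
      by (rule borel_measurable_add[OF borel_measurable_times])
    also have "(\<lambda>t. enn2real (ennreal (k t) * indicator {0<..} t) * (indicator {..1} t * t ^ (CARD('n) - 1)) + indicator {0} t * (k 0 * 0 ^ (CARD('n) - 1))) = ?f"
      using nn by (auto simp: fun_eq_iff split: split_indicator)
    finally show ?thesis .
  qed
  have "set_lebesgue_integral lebesgue {0..1} (\<lambda>t. k t * t ^ (CARD('n) - 1)) = enn2real (\<integral>\<^sup>+t. ennreal (?f t) \<partial>lebesgue)"
    unfolding set_lebesgue_integral_def
    using nn by (intro integral_eq_nn_integral fm) (auto split: split_indicator)
  also have "(\<integral>\<^sup>+t. ennreal (?f t) \<partial>lebesgue) = profile_mass CARD('n) (\<lambda>r. ennreal (k r))"
    unfolding profile_mass_def nn_integral_completion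
  proof (rule nn_integral_cong_AE)
    have "AE t in lborel. t \<noteq> (0::real)" "AE t in lborel. t \<noteq> (1::real)" by (rule AE_lborel_singleton)+
    then show "AE t in lborel. ennreal (?f t) = ennreal (k t) * ennreal (t ^ (CARD('n) - 1)) * indicator {0<..<1} t"
      by eventually_elim (use nn in \<open>auto split: split_indicator simp: ennreal_mult\<close>)
  qed
  finally show "kernel_mass CARD('n) k = unit_ball_vol (real (CARD('n) - 1)) * enn2real (profile_mass CARD('n) (\<lambda>r. ennreal (k r)))"
    by (simp add: kernel_mass_def)
qed

section \<open>Energies as inner part minus tail\<close>

text \<open>The form shared by the approximating and the limit energy. The factor combines the
  average over the torus with the 1/2 of the energies.\<close>

definition split_energy :: "real \<Rightarrow> (real \<Rightarrow> ennreal) \<Rightarrow> (real^'n \<Rightarrow> real) \<Rightarrow> ereal" where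
  "split_energy l K u = enn2ereal (ennreal (1 / (2 * l ^ CARD('n))) * inner_energy l K u)
     - enn2ereal (ennreal (1 / (2 * l ^ CARD('n))) * tail_loss l K u)"

text \<open>By the sum identity the perimeter term is a multiple of inner energy plus inner loss,
  and the loss cancels against the part of the shift term inside the ball. All quantities are finite
  here, so the cancellation takes place in the reals.\<close>

lemma energy_split:
  fixes u :: "real^'n \<Rightarrow> real" and k :: "real \<Rightarrow> real"
  assumes l: "l > 0" and u: "u \<in> BV01 l" and nn: "\<And>r. r \<ge> 0 \<Longrightarrow> 0 \<le> k r"
    and meas: "(\<lambda>z::real^'n. k (norm z)) \<in> borel_measurable lebesgue"
    and int: "set_integrable lebesgue (ball 0 1) (\<lambda>z::real^'n. k (norm z))"
    and tail: "tail_loss l (\<lambda>r. ennreal (k r)) u < \<infinity>"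
  shows "energy l k u = split_energy l (\<lambda>r. ennreal (k r)) u"
proof -
  let ?K = "\<lambda>r. ennreal (k r)" and ?L = "l ^ CARD('n)" and ?w = "unit_ball_vol (real (CARD('n) - 1))"
  have L: "?L > 0" using l by simp
  have K[measurable]: "(\<lambda>z::real^'n. ?K (norm z)) \<in> borel_measurable lebesgue" using meas by measurable
  have [measurable]: "(\<lambda>z. shift_difference l u z / norm z) \<in> borel_measurable lebesgue"
    by (rule borel_imp_lebesgue_measurable[OF shift_quotient_measurable[OF l u]])
  have [measurable]: "ball (0::real^'n) 1 \<in> sets lebesgue" by simp
  have "(\<integral>\<^sup>+z. ennreal (k (norm z) * (1 / ?L * (shift_difference l u z / (2 * norm z)))) \<partial>lebesgue)
     = (\<integral>\<^sup>+z. ennreal (1 / (2 * ?L)) * (?K (norm z) * ennreal (shift_difference l u z / norm z)) \<partial>(lebesgue :: (real^'n) measure))"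
  proof (rule nn_integral_cong)
    fix z :: "real^'n"
    have "k (norm z) * (1 / ?L * (shift_difference l u z / (2 * norm z))) = 1 / (2 * ?L) * (k (norm z) * (shift_difference l u z / norm z))" by simp
    then show "ennreal (k (norm z) * (1 / ?L * (shift_difference l u z / (2 * norm z)))) = ennreal (1 / (2 * ?L)) * (?K (norm z) * ennreal (shift_difference l u z / norm z))"
      using L nn[of "norm z"] shift_difference_nonneg[of l u z] by (simp only: ennreal_mult'[symmetric] ennreal_mult'[symmetric])
         (simp add: ennreal_mult'[symmetric])
  qed
  also have "\<dots> = ennreal (1 / (2 * ?L)) * (\<integral>\<^sup>+z. ?K (norm z) * ennreal (shift_difference l u z / norm z) \<partial>(lebesgue :: (real^'n) measure))"
    by (rule nn_integral_cmult) measurable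
  also have "(\<integral>\<^sup>+z. ?K (norm z) * ennreal (shift_difference l u z / norm z) \<partial>(lebesgue :: (real^'n) measure)) = inner_loss l ?K u + tail_loss l ?K u"
    unfolding inner_loss_def tail_loss_def
    by (subst nn_integral_add[symmetric]) (measurable, auto intro!: nn_integral_cong split: split_indicator)
  finally have loss: "(\<integral>\<^sup>+z. ennreal (k (norm z) * (1 / ?L * (shift_difference l u z / (2 * norm z)))) \<partial>lebesgue)
     = ennreal (1 / (2 * ?L)) * (inner_loss l ?K u + tail_loss l ?K u)" .
  obtain P where P: "profile_mass CARD('n) ?K = ennreal P" "P \<ge> 0"
    using kernel_mass_profile(1)[OF nn meas int] by (cases "profile_mass CARD('n) ?K") auto
  have sum: "inner_energy l ?K u + inner_loss l ?K u = ennreal (2 * ?w * tv l u * P)"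
    using inner_energy_plus_loss[OF l u K] P tv_nonneg[of l u] by (simp add: ennreal_mult')
  obtain I where I: "inner_energy l ?K u = ennreal I" "I \<ge> 0"
    using sum by (cases "inner_energy l ?K u") auto
  obtain J where J: "inner_loss l ?K u = ennreal J" "J \<ge> 0"
    using sum by (cases "inner_loss l ?K u") auto
  obtain T where T: "tail_loss l ?K u = ennreal T" "T \<ge> 0"
    using tail by (cases "tail_loss l ?K u") auto
  have IJ: "I + J = 2 * ?w * tv l u * P"
    using sum P tv_nonneg[of l u] I J by (simp add: ennreal_plus[symmetric] del: ennreal_plus)
  have km: "kernel_mass CARD('n) k = ?w * P" using kernel_mass_profile(2)[OF nn meas int] P by simp
  have "energy l k u = ereal (?w * P / ?L * tv l u) - ereal (1 / (2 * ?L) * (J + T))"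
  proof -
    have "enn2ereal (ennreal (1 / (2 * ?L)) * (inner_loss l ?K u + tail_loss l ?K u)) = ereal (1 / (2 * ?L) * (J + T))"
      using L J T by (simp add: ennreal_plus[symmetric] ennreal_mult'[symmetric] enn2ereal_ennreal del: ennreal_plus)
    moreover have "ereal (kernel_mass CARD('n) k / ?L) * total_variation l u = ereal (?w * P / ?L * tv l u)"
      by (simp only: km BV01_tv[OF u] times_ereal.simps)
    ultimately show ?thesis unfolding energy_def using u by (simp only: if_True loss)
  qed
  also have "\<dots> = ereal (1 / (2 * ?L) * I) - ereal (1 / (2 * ?L) * T)"
  proof -
    have "?w * P / ?L * tv l u = 1 / (2 * ?L) * (I + J)" unfolding IJ using L by (simp add: field_simps)
    then have "?w * P / ?L * tv l u - 1 / (2 * ?L) * (J + T) = 1 / (2 * ?L) * I - 1 / (2 * ?L) * T"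
    proof -
      have "c * (I + J) - c * (J + T) = c * I - c * T" for c :: real by (simp add: algebra_simps)
      then show ?thesis by (simp only: \<open>?w * P / ?L * tv l u = 1 / (2 * ?L) * (I + J)\<close>)
    qed
    then show ?thesis by (simp only: ereal_minus)
  qed
  also have "\<dots> = split_energy l ?K u"
    using L I T by (simp add: split_energy_def ennreal_mult'[symmetric] enn2ereal_ennreal)
  finally show ?thesis .
qed

text \<open>The integrand is nonnegative on the unit ball, where it is a multiple of the gap, and
  nonpositive outside, where only the shift term remains. So the two parts in
  \<open>extended_integral\<close> are multiples of the inner energy and the tail.\<close>

lemma limit_energy_split:
  fixes u :: "real^'n \<Rightarrow> real"
  assumes l: "l > 0" and u: "u \<in> BV01 l" and K[measurable]: "(\<lambda>z::real^'n. K (norm z)) \<in> borel_measurable lebesgue"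
    and tail: "tail_loss l K u < \<infinity>"
  shows "limit_energy l K u = split_energy l K u"
proof -
  let ?L = "l ^ CARD('n)"
  have L: "?L > 0" using l by simp
  let ?f = "\<lambda>z. enn2ereal (K (norm z)) * ereal (1 / ?L * (directional_variation l u ((1 / norm z) *\<^sub>R z) * indicator (ball 0 1) z - shift_difference l u z / norm z))"
  have [measurable]: "(\<lambda>z. shift_difference l u z / norm z) \<in> borel_measurable lebesgue"
    by (rule borel_imp_lebesgue_measurable[OF shift_quotient_measurable[OF l u]])
  have [measurable]: "gap l u \<in> borel_measurable lebesgue" by (rule borel_imp_lebesgue_measurable[OF gap_measurable[OF l u]])
  have [measurable]: "ball (0::real^'n) 1 \<in> sets lebesgue" by simp
  \<comment> \<open>Truncation acts on the sign of the real factor alone, even when the extended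
    factor is infinite, as \<open>K0\<close> may be.\<close>
  have enn: "e2ennreal (enn2ereal a * ereal b) = a * ennreal b" for a b
  proof (cases "b \<ge> 0")
    case True
    then have "enn2ereal a * ereal b = enn2ereal (a * ennreal b)" by (simp add: times_ennreal.rep_eq enn2ereal_ennreal)
    then show ?thesis by simp
  next
    case False
    have "enn2ereal a * ereal b \<le> 0"
      using False by (cases a) (auto simp: enn2ereal_ennreal mult_nonneg_nonpos enn2ereal_top)
    then show ?thesis using False by (simp add: e2ennreal_neg ennreal_neg)
  qed
  have D0: "0 \<le> shift_difference l u z / norm z" for z using shift_difference_nonneg[of l u z] by simp
  have pos: "e2ennreal (?f z) = ennreal (1 / ?L) * (K (norm z) * ennreal (gap l u z) * indicator (ball 0 1) z)" for z
  proof (cases "z \<in> ball 0 1")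
    case True
    then have "?f z = enn2ereal (K (norm z)) * ereal (1 / ?L * gap l u z)" by (simp add: gap_def unit_dir_def)
    moreover have "ennreal (1 / ?L * gap l u z) = ennreal (1 / ?L) * ennreal (gap l u z)"
      using L by (intro ennreal_mult') simp
    ultimately show ?thesis using True by (simp only: enn) (simp add: mult_ac)
  next
    case False
    have "1 / ?L * (0 - shift_difference l u z / norm z) \<le> 0" using L D0[of z] by (intro mult_nonneg_nonpos) auto
    then have "ennreal (1 / ?L * (0 - shift_difference l u z / norm z)) = 0" by (rule ennreal_neg)
    then show ?thesis using False by (simp only: enn) simp
  qed
  have neg: "e2ennreal (- ?f z) = ennreal (1 / ?L) * (K (norm z) * ennreal (shift_difference l u z / norm z) * indicator (- ball 0 1) z)" for z
  proof -
    have m: "- ?f z = enn2ereal (K (norm z)) * ereal (- (1 / ?L * (directional_variation l u ((1 / norm z) *\<^sub>R z) * indicator (ball 0 1) z - shift_difference l u z / norm z)))"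
      by (simp only: ereal_mult_minus_right[symmetric] uminus_ereal.simps)
    show ?thesis
    proof (cases "z \<in> ball 0 1")
      case True
      then have "- (1 / ?L * (directional_variation l u ((1 / norm z) *\<^sub>R z) * indicator (ball 0 1) z - shift_difference l u z / norm z)) \<le> 0"
        using gap_nonneg[OF l u, of z] L by (simp add: gap_def unit_dir_def)
      then show ?thesis using True by (simp only: m enn ennreal_neg) simp
    next
      case False
      then have "- (1 / ?L * (directional_variation l u ((1 / norm z) *\<^sub>R z) * indicator (ball 0 1) z - shift_difference l u z / norm z)) = 1 / ?L * (shift_difference l u z / norm z)" by simp
      then have "e2ennreal (- ?f z) = K (norm z) * ennreal (1 / ?L * (shift_difference l u z / norm z))" by (simp only: m enn)
      also have "ennreal (1 / ?L * (shift_difference l u z / norm z)) = ennreal (1 / ?L) * ennreal (shift_difference l u z / norm z)"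
        using L by (intro ennreal_mult') simp
      finally show ?thesis using False by (simp add: mult_ac)
    qed
  qed
  have p: "(\<integral>\<^sup>+z. e2ennreal (?f z) \<partial>lebesgue) = ennreal (1 / ?L) * inner_energy l K u"
    unfolding pos inner_energy_def by (rule nn_integral_cmult) measurable
  have n: "(\<integral>\<^sup>+z. e2ennreal (- ?f z) \<partial>lebesgue) = ennreal (1 / ?L) * tail_loss l K u"
    unfolding neg tail_loss_def by (rule nn_integral_cmult) measurable
  obtain T where T: "tail_loss l K u = ennreal T" "T \<ge> 0"
    using tail by (cases "tail_loss l K u") auto
  have "limit_energy l K u = ereal (1/2) * (enn2ereal (ennreal (1 / ?L) * inner_energy l K u) - enn2ereal (ennreal (1 / ?L) * tail_loss l K u))"
    using u unfolding limit_energy_def extended_integral_def p n by simp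
  also have "\<dots> = split_energy l K u"
  proof (cases "inner_energy l K u")
    case (real I)
    have "1/2 * (1 / ?L * I - 1 / ?L * T) = 1 / (2 * ?L) * I - 1 / (2 * ?L) * T" by (simp add: field_simps)
    then show ?thesis using real T L
      by (simp add: split_energy_def ennreal_mult'[symmetric] enn2ereal_ennreal del: times_divide_eq_left)
  next
    \<comment> \<open>The tail being finite, an infinite inner energy makes both sides
      infinite.\<close>
    case top
    have "ennreal (1 / ?L) * top = top" "ennreal (1 / (2 * ?L)) * top = top"
      using zero_less_power[OF l, of "CARD('n)"] by (simp_all only: ennreal_mult_top ennreal_eq_0_iff) (simp_all add: not_le)
    then show ?thesis using T L unfolding split_energy_def top
      by (simp add: ennreal_mult'[symmetric] enn2ereal_ennreal top_ereal_def)
  qed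
  finally show ?thesis .
qed

lemma inner_energy_mono:
  "(\<And>r. r \<ge> 0 \<Longrightarrow> K r \<le> K' r) \<Longrightarrow> inner_energy l K u \<le> inner_energy l K' u"
  unfolding inner_energy_def by (intro nn_integral_mono mult_right_mono) auto

lemma tail_loss_mono:
  "(\<And>r. r \<ge> 0 \<Longrightarrow> K r \<le> K' r) \<Longrightarrow> tail_loss l K u \<le> tail_loss l K' u"
  unfolding tail_loss_def by (intro nn_integral_mono mult_right_mono) auto

text \<open>The shift difference never exceeds the volume of the torus, so the weight
  \<open>K (norm z) / norm z\<close> is all that remains under the integral.\<close>

lemma shift_loss_bound:
  fixes u :: "real^'n \<Rightarrow> real"
  assumes l: "l > 0" and u: "u \<in> BV01 l" and S: "S \<in> sets lebesgue"
    and K[measurable]: "(\<lambda>z::real^'n. K (norm z)) \<in> borel_measurable lebesgue"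
  shows "(\<integral>\<^sup>+z\<in>S. K (norm z) * ennreal (shift_difference l u z / norm z) \<partial>lebesgue)
    \<le> ennreal (l ^ CARD('n)) * (\<integral>\<^sup>+z\<in>S. K (norm z) * ennreal (1 / norm z) \<partial>(lebesgue :: (real^'n) measure))"
proof -
  have [measurable]: "(\<lambda>z::real^'n. ennreal (1 / norm z)) \<in> borel_measurable lebesgue"
    by (rule borel_imp_lebesgue_measurable) measurable
  note S[measurable]
  have "(\<integral>\<^sup>+z\<in>S. K (norm z) * ennreal (shift_difference l u z / norm z) \<partial>lebesgue)
    \<le> (\<integral>\<^sup>+z. ennreal (l ^ CARD('n)) * (K (norm z) * ennreal (1 / norm z) * indicator S z) \<partial>(lebesgue :: (real^'n) measure))"
  proof (rule nn_integral_mono)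
    fix z :: "real^'n"
    have "ennreal (shift_difference l u z / norm z) \<le> ennreal (l ^ CARD('n) * (1 / norm z))"
      using shift_difference_le_volume[OF l u, of z] by (intro ennreal_leI) (simp add: divide_right_mono)
    also have "\<dots> = ennreal (l ^ CARD('n)) * ennreal (1 / norm z)" using l by (intro ennreal_mult) auto
    finally have "K (norm z) * ennreal (shift_difference l u z / norm z) * indicator S z \<le> K (norm z) * (ennreal (l ^ CARD('n)) * ennreal (1 / norm z)) * indicator S z"
      by (intro mult_right_mono mult_left_mono) auto
    then show "K (norm z) * ennreal (shift_difference l u z / norm z) * indicator S z \<le> ennreal (l ^ CARD('n)) * (K (norm z) * ennreal (1 / norm z) * indicator S z)"
      by (simp only: mult_ac)
  qed
  also have "\<dots> = ennreal (l ^ CARD('n)) * (\<integral>\<^sup>+z\<in>S. K (norm z) * ennreal (1 / norm z) \<partial>(lebesgue :: (real^'n) measure))"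
    by (rule nn_integral_cmult) measurable
  finally show ?thesis .
qed

text \<open>The shift difference is 2-Lipschitz in L1 uniformly in \<open>z\<close>; integrating
  against the weight \<open>K (norm z) / norm z\<close>, of total mass \<open>q\<close> on
  \<open>S\<close>, gives the constant.\<close>

lemma shift_loss_L1_continuous:
  fixes u v :: "real^'n \<Rightarrow> real"
  assumes l: "l > 0" and u: "u \<in> BV01 l" and v: "v \<in> BV01 l" and S: "S \<in> sets lebesgue"
    and K[measurable]: "(\<lambda>z::real^'n. K (norm z)) \<in> borel_measurable lebesgue"
    and q: "(\<integral>\<^sup>+z\<in>S. K (norm z) * ennreal (1 / norm z) \<partial>(lebesgue :: (real^'n) measure)) = ennreal q" "q \<ge> 0"
  shows "\<bar>enn2real (\<integral>\<^sup>+z\<in>S. K (norm z) * ennreal (shift_difference l u z / norm z) \<partial>lebesgue)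
     - enn2real (\<integral>\<^sup>+z\<in>S. K (norm z) * ennreal (shift_difference l v z / norm z) \<partial>lebesgue)\<bar> \<le> 2 * q * L1_dist l u v"
proof -
  define F where "F w = (\<integral>\<^sup>+z\<in>S. K (norm z) * ennreal (shift_difference l w z / norm z) \<partial>lebesgue)" for w :: "real^'n \<Rightarrow> real"
  have [measurable]: "(\<lambda>z::real^'n. ennreal (1 / norm z)) \<in> borel_measurable lebesgue"
    by (rule borel_imp_lebesgue_measurable) measurable
  note S[measurable]
  have fin: "F w < \<infinity>" if "w \<in> BV01 l" for w
  proof -
    have "F w \<le> ennreal (l ^ CARD('n)) * ennreal q" unfolding F_def q(1)[symmetric] by (rule shift_loss_bound[OF l that S K])
    also have "\<dots> < \<infinity>" by (simp add: ennreal_mult_less_top)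
    finally show ?thesis .
  qed
  have *: "enn2real (F u) \<le> enn2real (F v) + 2 * q * L1_dist l u v" if u: "u \<in> BV01 l" and v: "v \<in> BV01 l" for u v
  proof -
    have [measurable]: "(\<lambda>z. shift_difference l v z / norm z) \<in> borel_measurable lebesgue"
      by (rule borel_imp_lebesgue_measurable[OF shift_quotient_measurable[OF l v]])
    have "F u \<le> (\<integral>\<^sup>+z. K (norm z) * ennreal (shift_difference l v z / norm z) * indicator S z
       + ennreal (2 * L1_dist l u v) * (K (norm z) * ennreal (1 / norm z) * indicator S z) \<partial>lebesgue)"
      unfolding F_def
    proof (rule nn_integral_mono)
      fix z :: "real^'n"
      have "shift_difference l u z / norm z \<le> shift_difference l v z / norm z + 2 * L1_dist l u v * (1 / norm z)"
        using shift_difference_L1_lipschitz[OF l BV01_D(1)[OF u] BV01_D(1)[OF v], of z]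
        by (simp add: add_divide_distrib[symmetric] divide_right_mono abs_le_iff)
      then have "ennreal (shift_difference l u z / norm z) \<le> ennreal (shift_difference l v z / norm z + 2 * L1_dist l u v * (1 / norm z))"
        by (rule ennreal_leI)
      also have "\<dots> = ennreal (shift_difference l v z / norm z) + ennreal (2 * L1_dist l u v) * ennreal (1 / norm z)"
        using shift_difference_nonneg[of l v z] L1_dist_nonneg[of l u v] by (simp add: ennreal_mult[symmetric])
      finally have "K (norm z) * ennreal (shift_difference l u z / norm z) * indicator S z
        \<le> K (norm z) * (ennreal (shift_difference l v z / norm z) + ennreal (2 * L1_dist l u v) * ennreal (1 / norm z)) * indicator S z"
        by (intro mult_right_mono mult_left_mono) auto
      then show "K (norm z) * ennreal (shift_difference l u z / norm z) * indicator S z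
        \<le> K (norm z) * ennreal (shift_difference l v z / norm z) * indicator S z + ennreal (2 * L1_dist l u v) * (K (norm z) * ennreal (1 / norm z) * indicator S z)"
        by (simp only: distrib_left distrib_right mult_ac)
    qed
    also have "\<dots> = F v + ennreal (2 * L1_dist l u v) * ennreal q"
      unfolding F_def q(1)[symmetric] by (subst nn_integral_add) (measurable, simp add: nn_integral_cmult del: nn_integral_completion)
    also have "\<dots> = ennreal (enn2real (F v) + 2 * q * L1_dist l u v)"
      using fin[OF v] q(2) L1_dist_nonneg[of l u v] by (simp add: ennreal_mult[symmetric] mult_ac less_top[symmetric])
    finally have "F u \<le> ennreal (enn2real (F v) + 2 * q * L1_dist l u v)" .
    then show ?thesis using q(2) L1_dist_nonneg[of l u v] by (intro enn2real_leI) auto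
  qed
  from *[OF u v] *[OF v u] show ?thesis unfolding F_def[symmetric] using L1_dist_commute[of l u v] by (simp add: abs_le_iff)
qed

section \<open>Monotone families of kernels\<close>

text \<open>The energy is split at the unit sphere, so the tail is measured from radius 1. The
  parameter \<open>dim\<close> fixes the type that encodes the dimension.\<close>

locale kernel_family =
  fixes l :: real and K :: "real \<Rightarrow> real \<Rightarrow> real" and K0 :: "real \<Rightarrow> ennreal" and dim :: "'n::finite itself"
  assumes l_pos: "l > 0"
    and K_nonneg: "\<And>\<epsilon> r. \<epsilon> > 0 \<Longrightarrow> r \<ge> 0 \<Longrightarrow> 0 \<le> K \<epsilon> r"
    and K_measurable: "\<And>\<epsilon>. \<epsilon> > 0 \<Longrightarrow> (\<lambda>z::real^'n. K \<epsilon> (norm z)) \<in> borel_measurable lebesgue"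
    and K_L1: "\<And>\<epsilon>. \<epsilon> > 0 \<Longrightarrow> set_integrable lebesgue (ball 0 1) (\<lambda>z::real^'n. K \<epsilon> (norm z))"
    and K_mono: "\<And>\<epsilon> \<epsilon>' r. 0 < \<epsilon> \<Longrightarrow> \<epsilon> \<le> \<epsilon>' \<Longrightarrow> r \<ge> 0 \<Longrightarrow> K \<epsilon>' r \<le> K \<epsilon> r"
    and K_lim: "\<And>r. r \<ge> 0 \<Longrightarrow> ((\<lambda>\<epsilon>. ennreal (K \<epsilon> r)) \<longlongrightarrow> K0 r) (at_right 0)"
    and K0_infinite: "(\<integral>\<^sup>+r\<in>{0..1}. (K0 r * ennreal (r ^ (CARD('n) - 1))) \<partial>lebesgue) = \<infinity>"
    and K0_tail: "(\<integral>\<^sup>+r\<in>{1..}. (K0 r * ennreal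
        (min (r powi (int CARD('n) - 2)) (r powi (int CARD('n) - 1)))) \<partial>lebesgue) < \<infinity>"
begin

definition cutoff :: "nat \<Rightarrow> real" where
  "cutoff n = inverse (real (Suc n))"

lemma cutoff_pos: "cutoff n > 0" by (simp add: cutoff_def)

lemma cutoff_mono: "n \<le> m \<Longrightarrow> cutoff m \<le> cutoff n"
  by (simp add: cutoff_def le_imp_inverse_le)

lemma cutoff_lim: "cutoff \<longlonglongrightarrow> 0" unfolding cutoff_def by (rule LIMSEQ_inverse_real_of_nat)

text \<open>Cutting the kernels off at the radius \<open>cutoff n\<close> makes the associated shift losses continuous in
  \<open>L\<^sup>1\<close>, while the masses still diverge.\<close>

definition \<kappa> :: "nat \<Rightarrow> real \<Rightarrow> ennreal" where
  "\<kappa> n r = ennreal (K (cutoff n) r) * indicator {cutoff n..} r"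

lemma eventually_less_cutoff: "\<forall>\<^sub>F \<epsilon> in at_right 0. 0 < \<epsilon> \<and> \<epsilon> < cutoff n"
  by (rule eventually_at_rightI[OF _ cutoff_pos]) simp

lemma K_tendsto: "r \<ge> 0 \<Longrightarrow> (\<lambda>n. ennreal (K (cutoff n) r)) \<longlonglongrightarrow> K0 r"
proof -
  assume "r \<ge> 0"
  moreover have "filterlim cutoff (at_right 0) sequentially"
    unfolding filterlim_at
  proof
    have "cutoff n \<in> {0<..} \<and> cutoff n \<noteq> 0" for n using cutoff_pos[of n] by simp
    then show "\<forall>\<^sub>F n in sequentially. cutoff n \<in> {0<..} \<and> cutoff n \<noteq> 0" by (simp add: always_eventually)
  qed (rule cutoff_lim)
  ultimately show ?thesis using filterlim_compose[OF K_lim] by blast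
qed

lemma K_le_K0:
  assumes "\<epsilon> > 0" "r \<ge> 0"
  shows "ennreal (K \<epsilon> r) \<le> K0 r"
proof -
  have "\<forall>\<^sub>F n in sequentially. cutoff n < \<epsilon>" by (rule order_tendstoD(2)[OF cutoff_lim assms(1)])
  then have "\<forall>\<^sub>F n in sequentially. ennreal (K \<epsilon> r) \<le> ennreal (K (cutoff n) r)"
    by eventually_elim (intro ennreal_leI K_mono cutoff_pos less_imp_le assms)
  then show ?thesis by (rule tendsto_lowerbound[OF K_tendsto[OF assms(2)]]) simp
qed

lemma kap_le_K: "0 < \<epsilon> \<Longrightarrow> \<epsilon> \<le> cutoff n \<Longrightarrow> r \<ge> 0 \<Longrightarrow> \<kappa> n r \<le> ennreal (K \<epsilon> r)"
  unfolding \<kappa>_def by (auto split: split_indicator intro!: ennreal_leI K_mono)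

lemma kap_mono: "n \<le> m \<Longrightarrow> r \<ge> 0 \<Longrightarrow> \<kappa> n r \<le> \<kappa> m r"
  using cutoff_mono[of n m] unfolding \<kappa>_def
  by (auto split: split_indicator intro!: ennreal_leI K_mono cutoff_pos)

text \<open>The cutoff radius eventually drops below \<open>r\<close> and the truncation disappears.
  At radius 0 every \<open>\<kappa> n\<close> vanishes; hence the restriction to
  \<open>r > 0\<close>, with the origin discarded later as a null set.\<close>

lemma kap_SUP:
  assumes "r > 0"
  shows "(SUP n. \<kappa> n r) = K0 r"
proof -
  have "\<forall>\<^sub>F n in sequentially. cutoff n < r" by (rule order_tendstoD(2)[OF cutoff_lim assms])
  then have "\<forall>\<^sub>F n in sequentially. \<kappa> n r = ennreal (K (cutoff n) r)"
    by eventually_elim (simp add: \<kappa>_def)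
  then have "(\<lambda>n. \<kappa> n r) \<longlonglongrightarrow> K0 r" using K_tendsto[of r] assms by (simp add: tendsto_cong)
  moreover have "(\<lambda>n. \<kappa> n r) \<longlonglongrightarrow> (SUP n. \<kappa> n r)"
    using kap_mono assms by (intro LIMSEQ_SUP) (auto simp: incseq_def)
  ultimately show ?thesis using LIMSEQ_unique by blast
qed

lemma Ke_meas: "\<epsilon> > 0 \<Longrightarrow> (\<lambda>z::real^'n. ennreal (K \<epsilon> (norm z))) \<in> borel_measurable lebesgue"
  using K_measurable by measurable

lemma kap_meas: "(\<lambda>z::real^'n. \<kappa> n (norm z)) \<in> borel_measurable lebesgue"
proof -
  have "(\<lambda>z::real^'n. indicator {cutoff n..} (norm z) :: ennreal) \<in> borel_measurable lebesgue"
    by (rule borel_imp_lebesgue_measurable) measurable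
  then show ?thesis unfolding \<kappa>_def by (intro borel_measurable_times_ennreal Ke_meas cutoff_pos)
qed

lemma K0_meas: "(\<lambda>z::real^'n. K0 (norm z)) \<in> borel_measurable lebesgue"
  by (rule borel_measurable_LIMSEQ_order[OF K_tendsto Ke_meas[OF cutoff_pos]]) simp

lemma kap_profile_finite: "profile_mass CARD('n) (\<kappa> n) < \<infinity>"
proof -
  have "profile_mass CARD('n) (\<kappa> n) \<le> profile_mass CARD('n) (\<lambda>r. ennreal (K (cutoff n) r))"
    unfolding profile_mass_def by (intro nn_integral_mono) (auto split: split_indicator simp: \<kappa>_def)
  also have "\<dots> < \<infinity>"
    by (rule kernel_mass_profile(1)) (auto intro: K_nonneg K_measurable K_L1 cutoff_pos)
  finally show ?thesis .
qed

definition kernel_mass_cut :: "nat \<Rightarrow> real" where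
  "kernel_mass_cut n = enn2real (profile_mass CARD('n) (\<kappa> n))"

lemma kernel_mass_cut: "profile_mass CARD('n) (\<kappa> n) = ennreal (kernel_mass_cut n)" "0 \<le> kernel_mass_cut n"
  using kap_profile_finite[of n] by (simp_all add: kernel_mass_cut_def less_top[symmetric])

text \<open>Monotone convergence: the truncated profiles increase to \<open>K0\<close>, whose mass
  on the unit interval is infinite.\<close>

lemma kernel_mass_cut_unbounded: "\<exists>n. B < kernel_mass_cut n"
proof (rule ccontr)
  assume "\<not> ?thesis"
  then have le: "kernel_mass_cut n \<le> B" for n by (simp add: not_less)
  let ?f = "\<lambda>n t. \<kappa> n t * ennreal (t ^ (CARD('n) - 1)) * indicator {0<..<1} t"
  have m: "?f n \<in> borel_measurable lebesgue" for n
  proof -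
    have "(\<lambda>t. ennreal (t ^ (CARD('n) - 1)) * indicator {0<..<1} t) \<in> borel_measurable lebesgue"
      by (rule borel_imp_lebesgue_measurable) measurable
    then have "(\<lambda>t. (\<kappa> n t * indicator {0<..} t) * (ennreal (t ^ (CARD('n) - 1)) * indicator {0<..<1} t)) \<in> borel_measurable lebesgue"
      by (rule borel_measurable_times_ennreal[OF radial_profile_measurable[OF kap_meas]])
    also have "(\<lambda>t. (\<kappa> n t * indicator {0<..} t) * (ennreal (t ^ (CARD('n) - 1)) * indicator {0<..<1} t)) = ?f n"
      by (auto simp: fun_eq_iff split: split_indicator)
    finally show ?thesis .
  qed
  have inc: "incseq ?f"
    by (auto simp: incseq_def le_fun_def split: split_indicator intro!: mult_right_mono kap_mono)
  have "\<infinity> = (\<integral>\<^sup>+r\<in>{0..1}. (K0 r * ennreal (r ^ (CARD('n) - 1))) \<partial>lebesgue)" by (rule K0_infinite[symmetric])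
  also have "\<dots> = (\<integral>\<^sup>+t. (SUP n. ?f n t) \<partial>lebesgue)"
    unfolding nn_integral_completion
  proof (rule nn_integral_cong_AE)
    have "AE t in lborel. t \<noteq> (0::real)" "AE t in lborel. t \<noteq> (1::real)" by (rule AE_lborel_singleton)+
    then show "AE t in lborel. K0 t * ennreal (t ^ (CARD('n) - 1)) * indicator {0..1} t = (SUP n. ?f n t)"
    proof eventually_elim
      case (elim t)
      show ?case
      proof (cases "t \<in> {0<..<1}")
        case True
        then show ?thesis using kap_SUP[of t] by (simp add: SUP_mult_right_ennreal[symmetric])
      next
        case False
        then show ?thesis using elim by (auto split: split_indicator)
      qed
    qed
  qed
  also have "\<dots> = (SUP n. integral\<^sup>N lebesgue (?f n))"
    by (rule nn_integral_monotone_convergence_SUP[OF inc m])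
  also have "\<dots> \<le> ennreal B"
  proof (rule SUP_least)
    fix n
    have "integral\<^sup>N lebesgue (?f n) = ennreal (kernel_mass_cut n)" using kernel_mass_cut(1)[of n] by (simp add: profile_mass_def)
    then show "integral\<^sup>N lebesgue (?f n) \<le> ennreal B" using le[of n] by (simp add: ennreal_leI)
  qed
  finally show False by (simp add: top_unique)
qed

text \<open>On the support of the truncated kernel \<open>1 / norm z\<close> is at most
  \<open>1 / cutoff n\<close>, and \<open>K (cutoff n)\<close> is integrable on the ball. Without
  truncation the quotient may fail to be integrable at the origin.\<close>

lemma kap_quotient_finite: "(\<integral>\<^sup>+z\<in>ball 0 1. \<kappa> n (norm z) * ennreal (1 / norm z) \<partial>(lebesgue :: (real^'n) measure)) < \<infinity>"
proof -
  have [measurable]: "ball (0::real^'n) 1 \<in> sets lebesgue" by simp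
  have Km[measurable]: "(\<lambda>z::real^'n. ennreal (K (cutoff n) (norm z))) \<in> borel_measurable lebesgue" by (rule Ke_meas[OF cutoff_pos])
  have "(\<integral>\<^sup>+z\<in>ball 0 1. \<kappa> n (norm z) * ennreal (1 / norm z) \<partial>(lebesgue :: (real^'n) measure))
     \<le> (\<integral>\<^sup>+z. ennreal (1 / cutoff n) * (ennreal (K (cutoff n) (norm z)) * indicator (ball 0 1) z) \<partial>(lebesgue :: (real^'n) measure))"
  proof (rule nn_integral_mono)
    fix z :: "real^'n"
    show "\<kappa> n (norm z) * ennreal (1 / norm z) * indicator (ball 0 1) z \<le> ennreal (1 / cutoff n) * (ennreal (K (cutoff n) (norm z)) * indicator (ball 0 1) z)"
    proof (cases "cutoff n \<le> norm z")
      case True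
      then have "ennreal (1 / norm z) \<le> ennreal (1 / cutoff n)"
        using cutoff_pos[of n] less_le_trans[OF cutoff_pos True] by (intro ennreal_leI divide_left_mono mult_pos_pos) auto
      then have "ennreal (K (cutoff n) (norm z)) * ennreal (1 / norm z) * indicator (ball 0 1) z \<le> ennreal (K (cutoff n) (norm z)) * ennreal (1 / cutoff n) * indicator (ball 0 1) z"
        by (intro mult_right_mono mult_left_mono) auto
      then show ?thesis using True by (simp add: \<kappa>_def mult_ac)
    next
      case False
      then show ?thesis by (simp add: \<kappa>_def)
    qed
  qed
  also have "\<dots> = ennreal (1 / cutoff n) * (\<integral>\<^sup>+z. ennreal (norm (indicator (ball 0 1) z *\<^sub>R K (cutoff n) (norm z))) \<partial>(lebesgue :: (real^'n) measure))"
    using K_nonneg[OF cutoff_pos] by (subst nn_integral_cmult) (measurable, auto intro!: arg_cong2[where f="(*)"] nn_integral_cong split: split_indicator)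
  also have "\<dots> < \<infinity>"
    using K_L1[OF cutoff_pos[of n]] unfolding set_integrable_def integrable_iff_bounded
    by (simp add: ennreal_mult_less_top del: nn_integral_completion)
  finally show ?thesis .
qed

text \<open>For radii at least 1 the minimum in the tail condition is the power d - 2, which is the
  radial weight \<open>t ^ (d - 1)\<close> divided by \<open>t\<close>.\<close>

lemma K0_tail_quotient_finite: "(\<integral>\<^sup>+z\<in>- ball 0 1. K0 (norm z) * ennreal (1 / norm z) \<partial>(lebesgue :: (real^'n) measure)) < \<infinity>"
proof -
  have m: "(\<lambda>z::real^'n. K0 (norm z) * ennreal (1 / norm z)) \<in> borel_measurable lebesgue"
    by (intro borel_measurable_times_ennreal K0_meas borel_imp_lebesgue_measurable[of "\<lambda>z::real^'n. ennreal (1 / norm z)"]) measurable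
  have "(\<integral>\<^sup>+z\<in>- ball 0 1. K0 (norm z) * ennreal (1 / norm z) \<partial>(lebesgue :: (real^'n) measure))
     = (\<integral>\<^sup>+z. K0 (norm z) * ennreal (1 / norm z) * indicator {1..} (norm z) \<partial>(lebesgue :: (real^'n) measure))"
    by (intro nn_integral_cong) (auto split: split_indicator)
  also have "\<dots> = ennreal (DIM(real^'n) * unit_ball_vol DIM(real^'n)) *
      (\<integral>\<^sup>+t\<in>{0<..} \<inter> {1..}. K0 t * ennreal (1 / t) * ennreal (t ^ (DIM(real^'n) - 1)) \<partial>lebesgue)"
    by (rule nn_integral_radial_measure[OF m]) simp
  also have "(\<integral>\<^sup>+t\<in>{0<..} \<inter> {1..}. K0 t * ennreal (1 / t) * ennreal (t ^ (DIM(real^'n) - 1)) \<partial>lebesgue)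
     = (\<integral>\<^sup>+r\<in>{1..}. (K0 r * ennreal (min (r powi (int CARD('n) - 2)) (r powi (int CARD('n) - 1)))) \<partial>lebesgue)"
  proof (rule nn_integral_cong)
    fix t :: real
    \<comment> \<open>Integer powers appear because the exponent is -1 in dimension 1.\<close>
    have "1 / t * t ^ (CARD('n) - 1) = min (t powi (int CARD('n) - 2)) (t powi (int CARD('n) - 1))" if t: "t \<ge> 1"
    proof -
      have card1: "CARD('n) \<ge> 1" by (simp add: Suc_leI)
      have a: "t powi (int CARD('n) - 1) = t ^ (CARD('n) - 1)" using card1 by (simp add: power_int_def nat_diff_distrib)
      have b: "t powi (int CARD('n) - 2) = t powi (int CARD('n) - 1) / t"
        using t power_int_diff[of t "int CARD('n) - 1" 1] by simp
      have "t powi (int CARD('n) - 2) \<le> t powi (int CARD('n) - 1)"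
        unfolding b a using t by (simp add: divide_le_eq mult_left_mono[of 1 t "t ^ (CARD('n) - 1)", simplified])
      then show ?thesis using a b by simp
    qed
    then show "K0 t * ennreal (1 / t) * ennreal (t ^ (DIM(real^'n) - 1)) * indicator ({0<..} \<inter> {1..}) t
      = K0 t * ennreal (min (t powi (int CARD('n) - 2)) (t powi (int CARD('n) - 1))) * indicator {1..} t"
      by (cases "t \<ge> 1") (auto simp: mult.assoc ennreal_mult[symmetric])
  qed
  also have "ennreal (DIM(real^'n) * unit_ball_vol DIM(real^'n)) * \<dots> < \<infinity>"
    using K0_tail by (simp add: ennreal_mult_less_top del: nn_integral_completion)
  finally show ?thesis .
qed

definition inner_quotient :: "nat \<Rightarrow> real" where
  "inner_quotient n = enn2real (\<integral>\<^sup>+z\<in>ball 0 1. \<kappa> n (norm z) * ennreal (1 / norm z) \<partial>(lebesgue :: (real^'n) measure))"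

definition tail_quotient :: real where
  "tail_quotient = enn2real (\<integral>\<^sup>+z\<in>- ball 0 1. K0 (norm z) * ennreal (1 / norm z) \<partial>(lebesgue :: (real^'n) measure))"

lemma inner_quotient: "(\<integral>\<^sup>+z\<in>ball 0 1. \<kappa> n (norm z) * ennreal (1 / norm z) \<partial>(lebesgue :: (real^'n) measure)) = ennreal (inner_quotient n)" "0 \<le> inner_quotient n"
  using kap_quotient_finite[of n] by (simp_all add: inner_quotient_def less_top[symmetric] del: nn_integral_completion)

lemma tail_quotient: "(\<integral>\<^sup>+z\<in>- ball 0 1. K0 (norm z) * ennreal (1 / norm z) \<partial>(lebesgue :: (real^'n) measure)) = ennreal tail_quotient" "0 \<le> tail_quotient"
  using K0_tail_quotient_finite by (simp_all add: tail_quotient_def less_top[symmetric] del: nn_integral_completion)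

definition inner_val :: "nat \<Rightarrow> (real^'n \<Rightarrow> real) \<Rightarrow> real" where "inner_val n u = enn2real (inner_energy l (\<kappa> n) u)"
definition loss_val :: "nat \<Rightarrow> (real^'n \<Rightarrow> real) \<Rightarrow> real" where "loss_val n u = enn2real (inner_loss l (\<kappa> n) u)"
definition tail_val :: "(real^'n \<Rightarrow> real) \<Rightarrow> real" where "tail_val u = enn2real (tail_loss l K0 u)"
text \<open>The integral of \<open>\<bar>w \<bullet> \<sigma>\<bar>\<close> over the unit sphere,
  for any unit vector \<open>\<sigma>\<close>.\<close>

definition sphere_const :: real where "sphere_const = 2 * unit_ball_vol (real (CARD('n) - 1))"
definition energy_scale :: real where "energy_scale = 1 / (2 * l ^ CARD('n))"

lemma sphere_const_pos: "sphere_const > 0" by (simp add: sphere_const_def)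
lemma energy_scale_pos: "energy_scale > 0" using l_pos by (simp add: energy_scale_def)

lemma inner_val_nonneg: "0 \<le> inner_val n u" by (simp add: inner_val_def)
lemma tail_val_nonneg: "0 \<le> tail_val u" by (simp add: tail_val_def)

text \<open>In real numbers the identity is used both ways: it bounds the variation by inner energy
  and loss, and it expresses the inner energy as a multiple of the variation minus an L1-continuous
  loss.\<close>

lemma inner_val_plus_loss_val:
  fixes u :: "real^'n \<Rightarrow> real"
  assumes u: "u \<in> BV01 l"
  shows "inner_energy l (\<kappa> n) u = ennreal (inner_val n u)" "inner_val n u + loss_val n u = sphere_const * tv l u * kernel_mass_cut n"
proof -
  have s: "inner_energy l (\<kappa> n) u + inner_loss l (\<kappa> n) u = ennreal (sphere_const * tv l u * kernel_mass_cut n)"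
    using inner_energy_plus_loss[OF l_pos u kap_meas[of n]] kernel_mass_cut[of n] tv_nonneg[of l u]
    by (simp add: sphere_const_def ennreal_mult')
  obtain I where I: "inner_energy l (\<kappa> n) u = ennreal I" "I \<ge> 0" using s by (cases "inner_energy l (\<kappa> n) u") auto
  obtain J where J: "inner_loss l (\<kappa> n) u = ennreal J" "J \<ge> 0" using s by (cases "inner_loss l (\<kappa> n) u") auto
  show "inner_energy l (\<kappa> n) u = ennreal (inner_val n u)" using I by (simp add: inner_val_def)
  show "inner_val n u + loss_val n u = sphere_const * tv l u * kernel_mass_cut n"
    using s kernel_mass_cut[of n] tv_nonneg[of l u] sphere_const_pos I J by (simp add: inner_val_def loss_val_def ennreal_plus[symmetric] del: ennreal_plus)
qed

lemma ball_lebesgue: "ball (0::real^'n) 1 \<in> sets lebesgue" "- ball (0::real^'n) 1 \<in> sets lebesgue"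
  by auto

lemma loss_val_continuous:
  fixes u v :: "real^'n \<Rightarrow> real"
  assumes "u \<in> BV01 l" "v \<in> BV01 l"
  shows "\<bar>loss_val n u - loss_val n v\<bar> \<le> 2 * inner_quotient n * L1_dist l u v"
  unfolding loss_val_def inner_loss_def
  by (rule shift_loss_L1_continuous[OF l_pos assms ball_lebesgue(1) kap_meas inner_quotient])

lemma tail_val_continuous:
  fixes u v :: "real^'n \<Rightarrow> real"
  assumes "u \<in> BV01 l" "v \<in> BV01 l"
  shows "\<bar>tail_val u - tail_val v\<bar> \<le> 2 * tail_quotient * L1_dist l u v"
  unfolding tail_val_def tail_loss_def
  by (rule shift_loss_L1_continuous[OF l_pos assms ball_lebesgue(2) K0_meas tail_quotient])

lemma tail_val:
  fixes u :: "real^'n \<Rightarrow> real"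
  assumes u: "u \<in> BV01 l"
  shows "tail_loss l K0 u = ennreal (tail_val u)" "tail_val u \<le> l ^ CARD('n) * tail_quotient"
proof -
  have le: "tail_loss l K0 u \<le> ennreal (l ^ CARD('n) * tail_quotient)"
    using shift_loss_bound[OF l_pos u ball_lebesgue(2) K0_meas] tail_quotient l_pos by (simp add: tail_loss_def ennreal_mult)
  then have "tail_loss l K0 u < \<infinity>" by (rule le_less_trans) simp
  then show eq: "tail_loss l K0 u = ennreal (tail_val u)" by (simp add: tail_val_def less_top[symmetric])
  show "tail_val u \<le> l ^ CARD('n) * tail_quotient"
    using le tail_quotient(2) l_pos unfolding eq by (subst (asm) ennreal_le_iff) auto
qed

lemma loss_val_bound:
  fixes u :: "real^'n \<Rightarrow> real"
  assumes u: "u \<in> BV01 l"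
  shows "loss_val n u \<le> l ^ CARD('n) * inner_quotient n"
proof -
  have le: "inner_loss l (\<kappa> n) u \<le> ennreal (l ^ CARD('n) * inner_quotient n)"
    using shift_loss_bound[OF l_pos u ball_lebesgue(1) kap_meas, of n] inner_quotient[of n] l_pos by (simp add: inner_loss_def ennreal_mult)
  then have "enn2real (inner_loss l (\<kappa> n) u) \<le> enn2real (ennreal (l ^ CARD('n) * inner_quotient n))" by (rule enn2real_mono) simp
  then show ?thesis using inner_quotient(2)[of n] l_pos by (simp add: loss_val_def)
qed

lemma energy_eq_split:
  fixes u :: "real^'n \<Rightarrow> real"
  assumes u: "u \<in> BV01 l" and e: "\<epsilon> > 0"
  shows "energy l (K \<epsilon>) u = split_energy l (\<lambda>r. ennreal (K \<epsilon> r)) u"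
    and "tail_loss l (\<lambda>r. ennreal (K \<epsilon> r)) u \<le> ennreal (tail_val u)"
proof -
  show le: "tail_loss l (\<lambda>r. ennreal (K \<epsilon> r)) u \<le> ennreal (tail_val u)"
    unfolding tail_val(1)[OF u, symmetric] by (intro tail_loss_mono K_le_K0 e)
  then have "tail_loss l (\<lambda>r. ennreal (K \<epsilon> r)) u < \<infinity>" by (rule le_less_trans) simp
  then show "energy l (K \<epsilon>) u = split_energy l (\<lambda>r. ennreal (K \<epsilon> r)) u"
    using K_nonneg[OF e] K_measurable[OF e] K_L1[OF e] by (intro energy_split l_pos u) auto
qed

lemma limit_eq_split:
  fixes u :: "real^'n \<Rightarrow> real"
  assumes u: "u \<in> BV01 l"
  shows "limit_energy l K0 u = enn2ereal (ennreal energy_scale * inner_energy l K0 u) - ereal (energy_scale * tail_val u)"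
proof -
  have "limit_energy l K0 u = split_energy l K0 u"
    by (rule limit_energy_split[OF l_pos u K0_meas]) (simp add: tail_val(1)[OF u])
  also have "\<dots> = enn2ereal (ennreal energy_scale * inner_energy l K0 u) - ereal (energy_scale * tail_val u)"
    using energy_scale_pos tail_val_nonneg[of u] by (simp add: split_energy_def energy_scale_def[symmetric] tail_val(1)[OF u] ennreal_mult'[symmetric] enn2ereal_ennreal)
  finally show ?thesis .
qed

text \<open>For these \<epsilon> the truncated kernel lies below \<open>K \<epsilon>\<close>, and
  the tail is at most that of \<open>K0\<close>; the resulting lower bound does not depend on
  \<epsilon>.\<close>

lemma energy_lower:
  fixes u :: "real^'n \<Rightarrow> real"
  assumes u: "u \<in> BV01 l" and e: "0 < \<epsilon>" "\<epsilon> \<le> cutoff n"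
  shows "ereal (energy_scale * inner_val n u - energy_scale * tail_val u) \<le> energy l (K \<epsilon>) u"
proof -
  let ?K = "\<lambda>r. ennreal (K \<epsilon> r)"
  obtain T where T: "tail_loss l ?K u = ennreal T" "T \<ge> 0" "T \<le> tail_val u"
    using energy_eq_split(2)[OF u e(1)] tail_val_nonneg[of u]
    by (cases "tail_loss l ?K u") (auto simp: ennreal_le_iff top_unique)
  have "ennreal (energy_scale * inner_val n u) \<le> ennreal energy_scale * inner_energy l ?K u"
  proof -
    have "inner_energy l (\<kappa> n) u \<le> inner_energy l ?K u" by (intro inner_energy_mono kap_le_K e)
    then show ?thesis using energy_scale_pos inner_val_nonneg by (simp add: inner_val_plus_loss_val(1)[OF u] ennreal_mult mult_left_mono)
  qed
  then have "enn2ereal (ennreal (energy_scale * inner_val n u)) \<le> enn2ereal (ennreal energy_scale * inner_energy l ?K u)" by (simp add: less_eq_ennreal.rep_eq)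
  then have a: "ereal (energy_scale * inner_val n u) \<le> enn2ereal (ennreal energy_scale * inner_energy l ?K u)"
    using energy_scale_pos inner_val_nonneg[of n u] by (simp add: enn2ereal_ennreal)
  have "energy l (K \<epsilon>) u = enn2ereal (ennreal energy_scale * inner_energy l ?K u) - ereal (energy_scale * T)"
    unfolding energy_eq_split(1)[OF u e(1)] split_energy_def energy_scale_def[symmetric] T(1)
    using energy_scale_pos T(2) by (simp add: ennreal_mult[symmetric] enn2ereal_ennreal)
  moreover have "ereal (energy_scale * inner_val n u) - ereal (energy_scale * tail_val u) \<le> enn2ereal (ennreal energy_scale * inner_energy l ?K u) - ereal (energy_scale * T)"
    using a T(3) energy_scale_pos by (intro ereal_minus_mono) auto
  ultimately show ?thesis by simp
qed

lemma inner_val_bound: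
  fixes u :: "real^'n \<Rightarrow> real"
  assumes u: "u \<in> BV01 l" and e: "0 < \<epsilon>" "\<epsilon> \<le> cutoff n" and A: "energy l (K \<epsilon>) u \<le> ereal A"
  shows "inner_val n u \<le> A / energy_scale + tail_val u"
proof -
  have "ereal (energy_scale * inner_val n u - energy_scale * tail_val u) \<le> ereal A" using energy_lower[OF u e] A by (rule order_trans)
  then have "energy_scale * (inner_val n u - tail_val u) \<le> A" by (simp add: right_diff_distrib)
  then have "inner_val n u - tail_val u \<le> A / energy_scale" using energy_scale_pos by (simp add: pos_le_divide_eq mult.commute)
  then show ?thesis by simp
qed

text \<open>One truncated kernel of positive mass is enough: the inner energy is bounded through the
  energy and the tail, loss and tail through the volume, and the sum identity converts this into a
  bound on the variation.\<close>

lemma tv_bound: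
  assumes pos: "kernel_mass_cut n > 0"
  obtains C where "\<And>u \<epsilon>. u \<in> BV01 l \<Longrightarrow> 0 < \<epsilon> \<Longrightarrow> \<epsilon> \<le> cutoff n \<Longrightarrow> energy l (K \<epsilon>) u \<le> ereal A \<Longrightarrow> tv l (u :: real^'n \<Rightarrow> real) \<le> C"
proof -
  let ?C = "(A / energy_scale + l ^ CARD('n) * tail_quotient + l ^ CARD('n) * inner_quotient n) / (sphere_const * kernel_mass_cut n)"
  have "tv l u \<le> ?C" if u: "u \<in> BV01 l" and e: "0 < \<epsilon>" "\<epsilon> \<le> cutoff n" "energy l (K \<epsilon>) u \<le> ereal A" for u :: "real^'n \<Rightarrow> real" and \<epsilon>
  proof -
    have "tv l u * (sphere_const * kernel_mass_cut n) = inner_val n u + loss_val n u" using inner_val_plus_loss_val(2)[OF u, of n] by (simp add: mult_ac)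
    also have "\<dots> \<le> A / energy_scale + l ^ CARD('n) * tail_quotient + l ^ CARD('n) * inner_quotient n"
      using inner_val_bound[OF u e] tail_val(2)[OF u] loss_val_bound[OF u, of n] by linarith
    finally show ?thesis using pos sphere_const_pos by (simp add: pos_le_divide_eq)
  qed
  then show thesis by (rule that)
qed

text \<open>Monotone convergence along the truncated kernels, the origin being a null set.\<close>

lemma inner_energy_SUP:
  fixes u :: "real^'n \<Rightarrow> real"
  assumes u: "u \<in> BV01 l"
  shows "inner_energy l K0 u = (SUP n. inner_energy l (\<kappa> n) u)"
proof -
  let ?f = "\<lambda>n z. \<kappa> n (norm z) * ennreal (gap l u z) * indicator (ball 0 1) z"
  have g[measurable]: "gap l u \<in> borel_measurable lebesgue" by (rule borel_imp_lebesgue_measurable[OF gap_measurable[OF l_pos u]])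
  note ball_lebesgue[measurable]
  have m: "?f n \<in> borel_measurable lebesgue" for n using kap_meas[of n] by measurable
  have inc: "incseq ?f"
    by (auto simp: incseq_def le_fun_def intro!: mult_right_mono kap_mono)
  have "inner_energy l K0 u = (\<integral>\<^sup>+z. (SUP n. ?f n z) \<partial>lebesgue)"
    unfolding inner_energy_def nn_integral_completion
  proof (rule nn_integral_cong_AE)
    have "AE z in lborel. z \<noteq> (0::real^'n)" by (rule AE_lborel_singleton)
    then show "AE z in lborel. K0 (norm z) * ennreal (gap l u z) * indicator (ball 0 1) z = (SUP n. ?f n z)"
      by eventually_elim (simp add: SUP_mult_right_ennreal[symmetric] kap_SUP)
  qed
  also have "\<dots> = (SUP n. integral\<^sup>N lebesgue (?f n))"
    by (rule nn_integral_monotone_convergence_SUP[OF inc m])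
  finally show ?thesis by (simp add: inner_energy_def)
qed

lemma tail_loss_SUP:
  fixes u :: "real^'n \<Rightarrow> real"
  assumes u: "u \<in> BV01 l"
  shows "tail_loss l K0 u = (SUP n. tail_loss l (\<kappa> n) u)"
proof -
  let ?f = "\<lambda>n z. \<kappa> n (norm z) * ennreal (shift_difference l u z / norm z) * indicator (- ball 0 1) z"
  have g[measurable]: "(\<lambda>z. shift_difference l u z / norm z) \<in> borel_measurable lebesgue"
    by (rule borel_imp_lebesgue_measurable[OF shift_quotient_measurable[OF l_pos u]])
  note ball_lebesgue[measurable]
  have m: "?f n \<in> borel_measurable lebesgue" for n using kap_meas[of n] by measurable
  have inc: "incseq ?f"
    by (auto simp: incseq_def le_fun_def intro!: mult_right_mono kap_mono)
  have "tail_loss l K0 u = (\<integral>\<^sup>+z. (SUP n. ?f n z) \<partial>lebesgue)"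
    unfolding tail_loss_def nn_integral_completion
  proof (rule nn_integral_cong_AE)
    have "AE z in lborel. z \<noteq> (0::real^'n)" by (rule AE_lborel_singleton)
    then show "AE z in lborel. K0 (norm z) * ennreal (shift_difference l u z / norm z) * indicator (- ball 0 1) z = (SUP n. ?f n z)"
      by eventually_elim (simp add: SUP_mult_right_ennreal[symmetric] kap_SUP)
  qed
  also have "\<dots> = (SUP n. integral\<^sup>N lebesgue (?f n))"
    by (rule nn_integral_monotone_convergence_SUP[OF inc m])
  finally show ?thesis by (simp add: tail_loss_def)
qed

section \<open>Compactness and Gamma-convergence\<close>

text \<open>Lower semicontinuity gives one half of the convergence of variations. For the other,
  \<open>sphere_const * kernel_mass_cut n\<close> times the excess is at most a constant independent
  of \<open>n\<close> plus an error that vanishes in L1 for fixed \<open>n\<close>; so the mass is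
  chosen large before the index \<open>j\<close>.\<close>

lemma BV_compactness:
  fixes u :: "real \<Rightarrow> real^'n \<Rightarrow> real" and e :: "nat \<Rightarrow> real"
  assumes u: "\<And>\<epsilon>. \<epsilon> > 0 \<Longrightarrow> u \<epsilon> \<in> BV01 l" and A: "\<And>\<epsilon>. \<epsilon> > 0 \<Longrightarrow> energy l (K \<epsilon>) (u \<epsilon>) \<le> ereal A"
    and e: "\<And>j. 0 < e j" "e \<longlonglongrightarrow> 0"
  shows "\<exists>v\<in>BV01 l. \<exists>s :: nat \<Rightarrow> nat. strict_mono s \<and> (\<lambda>j. L1_dist l (u (e (s j))) v) \<longlonglongrightarrow> 0
    \<and> (\<lambda>j. total_variation l (u (e (s j)))) \<longlonglongrightarrow> total_variation l v"
proof -
  have small: "\<exists>j0. \<forall>j\<ge>j0. e j \<le> cutoff n" for n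
    using order_tendstoD(2)[OF e(2) cutoff_pos[of n]] by (auto simp: eventually_sequentially intro: less_imp_le)
  obtain n0 where "kernel_mass_cut n0 > 0" using kernel_mass_cut_unbounded by blast
  then obtain C where C: "\<And>u \<epsilon>. u \<in> BV01 l \<Longrightarrow> 0 < \<epsilon> \<Longrightarrow> \<epsilon> \<le> cutoff n0 \<Longrightarrow> energy l (K \<epsilon>) u \<le> ereal A \<Longrightarrow> tv l (u :: real^'n \<Rightarrow> real) \<le> C"
    using tv_bound by blast
  obtain j0 where j0: "\<And>j. j \<ge> j0 \<Longrightarrow> e j \<le> cutoff n0" using small by blast
  obtain v s where v: "v \<in> BV01 l" and s: "strict_mono (s :: nat \<Rightarrow> nat)" and conv: "(\<lambda>j. L1_dist l (u (e (s j + j0))) v) \<longlonglongrightarrow> 0"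
  proof -
    have "tv l (u (e (j + j0))) \<le> C" for j by (rule C[OF u[OF e(1)] e(1) j0 A[OF e(1)]]) simp
    from BV01_compact[where u="\<lambda>j. u (e (j + j0))", OF l_pos u[OF e(1)] this] show thesis using that by blast
  qed
  define s' where "s' j = s j + j0" for j
  have s': "strict_mono s'" using s by (simp add: s'_def strict_mono_def)
  let ?u = "\<lambda>j. u (e (s' j))"
  have conv': "(\<lambda>j. L1_dist l (?u j) v) \<longlonglongrightarrow> 0" using conv by (simp add: s'_def)
  have uB: "?u j \<in> BV01 l" for j using u e(1) by simp
  have "(\<lambda>j. tv l (?u j)) \<longlonglongrightarrow> tv l v"
  proof (rule order_tendstoI)
    fix a assume "a < tv l v"
    then show "\<forall>\<^sub>F j in sequentially. a < tv l (?u j)"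
      using tv_lsc[OF l_pos uB v conv', of "tv l v - a"] by simp
  next
    fix a assume "tv l v < a"
    define h where "h = a - tv l v"
    have h: "h > 0" using \<open>tv l v < a\<close> by (simp add: h_def)
    \<comment> \<open>A bound for \<open>inner_val\<close> that is uniform in \<open>n\<close>, in
      contrast to the bound on the loss.\<close>
    define A' where "A' = A / energy_scale + l ^ CARD('n) * tail_quotient"
    \<comment> \<open>With this mass \<open>A'\<close> takes less than half of
      \<open>sphere_const * kernel_mass_cut n * h\<close>; the other half is left for the L1
      error.\<close>
    obtain n where n: "kernel_mass_cut n > max 0 (2 * A' / (sphere_const * h))" using kernel_mass_cut_unbounded by blast
    then have pn: "kernel_mass_cut n > 0" "2 * A' / (sphere_const * h) < kernel_mass_cut n" by auto
    have A'p: "A' < sphere_const * kernel_mass_cut n * (h / 2)"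
      using pn(2) sphere_const_pos h by (simp add: divide_less_eq field_simps)
    have "(\<lambda>j. 2 * inner_quotient n * L1_dist l (?u j) v) \<longlonglongrightarrow> 2 * inner_quotient n * 0" by (intro tendsto_intros conv')
    from order_tendstoD(2)[OF this, of "sphere_const * kernel_mass_cut n * (h / 2)"] pn(1) sphere_const_pos h
    have ev1: "\<forall>\<^sub>F j in sequentially. 2 * inner_quotient n * L1_dist l (?u j) v < sphere_const * kernel_mass_cut n * (h / 2)" by simp
    obtain j1 where "\<And>j. j \<ge> j1 \<Longrightarrow> e j \<le> cutoff n" using small by blast
    then have ev2: "\<forall>\<^sub>F j in sequentially. e (s' j) \<le> cutoff n"
      using seq_suble[OF s'] by (auto simp: eventually_sequentially intro!: exI[of _ j1] dest: le_trans)
    from ev1 ev2 show "\<forall>\<^sub>F j in sequentially. tv l (?u j) < a"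
    proof eventually_elim
      case (elim j)
      have "sphere_const * kernel_mass_cut n * tv l (?u j) = inner_val n (?u j) + loss_val n (?u j)" using inner_val_plus_loss_val(2)[OF uB, of n j] by (simp add: mult_ac)
      also have "inner_val n (?u j) \<le> A'"
        using inner_val_bound[OF uB e(1) elim(2) A[OF e(1)]] tail_val(2)[OF uB[of j]] by (simp add: A'_def)
      also have "loss_val n (?u j) \<le> loss_val n v + 2 * inner_quotient n * L1_dist l (?u j) v"
        using loss_val_continuous[OF uB v, of n j] by (simp add: abs_le_iff)
      \<comment> \<open>The inner energy of \<open>v\<close> is nonnegative, so the loss is at most
        the full product.\<close>
      also have "loss_val n v \<le> sphere_const * kernel_mass_cut n * tv l v" using inner_val_plus_loss_val(2)[OF v, of n] inner_val_nonneg[of n v] by (simp add: mult_ac)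
      finally have "sphere_const * kernel_mass_cut n * tv l (?u j) < sphere_const * kernel_mass_cut n * (tv l v + h)"
        using elim(1) A'p by (simp add: distrib_left)
      then show ?case using pn(1) sphere_const_pos by (simp add: h_def)
    qed
  qed
  then have "(\<lambda>j. total_variation l (?u j)) \<longlonglongrightarrow> total_variation l v"
    by (simp add: BV01_tv[OF uB] BV01_tv[OF v])
  then show ?thesis using v s' conv' by blast
qed

text \<open>For fixed \<open>n\<close> the inner energy of the truncated kernel is a multiple of the
  variation minus a continuous loss, hence lower semicontinuous, and the tail is continuous. The
  bound by \<open>a\<close> thus passes to \<open>v\<close> for every \<open>n\<close>, and the
  supremum over \<open>n\<close> recovers \<open>K0\<close>.\<close>

lemma liminf_sequence:
  fixes u :: "nat \<Rightarrow> real^'n \<Rightarrow> real" and e :: "nat \<Rightarrow> real"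
  assumes u: "\<And>j. u j \<in> BV01 l" and A: "\<And>j. energy l (K (e j)) (u j) \<le> ereal a"
    and e: "\<And>j. 0 < e j" "e \<longlonglongrightarrow> 0" and v: "v \<in> torus_L1 l" and conv: "(\<lambda>j. L1_dist l (u j) v) \<longlonglongrightarrow> 0"
  shows "limit_energy l K0 v \<le> ereal a"
proof -
  have small: "\<exists>j0. \<forall>j\<ge>j0. e j \<le> cutoff n" for n
    using order_tendstoD(2)[OF e(2) cutoff_pos[of n]] by (auto simp: eventually_sequentially intro: less_imp_le)
  obtain n0 where "kernel_mass_cut n0 > 0" using kernel_mass_cut_unbounded by blast
  then obtain C where C: "\<And>u \<epsilon>. u \<in> BV01 l \<Longrightarrow> 0 < \<epsilon> \<Longrightarrow> \<epsilon> \<le> cutoff n0 \<Longrightarrow> energy l (K \<epsilon>) u \<le> ereal a \<Longrightarrow> tv l (u :: real^'n \<Rightarrow> real) \<le> C"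
    using tv_bound by blast
  obtain j0 where j0: "\<And>j. j \<ge> j0 \<Longrightarrow> e j \<le> cutoff n0" using small by blast
  have vB: "v \<in> BV01 l"
  proof (rule BV01_closed[OF l_pos, of "\<lambda>j. u (j + j0)" C])
    show "(\<lambda>j. L1_dist l (u (j + j0)) v) \<longlonglongrightarrow> 0" by (rule LIMSEQ_ignore_initial_segment[OF conv])
    show "tv l (u (j + j0)) \<le> C" for j by (rule C[OF u e(1) j0 A]) simp
  qed (use u v in auto)
  have main: "energy_scale * inner_val n v - energy_scale * tail_val v \<le> a" for n
  proof (rule field_le_epsilon)
    fix h :: real assume h: "h > 0"
    \<comment> \<open>The summand 1 covers a vanishing mass. A drop of the variation by
      \<open>eta\<close> costs at most \<open>h / 2\<close>, and the L1 errors take the other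
      half.\<close>
    define eta where "eta = h / (2 * (energy_scale * sphere_const * kernel_mass_cut n + 1))"
    have cop: "energy_scale * sphere_const * kernel_mass_cut n \<ge> 0" using energy_scale_pos sphere_const_pos kernel_mass_cut(2)[of n] by simp
    have eta: "eta > 0" "energy_scale * sphere_const * kernel_mass_cut n * eta \<le> h / 2"
    proof -
      show "eta > 0" using h cop by (simp add: eta_def)
      have "energy_scale * sphere_const * kernel_mass_cut n * eta \<le> (energy_scale * sphere_const * kernel_mass_cut n + 1) * eta" using \<open>eta > 0\<close> by (intro mult_right_mono) auto
      also have "\<dots> = h / 2"
      proof -
        have "(X + 1) * (h / (2 * (X + 1))) = h / 2" if "X \<ge> 0" for X :: real using that by (simp add: field_simps)
        from this[OF cop] show ?thesis by (simp add: eta_def)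
      qed
      finally show "energy_scale * sphere_const * kernel_mass_cut n * eta \<le> h / 2" .
    qed
    have "(\<lambda>j. energy_scale * (2 * inner_quotient n + 2 * tail_quotient) * L1_dist l (u j) v) \<longlonglongrightarrow> energy_scale * (2 * inner_quotient n + 2 * tail_quotient) * 0" by (intro tendsto_intros conv)
    from order_tendstoD(2)[OF this, of "h / 2"] h
    have ev1: "\<forall>\<^sub>F j in sequentially. energy_scale * (2 * inner_quotient n + 2 * tail_quotient) * L1_dist l (u j) v < h / 2" by simp
    have ev2: "\<forall>\<^sub>F j in sequentially. e j \<le> cutoff n" using small[of n] by (auto simp: eventually_sequentially)
    have ev3: "\<forall>\<^sub>F j in sequentially. tv l v - eta < tv l (u j)" by (rule tv_lsc[OF l_pos u vB conv eta(1)])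
    have "\<forall>\<^sub>F j in sequentially. energy_scale * inner_val n v - energy_scale * tail_val v \<le> a + h"
      using ev1 ev2 ev3
    proof eventually_elim
      case (elim j)
      have "ereal (energy_scale * inner_val n (u j) - energy_scale * tail_val (u j)) \<le> ereal a"
        using energy_lower[OF u e(1) elim(2)] A by (rule order_trans)
      then have 1: "energy_scale * inner_val n (u j) - energy_scale * tail_val (u j) \<le> a" by simp
      have "sphere_const * kernel_mass_cut n * (tv l v - eta) \<le> sphere_const * kernel_mass_cut n * tv l (u j)"
        using elim(3) sphere_const_pos kernel_mass_cut(2)[of n] by (intro mult_left_mono) auto
      then have "inner_val n v - sphere_const * kernel_mass_cut n * eta + loss_val n v \<le> inner_val n (u j) + loss_val n (u j)"
        using inner_val_plus_loss_val(2)[OF u, of n j] inner_val_plus_loss_val(2)[OF vB, of n] by (simp add: right_diff_distrib mult_ac)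
      then have "inner_val n v - sphere_const * kernel_mass_cut n * eta - 2 * inner_quotient n * L1_dist l (u j) v \<le> inner_val n (u j)"
        using loss_val_continuous[OF u vB, of n j] by (simp add: abs_le_iff)
      from mult_left_mono[OF this, of energy_scale] energy_scale_pos
      have 2: "energy_scale * inner_val n v - energy_scale * sphere_const * kernel_mass_cut n * eta - energy_scale * (2 * inner_quotient n * L1_dist l (u j) v) \<le> energy_scale * inner_val n (u j)"
        by (simp add: right_diff_distrib mult_ac)
      have "tail_val (u j) \<le> tail_val v + 2 * tail_quotient * L1_dist l (u j) v" using tail_val_continuous[OF u vB, of j] by (simp add: abs_le_iff)
      from mult_left_mono[OF this, of energy_scale] energy_scale_pos
      have 3: "energy_scale * tail_val (u j) \<le> energy_scale * tail_val v + energy_scale * (2 * tail_quotient * L1_dist l (u j) v)" by (simp add: distrib_left)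
      have 4: "energy_scale * (2 * inner_quotient n * L1_dist l (u j) v) + energy_scale * (2 * tail_quotient * L1_dist l (u j) v) < h / 2"
        using elim(1) by (simp add: algebra_simps)
      show ?case using 1 2 3 4 eta(2) by linarith
    qed
    then show "energy_scale * inner_val n v - energy_scale * tail_val v \<le> a + h" by (simp add: eventually_const)
  qed
  have i: "inner_val n v \<le> (a + energy_scale * tail_val v) / energy_scale" for n
    using main[of n] energy_scale_pos by (simp add: pos_le_divide_eq mult.commute)
  have x0: "0 \<le> (a + energy_scale * tail_val v) / energy_scale" using i[of 0] inner_val_nonneg[of 0 v] by linarith
  have "inner_energy l K0 v \<le> ennreal ((a + energy_scale * tail_val v) / energy_scale)"
    unfolding inner_energy_SUP[OF vB] inner_val_plus_loss_val(1)[OF vB] using i by (intro SUP_least ennreal_leI)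
  then have "ennreal energy_scale * inner_energy l K0 v \<le> ennreal energy_scale * ennreal ((a + energy_scale * tail_val v) / energy_scale)" by (rule mult_left_mono) simp
  also have "\<dots> = ennreal (a + energy_scale * tail_val v)" using energy_scale_pos x0 by (simp add: ennreal_mult[symmetric])
  finally have "enn2ereal (ennreal energy_scale * inner_energy l K0 v) \<le> enn2ereal (ennreal (a + energy_scale * tail_val v))" by (simp add: less_eq_ennreal.rep_eq)
  also have "\<dots> = ereal (a + energy_scale * tail_val v)" using x0 energy_scale_pos by (simp add: enn2ereal_ennreal zero_le_divide_iff)
  finally have "enn2ereal (ennreal energy_scale * inner_energy l K0 v) - ereal (energy_scale * tail_val v) \<le> ereal (a + energy_scale * tail_val v) - ereal (energy_scale * tail_val v)"
    by (rule ereal_minus_mono) simp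
  then show ?thesis by (simp add: limit_eq_split[OF vB])
qed

text \<open>A violation leaves room for a real \<open>a\<close> below the limit energy that is
  undercut at arbitrarily small \<epsilon>; picking such values below the cutoffs reduces the claim
  to sequences.\<close>

lemma gamma_liminf:
  fixes y :: "real \<Rightarrow> real^'n \<Rightarrow> real"
  assumes x: "x \<in> torus_L1 l" and conv: "((\<lambda>\<epsilon>. L1_dist l (y \<epsilon>) x) \<longlongrightarrow> 0) (at_right 0)"
  shows "limit_energy l K0 x \<le> Liminf (at_right 0) (\<lambda>\<epsilon>. energy l (K \<epsilon>) (y \<epsilon>))"
proof (rule ccontr)
  assume "\<not> ?thesis"
  then obtain a where a: "Liminf (at_right 0) (\<lambda>\<epsilon>. energy l (K \<epsilon>) (y \<epsilon>)) < ereal a" "ereal a < limit_energy l K0 x"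
    using ereal_dense2 by (metis not_le)
  have fr: "\<exists>\<epsilon>. 0 < \<epsilon> \<and> \<epsilon> < cutoff j \<and> energy l (K \<epsilon>) (y \<epsilon>) < ereal a" for j
  proof (rule ccontr)
    assume H: "\<not> ?thesis"
    have "\<forall>\<^sub>F \<epsilon> in at_right 0. ereal a \<le> energy l (K \<epsilon>) (y \<epsilon>)"
      using eventually_less_cutoff[of j]
    proof eventually_elim
      case (elim \<epsilon>)
      then show ?case using H by (metis not_less)
    qed
    then have "ereal a \<le> Liminf (at_right 0) (\<lambda>\<epsilon>. energy l (K \<epsilon>) (y \<epsilon>))" by (rule Liminf_bounded)
    with a(1) show False by simp
  qed
  then obtain e where e: "\<And>j. 0 < e j" "\<And>j. e j < cutoff j" "\<And>j. energy l (K (e j)) (y (e j)) < ereal a"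
    by metis
  have e0: "e \<longlonglongrightarrow> 0"
    by (rule tendsto_sandwich[OF _ _ tendsto_const cutoff_lim]) (use e in \<open>auto intro!: always_eventually less_imp_le\<close>)
  have "filterlim e (at_right 0) sequentially" unfolding filterlim_at
  proof
    have "e n \<in> {0<..} \<and> e n \<noteq> 0" for n using e(1)[of n] by simp
    then show "\<forall>\<^sub>F n in sequentially. e n \<in> {0<..} \<and> e n \<noteq> 0" by (simp add: always_eventually)
  qed (rule e0)
  from filterlim_compose[OF conv this] have L1_conv: "(\<lambda>j. L1_dist l (y (e j)) x) \<longlonglongrightarrow> 0" .
  \<comment> \<open>An energy below a real number forces membership in \<open>BV01\<close>, since
    the energy is infinite elsewhere.\<close>
  have "y (e j) \<in> BV01 l" for j using e(3)[of j] by (auto simp: energy_def split: if_splits)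
  then have "limit_energy l K0 x \<le> ereal a"
    by (rule liminf_sequence[OF _ _ e(1) e0 x L1_conv]) (use e(3) in \<open>auto intro: less_imp_le\<close>)
  with a(2) show False by simp
qed

text \<open>The inner energies of the fixed function \<open>x\<close> stay below that of
  \<open>K0\<close>. The tail enters with a minus sign and so needs a lower bound, taken from one
  truncated kernel whose tail is within the tolerance.\<close>

lemma gamma_limsup:
  fixes x :: "real^'n \<Rightarrow> real"
  shows "Limsup (at_right 0) (\<lambda>\<epsilon>. energy l (K \<epsilon>) x) \<le> limit_energy l K0 x"
proof (cases "x \<in> BV01 l")
  case False
  then show ?thesis by (simp add: limit_energy_def)
next
  case True
  show ?thesis
  proof (cases "inner_energy l K0 x")
    case top
    have "ennreal energy_scale * top = top" using energy_scale_pos by (simp add: ennreal_mult_top ennreal_eq_0_iff not_le)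
    then show ?thesis by (simp add: limit_eq_split[OF True] top top_ereal_def)
  next
    case (real I)
    have lim: "limit_energy l K0 x = ereal (energy_scale * I - energy_scale * tail_val x)"
      using real energy_scale_pos by (simp add: limit_eq_split[OF True] ennreal_mult[symmetric] enn2ereal_ennreal)
    show ?thesis
      unfolding lim
    proof (rule ereal_le_epsilon2)
      fix h :: real assume h: "h > 0"
      \<comment> \<open>The tolerance is divided by \<open>energy_scale\<close> because the tail
        enters the energy with that factor; a nonpositive left side is truncated to 0 and makes the
        later bound trivial.\<close>
      have "\<exists>n. ennreal (tail_val x - h / energy_scale) < tail_loss l (\<kappa> n) x \<or> tail_val x - h / energy_scale \<le> 0"
      proof (cases "tail_val x - h / energy_scale \<le> 0")
        case False
        moreover have "h / energy_scale > 0" using h energy_scale_pos by simp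
        ultimately have "ennreal (tail_val x - h / energy_scale) < ennreal (tail_val x)" by (intro ennreal_lessI) linarith+
        also have "\<dots> = (SUP n. tail_loss l (\<kappa> n) x)" using tail_val(1)[OF True] tail_loss_SUP[OF True] by simp
        finally show ?thesis by (auto simp: less_SUP_iff)
      qed auto
      then obtain n where n: "ennreal (tail_val x - h / energy_scale) \<le> tail_loss l (\<kappa> n) x" by (auto simp: ennreal_neg intro: less_imp_le)
      have "\<forall>\<^sub>F \<epsilon> in at_right 0. energy l (K \<epsilon>) x \<le> ereal (energy_scale * I - energy_scale * tail_val x) + ereal h"
        using eventually_less_cutoff[of n]
      proof eventually_elim
        case (elim \<epsilon>)
        then have e: "0 < \<epsilon>" "\<epsilon> \<le> cutoff n" by auto
        let ?K = "\<lambda>r. ennreal (K \<epsilon> r)"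
        obtain T where T: "tail_loss l ?K x = ennreal T" "T \<ge> 0"
          using energy_eq_split(2)[OF True e(1)] by (cases "tail_loss l ?K x") (auto simp: top_unique)
        have "ennreal (tail_val x - h / energy_scale) \<le> ennreal T"
          using n tail_loss_mono[of "\<kappa> n" ?K l x] kap_le_K[OF e] by (auto simp: T(1)[symmetric] intro: order_trans)
        then have "tail_val x - h / energy_scale \<le> T" using T(2) by (simp add: ennreal_le_iff)
        then have 1: "energy_scale * tail_val x - h \<le> energy_scale * T" using energy_scale_pos mult_left_mono[of "tail_val x - h / energy_scale" T energy_scale] by (simp add: right_diff_distrib)
        have "inner_energy l ?K x \<le> inner_energy l K0 x" by (intro inner_energy_mono K_le_K0 e)
        then obtain J where J: "inner_energy l ?K x = ennreal J" "J \<ge> 0" "J \<le> I"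
          using real by (cases "inner_energy l ?K x") (auto simp: top_unique)
        have "energy l (K \<epsilon>) x = ereal (energy_scale * J - energy_scale * T)"
          unfolding energy_eq_split(1)[OF True e(1)] split_energy_def energy_scale_def[symmetric] T(1) J(1)
          using energy_scale_pos T(2) J(2) by (simp add: ennreal_mult[symmetric] enn2ereal_ennreal)
        moreover have "energy_scale * J \<le> energy_scale * I" using J(3) energy_scale_pos by (intro mult_left_mono) auto
        ultimately show ?case using 1 by simp
      qed
      then show "Limsup (at_right 0) (\<lambda>\<epsilon>. energy l (K \<epsilon>) x) \<le> ereal (energy_scale * I - energy_scale * tail_val x) + ereal h"
        by (rule Limsup_bounded)
    qed
  qed
qed

end

theorem theorem1p1:
  fixes l :: real and K :: "real \<Rightarrow> real \<Rightarrow> real" and K0 :: "real \<Rightarrow> ennreal"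
  assumes l_pos: "l > 0"
    and K_nonneg: "\<forall>\<epsilon>>0. \<forall>r\<ge>0. 0 \<le> K \<epsilon> r"
    and K_measurable: "\<forall>\<epsilon>>0. (\<lambda>z::real^'n. K \<epsilon> (norm z)) \<in> borel_measurable lebesgue"
    and K_L1: "\<forall>\<epsilon>>0. set_integrable lebesgue (ball 0 1) (\<lambda>z::real^'n. K \<epsilon> (norm z))"
    and K_mono: "\<forall>\<epsilon> \<epsilon>'. 0 < \<epsilon> \<and> \<epsilon> \<le> \<epsilon>' \<longrightarrow> (\<forall>r\<ge>0. K \<epsilon>' r \<le> K \<epsilon> r)"
    and K_lim: "\<forall>r\<ge>0. ((\<lambda>\<epsilon>. ennreal (K \<epsilon> r)) \<longlongrightarrow> K0 r) (at_right 0)"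
    and K0_infinite: "(\<integral>\<^sup>+r\<in>{0..1}. (K0 r * ennreal (r ^ (CARD('n) - 1))) \<partial>lebesgue) = \<infinity>"
    and K0_tail: "\<forall>\<delta>>0. (\<integral>\<^sup>+r\<in>{\<delta>..}. (K0 r * ennreal
        (min (r powi (int CARD('n) - 2)) (r powi (int CARD('n) - 1)))) \<partial>lebesgue) < \<infinity>"
  shows
    "(\<forall>u :: real \<Rightarrow> real^'n \<Rightarrow> real.
        (\<forall>\<epsilon>>0. u \<epsilon> \<in> BV01 l) \<and> (SUP \<epsilon>\<in>{0<..}. energy l (K \<epsilon>) (u \<epsilon>)) < \<infinity> \<longrightarrow>
        (\<forall>e :: nat \<Rightarrow> real. (\<forall>j. 0 < e j) \<and> e \<longlonglongrightarrow> 0 \<longrightarrow>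
          (\<exists>v\<in>BV01 l. \<exists>s :: nat \<Rightarrow> nat. strict_mono s
             \<and> (\<lambda>j. L1_dist l (u (e (s j))) v) \<longlonglongrightarrow> 0
             \<and> (\<lambda>j. total_variation l (u (e (s j)))) \<longlonglongrightarrow> total_variation l v)))
     \<and> gamma_converges (torus_L1 l :: (real^'n \<Rightarrow> real) set) (L1_dist l) (at_right 0)
         (\<lambda>\<epsilon>. energy l (K \<epsilon>)) (limit_energy l K0)"
proof -
  interpret kernel_family l K K0 "TYPE('n)"
    using assms by unfold_locales auto
  show ?thesis
  proof (intro conjI allI impI)
    fix u :: "real \<Rightarrow> real^'n \<Rightarrow> real" and e :: "nat \<Rightarrow> real"
    assume u: "(\<forall>\<epsilon>>0. u \<epsilon> \<in> BV01 l) \<and> (SUP \<epsilon>\<in>{0<..}. energy l (K \<epsilon>) (u \<epsilon>)) < \<infinity>"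
      and e: "(\<forall>j. 0 < e j) \<and> e \<longlonglongrightarrow> 0"
    obtain A where A: "(SUP \<epsilon>\<in>{0<..}. energy l (K \<epsilon>) (u \<epsilon>)) \<le> ereal A"
      using u by (cases "SUP \<epsilon>\<in>{0<..}. energy l (K \<epsilon>) (u \<epsilon>)") auto
    have "energy l (K \<epsilon>) (u \<epsilon>) \<le> ereal A" if "\<epsilon> > 0" for \<epsilon>
      using that by (intro order_trans[OF SUP_upper A]) simp
    then show "\<exists>v\<in>BV01 l. \<exists>s :: nat \<Rightarrow> nat. strict_mono s
             \<and> (\<lambda>j. L1_dist l (u (e (s j))) v) \<longlonglongrightarrow> 0
             \<and> (\<lambda>j. total_variation l (u (e (s j)))) \<longlonglongrightarrow> total_variation l v"
      using u e by (intro BV_compactness[of u A e]) auto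
  next
    show "gamma_converges (torus_L1 l :: (real^'n \<Rightarrow> real) set) (L1_dist l) (at_right 0)
         (\<lambda>\<epsilon>. energy l (K \<epsilon>)) (limit_energy l K0)"
      unfolding gamma_converges_def
    proof (intro ballI conjI allI impI)
      fix x :: "real^'n \<Rightarrow> real" and y :: "real \<Rightarrow> real^'n \<Rightarrow> real"
      assume "x \<in> torus_L1 l" "(\<forall>p. y p \<in> torus_L1 l) \<and> ((\<lambda>p. L1_dist l (y p) x) \<longlongrightarrow> 0) (at_right 0)"
      then show "limit_energy l K0 x \<le> Liminf (at_right 0) (\<lambda>p. energy l (K p) (y p))"
        by (intro gamma_liminf) auto
    next
      fix x :: "real^'n \<Rightarrow> real" assume x: "x \<in> torus_L1 l"
      have "L1_dist l x x = 0" by (simp add: L1_dist_def)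
      then show "\<exists>y. (\<forall>p. y p \<in> torus_L1 l) \<and> ((\<lambda>p. L1_dist l (y p) x) \<longlongrightarrow> 0) (at_right 0)
          \<and> Limsup (at_right 0) (\<lambda>p. energy l (K p) (y p)) \<le> limit_energy l K0 x"
        using x gamma_limsup[of x] by (intro exI[of _ "\<lambda>_. x"]) simp
    qed
  qed
qed

end
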